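(* Under the simple uniform hashing assumption, let $n=2^d$ for $d\in\mathbb{N}$ and $\varepsilon\in[1/n,1]$. There is a minimal perfect hash function data structure (Monolithic CONSENSUS-RecSplit: a balanced binary tree of $n-1$ two-way splitting hash functions, each splitting the keys arriving at its node perfectly in half) with space requirement $\mathrm{OPT}_{\mathrm{MPHF}}+O(\varepsilon n+\log^2 n)$ bits, expected construction time $O(\max(n^{3/2},n/\varepsilon))$ and query time $O(\log n)$.
   Context: A minimal perfect hash function (MPHF) for a set $X$ of $n$ keys is a data structure representing a function mapping $X$ bijectively to $\{1,\dots,n\}$. $\mathrm{OPT}_{\mathrm{MPHF}}=n\log_2 e-O(\log n)$ is the space lower bound in bits for MPHFs. The simple uniform hashing assumption means access to an infinite sequence of fully random, mutually independent hash functions, each identified by an index (seed).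
   Formalization: A worst-case space bound cannot hold with certainty (with positive probability no seed fits), so construction may restart on fresh hash functions; the restart count, readable in O(1), counts as space, and the total meets the bound in expectation and with probability at least 1-1/n. *)

theory Defs
  imports "HOL-Probability.Probability" "HOL-Library.Landau_Symbols" "HOL-Library.Nat_Bijection"
begin

section \<open>Simple uniform hashing\<close>

text \<open>An infinite sequence of two-way hash functions, \<^term>\<open>h s\<close> being the one with seed \<^term>\<open>s\<close>;
  all values are independent fair bits.\<close>

definition simple_uniform_hashing :: "'w measure \<Rightarrow> (nat \<Rightarrow> 'k \<Rightarrow> 'w \<Rightarrow> bool) \<Rightarrow> bool" where
  "simple_uniform_hashing M h \<longleftrightarrow>
     prob_space M \<and>
     prob_space.indep_vars M (\<lambda>_. count_space UNIV) (\<lambda>(s, x). h s x) UNIV \<and>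
     (\<forall>s x. distr M (count_space UNIV) (h s x) = measure_pmf (pmf_of_set UNIV))"


section \<open>A word RAM with access to the hash functions\<close>

text \<open>Every memory cell holds a word of \<open>w\<close> bits, and every operation has unit cost. Keys are opaque:
  the only access to the input keys is the instruction \<open>Hash a s i\<close>, which stores at address \<open>a\<close>
  the hash value of the \<open>i\<close>-th input key under seed \<open>s\<close>.

  Only finitely many seeds fit into a word, so with positive probability none of them is good.
  The sequence of hash functions is therefore divided into infinitely many batches (by
  \<^const>\<open>prod_encode\<close>). The instruction \<open>Rehash\<close> moves on to the next batch, and the number
  of the batch in use, the second component of the state, belongs to the constructed data structure
  and is charged for in its space below.\<close>

datatype binop = Add | Sub | Mul | Div | Mod | Less | Equal | BAnd | BOr | BXor | Shl | Shr

datatype aexp = Const nat | Load aexp | Op binop aexp aexp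

datatype com =
    Skip
  | Store aexp aexp
  | Hash aexp aexp aexp
  | Rehash
  | Seq com com
  | Cond aexp com com
  | While aexp com

type_synonym memory = "nat \<Rightarrow> nat"
type_synonym state = "memory \<times> nat"

fun binop_val :: "binop \<Rightarrow> nat \<Rightarrow> nat \<Rightarrow> nat" where
  "binop_val Add a b = a + b"
| "binop_val Sub a b = a - b"
| "binop_val Mul a b = a * b"
| "binop_val Div a b = a div b"
| "binop_val Mod a b = a mod b"
| "binop_val Less a b = of_bool (a < b)"
| "binop_val Equal a b = of_bool (a = b)"
| "binop_val BAnd a b = Bit_Operations.and a b"
| "binop_val BOr a b = Bit_Operations.or a b"
| "binop_val BXor a b = Bit_Operations.xor a b"
| "binop_val Shl a b = push_bit b a"
| "binop_val Shr a b = drop_bit b a"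

fun aval :: "nat \<Rightarrow> memory \<Rightarrow> aexp \<Rightarrow> nat" where
  "aval w m (Const k) = take_bit w k"
| "aval w m (Load a) = m (aval w m a)"
| "aval w m (Op f a b) = take_bit w (binop_val f (aval w m a) (aval w m b))"

fun acost :: "aexp \<Rightarrow> nat" where
  "acost (Const k) = 1"
| "acost (Load a) = 1 + acost a"
| "acost (Op f a b) = 1 + acost a + acost b"

definition hash_val :: "(nat \<Rightarrow> 'k \<Rightarrow> bool) \<Rightarrow> 'k list \<Rightarrow> nat \<Rightarrow> nat \<Rightarrow> nat \<Rightarrow> nat" where
  "hash_val H ks g s i = (if i < length ks then of_bool (H (prod_encode (g, s)) (ks ! i)) else 0)"

text \<open>\<open>exec w H ks c s t s'\<close>: with word length \<open>w\<close>, hash functions \<open>H\<close> and input keys \<open>ks\<close>,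
  the command \<open>c\<close> started in state \<open>s\<close> terminates after \<open>t\<close> time units in state \<open>s'\<close>.\<close>

inductive exec ::
  "nat \<Rightarrow> (nat \<Rightarrow> 'k \<Rightarrow> bool) \<Rightarrow> 'k list \<Rightarrow> com \<Rightarrow> state \<Rightarrow> nat \<Rightarrow> state \<Rightarrow> bool"
  for w :: nat and H :: "nat \<Rightarrow> 'k \<Rightarrow> bool" and ks :: "'k list" where
  Skip: "exec w H ks Skip s 1 s"
| Store: "exec w H ks (Store a b) (m, g) (1 + acost a + acost b)
            (m(aval w m a := aval w m b), g)"
| Hash: "exec w H ks (Hash a b i) (m, g) (1 + acost a + acost b + acost i)
            (m(aval w m a := take_bit w (hash_val H ks g (aval w m b) (aval w m i))), g)"
| Rehash: "exec w H ks Rehash (m, g) 1 (m, Suc g)"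
| Seq: "exec w H ks c1 s1 t1 s2 \<Longrightarrow> exec w H ks c2 s2 t2 s3 \<Longrightarrow>
          exec w H ks (Seq c1 c2) s1 (t1 + t2) s3"
| CondTrue: "aval w (fst s) b \<noteq> 0 \<Longrightarrow> exec w H ks c1 s t s' \<Longrightarrow>
          exec w H ks (Cond b c1 c2) s (1 + acost b + t) s'"
| CondFalse: "aval w (fst s) b = 0 \<Longrightarrow> exec w H ks c2 s t s' \<Longrightarrow>
          exec w H ks (Cond b c1 c2) s (1 + acost b + t) s'"
| WhileFalse: "aval w (fst s) b = 0 \<Longrightarrow> exec w H ks (While b c) s (1 + acost b) s"
| WhileTrue: "aval w (fst s1) b \<noteq> 0 \<Longrightarrow> exec w H ks c s1 t1 s2 \<Longrightarrow>
          exec w H ks (While b c) s2 t2 s3 \<Longrightarrow>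
          exec w H ks (While b c) s1 (1 + acost b + t1 + t2) s3"

inductive_cases SkipE: "exec w H ks Skip s t s'"
inductive_cases StoreE: "exec w H ks (Store a b) s t s'"
inductive_cases HashE: "exec w H ks (Hash a b i) s t s'"
inductive_cases RehashE: "exec w H ks Rehash s t s'"
inductive_cases SeqE: "exec w H ks (Seq c1 c2) s t s'"
inductive_cases CondE: "exec w H ks (Cond b c1 c2) s t s'"
inductive_cases WhileE: "exec w H ks (While b c) s t s'"

lemma exec_deterministic:
  assumes "exec w H ks c s t s'" and "exec w H ks c s u s''"
  shows "u = t \<and> s'' = s'"
  using assms
proof (induction arbitrary: u s'' rule: exec.induct)
  case (Skip s)
  from Skip.prems show ?case by (rule SkipE) simp
next
  case (Store a b m g)
  from Store.prems show ?case by (rule StoreE) simp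
next
  case (Hash a b i m g)
  from Hash.prems show ?case by (rule HashE) simp
next
  case (Rehash m g)
  from Rehash.prems show ?case by (rule RehashE) simp
next
  case (Seq c1 s1 t1 s2 c2 t2 s3)
  from Seq.prems obtain t1' s2' t2' where
    *: "u = t1' + t2'" "exec w H ks c1 s1 t1' s2'" "exec w H ks c2 s2' t2' s''"
    by (rule SeqE)
  have "t1' = t1 \<and> s2' = s2" using Seq.IH(1)[OF *(2)] .
  with *(3) Seq.IH(2) have "t2' = t2 \<and> s'' = s3" by metis
  with \<open>t1' = t1 \<and> s2' = s2\<close> *(1) show ?case by simp
next
  case (CondTrue s b c1 t s' c2)
  from CondTrue.prems show ?case
  proof (rule CondE)
    fix t' assume "u = Suc (acost b + t')" "exec w H ks c1 s t' s''"
    with CondTrue.IH show ?thesis by simp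
  qed (use CondTrue.hyps in simp)
next
  case (CondFalse s b c2 t s' c1)
  from CondFalse.prems show ?case
  proof (rule CondE)
    fix t' assume "u = Suc (acost b + t')" "exec w H ks c2 s t' s''"
    with CondFalse.IH show ?thesis by simp
  qed (use CondFalse.hyps in simp)
next
  case (WhileFalse s b c)
  from WhileFalse.prems show ?case
    by (rule WhileE) (use WhileFalse.hyps in simp_all)
next
  case (WhileTrue s1 b c t1 s2 t2 s3)
  from WhileTrue.prems show ?case
  proof (rule WhileE)
    fix t1' s2' t2'
    assume *: "u = Suc (acost b + t1' + t2')" "exec w H ks c s1 t1' s2'"
      "exec w H ks (While b c) s2' t2' s''"
    have "t1' = t1 \<and> s2' = s2" using WhileTrue.IH(1)[OF *(2)] .
    with *(3) WhileTrue.IH(2) have "t2' = t2 \<and> s'' = s3" by metis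
    with \<open>t1' = t1 \<and> s2' = s2\<close> *(1) show ?thesis by simp
  qed (use WhileTrue.hyps in simp)
qed


section \<open>Construction and representation\<close>

text \<open>The construction finds the number of keys and \<open>\<lceil>1/\<epsilon>\<rceil>\<close> in its first two cells. It
  leaves a bit string in memory, its length in cell 0 and its bits packed into the cells from 1 on.
  The result is the running time, the bit string and the number of the batch of hash functions in
  use; it is \<^const>\<open>None\<close> if the construction does not terminate.\<close>

definition build_input :: "nat \<Rightarrow> real \<Rightarrow> memory" where
  "build_input n \<epsilon> = (\<lambda>_. 0)(0 := n, 1 := nat \<lceil>1 / \<epsilon>\<rceil>)"

definition output_bits :: "nat \<Rightarrow> memory \<Rightarrow> bool list" where
  "output_bits w m = map (\<lambda>i. bit (m (1 + i div w)) (i mod w)) [0..<m 0]"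

definition run_build ::
  "nat \<Rightarrow> (nat \<Rightarrow> 'k \<Rightarrow> bool) \<Rightarrow> 'k list \<Rightarrow> real \<Rightarrow> com \<Rightarrow> (nat \<times> bool list \<times> nat) option" where
  "run_build w H ks \<epsilon> c =
     (let R = (\<lambda>(t, s). exec w H ks c (build_input (length ks) \<epsilon>, 0) t s)
      in if \<exists>r. R r then (case THE r. R r of (t, m, g) \<Rightarrow> Some (t, output_bits w m, g)) else None)"

definition build_time :: "(nat \<times> bool list \<times> nat) option \<Rightarrow> ennreal" where
  "build_time r = (case r of None \<Rightarrow> \<infinity> | Some (t, bits, g) \<Rightarrow> of_nat t)"

text \<open>The batch number \<open>g\<close> is stored in unary, with \<open>g + 1\<close> bits, in front of the bit string.\<close>

definition space_bits :: "(nat \<times> bool list \<times> nat) option \<Rightarrow> ennreal" where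
  "space_bits r = (case r of None \<Rightarrow> \<infinity> | Some (t, bits, g) \<Rightarrow> of_nat (length bits + (g + 1)))"

text \<open>A query starts with nothing but the bit string in memory, packed into words, and
  leaves its answer in cell 0.\<close>

definition pack :: "nat \<Rightarrow> bool list \<Rightarrow> memory" where
  "pack w bits a = horner_sum of_bool 2 (take w (drop (a * w) bits))"


section \<open>The splitting tree\<close>

text \<open>The nodes of the balanced binary tree of depth \<open>d\<close> are numbered as in a heap: the root is 1, the
  children of \<open>v\<close> are \<open>2v\<close> and \<open>2v + 1\<close>, the inner nodes are \<open>1, \<dots>, 2\<^sup>d - 1\<close> and the leaves are
  \<open>2\<^sup>d, \<dots>, 2\<^sup>d\<^sup>+\<^sup>1 - 1\<close>. The function \<open>f v\<close> is the splitting hash function at \<open>v\<close>.\<close>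

primrec node_at :: "(nat \<Rightarrow> 'k \<Rightarrow> bool) \<Rightarrow> nat \<Rightarrow> 'k \<Rightarrow> nat" where
  "node_at f 0 x = 1"
| "node_at f (Suc j) x = 2 * node_at f j x + of_bool (f (node_at f j x) x)"

definition splits_perfectly :: "nat \<Rightarrow> (nat \<Rightarrow> 'k \<Rightarrow> bool) \<Rightarrow> 'k set \<Rightarrow> bool" where
  "splits_perfectly d f X \<longleftrightarrow>
     (\<forall>j<d. \<forall>v\<in>{2 ^ j..<2 ^ Suc j}.
        card {x \<in> X. node_at f j x = v \<and> f v x} = card {x \<in> X. node_at f j x = v \<and> \<not> f v x})"

definition leaf_rank :: "nat \<Rightarrow> (nat \<Rightarrow> 'k \<Rightarrow> bool) \<Rightarrow> 'k \<Rightarrow> nat" where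
  "leaf_rank d f x = node_at f d x + 1 - 2 ^ d"

end

theory Submission
  imports Defs "HOL-Library.Discrete_Functions" "HOL-Library.Log_Nat"
begin

text \<open>Every node of the splitting tree stores its seed in a window of a common bit string.  The
  windows of consecutive nodes of one level overlap, so a node only has \<open>b\<close> fresh bits, where \<open>b\<close> is
  about \<open>log (1 / p) + 2 ^ (- x)\<close> for the success probability \<open>p\<close> of a split and a slack \<open>2 ^ (- x)\<close>
  depending on the level; seeds are found by depth-first search over the fresh bits (CONSENSUS).  The
  expected number of tests at a node is then \<open>O (2 ^ x / p)\<close>.  Levels are cut into segments so that
  the windows fit into machine words and different candidate paths use different seeds except with
  tiny probability; if a search fails or exceeds its budget the next batch of hash functions is used,
  which happens with probability at most one half.\<close>

section \<open>Depth-first search for seeds\<close>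

text \<open>A layer is the acceptance test of a node for its candidate seeds, together with the number of
  fresh bits of the node after it.\<close>

type_synonym layer = "(nat \<Rightarrow> bool) \<times> nat"

context
  fixes W :: nat
begin

definition children :: "nat \<Rightarrow> nat \<Rightarrow> nat list" where
  "children b c = map (\<lambda>f. c div 2 ^ b + f * 2 ^ (W - b)) [0..<2 ^ b]"

definition next_level :: "layer \<Rightarrow> nat list \<Rightarrow> nat list" where
  "next_level l L = concat (map (children (snd l)) (filter (fst l) L))"

fun fails :: "layer list \<Rightarrow> nat list \<Rightarrow> bool" where
  "fails [] L = (L = [])"
| "fails (l # ls) L = fails ls (next_level l L)"

fun repeats :: "layer list \<Rightarrow> nat list \<Rightarrow> bool" where
  "repeats [] L = False"
| "repeats (l # ls) L = (\<not> distinct L \<or> repeats ls (next_level l L))"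

text \<open>The result is the path found, if any, and the number of tests made.\<close>

fun search :: "layer list \<Rightarrow> nat list \<Rightarrow> nat list option \<times> nat" where
  "search [] L = ((if L = [] then None else Some []), 0)"
| "search (l # ls) [] = (None, 0)"
| "search (l # ls) (c # cs) =
    (if fst l c then
        (case search ls (children (snd l) c) of
          (Some p, t) \<Rightarrow> (Some (c # p), Suc t)
        | (None, t) \<Rightarrow> (fst (search (l # ls) cs), Suc (t + snd (search (l # ls) cs))))
      else (fst (search (l # ls) cs), Suc (snd (search (l # ls) cs))))"

definition num_tried :: "layer list \<Rightarrow> nat list \<Rightarrow> nat" where
  "num_tried ls L = card {k. k < length L \<and> fails ls (take k L)}"

lemma length_children [simp]: "length (children b c) = 2 ^ b"
  by (simp add: children_def)

lemma children_not_Nil [simp]: "children b c \<noteq> []"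
  by (simp add: children_def)

lemma hd_children: "hd (children b c) = c div 2 ^ b"
  by (simp add: children_def hd_map)

lemma next_level_Nil [simp]: "next_level l [] = []"
  by (simp add: next_level_def)

lemma next_level_Cons:
  "next_level l (c # cs) = (if fst l c then children (snd l) c else []) @ next_level l cs"
  by (simp add: next_level_def)

lemma next_level_append: "next_level l (A @ B) = next_level l A @ next_level l B"
  by (simp add: next_level_def)

lemma length_next_level: "length (next_level l L) = 2 ^ snd l * length (filter (fst l) L)"
  by (induction L) (simp_all add: next_level_Cons)

lemma div_pow_less:
  assumes "b \<le> W" "(c::nat) < 2 ^ W"
  shows "c div 2 ^ b < 2 ^ (W - b)"
proof -
  have "(2::nat) ^ W = 2 ^ (W - b) * 2 ^ b" using assms(1) by (simp flip: power_add)
  thus ?thesis using assms(2) by (simp add: less_mult_imp_div_less)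
qed

lemma children_less:
  assumes "b \<le> W" "c < 2 ^ W" "u \<in> set (children b c)"
  shows "u < 2 ^ W"
proof -
  obtain f where f: "f < 2 ^ b" "u = c div 2 ^ b + f * 2 ^ (W - b)"
    using assms(3) by (auto simp: children_def)
  hence "u < (1 + f) * 2 ^ (W - b)" using div_pow_less[OF assms(1,2)] by simp
  also have "... \<le> 2 ^ b * 2 ^ (W - b)" using f by (intro mult_right_mono) auto
  also have "... = 2 ^ W" using assms(1) by (simp flip: power_add)
  finally show ?thesis .
qed

lemma children_mod:
  assumes "b \<le> W" "c < 2 ^ W" "u \<in> set (children b c)"
  shows "u mod 2 ^ (W - b) = c div 2 ^ b"
  using div_pow_less[OF assms(1,2)] assms(3) by (auto simp: children_def)

lemma next_level_less:
  assumes "snd l \<le> W" "\<forall>c\<in>set L. c < 2 ^ W"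
  shows "\<forall>u\<in>set (next_level l L). u < 2 ^ W"
  using assms children_less by (fastforce simp: next_level_def)

lemma fails_Nil [simp]: "fails ls []"
  by (induction ls) auto

lemma fails_append: "fails ls (A @ B) \<longleftrightarrow> fails ls A \<and> fails ls B"
  by (induction ls arbitrary: A B) (auto simp: next_level_append)

lemma fails_Cons_iff:
  "fails (l # ls) (c # cs) \<longleftrightarrow> (fst l c \<longrightarrow> fails ls (children (snd l) c)) \<and> fails (l # ls) cs"
  by (simp add: next_level_Cons fails_append)

lemma repeats_take: "repeats ls (take k L) \<Longrightarrow> repeats ls L"
proof -
  have "repeats ls A \<Longrightarrow> repeats ls (A @ B)" for A B
    by (induction ls arbitrary: A B) (auto simp: next_level_append)
  thus "repeats ls (take k L) \<Longrightarrow> repeats ls L" by (metis append_take_drop_id)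
qed

lemma search_None_iff: "fst (search ls L) = None \<longleftrightarrow> fails ls L"
proof (induction ls L rule: search.induct)
  case (3 l ls c cs)
  then show ?case
    by (auto simp: fails_Cons_iff simp del: fails.simps(2) split: prod.splits option.splits)
qed auto

lemma search_Nil [simp]: "snd (search ls []) = 0"
  by (cases ls) auto

lemma snd_search_append:
  "snd (search ls (A @ B)) = snd (search ls A) + (if fails ls A then snd (search ls B) else 0)"
proof (cases ls)
  case (Cons l ls')
  show ?thesis unfolding Cons
  proof (induction A)
    case (Cons c A)
    have "fst (search ls' (children (snd l) c)) = None \<longleftrightarrow> fails ls' (children (snd l) c)"
      by (rule search_None_iff)
    with Cons show ?case
      by (auto simp: fails_Cons_iff simp del: fails.simps(2) split: prod.splits option.splits)
  qed auto
qed auto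

lemma num_tried_Cons: "num_tried ls (c # cs) = Suc (if fails ls [c] then num_tried ls cs else 0)"
proof -
  have split: "fails ls (c # take k cs) \<longleftrightarrow> fails ls [c] \<and> fails ls (take k cs)" for k
    using fails_append[of ls "[c]" "take k cs"] by simp
  have "{k. k < length (c # cs) \<and> fails ls (take k (c # cs))} =
      insert 0 (Suc ` {k. k < length cs \<and> fails ls (c # take k cs)})"
    by (auto simp: image_iff less_Suc_eq_0_disj)
  hence "num_tried ls (c # cs) =
      card (insert 0 (Suc ` {k. k < length cs \<and> fails ls [c] \<and> fails ls (take k cs)}))"
    unfolding num_tried_def split by (simp only:)
  also have "... = Suc (card {k. k < length cs \<and> fails ls [c] \<and> fails ls (take k cs)})"
    by (subst card_insert_disjoint) (auto simp: card_image)
  finally show ?thesis by (cases "fails ls [c]") (simp_all add: num_tried_def)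
qed

lemma snd_search_Cons:
  "snd (search (l # ls) L) = num_tried (l # ls) L + snd (search ls (next_level l L))"
proof (induction L)
  case Nil
  show ?case by (simp add: num_tried_def)
next
  case (Cons c cs)
  have "fst (search ls (children (snd l) c)) = None \<longleftrightarrow> fails ls (children (snd l) c)"
    by (rule search_None_iff)
  moreover have "fails (l # ls) [c] \<longleftrightarrow> (fst l c \<longrightarrow> fails ls (children (snd l) c))"
    using fails_Cons_iff[of l ls c "[]"] by (cases "fst l c") (simp_all add: next_level_Cons)
  ultimately show ?case using Cons
    by (auto simp: num_tried_Cons next_level_Cons snd_search_append simp del: fails.simps(2)
        split: prod.splits option.splits)
qed

lemma search_Some_path:
  assumes "search ls cs = (Some p, t)"
  shows "length p = length ls \<and> (\<forall>i<length ls. fst (ls ! i) (p ! i)) \<and> (ls \<noteq> [] \<longrightarrow> hd p \<in> set cs) \<and>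
    (\<forall>i. Suc i < length ls \<longrightarrow> p ! Suc i \<in> set (children (snd (ls ! i)) (p ! i)))"
  using assms
proof (induction ls cs arbitrary: p t rule: search.induct)
  case (1 L)
  thus ?case by (auto split: if_splits)
next
  case (3 l ls c cs)
  show ?case
  proof (cases "fst l c \<and> fst (search ls (children (snd l) c)) \<noteq> None")
    case True
    then obtain q u where q: "search ls (children (snd l) c) = (Some q, u)"
      by (metis not_None_eq prod.collapse)
    have p: "p = c # q" using "3.prems" True q by simp
    note IH = "3.IH"(1)[OF conjunct1[OF True] q]
    have "p ! Suc i \<in> set (children (snd ((l # ls) ! i)) (p ! i))" if "Suc i < length (l # ls)" for i
      using IH that by (cases i; cases q) (auto simp: p)
    moreover have "fst ((l # ls) ! i) (p ! i)" if "i < length (l # ls)" for i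
      using IH True that by (cases i) (auto simp: p)
    ultimately show ?thesis using IH by (auto simp: p)
  next
    case False
    hence rest: "search (l # ls) cs = (Some p, snd (search (l # ls) cs))"
      using "3.prems" by (auto split: if_splits prod.splits option.splits intro!: prod_eqI)
    have "length p = length (l # ls) \<and> (\<forall>i<length (l # ls). fst ((l # ls) ! i) (p ! i)) \<and>
      (l # ls \<noteq> [] \<longrightarrow> hd p \<in> set cs) \<and>
      (\<forall>i. Suc i < length (l # ls) \<longrightarrow> p ! Suc i \<in> set (children (snd ((l # ls) ! i)) (p ! i)))"
    proof (cases "fst l c")
      case True
      then obtain u where "search ls (children (snd l) c) = (None, u)" using False by (metis prod.collapse)
      from "3.IH"(2)[OF True this[symmetric] refl rest] show ?thesis .
    qed (rule "3.IH"(4)[OF _ rest])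
    thus ?thesis by (meson list.set_intros(2))
  qed
qed simp

section \<open>Expected number of tests\<close>

abbreviation random_test :: "real \<Rightarrow> (nat \<Rightarrow> bool) pmf" where
  "random_test p \<equiv> Pi_pmf {..<2 ^ W} False (\<lambda>_. bernoulli_pmf p)"

fun random_layers :: "real \<Rightarrow> nat list \<Rightarrow> layer list pmf" where
  "random_layers p [] = return_pmf []"
| "random_layers p (b # bs) =
  bind_pmf (random_test p) (\<lambda>ok. map_pmf (\<lambda>ls. (ok, b) # ls) (random_layers p bs))"

lemma length_random_layers: "ls \<in> set_pmf (random_layers p bs) \<Longrightarrow> length ls = length bs"
  by (induction bs arbitrary: ls) auto

lemma nn_integral_prod_random_test:
  assumes "S \<subseteq> {..<2 ^ W}"
  shows "(\<integral>\<^sup>+ok. (\<Prod>c\<in>S. f (ok c)) \<partial>random_test p) = (\<integral>\<^sup>+v. f v \<partial>bernoulli_pmf p) ^ card S"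
proof -
  have "(\<Prod>c\<in>S. f (ok c)) = (\<Prod>c<2 ^ W. if c \<in> S then f (ok c) else 1)" for ok :: "nat \<Rightarrow> bool"
    using assms by (simp add: prod.If_cases inf.absorb_iff2)
  hence "(\<integral>\<^sup>+ok. (\<Prod>c\<in>S. f (ok c)) \<partial>random_test p) =
    (\<Prod>c<2 ^ W. \<integral>\<^sup>+v. (if c \<in> S then f v else 1) \<partial>bernoulli_pmf p)"
    by (simp only:) (rule nn_integral_prod_Pi_pmf, simp)
  also have "... = (\<Prod>c<2 ^ W. if c \<in> S then \<integral>\<^sup>+v. f v \<partial>bernoulli_pmf p else 1)"
    by (intro prod.cong refl) (simp add: measure_pmf.emeasure_space_1)
  also have "... = (\<integral>\<^sup>+v. f v \<partial>bernoulli_pmf p) ^ card S"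
    using assms by (simp add: prod.If_cases inf.absorb_iff2)
  finally show ?thesis .
qed

lemma nn_integral_power_filter:
  fixes L :: "nat list"
  assumes "0 \<le> q" "0 \<le> p" "p \<le> 1" "distinct L" "\<forall>c\<in>set L. c < 2 ^ W"
  shows "(\<integral>\<^sup>+ok. ennreal (q ^ length (filter ok L)) \<partial>random_test p) = ennreal ((1 - p + p * q) ^ length L)"
proof -
  have "(\<Prod>c\<in>set L. if ok c then ennreal q else 1) = ennreal (q ^ length (filter ok L))" for ok
  proof -
    have "(\<Prod>c\<in>set L. if ok c then ennreal q else 1) = (\<Prod>c\<in>set (filter ok L). ennreal q)"
      by (rule prod.mono_neutral_cong_right) auto
    thus ?thesis using assms distinct_card[of "filter ok L"] by (simp add: ennreal_power)
  qed
  hence "(\<integral>\<^sup>+ok. ennreal (q ^ length (filter ok L)) \<partial>random_test p) =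
    (\<integral>\<^sup>+ok. (\<Prod>c\<in>set L. if ok c then ennreal q else 1) \<partial>random_test p)" by simp
  also have "... = (\<integral>\<^sup>+v. (if v then ennreal q else 1) \<partial>bernoulli_pmf p) ^ card (set L)"
    by (rule nn_integral_prod_random_test) (use assms in auto)
  also have "(\<integral>\<^sup>+v. (if v then ennreal q else 1) \<partial>bernoulli_pmf p) = ennreal (1 - p + p * q)"
    using assms by (simp add: ennreal_plus ennreal_mult mult.commute add.commute)
  also have "... ^ card (set L) = ennreal ((1 - p + p * q) ^ length L)"
    using assms by (simp add: distinct_card ennreal_power del: ennreal_plus)
  finally show ?thesis .
qed

end

text \<open>The probability that the search below a single candidate succeeds, if no seed repeats.\<close>

fun success_prob :: "real \<Rightarrow> nat list \<Rightarrow> real" where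
  "success_prob p [] = 1"
| "success_prob p (b # bs) = p * (1 - (1 - success_prob p bs) ^ (2 ^ b))"

fun expected_tests :: "real \<Rightarrow> nat list \<Rightarrow> real" where
  "expected_tests p [] = 0"
| "expected_tests p (b # bs) = 1 / success_prob p (b # bs) + expected_tests p bs"

context
  fixes W :: nat and p :: real
  assumes p: "0 < p" "p \<le> 1"
begin

lemma success_prob_bounds: "0 < success_prob p bs \<and> success_prob p bs \<le> 1"
proof (induction bs)
  case (Cons b bs)
  have "(1 - success_prob p bs) ^ (2 ^ b) < 1" "0 \<le> (1 - success_prob p bs) ^ (2 ^ b)"
    using Cons by (auto simp: power_less_one_iff)
  thus ?case using p by (auto intro: mult_le_one)
qed auto

lemma expected_tests_nonneg: "0 \<le> expected_tests p bs"
  by (induction bs)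
    (auto intro!: add_nonneg_nonneg less_imp_le[OF conjunct1[OF success_prob_bounds]] simp del: success_prob.simps)

lemma prob_fails:
  assumes "\<forall>b\<in>set bs. b \<le> W" "\<forall>c\<in>set L. c < 2 ^ W"
  shows "(\<integral>\<^sup>+ls. of_bool (fails W ls L \<and> \<not> repeats W ls L) \<partial>random_layers W p bs) \<le>
    ennreal ((1 - success_prob p bs) ^ length L)"
  using assms
proof (induction bs arbitrary: L)
  case Nil
  show ?case by (cases L) auto
next
  case (Cons b bs)
  let ?s = "success_prob p bs" and ?N = "\<lambda>ok. next_level W (ok, b) L"
  have s: "0 < ?s" "?s \<le> 1" using success_prob_bounds by auto
  show ?case
  proof (cases "distinct L")
    case True
    have "(\<integral>\<^sup>+ls. of_bool (fails W ls L \<and> \<not> repeats W ls L) \<partial>random_layers W p (b # bs))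
      = (\<integral>\<^sup>+ok. \<integral>\<^sup>+ls. of_bool (fails W ls (?N ok) \<and> \<not> repeats W ls (?N ok)) \<partial>random_layers W p bs \<partial>random_test W p)"
      by (simp only: random_layers.simps nn_integral_bind_pmf nn_integral_map_pmf fails.simps repeats.simps True simp_thms)
    also have "... \<le> (\<integral>\<^sup>+ok. ennreal ((1 - ?s) ^ length (?N ok)) \<partial>random_test W p)"
      by (intro nn_integral_mono Cons.IH next_level_less) (use Cons.prems in simp_all)
    also have "... = (\<integral>\<^sup>+ok. ennreal (((1 - ?s) ^ 2 ^ b) ^ length (filter ok L)) \<partial>random_test W p)"
      by (simp add: length_next_level power_mult)
    also have "... = ennreal ((1 - p + p * (1 - ?s) ^ 2 ^ b) ^ length L)"
      by (rule nn_integral_power_filter) (use p s True Cons.prems in auto)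
    also have "1 - p + p * (1 - ?s) ^ 2 ^ b = 1 - success_prob p (b # bs)"
      by (simp add: algebra_simps)
    finally show ?thesis .
  qed simp
qed

lemma expected_num_tried:
  assumes "\<forall>b\<in>set bs. b \<le> W" "\<forall>c\<in>set L. c < 2 ^ W"
  shows "(\<integral>\<^sup>+ls. of_nat (num_tried W ls L) * of_bool (\<not> repeats W ls L) \<partial>random_layers W p bs) \<le>
    ennreal (1 / success_prob p bs)"
proof -
  let ?s = "success_prob p bs" and ?T = "\<lambda>k. take k L"
  have s: "0 < ?s" "?s \<le> 1" using success_prob_bounds by auto
  have "of_nat (num_tried W ls L) * of_bool (\<not> repeats W ls L) \<le>
      (\<Sum>k<length L. of_bool (fails W ls (?T k) \<and> \<not> repeats W ls (?T k)) :: ennreal)" for ls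
  proof (cases "repeats W ls L")
    case False
    hence "\<not> repeats W ls (?T k)" for k using repeats_take by blast
    moreover have "{k. k < length L \<and> fails W ls (?T k)} = {..<length L} \<inter> {k. fails W ls (?T k)}" by blast
    ultimately show ?thesis using False unfolding num_tried_def by (simp add: sum_of_bool_eq)
  qed simp
  hence "(\<integral>\<^sup>+ls. of_nat (num_tried W ls L) * of_bool (\<not> repeats W ls L) \<partial>random_layers W p bs) \<le>
    (\<integral>\<^sup>+ls. (\<Sum>k<length L. of_bool (fails W ls (?T k) \<and> \<not> repeats W ls (?T k))) \<partial>random_layers W p bs)"
    by (rule nn_integral_mono)
  also have "... = (\<Sum>k<length L. \<integral>\<^sup>+ls. of_bool (fails W ls (?T k) \<and> \<not> repeats W ls (?T k)) \<partial>random_layers W p bs)"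
    by (rule nn_integral_sum) simp
  also have "... \<le> (\<Sum>k<length L. ennreal ((1 - ?s) ^ k))"
  proof (rule sum_mono)
    fix k assume "k \<in> {..<length L}"
    thus "(\<integral>\<^sup>+ls. of_bool (fails W ls (?T k) \<and> \<not> repeats W ls (?T k)) \<partial>random_layers W p bs) \<le>
      ennreal ((1 - ?s) ^ k)"
      using prob_fails[OF assms(1), of "?T k"] assms(2) by (auto dest: in_set_takeD)
  qed
  also have "... = ennreal (\<Sum>k<length L. (1 - ?s) ^ k)" using s by (intro sum_ennreal) auto
  also have "(\<Sum>k<length L. (1 - ?s) ^ k) = (1 - (1 - ?s) ^ length L) / ?s"
    using s by (simp add: sum_gp_strict)
  also have "... \<le> 1 / ?s" using s by (intro divide_right_mono) auto
  finally show ?thesis using s by (simp add: ennreal_leI order_trans)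
qed

lemma expected_search_tests:
  assumes "\<forall>b\<in>set bs. b \<le> W" "\<forall>c\<in>set L. c < 2 ^ W"
  shows "(\<integral>\<^sup>+ls. of_nat (snd (search W ls L)) * of_bool (\<not> repeats W ls L) \<partial>random_layers W p bs) \<le>
    ennreal (expected_tests p bs)"
  using assms
proof (induction bs arbitrary: L)
  case (Cons b bs)
  let ?g = "\<lambda>ls L. of_nat (snd (search W ls L)) * of_bool (\<not> repeats W ls L) :: ennreal"
  let ?t = "\<lambda>ls. of_nat (num_tried W ls L) * of_bool (\<not> repeats W ls L) :: ennreal"
  let ?N = "\<lambda>ok. next_level W (ok, b) L"
  have "(\<integral>\<^sup>+ls. ?g ls L \<partial>random_layers W p (b # bs)) \<le>
    (\<integral>\<^sup>+ls. ?t ls + ?g (tl ls) (next_level W (hd ls) L) \<partial>random_layers W p (b # bs))"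
    unfolding random_layers.simps nn_integral_bind_pmf nn_integral_map_pmf list.sel
    by (intro nn_integral_mono) (simp add: snd_search_Cons algebra_simps del: fails.simps)
  also have "... = (\<integral>\<^sup>+ls. ?t ls \<partial>random_layers W p (b # bs)) +
    (\<integral>\<^sup>+ok. \<integral>\<^sup>+ls. ?g ls (?N ok) \<partial>random_layers W p bs \<partial>random_test W p)"
    unfolding random_layers.simps nn_integral_bind_pmf nn_integral_map_pmf list.sel
    by (subst nn_integral_add[symmetric], simp, simp, subst nn_integral_add[symmetric]) simp_all
  also have "... \<le> ennreal (1 / success_prob p (b # bs)) +
    (\<integral>\<^sup>+ok. ennreal (expected_tests p bs) \<partial>random_test W p)"
    by (intro add_mono expected_num_tried nn_integral_mono Cons.IH next_level_less)
      (use Cons.prems in simp_all)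
  also have "... = ennreal (expected_tests p (b # bs))"
    using success_prob_bounds[of "b # bs"] expected_tests_nonneg[of bs]
    by (simp add: measure_pmf.emeasure_space_1 ennreal_plus[symmetric] del: ennreal_plus success_prob.simps)
  finally show ?case .
qed simp

end

section \<open>Repeated seeds are rare\<close>

text \<open>Two candidates of a level repeat a seed if all their bits agree.  As the last bits of a candidate
  are those of its parent, the number of pairs agreeing in their first \<open>a\<close> bits can be followed from
  level to level if \<open>a\<close> shrinks by the number of fresh bits.\<close>

context
  fixes W :: nat
begin

definition agree :: "nat \<Rightarrow> nat \<Rightarrow> nat \<Rightarrow> bool" where
  "agree a x y \<longleftrightarrow> x div 2 ^ (W - a) = y div 2 ^ (W - a)"

definition num_agree :: "nat \<Rightarrow> nat \<Rightarrow> nat list \<Rightarrow> nat" where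
  "num_agree a x L = length (filter (agree a x) L)"

definition cross_agreements :: "nat \<Rightarrow> nat list \<Rightarrow> nat list \<Rightarrow> nat" where
  "cross_agreements a A B = (\<Sum>u\<leftarrow>A. num_agree a u B)"

fun agreements :: "nat \<Rightarrow> nat list \<Rightarrow> nat" where
  "agreements a [] = 0"
| "agreements a (x # L) = num_agree a x L + agreements a L"

lemma agree_sym: "agree a x y = agree a y x"
  by (auto simp: agree_def)

lemma num_agree_simps [simp]:
  "num_agree a x [] = 0" "num_agree a x (A @ B) = num_agree a x A + num_agree a x B"
  "num_agree a x (y # L) = of_bool (agree a x y) + num_agree a x L"
  by (auto simp: num_agree_def)

lemma agreements_append:
  "agreements a (A @ B) = agreements a A + agreements a B + cross_agreements a A B"
  by (induction A) (auto simp: cross_agreements_def)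

lemma cross_agreements_self: "cross_agreements a L L = 2 * agreements a L + length L"
proof (induction L)
  case (Cons x L)
  have "(\<Sum>u\<leftarrow>L. of_bool (agree a u x)) = num_agree a x L"
    unfolding num_agree_def by (induction L) (auto simp: agree_sym)
  moreover have "agree a x x" by (simp add: agree_def)
  ultimately show ?case using Cons by (simp add: cross_agreements_def sum_list_addf)
qed (simp add: cross_agreements_def)

lemma agreements_pos:
  assumes "\<not> distinct L"
  shows "1 \<le> agreements W L"
  using assms
proof (induction L)
  case (Cons x L)
  show ?case
  proof (cases "x \<in> set L")
    case True
    hence "num_agree W x L \<noteq> 0" by (auto simp: num_agree_def filter_empty_conv agree_def)
    thus ?thesis by simp
  qed (use Cons in auto)
qed simp

lemma num_agree_children: "num_agree a u (children W b y) =
  card {f. f < 2 ^ b \<and> agree a u (y div 2 ^ b + f * 2 ^ (W - b))}"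
  unfolding num_agree_def children_def length_filter_conv_card by (rule arg_cong[where f = card]) auto

lemma card_div_eq:
  assumes "f < s * (t::nat)"
  shows "card {f'. f' < s * t \<and> f' div s = f div s} = s"
proof -
  have s: "0 < s" using assms by (cases s) auto
  have "f div s < t" using assms by (simp add: less_mult_imp_div_less mult.commute)
  hence bound: "Suc (f div s) * s \<le> s * t" unfolding mult.commute[of s t] by (intro mult_le_mono1) simp
  have "f' div s = f div s \<longleftrightarrow> f div s * s \<le> f' \<and> f' < Suc (f div s) * s" for f'
    unfolding less_eq_div_iff_mult_less_eq[OF s, symmetric] div_less_iff_less_mult[OF s, symmetric] by auto
  hence "{f'. f' < s * t \<and> f' div s = f div s} = {f div s * s..<Suc (f div s) * s}"
    using bound by (intro set_eqI) (simp only: mem_Collect_eq atLeastLessThan_iff, linarith)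
  thus ?thesis by simp
qed

lemma num_agree_children_short:
  assumes "a \<le> b" "b \<le> W" "z < 2 ^ (W - b)" "y < 2 ^ W" "f < 2 ^ b"
  shows "num_agree a (z + f * 2 ^ (W - b)) (children W b y) = 2 ^ (b - a)"
proof -
  have "W - a = (W - b) + (b - a)" using assms by simp
  hence top: "(u + f' * 2 ^ (W - b)) div 2 ^ (W - a) = f' div 2 ^ (b - a)" if "u < 2 ^ (W - b)"
    for u f' :: nat
    using that by (simp add: power_add div_mult2_eq)
  have "(2::nat) ^ b = 2 ^ (b - a) * 2 ^ a" using assms(1) by (simp flip: power_add)
  thus ?thesis
    using assms(5) card_div_eq[of f "2 ^ (b - a)" "2 ^ a"] top[OF assms(3)] top[OF div_pow_less[OF assms(2,4)]]
    by (simp add: num_agree_children agree_def eq_commute)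
qed

lemma num_agree_children_long:
  assumes "b < a" "a \<le> W" "x < 2 ^ W" "y < 2 ^ W" "f < 2 ^ b"
  shows "num_agree a (x div 2 ^ b + f * 2 ^ (W - b)) (children W b y) = of_bool (agree (a - b) x y)"
proof -
  let ?s = "2 ^ (a - b) :: nat" and ?q = "\<lambda>z. z div 2 ^ b div 2 ^ (W - a) :: nat"
  have e: "W - b = (a - b) + (W - a)" using assms by simp
  have top: "(z div 2 ^ b + f' * 2 ^ (W - b)) div 2 ^ (W - a) = ?q z + f' * ?s" for z f'
  proof -
    have "f' * 2 ^ (W - b) = (f' * ?s) * 2 ^ (W - a)" unfolding e power_add by (simp only: ac_simps)
    thus ?thesis using div_mult_self1[of "2 ^ (W - a)" "z div 2 ^ b" "f' * ?s"] by (simp only:) simp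
  qed
  have q: "?q z < ?s" if "z < 2 ^ W" for z
    using div_pow_less[of b W z] that assms unfolding e power_add by (simp add: less_mult_imp_div_less)
  have "?q x + f * ?s = ?q y + f' * ?s \<longleftrightarrow> f = f' \<and> ?q x = ?q y" for f'
  proof
    assume eq: "?q x + f * ?s = ?q y + f' * ?s"
    from arg_cong[OF eq, of "\<lambda>u. u div ?s"] have "f = f'" using q assms(3,4) by simp
    thus "f = f' \<and> ?q x = ?q y" using eq by simp
  qed simp
  moreover have "?q z = z div 2 ^ (W - (a - b))" for z
    using assms by (simp add: add.commute flip: div_mult2_eq power_add)
  ultimately have "agree a (x div 2 ^ b + f * 2 ^ (W - b)) (y div 2 ^ b + f' * 2 ^ (W - b)) \<longleftrightarrow>
    f = f' \<and> agree (a - b) x y" for f'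
    by (simp add: agree_def top)
  hence "{f'. f' < 2 ^ b \<and> agree a (x div 2 ^ b + f * 2 ^ (W - b)) (y div 2 ^ b + f' * 2 ^ (W - b))} =
    (if agree (a - b) x y then {f} else {})"
    using assms(5) by auto
  thus ?thesis by (simp add: num_agree_children)
qed

lemma cross_agreements_children:
  assumes "a \<le> W" "b \<le> W" "x < 2 ^ W" "y < 2 ^ W"
  shows "2 ^ a * cross_agreements a (children W b x) (children W b y) =
    4 ^ b * 2 ^ (a - b) * of_bool (agree (a - b) x y)"
proof -
  have four: "(4::nat) ^ b = 2 ^ b * 2 ^ b" by (simp flip: power_mult_distrib)
  have sum: "cross_agreements a (children W b x) (children W b y) =
      (\<Sum>f<2 ^ b. num_agree a (x div 2 ^ b + f * 2 ^ (W - b)) (children W b y))"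
    unfolding cross_agreements_def children_def[of W b x]
    by (simp add: sum_list_distinct_conv_sum_set atLeast0LessThan comp_def)
  show ?thesis
  proof (cases "a \<le> b")
    case True
    have "agree 0 x y" using assms by (simp add: agree_def)
    moreover have "(2::nat) ^ b = 2 ^ a * 2 ^ (b - a)" using True by (simp flip: power_add)
    ultimately show ?thesis unfolding sum four
      using True assms div_pow_less[OF assms(2,3)] by (simp add: num_agree_children_short)
  next
    case False
    hence "(2::nat) ^ a = 2 ^ b * 2 ^ (a - b)" by (simp flip: power_add)
    thus ?thesis unfolding sum four using False assms by (simp add: num_agree_children_long)
  qed
qed

lemma agreements_children_le:
  assumes "a \<le> W" "b \<le> W" "x < 2 ^ W"
  shows "2 ^ a * agreements a (children W b x) \<le> 4 ^ b"
proof -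
  have four: "(4::nat) ^ b = 2 ^ b * 2 ^ b" by (simp flip: power_mult_distrib)
  have pairs: "2 ^ a * (2 * agreements a (children W b x) + 2 ^ b) = 4 ^ b * 2 ^ (a - b)"
    using cross_agreements_children[OF assms(1-3,3)] cross_agreements_self[of a "children W b x"]
    by (simp add: agree_def)
  show ?thesis
  proof (cases "a \<le> b")
    case False
    hence "(2::nat) ^ a = 2 ^ b * 2 ^ (a - b)" by (simp flip: power_add)
    with pairs have "2 ^ a * (2 * agreements a (children W b x)) = 0" by (simp add: algebra_simps four)
    thus ?thesis by simp
  qed (use pairs in \<open>simp add: algebra_simps\<close>)
qed

lemma agreements_next_level_Cons: "agreements a (next_level W (ok, b) (x # L)) =
  of_bool (ok x) * agreements a (children W b x) + agreements a (next_level W (ok, b) L) +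
  (\<Sum>y\<leftarrow>L. of_bool (ok x \<and> ok y) * cross_agreements a (children W b x) (children W b y))"
proof -
  have "cross_agreements a C (next_level W (ok, b) L) =
    (\<Sum>y\<leftarrow>L. of_bool (ok y) * cross_agreements a C (children W b y))" for C
    by (induction L) (auto simp: next_level_Cons sum_list_addf cross_agreements_def)
  thus ?thesis by (cases "ok x") (simp_all add: next_level_Cons agreements_append)
qed

context
  fixes p :: real
  assumes p: "0 \<le> p" "p \<le> 1"
begin

lemma prob_all_accepted:
  assumes "S \<subseteq> {..<2 ^ W}"
  shows "(\<integral>\<^sup>+ok. of_bool (\<forall>c\<in>S. ok c) \<partial>random_test W p) = ennreal p ^ card S"
proof -
  have "finite S" using assms finite_subset by blast
  hence "of_bool (\<forall>c\<in>S. ok c) = (\<Prod>c\<in>S. of_bool (ok c) :: ennreal)" for ok by (induction S) auto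
  thus ?thesis using nn_integral_prod_random_test[OF assms, where f = of_bool] p by simp
qed

lemma expected_num_accepted:
  assumes "\<forall>c\<in>set L. c < 2 ^ W"
  shows "(\<integral>\<^sup>+ok. of_nat (length (filter ok L)) \<partial>random_test W p) = ennreal p * of_nat (length L)"
  using assms
proof (induction L)
  case (Cons x L)
  have "(\<integral>\<^sup>+ok. of_nat (length (filter ok (x # L))) \<partial>random_test W p) =
    (\<integral>\<^sup>+ok. of_bool (\<forall>c\<in>{x}. ok c) + of_nat (length (filter ok L)) \<partial>random_test W p)"
    by (intro nn_integral_cong) simp
  also have "... = ennreal p ^ card {x} + ennreal p * of_nat (length L)"
    by (subst nn_integral_add) (use Cons prob_all_accepted[of "{x}"] in simp_all)
  finally show ?case by (simp add: algebra_simps)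
qed simp

lemma expected_cross_agreements:
  assumes "a \<le> W" "b \<le> W" "x < 2 ^ W" "x \<notin> set L" "\<forall>c\<in>set L. c < 2 ^ W"
  shows "(\<integral>\<^sup>+ok. (\<Sum>y\<leftarrow>L. of_bool (ok x \<and> ok y) *
      (2 ^ a * of_nat (cross_agreements a (children W b x) (children W b y)))) \<partial>random_test W p) =
    (ennreal p * 2 ^ b)\<^sup>2 * (2 ^ (a - b) * of_nat (num_agree (a - b) x L))"
  using assms(4,5)
proof (induction L)
  case (Cons y L)
  let ?c = "\<lambda>y. 2 ^ a * of_nat (cross_agreements a (children W b x) (children W b y)) :: ennreal"
  have c: "?c y = (2 ^ b)\<^sup>2 * 2 ^ (a - b) * of_bool (agree (a - b) x y)"
  proof -
    have "of_nat (2 ^ a * cross_agreements a (children W b x) (children W b y)) =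
        (of_nat (4 ^ b * 2 ^ (a - b) * of_bool (agree (a - b) x y)) :: ennreal)"
      using cross_agreements_children[OF assms(1-3)] Cons.prems by simp
    moreover have "(4::ennreal) ^ b = (2 ^ b)\<^sup>2" by (simp add: power2_eq_square flip: power_mult_distrib)
    ultimately show ?thesis by simp
  qed
  have "(\<integral>\<^sup>+ok. (\<Sum>y\<leftarrow>y # L. of_bool (ok x \<and> ok y) * ?c y) \<partial>random_test W p) =
    (\<integral>\<^sup>+ok. ?c y * of_bool (\<forall>z\<in>{x, y}. ok z) + (\<Sum>y\<leftarrow>L. of_bool (ok x \<and> ok y) * ?c y) \<partial>random_test W p)"
    by (intro nn_integral_cong) (simp add: mult.commute)
  also have "... = ?c y * ennreal p ^ card {x, y} +
    (ennreal p * 2 ^ b)\<^sup>2 * (2 ^ (a - b) * of_nat (num_agree (a - b) x L))"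
    using Cons prob_all_accepted[of "{x, y}"] assms(3)
    by (subst nn_integral_add) (simp_all add: nn_integral_cmult)
  also have "card {x, y} = 2" using Cons.prems by auto
  finally show ?case unfolding c by (simp add: algebra_simps power_mult_distrib)
qed simp

lemma expected_agreements_next_level:
  assumes ab: "a \<le> W" "b \<le> W" and "distinct L" "\<forall>c\<in>set L. c < 2 ^ W"
  shows "(\<integral>\<^sup>+ok. 2 ^ a * of_nat (agreements a (next_level W (ok, b) L)) \<partial>random_test W p) \<le>
    (ennreal p * 2 ^ b)\<^sup>2 * (2 ^ (a - b) * of_nat (agreements (a - b) L)) + ennreal p * 4 ^ b * of_nat
      (length L)"
  using assms(3,4)
proof (induction L)
  case (Cons x L)
  let ?N = "\<lambda>ok. 2 ^ a * of_nat (agreements a (next_level W (ok, b) L)) :: ennreal"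
  let ?c = "2 ^ a * of_nat (agreements a (children W b x)) :: ennreal"
  let ?X = "\<lambda>ok. \<Sum>y\<leftarrow>L. of_bool (ok x \<and>
    ok y) * (2 ^ a * of_nat (cross_agreements a (children W b x) (children W b y))) :: ennreal"
  have x: "x < 2 ^ W" "x \<notin> set L" and L: "\<forall>c\<in>set L. c < 2 ^ W" using Cons.prems by auto
  have "2 ^ a * of_nat (agreements a (next_level W (ok, b) (x # L))) =
    ?c * of_bool (\<forall>c\<in>{x}. ok c) + (?N ok + ?X ok)" for ok
  proof -
    have "2 ^ a * of_nat (\<Sum>y\<leftarrow>L. of_bool (ok x \<and> ok y) * cross_agreements a (children W b x) (children W b y)) = ?X ok"
      by (induction L) (auto simp: algebra_simps)
    thus ?thesis unfolding agreements_next_level_Cons by (simp add: algebra_simps)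
  qed
  hence "(\<integral>\<^sup>+ok. 2 ^ a * of_nat (agreements a (next_level W (ok, b) (x # L))) \<partial>random_test W p) =
    ?c * ennreal p + ((\<integral>\<^sup>+ok. ?N ok \<partial>random_test W p) + (\<integral>\<^sup>+ok. ?X ok \<partial>random_test W p))"
    using prob_all_accepted[of "{x}"] x by (simp add: nn_integral_add nn_integral_cmult)
  also have "... \<le> 4 ^ b * ennreal p +
    ((ennreal p * 2 ^ b)\<^sup>2 * (2 ^ (a - b) * of_nat (agreements (a - b) L)) + ennreal p * 4 ^ b * of_nat (length L) +
      (ennreal p * 2 ^ b)\<^sup>2 * (2 ^ (a - b) * of_nat (num_agree (a - b) x L)))"
  proof (intro add_mono mult_right_mono)
    show "?c \<le> 4 ^ b" using of_nat_mono[OF agreements_children_le[OF ab x(1)], where 'a = ennreal] by simp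
    show "(\<integral>\<^sup>+ok. ?X ok \<partial>random_test W p) \<le>
      (ennreal p * 2 ^ b)\<^sup>2 * (2 ^ (a - b) * of_nat (num_agree (a - b) x L))"
      using expected_cross_agreements[OF ab x L] by simp
  qed (use Cons in auto)
  also have "... = (ennreal p * 2 ^ b)\<^sup>2 * (2 ^ (a - b) * of_nat (agreements (a - b) (x # L))) +
    ennreal p * 4 ^ b * of_nat (length (x # L))"
    by (simp add: algebra_simps)
  finally show ?case .
qed simp

end

end

text \<open>The expected growth of the number of candidates over the next \<open>i\<close> levels, and the expected number
  of agreeing pairs below a single candidate.\<close>

fun growth :: "'a::comm_semiring_1 \<Rightarrow> nat \<Rightarrow> nat list \<Rightarrow> 'a" where
  "growth p 0 bs = 1"
| "growth p (Suc i) [] = 0"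
| "growth p (Suc i) (b # bs) = p * 2 ^ b * growth p i bs"

fun fresh_agreements :: "'a::comm_semiring_1 \<Rightarrow> nat \<Rightarrow> nat list \<Rightarrow> 'a" where
  "fresh_agreements p 0 bs = 0"
| "fresh_agreements p (Suc i) [] = 0"
| "fresh_agreements p (Suc i) (b # bs) =
  (growth p i bs)\<^sup>2 * (p * 4 ^ b) + fresh_agreements p i bs * (p * 2 ^ b)"

lemma growth_ennreal: "0 \<le> p \<Longrightarrow> growth (ennreal p) i bs = ennreal (growth p i bs) \<and> 0 \<le> growth p i bs"
  by (induction p i bs rule: growth.induct)
    (auto simp: ennreal_mult simp flip: ennreal_power ennreal_numeral)

lemma fresh_agreements_le:
  fixes p :: ennreal
  assumes "p \<le> 1" "\<forall>b\<in>set bs. b \<le> B" "\<And>t. t \<le> i \<Longrightarrow> c * growth p t bs \<le> G"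
    and "\<And>s t. s \<le> length bs \<Longrightarrow> growth p t (drop s bs) \<le> G"
  shows "c * fresh_agreements p i bs \<le> of_nat i * (G ^ 3 * 4 ^ B)"
  using assms
proof (induction i arbitrary: bs c)
  case (Suc i bs0 c)
  show ?case
  proof (cases bs0)
    case (Cons b bs)
    have g: "growth p i bs \<le> G" and c: "c \<le> G" using Suc.prems(3)[of 0] Suc.prems(4)[of 1 i] Cons by auto
    have "c * (p * 2 ^ b) * fresh_agreements p i bs \<le> of_nat i * (G ^ 3 * 4 ^ B)"
    proof (rule Suc.IH)
      show "c * (p * 2 ^ b) * growth p t bs \<le> G" if "t \<le> i" for t
        using Suc.prems(3)[of "Suc t"] that Cons by (simp add: mult.assoc)
      show "growth p t (drop s bs) \<le> G" if "s \<le> length bs" for s t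
        using Suc.prems(4)[of "Suc s" t] that Cons by simp
    qed (use Suc.prems Cons in auto)
    moreover have "c * ((growth p i bs)\<^sup>2 * (p * 4 ^ b)) \<le> G * (G\<^sup>2 * (1 * 4 ^ B))"
      using Suc.prems Cons g c by (intro mult_mono power_mono power_increasing) auto
    ultimately show ?thesis using Cons add_mono
      by (fastforce simp: algebra_simps power3_eq_cube power2_eq_square)
  qed simp
qed simp

context
  fixes W :: nat
begin

fun level_agreements :: "nat \<Rightarrow> nat \<Rightarrow> layer list \<Rightarrow> nat list \<Rightarrow> nat" where
  "level_agreements 0 a ls L = agreements W a L"
| "level_agreements (Suc i) a [] L = 0"
| "level_agreements (Suc i) a (l # ls) L =
  (if distinct L then level_agreements i a ls (next_level W l L) else 0)"

lemma repeats_le_level_agreements: "of_bool (repeats W ls L) \<le> (\<Sum>i<length ls. level_agreements i W ls L)"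
proof (induction ls arbitrary: L)
  case (Cons l ls)
  have levels: "(\<Sum>i<length (l # ls). level_agreements i W (l # ls) L) =
    agreements W W L + (\<Sum>i<length ls. level_agreements (Suc i) W (l # ls) L)"
    unfolding length_Cons sum.lessThan_Suc_shift by simp
  show ?case
  proof (cases "distinct L")
    case True
    thus ?thesis unfolding levels using Cons[of "next_level W l L"] by simp
  next
    case False
    thus ?thesis unfolding levels using agreements_pos[OF False, of W] by simp
  qed
qed simp

context
  fixes p :: real
  assumes p: "0 \<le> p" "p \<le> 1"
begin

lemma expected_level_agreements:
  assumes "a \<le> W" "\<forall>b\<in>set bs. b \<le> W" "\<forall>c\<in>set L. c < 2 ^ W"
  defines "s \<equiv> \<lambda>i bs. a - sum_list (take i bs)"
  shows "(\<integral>\<^sup>+ls. 2 ^ a * of_nat (level_agreements i a ls L) \<partial>random_layers W p bs) \<le>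
    (growth (ennreal p) i bs)\<^sup>2 * (2 ^ s i bs * of_nat (agreements W (s i bs) L)) +
    fresh_agreements (ennreal p) i bs * of_nat (length L)"
  using assms(2,3)
proof (induction i arbitrary: bs L)
  case 0
  show ?case by (simp add: s_def measure_pmf.emeasure_space_1)
next
  case (Suc i bs0 L)
  show ?case
  proof (cases "bs0 \<noteq> [] \<and> distinct L")
    case True
    then obtain b bs where bs0: "bs0 = b # bs" by (cases bs0) auto
    let ?G = "growth (ennreal p) i bs" and ?F = "fresh_agreements (ennreal p) i bs" and ?s = "s i bs"
    let ?N = "\<lambda>ok. next_level W (ok, b) L"
    have "(\<integral>\<^sup>+ls. 2 ^ a * of_nat (level_agreements (Suc i) a ls L) \<partial>random_layers W p bs0) =
      (\<integral>\<^sup>+ok. \<integral>\<^sup>+ls. 2 ^ a * of_nat (level_agreements i a ls (?N ok)) \<partial>random_layers W p bs \<partial>random_test W p)"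
      by (simp only: bs0 random_layers.simps nn_integral_bind_pmf nn_integral_map_pmf level_agreements.simps True if_True)
    also have "... \<le> (\<integral>\<^sup>+ok. ?G\<^sup>2 * (2 ^ ?s * of_nat (agreements W ?s (?N ok))) +
      ?F * of_nat (length (?N ok)) \<partial>random_test W p)"
      by (intro nn_integral_mono Suc.IH next_level_less) (use bs0 Suc.prems in simp_all)
    also have "... = (\<integral>\<^sup>+ok. ?G\<^sup>2 * (2 ^ ?s * of_nat (agreements W ?s (?N ok))) +
      ?F * 2 ^ b * of_nat (length (filter ok L)) \<partial>random_test W p)"
      by (simp add: length_next_level mult.assoc)
    also have "... = ?G\<^sup>2 * (\<integral>\<^sup>+ok. 2 ^ ?s * of_nat (agreements W ?s (?N ok)) \<partial>random_test W p) +
      ?F * 2 ^ b * (ennreal p * of_nat (length L))"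
      using expected_num_accepted[OF p Suc.prems(2)] by (simp add: nn_integral_add nn_integral_cmult)
    also have "... \<le> ?G\<^sup>2 * ((ennreal p * 2 ^ b)\<^sup>2 * (2 ^ (?s - b) * of_nat (agreements W (?s - b) L)) +
      ennreal p * 4 ^ b * of_nat (length L)) +
        ?F * 2 ^ b * (ennreal p * of_nat (length L))"
      by (intro add_mono mult_left_mono order_refl expected_agreements_next_level p)
        (use bs0 assms(1) True Suc.prems in \<open>auto simp: s_def\<close>)
    also have "?s - b = s (Suc i) bs0" by (simp add: bs0 s_def)
    finally show ?thesis by (simp add: bs0 algebra_simps power_mult_distrib)
  next
    case False
    hence "(\<integral>\<^sup>+ls. 2 ^ a * of_nat (level_agreements (Suc i) a ls L) \<partial>random_layers W p bs0) = 0"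
      by (cases bs0) (simp_all add: nn_integral_0_iff_AE)
    thus ?thesis by simp
  qed
qed

lemma prob_repeats:
  fixes G :: ennreal
  assumes bs: "\<forall>b\<in>set bs. b \<le> W" "\<forall>b\<in>set bs. b \<le> B" and a: "a \<le> W"
    and G: "\<And>s t. s \<le> length bs \<Longrightarrow> growth (ennreal p) t (drop s bs) \<le> G"
  shows "2 ^ W * (\<integral>\<^sup>+ls. of_bool (repeats W ls (children W a 0)) \<partial>random_layers W p bs) \<le>
    of_nat (length bs) * (G\<^sup>2 * 4 ^ a + of_nat (length bs) * (G ^ 3 * 4 ^ B) * 2 ^ a)"
proof -
  let ?L = "children W a 0"
  let ?I = "\<lambda>i. \<integral>\<^sup>+ls. 2 ^ W * of_nat (level_agreements i W ls ?L) \<partial>random_layers W p bs"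
  have level: "?I i \<le> G\<^sup>2 * 4 ^ a + of_nat (length bs) * (G ^ 3 * 4 ^ B) * 2 ^ a" if "i < length bs" for i
  proof -
    let ?s = "W - sum_list (take i bs)"
    have fresh: "fresh_agreements (ennreal p) i bs \<le> of_nat i * (G ^ 3 * 4 ^ B)"
      using fresh_agreements_le[of "ennreal p" bs B i 1 G] p bs(2) G G[of 0] by simp
    have "?I i \<le> (growth (ennreal p) i bs)\<^sup>2 * (2 ^ ?s * of_nat (agreements W ?s ?L)) +
      fresh_agreements (ennreal p) i bs * of_nat (2 ^ a)"
      using expected_level_agreements[OF order_refl bs(1), of ?L i] children_less[OF a, of 0] by simp
    also have "... \<le> G\<^sup>2 * 4 ^ a + of_nat i * (G ^ 3 * 4 ^ B) * of_nat (2 ^ a)"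
    proof (intro add_mono mult_mono power_mono fresh)
      have "2 ^ ?s * agreements W ?s ?L \<le> 4 ^ a" by (rule agreements_children_le) (use a in auto)
      from of_nat_mono[OF this] show "2 ^ ?s * of_nat (agreements W ?s ?L) \<le> (4 ^ a :: ennreal)" by simp
    qed (use G[of 0] in simp_all)
    also have "... \<le> G\<^sup>2 * 4 ^ a + of_nat (length bs) * (G ^ 3 * 4 ^ B) * of_nat (2 ^ a)"
      using that by (intro add_left_mono mult_right_mono of_nat_mono) auto
    finally show ?thesis by simp
  qed
  have "2 ^ W * (\<integral>\<^sup>+ls. of_bool (repeats W ls ?L) \<partial>random_layers W p bs) =
    (\<integral>\<^sup>+ls. 2 ^ W * of_bool (repeats W ls ?L) \<partial>random_layers W p bs)"
    by (simp add: nn_integral_cmult)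
  also have "... \<le> (\<integral>\<^sup>+ls. (\<Sum>i<length bs. 2 ^ W * of_nat (level_agreements i W ls ?L)) \<partial>random_layers W p bs)"
  proof (rule nn_integral_mono_AE, rule AE_pmfI)
    fix ls assume "ls \<in> set_pmf (random_layers W p bs)"
    hence "of_nat (of_bool (repeats W ls ?L)) \<le>
      (of_nat (\<Sum>i<length bs. level_agreements i W ls ?L) :: ennreal)"
      using repeats_le_level_agreements[of ls ?L] length_random_layers by (intro of_nat_mono) metis
    from mult_left_mono[OF this, of "2 ^ W"]
    show "2 ^ W * of_bool (repeats W ls ?L) \<le>
      (\<Sum>i<length bs. 2 ^ W * of_nat (level_agreements i W ls ?L) :: ennreal)"
      by (simp add: sum_distrib_left)
  qed
  also have "... = (\<Sum>i<length bs. ?I i)" by (rule nn_integral_sum) simp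
  also have "... \<le> (\<Sum>i<length bs. G\<^sup>2 * 4 ^ a + of_nat (length bs) * (G ^ 3 * 4 ^ B) * 2 ^ a)"
    by (intro sum_mono level) simp
  finally show ?thesis by simp
qed

end

end

section \<open>Reasoning about programs\<close>

fun loop_free :: "com \<Rightarrow> bool" where
  "loop_free (Seq a b) \<longleftrightarrow> loop_free a \<and> loop_free b"
| "loop_free (Cond e a b) \<longleftrightarrow> loop_free a \<and> loop_free b"
| "loop_free (While e a) \<longleftrightarrow> False"
| "loop_free _ \<longleftrightarrow> True"

fun cost_bound :: "com \<Rightarrow> nat" where
  "cost_bound (Store a b) = 1 + acost a + acost b"
| "cost_bound (Hash a b i) = 1 + acost a + acost b + acost i"
| "cost_bound (Seq a b) = cost_bound a + cost_bound b"
| "cost_bound (Cond e a b) = 1 + acost e + max (cost_bound a) (cost_bound b)"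
| "cost_bound _ = 1"

locale word_ram =
  fixes w :: nat and H :: "nat \<Rightarrow> 'k \<Rightarrow> bool" and ks :: "'k list"
begin

fun denote :: "com \<Rightarrow> state \<Rightarrow> state" where
  "denote (Store a b) s = ((fst s)(aval w (fst s) a := aval w (fst s) b), snd s)"
| "denote (Hash a b i) s =
    ((fst s)(aval w (fst s) a := take_bit w (hash_val H ks (snd s) (aval w (fst s) b) (aval w (fst s) i))), snd s)"
| "denote Rehash s = (fst s, Suc (snd s))"
| "denote (Seq a b) s = denote b (denote a s)"
| "denote (Cond e a b) s = (if aval w (fst s) e \<noteq> 0 then denote a s else denote b s)"
| "denote _ s = s"

lemma exec_denote: "loop_free c \<Longrightarrow> \<exists>t\<le>cost_bound c. exec w H ks c s t (denote c s)"
proof (induction c arbitrary: s)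
  case Skip
  show ?case using exec.Skip[of w H ks s] by (intro exI[of _ 1]) simp
next
  case (Store a b)
  show ?case using exec.Store[of w H ks a b "fst s" "snd s"]
    by (intro exI[of _ "1 + acost a + acost b"]) simp
next
  case (Hash a b i)
  show ?case using exec.Hash[of w H ks a b i "fst s" "snd s"]
    by (intro exI[of _ "1 + acost a + acost b + acost i"]) simp
next
  case Rehash
  show ?case using exec.Rehash[of w H ks "fst s" "snd s"] by (intro exI[of _ 1]) simp
next
  case (Seq a b)
  then obtain t u where "t \<le> cost_bound a" "exec w H ks a s t (denote a s)"
    "u \<le> cost_bound b" "exec w H ks b (denote a s) u (denote b (denote a s))" by (metis loop_free.simps(1))
  thus ?case using exec.Seq by (intro exI[of _ "t + u"]) fastforce
next
  case (Cond e a b)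
  show ?case
  proof (cases "aval w (fst s) e = 0")
    case True
    obtain t where "t \<le> cost_bound b" "exec w H ks b s t (denote b s)" using Cond by fastforce
    thus ?thesis using exec.CondFalse[OF True, of H ks b t _ a] True
      by (intro exI[of _ "1 + acost e + t"]) simp
  next
    case False
    obtain t where "t \<le> cost_bound a" "exec w H ks a s t (denote a s)" using Cond by fastforce
    thus ?thesis using exec.CondTrue[OF False, of H ks a t _ b] False
      by (intro exI[of _ "1 + acost e + t"]) simp
  qed
qed simp

definition reaches :: "com \<Rightarrow> state \<Rightarrow> nat \<Rightarrow> (state \<Rightarrow> bool) \<Rightarrow> bool" where
  "reaches c s T Q \<longleftrightarrow> (\<exists>t s'. exec w H ks c s t s' \<and> t \<le> T \<and> Q s')"

definition runs :: "nat \<Rightarrow> com \<Rightarrow> memory \<Rightarrow> nat \<Rightarrow> (memory \<Rightarrow> bool) \<Rightarrow> bool" where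
  "runs g c m T Q \<longleftrightarrow> reaches c (m, g) T (\<lambda>s. snd s = g \<and> Q (fst s))"

lemma reaches_denote: "loop_free c \<Longrightarrow> cost_bound c \<le> T \<Longrightarrow> Q (denote c s) \<Longrightarrow> reaches c s T Q"
  using exec_denote[of c s] unfolding reaches_def by (meson order_trans)

lemma reaches_mono: "reaches c s T Q \<Longrightarrow> T \<le> T' \<Longrightarrow> (\<And>s. Q s \<Longrightarrow> Q' s) \<Longrightarrow> reaches c s T' Q'"
  unfolding reaches_def by (meson order_trans)

lemma reaches_Seq:
  assumes "reaches a s T1 R" "\<And>s'. R s' \<Longrightarrow> reaches b s' T2 Q" "T1 + T2 \<le> T"
  shows "reaches (Seq a b) s T Q"
proof -
  obtain t1 s1 where a: "exec w H ks a s t1 s1" "t1 \<le> T1" "R s1" using assms(1) by (auto simp: reaches_def)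
  obtain t2 s2 where b: "exec w H ks b s1 t2 s2" "t2 \<le> T2" "Q s2" using assms(2)[OF a(3)]
    by (auto simp: reaches_def)
  show ?thesis unfolding reaches_def using exec.Seq[OF a(1) b(1)] a(2) b(2,3) assms(3)
    by (intro exI[of _ "t1 + t2"] exI[of _ s2]) simp
qed

lemma reaches_Cond:
  assumes "aval w (fst s) e \<noteq> 0 \<Longrightarrow> reaches a s T1 Q" "aval w (fst s) e = 0 \<Longrightarrow> reaches b s T1 Q"
    "1 + acost e + T1 \<le> T"
  shows "reaches (Cond e a b) s T Q"
proof (cases "aval w (fst s) e = 0")
  case True
  then obtain t s' where "exec w H ks b s t s'" "t \<le> T1" "Q s'" using assms(2) by (auto simp: reaches_def)
  thus ?thesis unfolding reaches_def using exec.CondFalse[OF True, of H ks b t s' a] assms(3)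
    by (intro exI[of _ "1 + acost e + t"] exI[of _ s']) simp
next
  case False
  then obtain t s' where "exec w H ks a s t s'" "t \<le> T1" "Q s'" using assms(1) by (auto simp: reaches_def)
  thus ?thesis unfolding reaches_def using exec.CondTrue[OF False, of H ks a t s' b] assms(3)
    by (intro exI[of _ "1 + acost e + t"] exI[of _ s']) simp
qed

lemma reaches_While_done: "aval w (fst s) b = 0 \<Longrightarrow> 1 + acost b \<le> T \<Longrightarrow> Q s \<Longrightarrow> reaches (While b c) s T Q"
  unfolding reaches_def using exec.WhileFalse[of w s b H ks c] by blast

lemma reaches_While_step:
  assumes "aval w (fst s) b \<noteq> 0" "reaches c s T1 R"
    "\<And>s'. R s' \<Longrightarrow> reaches (While b c) s' T2 Q" "1 + acost b + T1 + T2 \<le> T"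
  shows "reaches (While b c) s T Q"
proof -
  obtain t1 s1 where c: "exec w H ks c s t1 s1" "t1 \<le> T1" "R s1" using assms(2) by (auto simp: reaches_def)
  obtain t2 s2 where l: "exec w H ks (While b c) s1 t2 s2" "t2 \<le> T2" "Q s2" using assms(3)[OF c(3)]
    by (auto simp: reaches_def)
  show ?thesis unfolding reaches_def using exec.WhileTrue[OF assms(1) c(1) l(1)] c(2) l(2,3) assms(4)
    by (intro exI[of _ "1 + acost b + t1 + t2"] exI[of _ s2]) simp
qed

lemma runs_denote:
  assumes "loop_free c" "cost_bound c \<le> T" "denote c (m, g) = (m', g)" "Q m'"
  shows "runs g c m T Q"
  using assms unfolding runs_def by (intro reaches_denote) auto

lemma runs_mono: "runs g c m T Q \<Longrightarrow> T \<le> T' \<Longrightarrow> (\<And>m. Q m \<Longrightarrow> Q' m) \<Longrightarrow> runs g c m T' Q'"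
  unfolding runs_def by (erule reaches_mono) auto

lemma runs_Seq:
  assumes "runs g a m T1 R" "\<And>m'. R m' \<Longrightarrow> runs g b m' T2 Q" "T1 + T2 \<le> T"
  shows "runs g (Seq a b) m T Q"
  using assms unfolding runs_def by (intro reaches_Seq[OF assms(1)[unfolded runs_def]]) auto

lemma runs_Seq_denote:
  assumes "loop_free a" "denote a (m, g) = (m', g)" "runs g b m' T2 Q" "cost_bound a + T2 \<le> T"
  shows "runs g (Seq a b) m T Q"
  by (rule runs_Seq[OF runs_denote[OF assms(1) order_refl assms(2), where Q = "\<lambda>m. m = m'"]])
    (use assms in auto)

lemma runs_Cond:
  assumes "aval w m e \<noteq> 0 \<Longrightarrow> runs g a m T1 Q" "aval w m e = 0 \<Longrightarrow> runs g b m T1 Q" "1 + acost e + T1 \<le> T"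
  shows "runs g (Cond e a b) m T Q"
  using assms unfolding runs_def by (intro reaches_Cond[where ?T1.0 = T1]) auto

lemma runs_for:
  assumes "I 0 m"
    and "\<And>i m. i < N \<Longrightarrow> I i m \<Longrightarrow> aval w m b \<noteq> 0 \<and> runs g c m (T i) (I (Suc i))"
    and "\<And>m. I N m \<Longrightarrow> aval w m b = 0"
    and "(\<Sum>i<N. T i + (1 + acost b)) + (1 + acost b) \<le> T'"
    and "\<And>m. I N m \<Longrightarrow> Q m"
  shows "runs g (While b c) m T' Q"
proof -
  let ?R = "\<lambda>k. (\<Sum>i=k..<N. T i + (1 + acost b)) + (1 + acost b)"
  have "reaches (While b c) (m, g) (?R k) (\<lambda>s. snd s = g \<and> I N (fst s))" if "k \<le> N" "I k m" for k m
    using that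
  proof (induction "N - k" arbitrary: k m)
    case 0
    thus ?case using assms(3) by (intro reaches_While_done) auto
  next
    case (Suc n)
    hence k: "k < N" by simp
    show ?case
    proof (rule reaches_While_step)
      show "aval w (fst (m, g)) b \<noteq> 0" "reaches c (m, g) (T k) (\<lambda>s. snd s = g \<and> I (Suc k) (fst s))"
        using assms(2)[OF k Suc.prems(2)] by (auto simp: runs_def)
      show "reaches (While b c) s (?R (Suc k)) (\<lambda>s. snd s = g \<and> I N (fst s))"
        if "snd s = g \<and> I (Suc k) (fst s)" for s
        using Suc.hyps(1)[of "Suc k" "fst s"] Suc.hyps(2) k that by (cases s) auto
      show "1 + acost b + T k + ?R (Suc k) \<le> ?R k" using k by (subst (2) sum.atLeast_Suc_lessThan) auto
    qed
  qed
  from this[of 0 m] assms(1,4,5) show ?thesis unfolding runs_def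
    by (auto simp: atLeast0LessThan intro: reaches_mono)
qed

end

lemma exec_bounded:
  assumes "exec w H ks c s t s'" "\<forall>a. fst s a < 2 ^ w"
  shows "\<forall>a. fst s' a < 2 ^ w"
proof -
  have "aval w m e < 2 ^ w" if "\<forall>a. m a < 2 ^ w" for m e
    using that by (induction e) (auto simp: take_bit_nat_less_exp)
  with assms show ?thesis by (induction rule: exec.induct) (auto simp: take_bit_nat_less_exp)
qed

lemma exec_finitely_many_hashes:
  assumes "exec w H ks c s t s'"
  shows "eventually (\<lambda>N. \<forall>H'. (\<forall>i<N. \<forall>x\<in>set ks. H' i x = H i x) \<longrightarrow> exec w H' ks c s t s') sequentially"
  using assms
proof (induction rule: exec.induct)
  case (Hash a b i m g)
  show ?case using eventually_gt_at_top[of "prod_encode (g, aval w m b)"]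
  proof (eventually_elim, intro allI impI)
    fix N H' assume "prod_encode (g, aval w m b) < N" "\<forall>i<N. \<forall>x\<in>set ks. H' i x = H i x"
    hence "hash_val H' ks g (aval w m b) (aval w m i) = hash_val H ks g (aval w m b) (aval w m i)"
      by (simp add: hash_val_def)
    thus "exec w H' ks (Hash a b i) (m, g) (1 + acost a + acost b + acost i)
        (m(aval w m a := take_bit w (hash_val H ks g (aval w m b) (aval w m i))), g)"
      using exec.Hash[of w H' ks a b i m g] by simp
  qed
next
  case (Seq c1 s1 t1 s2 c2 t2 s3)
  from Seq.IH show ?case by eventually_elim (blast intro: exec.Seq)
next
  case (WhileTrue s1 b c t1 s2 t2 s3)
  from WhileTrue.IH show ?case by eventually_elim (blast intro: exec.WhileTrue[OF WhileTrue.hyps(1)])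
next
  case (CondTrue s b c1 t s' c2)
  from CondTrue.IH show ?case by eventually_elim (blast intro: exec.CondTrue[OF CondTrue.hyps(1)])
next
  case (CondFalse s b c2 t s' c1)
  from CondFalse.IH show ?case by eventually_elim (blast intro: exec.CondFalse[OF CondFalse.hyps(1)])
qed (intro always_eventually allI impI exec.intros; assumption?)+

lemma sets_Collect_finitely_determined:
  fixes h :: "nat \<Rightarrow> 'k \<Rightarrow> 'w \<Rightarrow> bool"
  assumes h: "\<And>s x. h s x \<in> measurable M (count_space UNIV)" and K: "finite K"
    and P: "\<And>H. P H \<Longrightarrow> \<exists>N. \<forall>H'. (\<forall>i<N. \<forall>x\<in>K. H' i x = H i x) \<longrightarrow> P H'"
  shows "{om \<in> space M. P (\<lambda>s x. h s x om)} \<in> sets M"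
proof -
  define forces where "forces N T \<longleftrightarrow> (\<forall>H'. (\<forall>i<N. \<forall>x\<in>K. H' i x \<longleftrightarrow> (i, x) \<in> T) \<longrightarrow> P H')" for N :: nat and T
  let ?C = "\<lambda>N T. {om \<in> space M. \<forall>z\<in>{..<N} \<times> K. h (fst z) (snd z) om \<longleftrightarrow> z \<in> T}"
  have "{om \<in> space M. P (\<lambda>s x. h s x om)} = (\<Union>N. \<Union>T\<in>{T \<in> Pow ({..<N} \<times> K). forces N T}. ?C N T)"
    (is "?A = ?B")
  proof (intro set_eqI iffI)
    fix om assume "om \<in> ?A"
    hence om: "om \<in> space M" "P (\<lambda>s x. h s x om)" by auto
    obtain N where N: "\<forall>H'. (\<forall>i<N. \<forall>x\<in>K. H' i x = h i x om) \<longrightarrow> P H'" using P[OF om(2)] by auto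
    let ?T = "{z \<in> {..<N} \<times> K. h (fst z) (snd z) om}"
    have "forces N ?T" using N unfolding forces_def by auto
    thus "om \<in> ?B" using om(1) by (intro UN_I[of N] UN_I[of ?T]) auto
  next
    fix om assume "om \<in> ?B"
    thus "om \<in> ?A" unfolding forces_def by fastforce
  qed
  also have "... \<in> sets M"
  proof -
    have "?C N T \<in> sets M" for N T
    proof (rule sets.sets_Collect_finite_All)
      fix z assume "z \<in> {..<N} \<times> K"
      have "Measurable.pred M (h (fst z) (snd z))" using h by auto
      thus "{om \<in> space M. h (fst z) (snd z) om \<longleftrightarrow> z \<in> T} \<in> sets M" by measurable
    qed (use K in simp)
    hence "(\<Union>T\<in>{T \<in> Pow ({..<N} \<times> K). forces N T}. ?C N T) \<in> sets M" for N
      by (intro sets.finite_UN) (use K in auto)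
    thus ?thesis by (intro sets.countable_UN) auto
  qed
  finally show ?thesis .
qed

section \<open>The probability of a perfect split\<close>

definition central_binomial :: "nat \<Rightarrow> real" where
  "central_binomial t = real ((2 * t) choose t) / 4 ^ t"

lemma central_binomial_0 [simp]: "central_binomial 0 = 1"
  by (simp add: central_binomial_def)

lemma central_binomial_Suc:
  "central_binomial (Suc t) = central_binomial t * ((2 * real t + 1) / (2 * real t + 2))"
proof -
  have f: "real ((2 * t) choose t) = fact (2 * t) / (fact t * fact t)" for t
    by (simp add: binomial_fact)
  have "fact (2 * Suc t) = (2 * real t + 2) * (2 * real t + 1) * fact (2 * t)"
    by (simp add: algebra_simps)
  moreover have "fact (Suc t) = (real t + 1) * fact t" by (simp add: algebra_simps)
  ultimately show ?thesis unfolding central_binomial_def f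
    by (simp add: divide_simps) (simp add: algebra_simps)
qed

lemma central_binomial_pos: "0 < central_binomial t"
  by (simp add: central_binomial_def)

lemma central_binomial_le_half: "1 \<le> t \<Longrightarrow> central_binomial t \<le> 1 / 2"
proof (induction t rule: nat_induct_at_least)
  case base
  show ?case by (simp add: central_binomial_def)
next
  case (Suc t)
  have "central_binomial (Suc t) \<le> central_binomial t * 1"
    unfolding central_binomial_Suc using central_binomial_pos[of t] by (intro mult_left_mono) auto
  thus ?case using Suc by linarith
qed

lemma central_binomial_square_ge: "1 \<le> t \<Longrightarrow> 1 \<le> 4 * real t * (central_binomial t)\<^sup>2"
proof (induction t rule: nat_induct_at_least)
  case base
  show ?case by (simp add: central_binomial_def power2_eq_square)
next
  case (Suc t)
  let ?c = "(central_binomial t)\<^sup>2"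
  have two: "2 * real t + 2 = 2 * (real t + 1)" by simp
  have "(4 * real t * ?c) * (real t + 1) \<le> (2 * real t + 1)\<^sup>2 * ?c"
    by (simp add: power2_eq_square algebra_simps)
  moreover have "1 * (real t + 1) \<le> (4 * real t * ?c) * (real t + 1)"
    by (rule mult_right_mono[OF Suc.IH]) simp
  ultimately have "1 * (real t + 1) \<le> (2 * real t + 1)\<^sup>2 * ?c" by (rule order_trans[rotated])
  hence "1 \<le> (2 * real t + 1)\<^sup>2 * ?c / (real t + 1)" by (simp add: le_divide_eq)
  also have "... = 4 * (real t + 1) * ?c * (2 * real t + 1)\<^sup>2 / (2 * (real t + 1))\<^sup>2"
    by (simp add: divide_simps power2_eq_square) (simp add: algebra_simps)
  also have "... = 4 * real (Suc t) * (central_binomial (Suc t))\<^sup>2"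
    unfolding central_binomial_Suc two by (simp add: power_mult_distrib power_divide add.commute)
  finally show ?case .
qed

definition split_prob :: "nat \<Rightarrow> real" where
  "split_prob k = central_binomial (2 ^ (k - 1))"

lemma split_prob_pos: "0 < split_prob k" and split_prob_le_half: "split_prob k \<le> 1 / 2"
  unfolding split_prob_def using central_binomial_pos central_binomial_le_half[of "2 ^ (k - 1)"] by auto

lemma split_prob_bounds: "0 \<le> split_prob k" "split_prob k \<le> 1"
  using split_prob_pos[of k] split_prob_le_half[of k] by auto

lemma inverse_split_prob_le:
  assumes "1 \<le> k"
  shows "1 / split_prob k \<le> 2 * 2 powr (real k / 2)"
proof -
  let ?t = "2 ^ (k - 1) :: nat" and ?b = "2 * 2 powr (real k / 2)"
  have "1 \<le> 4 * real ?t * (split_prob k)\<^sup>2" unfolding split_prob_def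
    by (rule central_binomial_square_ge) simp
  also have "4 * real ?t = 2 * 2 ^ k" using assms by (cases k) auto
  also have "2 * 2 ^ k \<le> ?b\<^sup>2"
  proof -
    have "(2 powr (real k / 2))\<^sup>2 = (2::real) ^ k"
      by (simp add: power2_eq_square flip: powr_add powr_realpow)
    thus ?thesis by (simp add: power_mult_distrib)
  qed
  finally have "1 \<le> (?b * split_prob k)\<^sup>2"
    by (simp add: power_mult_distrib mult_right_mono)
  hence "1 \<le> ?b * split_prob k"
    using split_prob_pos[of k] abs_le_square_iff[of 1 "?b * split_prob k"] by simp
  thus ?thesis using split_prob_pos[of k] by (simp add: divide_simps mult.commute)
qed

text \<open>The probability that all splits are perfect is \<open>fact n / n ^ n\<close>.\<close>

lemma sum_log_split_prob:
  "(\<Sum>k=1..d. 2 ^ (d - k) * log 2 (1 / split_prob k)) = log 2 ((2 ^ d) ^ (2 ^ d) / fact (2 ^ d))"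
proof (induction d)
  case (Suc d)
  let ?m = "2 ^ d :: nat"
  let ?x = "real ?m ^ ?m / fact ?m"
  have x: "0 < ?x" by simp
  have "(\<Sum>k=1..Suc d. 2 ^ (Suc d - k) * log 2 (1 / split_prob k)) =
    2 * (\<Sum>k=1..d. 2 ^ (d - k) * log 2 (1 / split_prob k)) + log 2 (1 / split_prob (Suc d))"
    by (simp add: sum_distrib_left Suc_diff_le mult.assoc)
  also have "... = 2 * log 2 ?x + log 2 (1 / split_prob (Suc d))"
    using Suc by simp
  also have "... = log 2 (?x\<^sup>2 * (1 / split_prob (Suc d)))"
    using log_nat_power[OF less_imp_le[OF x], of 2 2] x split_prob_pos[of "Suc d"]
    by (subst log_mult) (auto simp del: of_nat_power)
  also have "1 / split_prob (Suc d) = 4 ^ ?m * (fact ?m)\<^sup>2 / fact (2 * ?m)"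
    by (simp add: split_prob_def central_binomial_def binomial_fact power2_eq_square)
  also have "?x\<^sup>2 * (4 ^ ?m * (fact ?m)\<^sup>2 / fact (2 * ?m)) = (2 ^ Suc d) ^ (2 ^ Suc d) / fact (2 ^ Suc d)"
  proof -
    have "(2 * real ?m) ^ (2 * ?m) = 2 ^ (2 * ?m) * real ?m ^ (?m * 2)"
      by (simp only: power_mult_distrib mult.commute[of 2 ?m])
    also have "... = (real ?m ^ ?m)\<^sup>2 * 4 ^ ?m"
      by (simp only: power_mult power2_eq_square) simp
    finally show ?thesis by (simp add: power_divide field_simps)
  qed
  finally show ?case .
qed (simp add: split_prob_def)

lemma power_div_fact_le_exp: "real n ^ n / fact n \<le> exp (real n)"
proof -
  have "(\<Sum>i\<in>{n}. real n ^ i /\<^sub>R fact i) \<le> (\<Sum>i. real n ^ i /\<^sub>R fact i)"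
    by (rule sum_le_suminf[OF summable_exp_generic]) auto
  thus ?thesis by (simp add: exp_def divide_inverse mult.commute)
qed

lemma sum_log_split_prob_le: "(\<Sum>k=1..d. 2 ^ (d - k) * log 2 (1 / split_prob k)) \<le> 2 ^ d * log 2 (exp 1)"
proof -
  have "log 2 ((2 ^ d) ^ (2 ^ d) / fact (2 ^ d)) \<le> log 2 (exp (real (2 ^ d)))"
    using power_div_fact_le_exp[of "2 ^ d"] by (intro log_mono) auto
  also have "... = 2 ^ d * log 2 (exp 1)" by (simp add: log_def)
  finally show ?thesis unfolding sum_log_split_prob .
qed

section \<open>Logarithms in integer arithmetic\<close>

text \<open>A pair \<open>(X, E)\<close> is the floating-point number \<open>X / 2 ^ (q + E)\<close>. Squaring the approximation of a
  probability repeatedly turns its exponent into a multiple of the logarithm.\<close>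

definition renorm :: "nat \<Rightarrow> nat \<Rightarrow> nat \<Rightarrow> nat \<times> nat" where
  "renorm q X E = (if X < 2 ^ (q - 1) then (2 * X, E + 1) else (X, E))"

fun float_central :: "nat \<Rightarrow> nat \<Rightarrow> nat \<times> nat" where
  "float_central q 0 = (2 ^ q, 0)"
| "float_central q (Suc t) =
    renorm q (fst (float_central q t) * (2 * t + 1) div (2 * t + 2)) (snd (float_central q t))"

fun float_square :: "nat \<Rightarrow> nat \<times> nat \<Rightarrow> nat \<Rightarrow> nat \<times> nat" where
  "float_square q s 0 = s"
| "float_square q s (Suc i) =
    renorm q (fst (float_square q s i) * fst (float_square q s i) div 2 ^ q) (2 * snd (float_square q s i))"

definition approximates :: "nat \<Rightarrow> nat \<Rightarrow> nat \<times> nat \<Rightarrow> real \<Rightarrow> bool" where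
  "approximates q N s p \<longleftrightarrow> 2 ^ (q - 1) \<le> real (fst s) \<and> real (fst s) \<le> 2 ^ q \<and>
    fst s / 2 ^ (q + snd s) \<le> p \<and> p \<le> fst s / 2 ^ (q + snd s) * (1 + 1 / 2 ^ (q - 2)) ^ N"

lemma approximatesD:
  assumes "approximates q N s p"
  shows "2 ^ (q - 1) \<le> real (fst s)" "real (fst s) \<le> 2 ^ q" "fst s / 2 ^ (q + snd s) \<le> p"
    "p \<le> fst s / 2 ^ (q + snd s) * (1 + 1 / 2 ^ (q - 2)) ^ N"
  using assms by (simp_all add: approximates_def)

lemma approximates_renorm:
  fixes X :: nat and Y :: real
  assumes q: "2 \<le> q" and Y: "2 ^ (q - 2) \<le> Y" "Y \<le> 2 ^ q" and X: "real X \<le> Y" "Y < real X + 1"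
    and p: "Y / 2 ^ (q + E) \<le> p" "p \<le> Y / 2 ^ (q + E) * (1 + 1 / 2 ^ (q - 2)) ^ N"
  shows "approximates q (Suc N) (renorm q X E) p"
proof -
  define u where "u = (2::real) ^ (q - 2)"
  have u: "(2::real) ^ (q - 1) = 2 * u" "(2::real) ^ q = 4 * u" "0 < u"
    using q by (auto simp: u_def power_diff)
  have "2 ^ (q - 2) < real (Suc X)" using X Y by simp
  hence "(2::nat) ^ (q - 2) \<le> X" by (metis less_Suc_eq_le of_nat_less_iff of_nat_numeral of_nat_power)
  from of_nat_mono[OF this, where 'a = real] have Xu: "u \<le> real X" by (simp add: u_def)
  have "1 \<le> real X / u" using Xu u by simp
  hence YX: "Y \<le> real X * (1 + 1 / u)" using X by (simp add: distrib_left)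
  have lo: "real X / 2 ^ (q + E) \<le> p"
    using X(1) p(1) by (meson divide_right_mono order_trans zero_le_numeral zero_le_power)
  have "p \<le> (real X * (1 + 1 / u)) / 2 ^ (q + E) * (1 + 1 / u) ^ N"
    using p(2) YX u(3) unfolding u_def[symmetric]
      by (elim order_trans) (intro mult_right_mono divide_right_mono, auto)
  hence hi: "p \<le> real X / 2 ^ (q + E) * (1 + 1 / u) ^ Suc N" by (simp add: mult_ac)
  show ?thesis
  proof (cases "X < 2 ^ (q - 1)")
    case True
    hence "real X \<le> 2 * u" unfolding u(1)[symmetric] by simp
    thus ?thesis using True Xu u lo hi unfolding approximates_def renorm_def u_def[symmetric]
      by (simp add: field_simps)
  next
    case False
    hence "2 * u \<le> real X" unfolding u(1)[symmetric] by simp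
    thus ?thesis using False X Y lo hi u unfolding approximates_def renorm_def u_def[symmetric] by simp
  qed
qed

lemma real_div_nat:
  assumes "0 < b"
  shows "real (a div b) \<le> real a / real b" "real a / real b < real (a div b) + 1"
proof -
  have "\<lfloor>real a / real b\<rfloor> = int (a div b)" by (rule floor_divide_of_nat_eq)
  thus "real (a div b) \<le> real a / real b" "real a / real b < real (a div b) + 1" by linarith+
qed

lemma approximates_float_central:
  assumes q: "2 \<le> q"
  shows "approximates q t (float_central q t) (central_binomial t)"
proof (induction t)
  case 0
  show ?case by (simp add: approximates_def power_increasing)
next
  case (Suc t)
  obtain X E where XE: "float_central q t = (X, E)" by fastforce
  note IH = approximatesD[OF Suc, unfolded XE fst_conv snd_conv]
  let ?f = "(2 * real t + 1) / (2 * real t + 2)"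
  let ?Y = "real X * ?f"
  have f: "1 / 2 \<le> ?f" "?f \<le> 1" by (auto simp: divide_simps)
  have "approximates q (Suc t) (renorm q (X * (2 * t + 1) div (2 * t + 2)) E) (central_binomial (Suc t))"
  proof (rule approximates_renorm[OF q, of ?Y])
    have "(2::real) ^ (q - 2) = 2 ^ (q - 1) * (1 / 2)" using q by (simp add: power_diff)
    also have "... \<le> ?Y" using IH(1) f by (intro mult_mono) auto
    finally show "2 ^ (q - 2) \<le> ?Y" .
    show "?Y \<le> 2 ^ q" using mult_mono[OF IH(2) f(2)] by simp
    have Y: "?Y = real (X * (2 * t + 1)) / real (2 * t + 2)" by (simp add: algebra_simps)
    show "real (X * (2 * t + 1) div (2 * t + 2)) \<le> ?Y" "?Y < real (X * (2 * t + 1) div (2 * t + 2)) + 1"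
      unfolding Y by (rule real_div_nat, simp)+
    show "?Y / 2 ^ (q + E) \<le> central_binomial (Suc t)"
      unfolding central_binomial_Suc using mult_right_mono[OF IH(3), of ?f] by (simp add: mult_ac)
    show "central_binomial (Suc t) \<le> ?Y / 2 ^ (q + E) * (1 + 1 / 2 ^ (q - 2)) ^ t"
      unfolding central_binomial_Suc using mult_right_mono[OF IH(4), of ?f] by (simp add: mult_ac)
  qed
  thus ?case by (simp add: XE)
qed

lemma approximates_float_square_step:
  assumes q: "2 \<le> q" and s: "approximates q N (X, E) p" and p: "0 \<le> p"
  shows "approximates q (Suc (2 * N)) (renorm q (X * X div 2 ^ q) (2 * E)) (p * p)"
proof -
  note X = approximatesD[OF s, unfolded fst_conv snd_conv]
  let ?Y = "real X * real X / 2 ^ q"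
  have e: "(2::real) ^ (q + 2 * E) = 2 ^ (q + E) * 2 ^ (q + E) / 2 ^ q" by (simp add: mult_2 power_add)
  show ?thesis
  proof (rule approximates_renorm[OF q, of ?Y])
    have "(2::real) ^ (q - 2) = 2 ^ (q - 1) * 2 ^ (q - 1) / 2 ^ q" using q by (simp add: power_diff)
    also have "... \<le> ?Y" using X(1) by (intro divide_right_mono mult_mono) auto
    finally show "2 ^ (q - 2) \<le> ?Y" .
    have "?Y \<le> 2 ^ q * 2 ^ q / 2 ^ q" using X(2) by (intro divide_right_mono mult_mono) auto
    thus "?Y \<le> 2 ^ q" by simp
    have Y: "?Y = real (X * X) / real (2 ^ q)" by simp
    show "real (X * X div 2 ^ q) \<le> ?Y" "?Y < real (X * X div 2 ^ q) + 1"
      unfolding Y by (rule real_div_nat, simp)+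
    show "?Y / 2 ^ (q + 2 * E) \<le> p * p" using mult_mono[OF X(3) X(3)] p unfolding e by simp
    have "p * p \<le> (X / 2 ^ (q + E) * (1 + 1 / 2 ^ (q - 2)) ^ N) * (X / 2 ^ (q + E) * (1 + 1 / 2 ^ (q - 2)) ^ N)"
      using X(4) p by (intro mult_mono) auto
    also have "... = ?Y / 2 ^ (q + 2 * E) * (1 + 1 / 2 ^ (q - 2)) ^ (2 * N)"
      unfolding e mult_2 power_add by (simp add: mult_ac)
    finally show "p * p \<le> ?Y / 2 ^ (q + 2 * E) * (1 + 1 / 2 ^ (q - 2)) ^ (2 * N)" .
  qed
qed

lemma approximates_float_square:
  assumes q: "2 \<le> q" and s: "approximates q N s p" and p: "0 \<le> p"
  shows "approximates q (2 ^ i * (N + 1) - 1) (float_square q s i) (p ^ 2 ^ i)"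
proof (induction i)
  case (Suc i)
  let ?M = "2 ^ i * (N + 1) - 1" and ?s = "float_square q s i"
  have "0 < 2 ^ i * (N + 1)" by simp
  hence M: "Suc (2 * ?M) = 2 ^ Suc i * (N + 1) - 1" unfolding power_Suc mult.assoc by linarith
  have "approximates q (Suc (2 * ?M)) (float_square q s (Suc i)) (p ^ 2 ^ i * p ^ 2 ^ i)"
    using approximates_float_square_step[OF q, of ?M "fst ?s" "snd ?s"] Suc p by simp
  thus ?case unfolding M by (simp add: mult_2 flip: power_add)
qed (use s in simp)

lemma approximates_log:
  assumes q: "2 \<le> q" and s: "approximates q N s p" and N: "2 * N \<le> 2 ^ (q - 2)"
  shows "log 2 (1 / p) \<le> real (snd s) + 1" "real (snd s) \<le> log 2 (1 / p) + 1"
proof -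
  obtain X E where XE: "s = (X, E)" by fastforce
  note X = approximatesD[OF s, unfolded XE fst_conv snd_conv]
  have hq: "(2::real) ^ q = 2 * 2 ^ (q - 1)" using q by (simp flip: power_Suc)
  have "(1 + 1 / 2 ^ (q - 2)) ^ N \<le> (exp (1 / 2 ^ (q - 2)) :: real) ^ N"
    by (intro power_mono exp_ge_add_one_self) auto
  also have "... = exp (real N / 2 ^ (q - 2))" by (simp add: exp_of_nat_mult[symmetric])
  also have "... \<le> exp (1 / 2 :: real)" using N[THEN of_nat_mono, where 'a = real]
    by (simp add: divide_simps)
  also have "... \<le> (2::real)" using exp_bound[of "1/2 :: real"] by (simp add: power2_eq_square)
  finally have err: "(1 + 1 / 2 ^ (q - 2)) ^ N \<le> (2::real)" .
  have "1 / 2 ^ (E + 1) = (2::real) ^ (q - 1) / 2 ^ (q + E)" by (simp add: power_add hq)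
  also have "... \<le> X / 2 ^ (q + E)" using X(1) by (intro divide_right_mono) auto
  finally have lo: "1 / (2::real) ^ (E + 1) \<le> p" using X(3) by linarith
  hence p: "0 < p" by (smt (verit) divide_pos_pos zero_less_power)
  have "p \<le> X / 2 ^ (q + E) * 2"
    using X(4) mult_left_mono[OF err, of "X / 2 ^ (q + E)"] by simp
  also have "... \<le> 2 ^ q / 2 ^ (q + E) * 2" using X(2) by (intro mult_right_mono divide_right_mono) auto
  finally have hi: "p \<le> 2 / 2 ^ E" by (simp add: power_add)
  have "log 2 (1 / 2 ^ (E + 1)) \<le> log 2 p" "log 2 p \<le> log 2 (2 / 2 ^ E)" using lo hi p
    by (auto intro: log_mono)
  moreover have "log 2 (1 / 2 ^ (E + 1)) = - (real E + 1)"
    by (simp add: log_divide log_nat_power del: power_Suc)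
  moreover have "log 2 (2 / 2 ^ E) = 1 - real E" by (simp add: log_divide log_nat_power)
  moreover have "log 2 (1 / p) = - log 2 p" using p by (simp add: log_divide)
  ultimately show "log 2 (1 / p) \<le> real (snd s) + 1" "real (snd s) \<le> log 2 (1 / p) + 1"
    by (simp_all add: XE)
qed

lemma snd_renorm_le: "snd (renorm q X E) \<le> E + 1"
  by (simp add: renorm_def)

lemma snd_float_central_le: "snd (float_central q t) \<le> t"
  by (induction t) (auto intro: order_trans[OF snd_renorm_le])

lemma snd_float_square_le: "snd (float_square q s i) + 1 \<le> 2 ^ i * (snd s + 1)"
proof (induction i)
  case (Suc i)
  have "snd (float_square q s (Suc i)) + 1 \<le> 2 * (snd (float_square q s i) + 1)"
    using snd_renorm_le[of q "fst (float_square q s i) * fst (float_square q s i) div 2 ^ q" "2 * snd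
      (float_square q s i)"] by simp
  also have "... \<le> 2 * (2 ^ i * (snd s + 1))" using Suc by (rule mult_le_mono2)
  finally show ?case by simp
qed simp

lemma fst_float_le:
  assumes q: "2 \<le> q"
  shows "fst (float_central q t) \<le> 2 ^ q" "fst (float_square q (float_central q t) i) \<le> 2 ^ q"
proof -
  have "fst s \<le> 2 ^ q" if "approximates q N s p" for N s p
    using approximatesD(2)[OF that] by (metis of_nat_le_iff of_nat_numeral of_nat_power)
  thus "fst (float_central q t) \<le> 2 ^ q" "fst (float_square q (float_central q t) i) \<le> 2 ^ q"
    using approximates_float_central[OF q] approximates_float_square[OF q] central_binomial_pos less_imp_le
      by blast+
qed

section \<open>Segments of a level\<close>

lemma inverse_success_prob_Cons_le:
  assumes p: "0 < p" "p \<le> 1"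
  shows "1 / success_prob p (b # bs) \<le> 1 / p + 1 / success_prob p bs / (p * 2 ^ b)"
proof -
  let ?t = "success_prob p bs" and ?B = "2 ^ b :: nat"
  have t: "0 < ?t" "?t \<le> 1" using success_prob_bounds[OF p] by auto
  have "(1 - ?t) ^ ?B * (1 + real ?B * ?t) \<le> (1 - ?t) ^ ?B * (1 + ?t) ^ ?B"
    using t Bernoulli_inequality[of ?t ?B] by (intro mult_left_mono) auto
  also have "... = (1 - ?t\<^sup>2) ^ ?B" by (simp add: power2_eq_square algebra_simps flip: power_mult_distrib)
  also have "... \<le> 1" using t by (intro power_le_one) (auto simp: abs_square_le_1)
  finally have le: "(1 - ?t) ^ ?B * (1 + real ?B * ?t) \<le> 1" .
  have pos: "0 < 1 + real ?B * ?t" using t by (simp add: add_pos_nonneg)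
  have "real ?B * ?t / (1 + real ?B * ?t) \<le> 1 - (1 - ?t) ^ ?B"
    using le pos by (subst pos_divide_le_eq) (auto simp: algebra_simps)
  from mult_left_mono[OF this, of p]
  have "p * (real ?B * ?t / (1 + real ?B * ?t)) \<le> success_prob p (b # bs)" using p by simp
  moreover have "0 < p * (real ?B * ?t / (1 + real ?B * ?t))" using p t pos by simp
  ultimately have "1 / success_prob p (b # bs) \<le> 1 / (p * (real ?B * ?t / (1 + real ?B * ?t)))"
    by (intro frac_le) simp_all
  also have "... = 1 / p + 1 / ?t / (p * 2 ^ b)" using p t pos by (simp add: field_simps)
  finally show ?thesis .
qed

lemma expected_tests_eq: "expected_tests p bs = (\<Sum>s<length bs. 1 / success_prob p (drop s bs))"
  by (induction bs) (simp_all add: sum.lessThan_Suc_shift del: success_prob.simps sum.lessThan_Suc)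

lemma half_le_ln2: "1 / 2 \<le> ln (2::real)"
proof -
  have "exp (1 / 2 :: real) \<le> 2" using exp_bound[of "1/2 :: real"] by (simp add: power2_eq_square)
  thus ?thesis by (subst ln_ge_iff) auto
qed

text \<open>The number of keys is \<open>2 ^ d\<close> and \<open>\<epsilon>\<close> is about \<open>2 ^ (- y)\<close>. A node with \<open>2 ^ k\<close> keys gets
  \<open>rate k / 2 ^ (d + 2)\<close> bits on average, about \<open>2 ^ (- slack k)\<close> more than \<open>log (1 / split_prob k)\<close>.
  The \<open>2 ^ (d - k)\<close> nodes of the level are searched in segments of \<open>2 ^ seg_exp k\<close> nodes; in the
  string of a segment the window of the \<open>r\<close>-th node starts at \<open>seg_offset k r\<close>.\<close>

locale params =
  fixes d y :: nat
  assumes y_le: "y \<le> d"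
begin

definition log_estimate :: "nat \<Rightarrow> nat" where
  "log_estimate k = snd (float_square (2 * d + 8) (float_central (2 * d + 8) (2 ^ (k - 1))) (d + 2))"

definition slack :: "nat \<Rightarrow> nat" where
  "slack k = y - 3 * k div 4"

definition rate :: "nat \<Rightarrow> nat" where
  "rate k = log_estimate k + 1 + 2 ^ (d + 2 - slack k)"

definition seg_exp :: "nat \<Rightarrow> nat" where
  "seg_exp k = min (d - k) (slack k + ceillog2 (d + 1))"

definition seg_offset :: "nat \<Rightarrow> nat \<Rightarrow> nat" where
  "seg_offset k r = r * rate k div 2 ^ (d + 2)"

definition fresh_bits :: "nat \<Rightarrow> nat list" where
  "fresh_bits k = map (\<lambda>r. seg_offset k (Suc r) - seg_offset k r) [0..<2 ^ seg_exp k - 1] @ [0]"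

definition seg_width :: "nat \<Rightarrow> nat" where
  "seg_width k = 64 * (d + 1) + seg_offset k (2 ^ seg_exp k - 1)"

definition level_offset :: "nat \<Rightarrow> nat" where
  "level_offset k = (\<Sum>i=1..<k. 2 ^ (d - i) div 2 ^ seg_exp i * seg_width i)"

definition bits_per_node :: "nat \<Rightarrow> real" where
  "bits_per_node k = rate k / 2 ^ (d + 2)"

definition frac_offset :: "nat \<Rightarrow> nat \<Rightarrow> real" where
  "frac_offset k r = real r * bits_per_node k - real (seg_offset k r)"

definition gain :: "nat \<Rightarrow> real" where
  "gain k = split_prob k * 2 powr bits_per_node k"

lemma slack_le: "slack k \<le> d"
  using y_le by (simp add: slack_def)

lemma seg_exp_le [simp]: "seg_exp k \<le> d - k" "seg_exp k \<le> d"
  by (simp_all add: seg_exp_def)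

lemma length_fresh_bits [simp]: "length (fresh_bits k) = 2 ^ seg_exp k"
  by (simp add: fresh_bits_def)

lemma fresh_bits_nth: "r < 2 ^ seg_exp k \<Longrightarrow>
  fresh_bits k ! r = (if Suc r < 2 ^ seg_exp k then seg_offset k (Suc r) - seg_offset k r else 0)"
  by (auto simp: fresh_bits_def nth_append)

lemma drop_fresh_bits:
  assumes "s < 2 ^ seg_exp k"
  shows "drop s (fresh_bits k) =
    (if Suc s = 2 ^ seg_exp k then 0 else seg_offset k (Suc s) - seg_offset k s) # drop (Suc s)
      (fresh_bits k)"
  using assms Cons_nth_drop_Suc[of s "fresh_bits k"] by (auto simp: fresh_bits_nth)

lemma seg_offset_mono: "r \<le> r' \<Longrightarrow> seg_offset k r \<le> seg_offset k r'"
  unfolding seg_offset_def by (intro div_le_mono mult_le_mono1)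

lemma frac_offset_bounds: "0 \<le> frac_offset k r" "frac_offset k r < 1"
  using real_div_nat[of "2 ^ (d + 2)" "r * rate k"]
  unfolding frac_offset_def seg_offset_def bits_per_node_def by simp_all

lemma seg_offset_diff:
  "real (seg_offset k (Suc r) - seg_offset k r) =
    bits_per_node k + (frac_offset k r - frac_offset k (Suc r))"
  using seg_offset_mono[of r "Suc r" k] unfolding frac_offset_def by (simp add: algebra_simps of_nat_diff)

lemma split_prob_mult_pow:
  "split_prob k * 2 ^ (seg_offset k (Suc r) - seg_offset k r) =
    gain k * 2 powr (frac_offset k r - frac_offset k (Suc r))"
  unfolding gain_def using seg_offset_diff[of k r] by (simp add: powr_add flip: powr_realpow)

context
  fixes k
  assumes k: "k \<in> {1..d}"
begin

lemma log_estimate_bounds: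
  "2 ^ (d + 2) * log 2 (1 / split_prob k) \<le> real (log_estimate k) + 1"
  "real (log_estimate k) \<le> 2 ^ (d + 2) * log 2 (1 / split_prob k) + 1"
proof -
  let ?q = "2 * d + 8" and ?N = "2 ^ (d + 2) * (2 ^ (k - 1) + 1) - 1 :: nat"
  have ap: "approximates ?q ?N (float_square ?q (float_central ?q (2 ^ (k - 1))) (d + 2)) (split_prob k ^ 2 ^ (d + 2))"
    unfolding split_prob_def
    by (intro approximates_float_square approximates_float_central less_imp_le central_binomial_pos) simp_all
  have "2 ^ (k - 1) \<le> (2::nat) ^ d" "1 \<le> (2::nat) ^ d" using k by (auto intro: power_increasing)
  hence "2 ^ (d + 2) * (2 ^ (k - 1) + 1) \<le> 2 ^ (d + 2) * (2 ^ d + (2::nat) ^ d)"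
    by (intro mult_le_mono2 add_mono)
  moreover have "2 * (2 ^ (d + 2) * (2 ^ d + 2 ^ d)) \<le> (2::nat) ^ (?q - 2)"
    by (simp add: power_add power_even_eq power2_eq_square)
  ultimately have "2 * ?N \<le> 2 ^ (?q - 2)" by linarith
  note approximates_log[OF _ ap this, folded log_estimate_def]
  moreover have "log 2 (1 / split_prob k ^ 2 ^ (d + 2)) = 2 ^ (d + 2) * log 2 (1 / split_prob k)"
    using log_nat_power[of "1 / split_prob k" 2 "2 ^ (d + 2)"] split_prob_pos[of k]
      by (simp add: power_divide)
  ultimately show "2 ^ (d + 2) * log 2 (1 / split_prob k) \<le> real (log_estimate k) + 1"
    "real (log_estimate k) \<le> 2 ^ (d + 2) * log 2 (1 / split_prob k) + 1" by simp_all
qed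

lemma bits_per_node_bounds:
  "log 2 (1 / split_prob k) + 1 / 2 ^ slack k \<le> bits_per_node k"
  "bits_per_node k \<le> log 2 (1 / split_prob k) + 2 / 2 ^ slack k"
proof -
  let ?J = "(2::real) ^ (d + 2)"
  have J: "(2::real) ^ (d + 2 - slack k) = ?J / 2 ^ slack k"
    using slack_le[of k] by (simp add: power_diff)
  have "(4::real) = ?J / 2 ^ d" by (simp add: power_add)
  also have "... \<le> ?J / 2 ^ slack k" using slack_le by (intro divide_left_mono power_increasing) auto
  finally have four: "4 \<le> ?J / 2 ^ slack k" .
  have rate: "real (rate k) = real (log_estimate k) + 1 + ?J / 2 ^ slack k"
    by (simp only: rate_def J of_nat_add of_nat_1 of_nat_power of_nat_numeral)
  have "?J * (log 2 (1 / split_prob k) + 1 / 2 ^ slack k) \<le> rate k"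
    "rate k \<le> ?J * (log 2 (1 / split_prob k) + 2 / 2 ^ slack k)"
    using log_estimate_bounds rate four by (simp_all add: algebra_simps)
  thus "log 2 (1 / split_prob k) + 1 / 2 ^ slack k \<le> bits_per_node k"
    "bits_per_node k \<le> log 2 (1 / split_prob k) + 2 / 2 ^ slack k"
    by (simp_all add: bits_per_node_def pos_le_divide_eq pos_divide_le_eq mult.commute)
qed

lemma gain_bounds: "1 + 1 / 2 ^ slack k / 2 \<le> gain k" "gain k \<le> 2 powr (2 / 2 ^ slack k)"
proof -
  let ?s = "1 / 2 ^ slack k :: real"
  have "2 powr (- log 2 (1 / split_prob k)) = split_prob k"
    using split_prob_pos[of k] by (simp add: log_divide)
  hence gain: "gain k = 2 powr (bits_per_node k - log 2 (1 / split_prob k))"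
    unfolding gain_def by (simp add: powr_diff powr_minus field_simps)
  thus "gain k \<le> 2 powr (2 / 2 ^ slack k)" using bits_per_node_bounds by simp
  have "1 + ?s / 2 \<le> 1 + ?s * ln 2" using half_le_ln2 mult_left_mono[of "1/2" "ln 2" ?s] by simp
  also have "... \<le> 2 powr ?s" using exp_ge_add_one_self[of "?s * ln 2"] by (simp add: powr_def)
  also have "... \<le> gain k" unfolding gain using bits_per_node_bounds by (intro powr_mono) auto
  finally show "1 + ?s / 2 \<le> gain k" .
qed

lemma gain_ge_1: "1 \<le> gain k"
  by (rule order_trans[OF _ gain_bounds(1)]) simp

lemma one_minus_inverse_gain_ge: "1 / 2 ^ slack k / 3 \<le> 1 - 1 / gain k"
proof -
  define s where "s = 1 / (2::real) ^ slack k"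
  have s: "0 \<le> s" "s \<le> 1" by (auto simp: s_def)
  have "s * s \<le> s" using s by (intro mult_left_le) auto
  hence "1 \<le> (1 - s / 3) * (1 + s / 2)" by (simp add: algebra_simps)
  also have "... \<le> (1 - s / 3) * gain k" using gain_bounds(1)[folded s_def] s by (intro mult_left_mono) auto
  finally have "1 \<le> (1 - s / 3) * gain k" .
  moreover have "0 < gain k" using gain_ge_1 by linarith
  ultimately have "1 / gain k \<le> 1 - s / 3" by (simp only: pos_divide_le_eq)
  thus ?thesis by (simp add: s_def)
qed

lemma inverse_success_prob_step:
  fixes f :: real
  assumes "0 \<le> f" "f \<le> 1"
  defines "c \<equiv> 6 * 2 ^ slack k / split_prob k * 2 powr (- f)"
  shows "1 / split_prob k + c / gain k \<le> c"
proof -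
  have "1 / 2 = (2::real) powr (-1)" by (simp add: powr_minus)
  also have "... \<le> 2 powr (- f)" using assms by (intro powr_mono) auto
  finally have f: "1 / 2 \<le> 2 powr (- f)" .
  hence "6 * 2 ^ slack k / split_prob k * (1 / 2) * (1 / 2 ^ slack k / 3) \<le> c * (1 - 1 / gain k)"
    unfolding c_def using split_prob_pos[of k] one_minus_inverse_gain_ge by (intro mult_mono) auto
  thus ?thesis by (simp add: algebra_simps)
qed

lemma inverse_success_prob_le_frac:
  assumes "s < 2 ^ seg_exp k"
  shows "1 / success_prob (split_prob k) (drop s (fresh_bits k)) \<le>
    6 * 2 ^ slack k / split_prob k * 2 powr (- frac_offset k s)"
  using assms
proof (induction "2 ^ seg_exp k - s" arbitrary: s)
  case (Suc n)
  let ?p = "split_prob k" and ?f = "frac_offset k"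
  let ?c = "\<lambda>s. 6 * 2 ^ slack k / ?p * 2 powr (- ?f s)"
  have p: "0 < ?p" "?p \<le> 1" using split_prob_pos[of k] split_prob_bounds[of k] by auto
  have c: "1 / ?p + ?c s / gain k \<le> ?c s"
    by (intro inverse_success_prob_step less_imp_le[OF frac_offset_bounds(2)] frac_offset_bounds)
  show ?case
  proof (cases "Suc s = 2 ^ seg_exp k")
    case True
    hence "1 / success_prob ?p (drop s (fresh_bits k)) = 1 / ?p" using drop_fresh_bits[OF Suc.prems] by simp
    moreover have "0 \<le> ?c s / gain k" using p gain_ge_1 by simp
    ultimately show ?thesis using c by linarith
  next
    case False
    let ?b = "seg_offset k (Suc s) - seg_offset k s"
    have "1 / success_prob ?p (drop s (fresh_bits k)) \<le>
      1 / ?p + 1 / success_prob ?p (drop (Suc s) (fresh_bits k)) / (?p * 2 ^ ?b)"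
      using inverse_success_prob_Cons_le[OF p, of ?b "drop (Suc s) (fresh_bits k)"] drop_fresh_bits[OF Suc.prems] False
      by (simp del: success_prob.simps)
    also have "... \<le> 1 / ?p + ?c (Suc s) / (?p * 2 ^ ?b)"
      using Suc.hyps(1)[of "Suc s"] Suc.hyps(2) Suc.prems False p
      by (intro add_left_mono divide_right_mono) auto
    also have "... = 1 / ?p + ?c s / gain k"
      unfolding split_prob_mult_pow by (simp add: powr_diff powr_minus field_simps)
    finally show ?thesis using c by linarith
  qed
qed simp

lemma inverse_success_prob_le:
  assumes "s < 2 ^ seg_exp k"
  shows "1 / success_prob (split_prob k) (drop s (fresh_bits k)) \<le> 6 * 2 ^ slack k / split_prob k"
proof -
  have "2 powr (- frac_offset k s) \<le> 2 powr 0" using frac_offset_bounds by (intro powr_mono) auto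
  hence "6 * 2 ^ slack k / split_prob k * 2 powr (- frac_offset k s) \<le> 6 * 2 ^ slack k / split_prob k * 1"
    using split_prob_pos[of k] by (intro mult_left_mono) auto
  thus ?thesis using inverse_success_prob_le_frac[OF assms] by simp
qed

lemma expected_tests_fresh_bits_le:
  "expected_tests (split_prob k) (fresh_bits k) \<le> real (2 ^ seg_exp k) * (6 * 2 ^ slack k / split_prob k)"
proof -
  have "expected_tests (split_prob k) (fresh_bits k) \<le>
    (\<Sum>s<(2::nat) ^ seg_exp k. 6 * 2 ^ slack k / split_prob k)"
    unfolding expected_tests_eq length_fresh_bits by (intro sum_mono inverse_success_prob_le) auto
  thus ?thesis by simp
qed

lemma inverse_success_prob_fresh_bits_le:
  "1 / success_prob (split_prob k) (fresh_bits k) \<le> 2 ^ (6 * (d + 1))"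
proof -
  have "1 / success_prob (split_prob k) (fresh_bits k) \<le> 6 * 2 ^ slack k * (1 / split_prob k)"
    using inverse_success_prob_le[of 0] by simp
  also have "... \<le> 8 * 2 ^ d * (2 * 2 powr (real k / 2))"
    using inverse_split_prob_le[of k] split_prob_pos[of k] slack_le k
      by (intro mult_mono power_increasing) auto
  also have "... \<le> 8 * 2 ^ d * (2 * 2 powr (real d))"
    using k by (intro mult_left_mono powr_mono) auto
  also have "... = 2 ^ (2 * d + 4)" by (simp add: powr_realpow power_add power_even_eq power2_eq_square)
  also have "... \<le> (2::real) ^ (6 * (d + 1))" by (intro power_increasing) auto
  finally show ?thesis .
qed

lemma fresh_bits_le:
  assumes "b \<in> set (fresh_bits k)"
  shows "b \<le> 4 * (d + 1)"
proof -
  have "seg_offset k (Suc r) - seg_offset k r \<le> 4 * (d + 1)" for r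
  proof -
    have "real (seg_offset k (Suc r) - seg_offset k r) \<le> bits_per_node k + 1"
      unfolding seg_offset_diff using frac_offset_bounds[of k r] frac_offset_bounds[of k "Suc r"] by simp
    also have "bits_per_node k \<le> log 2 (1 / split_prob k) + 2 / 2 ^ slack k" by (rule bits_per_node_bounds)
    also have "log 2 (1 / split_prob k) \<le> log 2 (2 * 2 powr (real k / 2))"
      using inverse_split_prob_le[of k] split_prob_pos[of k] k by (intro log_mono) auto
    also have "... = 1 + real k / 2" by (subst log_mult) auto
    also have "2 / 2 ^ slack k \<le> (2::real)" using divide_left_mono[of 1 "2 ^ slack k" "2::real"] by simp
    finally have "real (seg_offset k (Suc r) - seg_offset k r) \<le> real (4 * (d + 1))" using k by simp
    thus ?thesis by (simp only: of_nat_le_iff)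
  qed
  thus ?thesis using assms by (auto simp: fresh_bits_def)
qed

lemma growth_fresh_bits_le_gain:
  assumes "s < 2 ^ seg_exp k"
  shows "growth (split_prob k) t (drop s (fresh_bits k)) \<le> gain k ^ t * 2 powr frac_offset k s"
  using assms
proof (induction t arbitrary: s)
  case 0
  show ?case using frac_offset_bounds[of k s] by (simp add: ge_one_powr_ge_zero)
next
  case (Suc t)
  let ?f = "frac_offset k"
  show ?case
  proof (cases "Suc s = 2 ^ seg_exp k")
    case True
    have "growth (split_prob k) (Suc t) (drop s (fresh_bits k)) \<le> 1"
      using drop_fresh_bits[OF Suc.prems] True split_prob_bounds by (cases t) auto
    also have "... \<le> gain k ^ Suc t * 2 powr ?f s"
      using mult_mono[of 1 "gain k ^ Suc t" 1 "2 powr ?f s"] gain_ge_1 frac_offset_bounds[of k s]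
      by (simp add: ge_one_powr_ge_zero one_le_power del: power_Suc)
    finally show ?thesis .
  next
    case False
    have "growth (split_prob k) (Suc t) (drop s (fresh_bits k)) =
      gain k * 2 powr (?f s - ?f (Suc s)) * growth (split_prob k) t (drop (Suc s) (fresh_bits k))"
      using drop_fresh_bits[OF Suc.prems] False by (simp add: split_prob_mult_pow)
    also have "... \<le> gain k * 2 powr (?f s - ?f (Suc s)) * (gain k ^ t * 2 powr ?f (Suc s))"
      using Suc.IH[of "Suc s"] Suc.prems False gain_ge_1 by (intro mult_left_mono) auto
    also have "... = gain k ^ Suc t * 2 powr ?f s" by (simp add: powr_diff)
    finally show ?thesis .
  qed
qed

lemma seg_size_le: "2 ^ seg_exp k / 2 ^ slack k \<le> 2 * (real d + 1)"
proof -
  have "seg_exp k \<le> slack k + ceillog2 (d + 1)" by (simp add: seg_exp_def)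
  hence "(2::real) ^ seg_exp k \<le> 2 ^ slack k * 2 ^ ceillog2 (d + 1)" by (simp flip: power_add)
  hence "2 ^ seg_exp k / 2 ^ slack k \<le> (2::real) ^ ceillog2 (d + 1)"
    by (simp add: divide_simps mult.commute)
  also have "... \<le> real (2 * (d + 1))"
    using less_imp_le[OF two_power_ceillog2_gt[of "d + 1"], THEN of_nat_mono, where 'a = real] by simp
  finally show ?thesis by simp
qed

lemma growth_fresh_bits_le: "growth (split_prob k) t (drop s (fresh_bits k)) \<le> 2 ^ (5 * (d + 1))"
proof (cases "s < 2 ^ seg_exp k \<and> t \<le> 2 ^ seg_exp k")
  case True
  let ?s = "1 / 2 ^ slack k :: real"
  have "growth (split_prob k) t (drop s (fresh_bits k)) \<le> gain k ^ t * 2 powr frac_offset k s"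
    using True by (intro growth_fresh_bits_le_gain) auto
  also have "... \<le> gain k ^ 2 ^ seg_exp k * 2 powr 1"
    using True gain_ge_1 frac_offset_bounds[of k s] by (intro mult_mono power_increasing powr_mono) auto
  also have "... \<le> (2 powr (2 / 2 ^ slack k)) ^ 2 ^ seg_exp k * 2 powr 1"
    using gain_ge_1 gain_bounds by (intro mult_right_mono power_mono) auto
  also have "... = 2 powr (2 * (2 ^ seg_exp k / 2 ^ slack k) + 1)"
    by (simp add: powr_powr powr_add mult_ac flip: powr_realpow)
  also have "... \<le> 2 powr (real (5 * (d + 1)))" using seg_size_le by (intro powr_mono) auto
  finally show ?thesis by (simp only: powr_realpow zero_less_numeral)
next
  case False
  have long: "growth q t bs = 0" if "length bs < t" for q :: real and bs
    using that by (induction q t bs rule: growth.induct) auto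
  have "length (drop s (fresh_bits k)) < t \<or> t = 0" using False by auto
  hence "growth (split_prob k) t (drop s (fresh_bits k)) \<le> 1" using long by auto
  also have "(1::real) \<le> 2 ^ (5 * (d + 1))" by (rule one_le_power) simp
  finally show ?thesis .
qed

end

section \<open>Time and space\<close>

lemma pow_slack_le: "2 ^ slack k \<le> 1 + 2 * 2 ^ y * 2 powr (- 3 * real k / 4)"
proof (cases "3 * k div 4 \<le> y")
  case True
  have f: "3 * real k / 4 - 1 \<le> real (3 * k div 4)" using real_div_nat[of 4 "3 * k"] by simp
  have "2 ^ slack k = 2 powr (real y - real (3 * k div 4))"
    using True by (simp add: slack_def of_nat_diff flip: powr_realpow)
  also have "... \<le> 2 powr (real y + 1 + (- 3 * real k / 4))" using f by (intro powr_mono) auto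
  also have "... = 2 * 2 ^ y * 2 powr (- 3 * real k / 4)"
    by (simp only: powr_add powr_realpow zero_less_numeral) simp
  finally show ?thesis by simp
qed (simp add: slack_def)

lemma inverse_pow_slack_le: "1 / 2 ^ slack k \<le> 2 powr (3 * real k / 4) / 2 ^ y"
proof -
  have "real y - 3 * real k / 4 \<le> real (slack k)"
    using real_div_nat[of 4 "3 * k"] unfolding slack_def
      by (cases "3 * k div 4 \<le> y") (auto simp: of_nat_diff)
  hence "2 powr (- real (slack k)) \<le> 2 powr (3 * real k / 4 - real y)" by (intro powr_mono) auto
  moreover have "2 powr (- real (slack k)) = 1 / 2 ^ slack k" by (simp add: powr_minus_divide powr_realpow)
  moreover have "2 powr (3 * real k / 4 - real y) = 2 powr (3 * real k / 4) / 2 ^ y"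
    by (subst powr_diff) (simp add: powr_realpow)
  ultimately show ?thesis by simp
qed

lemma sum_powr_half_le: "(\<Sum>k=1..n. 2 powr (real k / 2)) \<le> 4 * 2 powr (real n / 2)"
proof (induction n)
  case (Suc n)
  have s: "2 powr (real (Suc n) / 2) = 2 powr (real n / 2) * sqrt 2"
    by (simp add: add_divide_distrib powr_add powr_half_sqrt)
  have "4 / 3 \<le> sqrt (2::real)" by (rule real_le_rsqrt) (simp add: power2_eq_square)
  hence "2 powr (real n / 2) * (4 + sqrt 2) \<le> 2 powr (real n / 2) * (4 * sqrt 2)"
    by (intro mult_left_mono) auto
  moreover have "(\<Sum>k=1..Suc n. 2 powr (real k / 2)) \<le> 2 powr (real n / 2) * (4 + sqrt 2)"
    using Suc s by (simp add: algebra_simps)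
  ultimately have "(\<Sum>k=1..Suc n. 2 powr (real k / 2)) \<le> 2 powr (real n / 2) * (4 * sqrt 2)" by linarith
  thus ?case using s by (simp add: mult.commute)
qed simp

lemma sum_powr_quarter_le: "(\<Sum>k=1..n. 2 powr (- real k / 4)) \<le> 6"
proof -
  let ?r = "2 powr (- 1 / 4) :: real"
  have r: "?r \<le> 6 / 7"
  proof (rule ccontr)
    assume "\<not> ?thesis"
    hence "(6 / 7) ^ 4 < ?r ^ 4" by (intro power_strict_mono) auto
    also have "?r ^ 4 = 2 powr (- 1)" by (subst powr_realpow[symmetric]) (simp_all add: powr_powr)
    finally show False by (simp add: powr_minus power4_eq_xxxx)
  qed
  have "(\<Sum>k=1..n. 2 powr (- real k / 4)) \<le> 6 - 6 * 2 powr (- real n / 4)"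
  proof (induction n)
    case (Suc n)
    have "2 powr (- real (Suc n) / 4) = 2 powr (- real n / 4) * ?r"
      by (simp add: diff_divide_distrib add.commute flip: powr_add)
    also have "... \<le> 2 powr (- real n / 4) * (6 / 7)" using r by (intro mult_left_mono) auto
    finally have "2 powr (- real (Suc n) / 4) \<le> 2 powr (- real n / 4) * (6 / 7)" .
    moreover have "(\<Sum>k=1..Suc n. 2 powr (- real k / 4)) =
      2 powr (- real (Suc n) / 4) + (\<Sum>k=1..n. 2 powr (- real k / 4))"
      by (rule sum.nat_ivl_Suc') simp
    ultimately show ?case using Suc.IH by linarith
  qed simp
  moreover have "0 \<le> 2 powr (- real n / 4)" by simp
  ultimately show ?thesis by linarith
qed

definition search_cost_bound :: real where
  "search_cost_bound = 48 * 2 powr (3 * real d / 2) + 144 * (2 ^ d * 2 ^ y)"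

lemma search_cost_bound_le: "search_cost_bound \<le> 192 * 4 ^ d"
  and search_cost_bound_nonneg: "0 \<le> search_cost_bound"
proof -
  have "(2::real) powr (3 * real d / 2) \<le> 2 powr (2 * real d)" by (rule powr_mono) auto
  also have "... = 4 ^ d" using powr_realpow[of "2::real" "2 * d"] by (simp add: power_mult)
  finally have "(2::real) powr (3 * real d / 2) \<le> 4 ^ d" .
  moreover have "(2::real) ^ d * 2 ^ y \<le> 2 ^ d * 2 ^ d" using y_le
    by (intro mult_left_mono power_increasing) auto
  moreover have "(2::real) ^ d * 2 ^ d = 4 ^ d" by (simp flip: power_mult_distrib)
  ultimately show "search_cost_bound \<le> 192 * 4 ^ d" unfolding search_cost_bound_def by linarith
qed (simp add: search_cost_bound_def)

lemma sum_search_cost_le: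
  "(\<Sum>k=1..d. 2 ^ (d - k) * (2 ^ k * (6 * 2 ^ slack k / split_prob k))) \<le> search_cost_bound"
proof -
  have "2 ^ (d - k) * (2 ^ k * (6 * 2 ^ slack k / split_prob k)) \<le>
    12 * 2 ^ d * (2 powr (real k / 2) + 2 * 2 ^ y * 2 powr (- real k / 4))" if k: "k \<in> {1..d}" for k
  proof -
    have "(2::real) ^ (d - k) * 2 ^ k = 2 ^ d" using k by (simp flip: power_add)
    hence "2 ^ (d - k) * (2 ^ k * (6 * 2 ^ slack k / split_prob k)) =
      6 * 2 ^ d * (2 ^ slack k * (1 / split_prob k))"
      by (simp add: mult.assoc[symmetric])
    also have "... \<le> 6 * 2 ^ d * ((1 + 2 * 2 ^ y * 2 powr (- 3 * real k / 4)) * (2 * 2 powr (real k / 2)))"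
      using k inverse_split_prob_le[of k] split_prob_pos[of k] pow_slack_le[of k]
      by (intro mult_left_mono mult_mono) auto
    also have "... = 12 * 2 ^ d * (2 powr (real k / 2) + 2 * 2 ^ y * (2 powr (- 3 * real k / 4) * 2 powr (real k / 2)))"
      by (simp add: algebra_simps)
    finally show ?thesis by (simp flip: powr_add)
  qed
  hence "(\<Sum>k=1..d. 2 ^ (d - k) * (2 ^ k * (6 * 2 ^ slack k / split_prob k))) \<le>
    (\<Sum>k=1..d. 12 * 2 ^ d * (2 powr (real k / 2) + 2 * 2 ^ y * 2 powr (- real k / 4)))" by (rule sum_mono)
  also have "... = 12 * 2 ^ d * ((\<Sum>k=1..d. 2 powr (real k / 2)) + 2 * 2 ^ y * (\<Sum>k=1..d. 2 powr (- real k / 4)))"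
    by (simp only: sum_distrib_left[symmetric] sum.distrib)
  also have "... \<le> 12 * 2 ^ d * (4 * 2 powr (real d / 2) + 2 * 2 ^ y * 6)"
    using sum_powr_half_le[of d] sum_powr_quarter_le[of d] by (intro mult_left_mono add_mono) auto
  also have "... = 48 * (2 ^ d * 2 powr (real d / 2)) + 144 * (2 ^ d * 2 ^ y)" by (simp add: algebra_simps)
  also have "2 ^ d * 2 powr (real d / 2) = 2 powr (3 * real d / 2)"
    by (simp flip: powr_realpow powr_add)
  finally show ?thesis unfolding search_cost_bound_def .
qed

lemma sum_slack_le: "(\<Sum>k=1..d. 2 ^ (d - k) * (1 / 2 ^ slack k)) \<le> 6 * (2 ^ d / 2 ^ y :: real)"
proof -
  have "2 ^ (d - k) * (1 / 2 ^ slack k) \<le> 2 ^ d / 2 ^ y * (2 powr (- real k / 4) :: real)"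
    if k: "k \<in> {1..d}" for k
  proof -
    have "2 ^ (d - k) * (1 / 2 ^ slack k) \<le> 2 ^ (d - k) * (2 powr (3 * real k / 4) / 2 ^ y)"
      using inverse_pow_slack_le by (intro mult_left_mono) auto
    also have "... = 2 ^ d / 2 ^ y * (2 powr (- real k) * 2 powr (3 * real k / 4))"
      using k by (simp add: power_diff powr_minus_divide powr_realpow)
    finally show ?thesis by (simp flip: powr_add)
  qed
  hence "(\<Sum>k=1..d. 2 ^ (d - k) * (1 / 2 ^ slack k)) \<le>
    (\<Sum>k=1..d. 2 ^ d / 2 ^ y * (2 powr (- real k / 4) :: real))"
    by (rule sum_mono)
  also have "... = 2 ^ d / 2 ^ y * (\<Sum>k=1..d. 2 powr (- real k / 4))" by (simp add: sum_distrib_left)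
  also have "... \<le> 2 ^ d / 2 ^ y * 6" using sum_powr_quarter_le by (intro mult_left_mono) auto
  finally show ?thesis by (simp add: mult.commute)
qed

lemma level_size_le:
  assumes k: "k \<in> {1..d}"
  shows "real (2 ^ (d - k) div 2 ^ seg_exp k * seg_width k) \<le>
    64 * (real d + 1) + 2 ^ (d - k) * log 2 (1 / split_prob k) + 66 * (2 ^ (d - k) * (1 / 2 ^ slack k))"
proof -
  let ?K = "2 ^ seg_exp k :: real" and ?n = "2 ^ (d - k) :: real" and ?s = "1 / 2 ^ slack k :: real"
  have q: "real (2 ^ (d - k) div 2 ^ seg_exp k) = ?n / ?K"
    by (simp add: le_imp_power_dvd real_of_nat_div)
  have windows: "?n / ?K * (64 * (real d + 1)) \<le> 64 * (real d + 1) + 64 * (?n * ?s)"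
  proof (cases "seg_exp k = d - k")
    case False
    hence e: "seg_exp k = slack k + ceillog2 (d + 1)" by (auto simp: seg_exp_def min_def split: if_splits)
    have "real d + 1 \<le> 2 ^ ceillog2 (d + 1)"
      using le_two_power_ceillog2[of "d + 1", THEN of_nat_mono, where 'a = real] by simp
    hence "64 * (?n * ?s) * ((real d + 1) / 2 ^ ceillog2 (d + 1)) \<le> 64 * (?n * ?s) * 1"
      by (intro mult_left_mono) simp_all
    moreover have "?n / ?K * (64 * (real d + 1)) = 64 * (?n * ?s) * ((real d + 1) / 2 ^ ceillog2 (d + 1))"
      by (simp add: e power_add)
    moreover have "0 \<le> 64 * (real d + 1)" by simp
    ultimately show ?thesis by linarith
  qed simp
  have "real (seg_offset k (2 ^ seg_exp k - 1)) \<le> real (2 ^ seg_exp k - 1) * bits_per_node k"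
    using frac_offset_bounds(1)[of k "2 ^ seg_exp k - 1"] by (simp add: frac_offset_def)
  also have "... \<le> ?K * bits_per_node k" by (intro mult_right_mono) (auto simp: bits_per_node_def)
  finally have "?n / ?K * real (seg_offset k (2 ^ seg_exp k - 1)) \<le> ?n / ?K * (?K * bits_per_node k)"
    by (intro mult_left_mono) auto
  also have "... \<le> ?n * (log 2 (1 / split_prob k) + 2 * ?s)"
    using bits_per_node_bounds(2)[OF k] by simp
  also have "... = ?n * log 2 (1 / split_prob k) + 2 * (?n * ?s)" by (simp add: algebra_simps)
  moreover have "real (2 ^ (d - k) div 2 ^ seg_exp k * seg_width k) =
    ?n / ?K * (64 * (real d + 1)) + ?n / ?K * real (seg_offset k (2 ^ seg_exp k - 1))"
    unfolding of_nat_mult q seg_width_def by (simp add: algebra_simps)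
  ultimately show ?thesis using windows by linarith
qed

lemma level_offset_bound:
  "real (level_offset (Suc d)) \<le> 2 ^ d * log 2 (exp 1) + 64 * real d * (real d + 1) + 396 * (2 ^ d / 2 ^ y)"
proof -
  have "real (level_offset (Suc d)) \<le>
    (\<Sum>k=1..d. 64 * (real d + 1) + 2 ^ (d - k) * log 2 (1 / split_prob k) + 66 * (2 ^ (d - k) * (1 / 2 ^ slack k)))"
    unfolding level_offset_def of_nat_sum atLeastLessThanSuc_atLeastAtMost by (intro sum_mono level_size_le)
  also have "... = 64 * real d * (real d + 1) + (\<Sum>k=1..d. 2 ^ (d - k) * log 2 (1 / split_prob k)) +
    66 * (\<Sum>k=1..d. 2 ^ (d - k) * (1 / 2 ^ slack k))"
    by (simp add: sum.distrib sum_distrib_left algebra_simps)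
  also have "... \<le> 64 * real d * (real d + 1) + 2 ^ d * log 2 (exp 1) + 66 * (6 * (2 ^ d / 2 ^ y))"
    using sum_log_split_prob_le[of d] sum_slack_le by (intro add_mono mult_left_mono) auto
  finally show ?thesis by simp
qed

lemma level_offset_mono: "k \<le> k' \<Longrightarrow> level_offset k \<le> level_offset k'"
  unfolding level_offset_def by (rule sum_mono2) auto

lemma level_offset_Suc:
  "1 \<le> k \<Longrightarrow> level_offset (Suc k) = level_offset k + 2 ^ (d - k) div 2 ^ seg_exp k * seg_width k"
  by (simp add: level_offset_def)

end

section \<open>Quantities that fit into a word\<close>

definition unchanged :: "nat set \<Rightarrow> memory \<Rightarrow> memory \<Rightarrow> bool" where
  "unchanged A m m' \<longleftrightarrow> (\<forall>b. b \<notin> A \<longrightarrow> m' b = m b)"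

lemma unchangedD: "unchanged A m m' \<Longrightarrow> b \<notin> A \<Longrightarrow> m' b = m b"
  by (simp add: unchanged_def)

lemma unchanged_refl [simp]: "unchanged A m m"
  by (simp add: unchanged_def)

lemma unchanged_upd [simp]: "unchanged A m m' \<Longrightarrow> a \<in> A \<Longrightarrow> unchanged A m (m'(a := x))"
  by (auto simp: unchanged_def)

lemma unchanged_trans: "unchanged A m m' \<Longrightarrow> unchanged B m' m'' \<Longrightarrow> A \<union> B \<subseteq> C \<Longrightarrow> unchanged C m m''"
  unfolding unchanged_def by (metis UnI1 UnI2 subsetD)

context params
begin

definition fits :: "nat \<Rightarrow> nat \<Rightarrow> bool" where
  "fits a x \<longleftrightarrow> x \<le> 2 ^ (a * (d + 1))"

lemma fits_mono: "fits a x \<Longrightarrow> a \<le> b \<Longrightarrow> fits b x"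
  unfolding fits_def by (erule order_trans) (intro power_increasing mult_le_mono1, auto)

lemma fits_le: "fits a x \<Longrightarrow> z \<le> x \<Longrightarrow> fits a z"
  unfolding fits_def by (rule order_trans)

lemma fits_add [simp]:
  assumes "1 \<le> a" "fits (a - 1) x" "fits (a - 1) z"
  shows "fits a (x + z)"
proof -
  have "x + z \<le> 2 ^ Suc ((a - 1) * (d + 1))" using assms(2,3) unfolding fits_def power_Suc by linarith
  also have "... \<le> 2 ^ (a * (d + 1))" using assms(1) by (intro power_increasing) (cases a, auto)
  finally show ?thesis by (simp add: fits_def)
qed

lemma fits_Suc [simp]: "1 \<le> a \<Longrightarrow> fits (a - 1) x \<Longrightarrow> fits a (Suc x)"
  using fits_add[of a x 1] by (simp add: fits_def)

lemma fits_mult [simp]: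
  assumes "fits (a div 2) x" "fits (a div 2) z"
  shows "fits a (x * z)"
proof -
  have "x * z \<le> 2 ^ (a div 2 * (d + 1)) * 2 ^ (a div 2 * (d + 1))"
    using assms unfolding fits_def by (rule mult_le_mono)
  also have "... \<le> 2 ^ (a * (d + 1))" unfolding power_add[symmetric] add_mult_distrib[symmetric]
    by (intro power_increasing mult_le_mono1) auto
  finally show ?thesis by (simp add: fits_def)
qed

lemma fits_div [simp]: "fits a x \<Longrightarrow> fits a (x div z)" and fits_mod [simp]: "fits a x \<Longrightarrow> fits a (x mod z)"
  and fits_minus [simp]: "fits a x \<Longrightarrow> fits a (x - z)"
  by (erule fits_le, simp)+

lemma fits_pow [simp]: "e \<le> a * (d + 1) \<Longrightarrow> fits a (2 ^ e)"
  unfolding fits_def by (rule power_increasing) auto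

lemma fits_pow_le [simp]: "e \<le> d \<Longrightarrow> 1 \<le> a \<Longrightarrow> fits a (2 ^ e)"
  by (rule fits_mono[OF fits_pow[of _ 1]]) auto

lemma fits_numeral [simp]: "(numeral k :: nat) \<le> 2 ^ a \<Longrightarrow> fits a (numeral k)" "fits a 0" "fits a 1"
  "fits a (Suc 0)"
  unfolding fits_def by (erule order_trans, intro power_increasing) auto

lemma fits_of_bool [simp]: "fits a (of_bool b)"
  by (cases b) auto

lemma fits_le_pow: "x \<le> 2 ^ d \<Longrightarrow> 1 \<le> a \<Longrightarrow> fits a x"
  by (rule fits_le[OF fits_pow_le[OF order_refl]])

lemma fits_le_d: "x \<le> d \<Longrightarrow> 1 \<le> a \<Longrightarrow> fits a x"
  by (intro fits_le_pow order_trans[OF _ less_imp_le[OF less_exp]])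

lemma fits_d [simp]: "1 \<le> a \<Longrightarrow> fits a d"
  by (rule fits_le_d) auto

lemma fits_window: "x < 2 ^ (64 * (d + 1)) \<Longrightarrow> 64 \<le> a \<Longrightarrow> fits a x"
  by (rule fits_mono[of 64]) (auto simp: fits_def)

lemma fits_ceillog2 [simp]: "4 \<le> a \<Longrightarrow> fits a (ceillog2 (Suc d))"
proof -
  assume a: "4 \<le> a"
  have "ceillog2 (Suc d) \<le> Suc d" using less_exp[of "Suc d"] by (subst ceillog2_le_iff) auto
  moreover have "fits a (Suc d)" using a by simp
  ultimately show ?thesis by (rule fits_le[rotated])
qed

lemma fits_slack [simp]: "1 \<le> a \<Longrightarrow> fits a (slack k)"
  using slack_le by (rule fits_le_d)

lemma fits_float [simp]:
  assumes "8 \<le> a"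
  shows "fits a (fst (float_central (2 * d + 8) t))"
    "fits a (fst (float_square (2 * d + 8) (float_central (2 * d + 8) t) i))"
  by (rule fits_le[OF fits_mono[OF fits_pow assms] fst_float_le(1)]; simp)
    (rule fits_le[OF fits_mono[OF fits_pow assms] fst_float_le(2)]; simp)

lemma fits_snd_float_square:
  assumes "k \<le> d" "i \<le> d + 2" "6 \<le> a"
  shows "fits a (snd (float_square q (float_central q (2 ^ (k - 1))) i))"
proof (rule fits_mono[OF fits_le assms(3)])
  show "snd (float_square q (float_central q (2 ^ (k - 1))) i) \<le> 2 ^ i * Suc (2 ^ (k - 1))"
    using order_trans[OF add_leD1[OF snd_float_square_le] mult_le_mono2[OF add_le_mono1[OF snd_float_central_le]]]
    by (simp only: Suc_eq_plus1)
  show "fits 6 (2 ^ i * Suc (2 ^ (k - 1)))" using assms(1,2) by simp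
qed

lemma fits_log_estimate [simp]: "k \<le> d \<Longrightarrow> 6 \<le> a \<Longrightarrow> fits a (log_estimate k)"
  unfolding log_estimate_def by (rule fits_snd_float_square) auto

lemma fits_rate [simp]: "k \<le> d \<Longrightarrow> 8 \<le> a \<Longrightarrow> fits a (rate k)"
  unfolding rate_def by (rule fits_mono[of 8]) auto

lemma seg_index_le: "r \<le> 2 ^ seg_exp k \<Longrightarrow> r \<le> 2 ^ d" for r :: nat
  by (erule order_trans) simp

lemma fits_seg_offset [simp]:
  assumes "k \<le> d" "r \<le> 2 ^ seg_exp k" "17 \<le> a"
  shows "fits a (seg_offset k r)"
proof -
  have "fits 16 (r * rate k)" using fits_le_pow[OF seg_index_le[OF assms(2)]] assms(1) by simp
  hence "fits 17 (r * rate k)" by (rule fits_mono) simp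
  thus ?thesis unfolding seg_offset_def by (intro fits_mono[OF fits_div assms(3)])
qed

lemma fits_seg_width [simp]: "k \<le> d \<Longrightarrow> 18 \<le> a \<Longrightarrow> fits a (seg_width k)"
  unfolding seg_width_def by (rule fits_mono[of 18]) simp_all

lemma fits_level_offset [simp]:
  assumes "k \<le> Suc d" "18 \<le> a"
  shows "fits a (level_offset k)"
proof (rule fits_mono[OF _ assms(2)])
  have "real (level_offset k) \<le> real (level_offset (Suc d))" using level_offset_mono[OF assms(1)] by simp
  also have "... \<le> 2 ^ d * 2 + 64 * real d * (real d + 1) + 396 * 2 ^ d"
  proof -
    have "log 2 (exp 1) \<le> log 2 (2 ^ 2 :: real)" using exp_le by (intro log_mono) auto
    also have "... = 2" by (subst log_nat_power) auto
    finally have "2 ^ d * log 2 (exp 1) \<le> 2 ^ d * (2::real)" by (intro mult_left_mono) auto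
    moreover have "(2::real) ^ d / 2 ^ y \<le> 2 ^ d" by (simp add: field_simps)
    ultimately show ?thesis using level_offset_bound by linarith
  qed
  finally have "real (level_offset k) \<le> real (398 * 2 ^ d + 64 * (d * (d + 1)))"
    by (simp add: algebra_simps)
  hence "level_offset k \<le> 398 * 2 ^ d + 64 * (d * (d + 1))" by (simp only: of_nat_le_iff)
  moreover have "fits 17 (398 * 2 ^ d)" by (rule fits_le[OF fits_pow[of "d + 9"]]) (simp_all add: power_add)
  hence "fits 18 (398 * 2 ^ d + 64 * (d * (d + 1)))" by (intro fits_add) simp_all
  ultimately show "fits 18 (level_offset k)" by (rule fits_le[rotated])
qed

section \<open>The tree in memory\<close>

text \<open>Nodes are numbered as in a heap; a node \<open>v\<close> has \<open>2 ^ height v\<close> keys and is number \<open>rank v\<close> of its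
  level. Its window starts at \<open>position v\<close> and overlaps all but the first \<open>shift v\<close> bits of the window
  before it; \<open>step v\<close> is the distance of two candidates for it. Memory consists of registers (cells
  below 64), the header with the four parameters of each level (from cell 64), the bit string, and
  the arrays \<open>1, 2, \<dots>\<close> of \<open>stride\<close> cells: for each node its shift, step, list address, number of keys,
  position and window in arrays 1 to 6, and from array 8 on the keys arriving at the nodes, one array
  per level. Registers: 0 number of keys, 1 \<open>\<lceil>1/\<epsilon>\<rceil>\<close>, 2 \<open>d\<close>, 3 \<open>y\<close>, 5 window length, 6 stride, 8 precision,
  9 fuel, 10 node, 11 retreating, 12 given up, 13 attempt succeeded, 15 height, 44 word length.\<close>

definition height :: "nat \<Rightarrow> nat" where
  "height v = d - floor_log v"

definition rank :: "nat \<Rightarrow> nat" where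
  "rank v = v - 2 ^ floor_log v"

definition shift :: "nat \<Rightarrow> nat" where
  "shift v = (let k = height v; r = rank v mod 2 ^ seg_exp k in
    if r = 0 then 64 * (d + 1) else seg_offset k r - seg_offset k (r - 1))"

definition step :: "nat \<Rightarrow> nat" where
  "step v = (if rank v mod 2 ^ seg_exp (height v) = 0 then 2 ^ (56 * (d + 1)) else 2 ^ (64 * (d + 1) - shift v))"

definition position :: "nat \<Rightarrow> nat" where
  "position v = (let k = height v in
    level_offset k + rank v div 2 ^ seg_exp k * seg_width k + seg_offset k (rank v mod 2 ^ seg_exp k))"

definition stride :: nat where
  "stride = 2 ^ (20 * (d + 1))"

definition list_addr :: "nat \<Rightarrow> nat" where
  "list_addr v = (8 + floor_log v) * stride + rank v * 2 ^ height v"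

lemma floor_log_bounds: "1 \<le> v \<Longrightarrow> 2 ^ floor_log v \<le> v" "v < 2 * 2 ^ floor_log v"
  using floor_log_exp2_le[of v] floor_log_exp2_gt[of v] by auto

lemma floor_log_less: "1 \<le> v \<Longrightarrow> v < 2 ^ e \<Longrightarrow> floor_log v < e"
  by (meson floor_log_bounds(1) le_less_trans power_less_imp_less_exp one_less_numeral_iff semiring_norm(76))

lemma floor_log_pow_add: "r < 2 ^ j \<Longrightarrow> floor_log (2 ^ j + r) = j"
  by (rule floor_log_eqI) auto

lemma fits_stride [simp]: "20 \<le> a \<Longrightarrow> fits a stride"
  unfolding stride_def by (rule fits_mono[OF fits_pow]) simp_all

lemma fits_less_stride: "fits a x \<Longrightarrow> a \<le> 19 \<Longrightarrow> x < stride"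
proof -
  assume "fits a x" "a \<le> 19"
  hence "x \<le> 2 ^ (19 * (d + 1))" using fits_mono[of a x 19] by (simp add: fits_def)
  also have "... < stride" unfolding stride_def by (rule power_strict_increasing) auto
  finally show "x < stride" .
qed

lemma stride_gt: "64 + 4 * d < stride" "4 * 2 ^ d < stride"
  by (rule fits_less_stride[where a = 19]; simp)+

lemma node_less_stride: "v < 2 ^ d \<Longrightarrow> v < stride"
  using stride_gt(2) by simp

lemma height_le [simp]: "height v \<le> d" "height v - Suc 0 \<le> d"
  by (simp_all add: height_def)

lemma fits_step [simp]: "64 \<le> a \<Longrightarrow> fits a (step v)"
  unfolding step_def
  by (rule fits_mono[of 64])
    (simp_all only: if_split fits_pow mult_le_mono1 numeral_le_iff diff_le_self, simp)

definition node_ok :: "nat \<Rightarrow> memory \<Rightarrow> bool" where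
  "node_ok v m \<longleftrightarrow> m (stride + v) = shift v \<and> m (2 * stride + v) = step v \<and> m (3 * stride + v) = list_addr v \<and>
    m (4 * stride + v) = 2 ^ height v \<and> m (5 * stride + v) = position v"

definition node_cells :: "nat set \<Rightarrow> nat set" where
  "node_cells V = (\<Union>v\<in>V. (\<lambda>c. c * stride + v) ` {1..5})"

definition header_cells :: "nat \<Rightarrow> nat set" where
  "header_cells k = {64 + 4 * (d - k)..<68 + 4 * (d - k)}"

definition header_ok :: "nat \<Rightarrow> memory \<Rightarrow> bool" where
  "header_ok k m \<longleftrightarrow> (let a = 64 + 4 * (d - k) in
    m a = level_offset k \<and> m (a + 1) = rate k \<and> m (a + 2) = seg_exp k \<and> m (a + 3) = seg_width k)"

definition constants_ok :: "memory \<Rightarrow> bool" where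
  "constants_ok m \<longleftrightarrow> m 0 = 2 ^ d \<and> m 2 = d \<and> m 3 = y \<and> m 4 = ceillog2 (d + 1) \<and> m 5 = 64 * (d + 1) \<and>
    m 6 = stride \<and> m 7 = d + 2 \<and> m 8 = 2 * d + 8 \<and> m 44 = 256 * (d + 1)"

lemma in_node_cells_iff: "b \<in> node_cells V \<longleftrightarrow>
  (\<exists>v\<in>V. b = stride + v \<or> b = 2 * stride + v \<or> b = 3 * stride + v \<or> b = 4 * stride + v \<or> b = 5 * stride + v)"
proof -
  have c: "{1..5} = {1, 2, 3, 4, 5::nat}" by auto
  show ?thesis unfolding node_cells_def c by auto
qed

lemma node_cells_ge: "b \<in> node_cells V \<Longrightarrow> stride \<le> b"
  by (auto simp: in_node_cells_iff)

lemma numeral_less_stride [simp]: "(numeral k :: nat) \<le> 2 ^ 19 \<Longrightarrow> numeral k < stride" "0 < stride"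
  "Suc 0 < stride"
  by (rule fits_less_stride[where a = 19]; simp)+

lemma array_neq_register [simp]:
  "(numeral k :: nat) \<le> 2 ^ 19 \<Longrightarrow> stride + v \<noteq> numeral k"
  "(numeral k :: nat) \<le> 2 ^ 19 \<Longrightarrow> numeral c * stride + v \<noteq> numeral k"
  "(numeral k :: nat) \<le> 2 ^ 19 \<Longrightarrow> \<not> numeral c * stride \<le> numeral k"
    "(numeral k :: nat) \<le> 2 ^ 19 \<Longrightarrow> numeral c * stride \<noteq> numeral k"
  "(numeral k :: nat) \<le> 2 ^ 19 \<Longrightarrow> \<not> numeral c * stride + v \<le> numeral k"
  "(numeral k :: nat) \<le> 2 ^ 19 \<Longrightarrow> Suc (numeral c * stride + v) \<noteq> numeral k"
proof -
  have "stride \<le> numeral c * stride" by simp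
  assume "(numeral k :: nat) \<le> 2 ^ 19"
  hence "numeral k < stride" by (rule numeral_less_stride)
  thus "stride + v \<noteq> numeral k" "numeral c * stride + v \<noteq> numeral k" "\<not> numeral c * stride \<le> numeral k"
    "numeral c * stride \<noteq> numeral k"
    "\<not> numeral c * stride + v \<le> numeral k" "Suc (numeral c * stride + v) \<noteq> numeral k"
      using \<open>stride \<le> numeral c * stride\<close> by linarith+
qed

lemma node_cells_gt: "b \<in> node_cells V \<Longrightarrow> 64 + 4 * d < b"
  using node_cells_ge stride_gt(1) by fastforce

lemma less_stride_node_cells [simp]: "b < stride \<Longrightarrow> b \<notin> node_cells V"
  using node_cells_ge by fastforce

lemma node_cells_mono: "V \<subseteq> V' \<Longrightarrow> node_cells V \<subseteq> node_cells V'"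
  unfolding node_cells_def by auto

lemma node_cells_disjoint:
  assumes "V \<subseteq> {..<stride}" "V' \<subseteq> {..<stride}" "V \<inter> V' = {}"
  shows "node_cells V \<inter> node_cells V' = {}"
proof -
  have "c * stride + v \<noteq> c' * stride + v'" if "v \<in> V" "v' \<in> V'" for c c' v v'
  proof
    assume e: "c * stride + v = c' * stride + v'"
    have "v < stride" "v' < stride" using assms that by auto
    hence "v = v'" using arg_cong[OF e, of "\<lambda>b. b mod stride"] by simp
    thus False using assms(3) that by auto
  qed
  thus ?thesis by (fastforce simp: node_cells_def)
qed

lemma node_ok_cong: "(\<And>b. b \<in> node_cells {v} \<Longrightarrow> m' b = m b) \<Longrightarrow> node_ok v m' = node_ok v m"
  by (simp add: node_ok_def in_node_cells_iff)

lemma header_ok_cong: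
  assumes "\<And>b. b \<in> header_cells k \<Longrightarrow> m' b = m b"
  shows "header_ok k m' = header_ok k m"
proof -
  have "m' (64 + 4 * (d - k) + i) = m (64 + 4 * (d - k) + i)" if "i < 4" for i using assms that
    by (simp add: header_cells_def)
  from this[of 0] this[of 1] this[of 2] this[of 3] show ?thesis by (simp add: header_ok_def Let_def)
qed

lemma constants_ok_cong:
  "unchanged A m m' \<Longrightarrow> A \<inter> {0, 2, 3, 4, 5, 6, 7, 8, 44} = {} \<Longrightarrow> constants_ok m' = constants_ok m"
  by (auto simp: constants_ok_def unchanged_def)

definition level :: "nat \<Rightarrow> nat set" where
  "level k = {2 ^ (d - k)..<2 * 2 ^ (d - k)}"

lemma two_times_pow_le: "a < b \<Longrightarrow> 2 * 2 ^ a \<le> (2::nat) ^ b"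
  unfolding power_Suc[symmetric] by (intro power_increasing) auto

lemma level_subset: "k \<in> {1..d} \<Longrightarrow> level k \<subseteq> {1..<2 ^ d}"
proof -
  assume "k \<in> {1..d}"
  hence "2 * 2 ^ (d - k) \<le> (2::nat) ^ d" by (intro two_times_pow_le) auto
  moreover have "1 \<le> (2::nat) ^ (d - k)" by simp
  ultimately show "level k \<subseteq> {1..<2 ^ d}" by (auto simp: level_def)
qed

lemma levels_disjoint:
  assumes "k < k'" "k' \<le> d"
  shows "level k \<inter> level k' = {}"
proof -
  have "2 * 2 ^ (d - k') \<le> (2::nat) ^ (d - k)" using assms by (intro two_times_pow_le) auto
  thus ?thesis by (auto simp: level_def)
qed

lemma height_bounds: "v \<in> {1..<2 ^ d} \<Longrightarrow> height v \<in> {1..d}"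
  using floor_log_less[of v d] by (auto simp: height_def)

lemma in_level_height: "v \<in> {1..<2 ^ d} \<Longrightarrow> v \<in> level (height v)"
  using floor_log_less[of v d] floor_log_bounds[of v] by (simp add: level_def height_def)

lemma rank_less: "v \<in> {1..<2 ^ d} \<Longrightarrow> rank v < 2 ^ (d - height v)"
  using floor_log_less[of v d] floor_log_bounds[of v] by (auto simp: rank_def height_def)

end

section \<open>Computing the parameters\<close>

abbreviation reg :: "nat \<Rightarrow> aexp" where "reg k \<equiv> Load (Const k)"
abbreviation assign :: "nat \<Rightarrow> aexp \<Rightarrow> com" (infix "::=" 62) where "k ::= e \<equiv> Store (Const k) e"
abbreviation then_do :: "com \<Rightarrow> com \<Rightarrow> com" (infixr ";;" 60) where "c ;; c' \<equiv> Seq c c'"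
abbreviation plus_exp :: "aexp \<Rightarrow> aexp \<Rightarrow> aexp" (infixl "+." 65) where "e +. f \<equiv> Op Add e f"
abbreviation minus_exp :: "aexp \<Rightarrow> aexp \<Rightarrow> aexp" (infixl "-." 65) where "e -. f \<equiv> Op Sub e f"
abbreviation times_exp :: "aexp \<Rightarrow> aexp \<Rightarrow> aexp" (infixl "*." 70) where "e *. f \<equiv> Op Mul e f"
abbreviation div_exp :: "aexp \<Rightarrow> aexp \<Rightarrow> aexp" (infixl "div." 70) where "e div. f \<equiv> Op Div e f"
abbreviation mod_exp :: "aexp \<Rightarrow> aexp \<Rightarrow> aexp" (infixl "mod." 70) where "e mod. f \<equiv> Op Mod e f"
abbreviation less_exp :: "aexp \<Rightarrow> aexp \<Rightarrow> aexp" (infix "<." 64) where "e <. f \<equiv> Op Less e f"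
abbreviation pow2 :: "aexp \<Rightarrow> aexp" where "pow2 e \<equiv> Op Shl (Const 1) e"
abbreviation inc :: "nat \<Rightarrow> com" where "inc k \<equiv> k ::= reg k +. Const 1"
abbreviation arr :: "nat \<Rightarrow> aexp \<Rightarrow> aexp" where "arr k e \<equiv> Const k *. reg 6 +. e"

definition ceillog_prog :: "nat \<Rightarrow> nat \<Rightarrow> com" where
  "ceillog_prog z x = z ::= Const 0 ;; While (pow2 (reg z) <. reg x) (inc z)"

definition renorm_prog :: "nat \<Rightarrow> nat \<Rightarrow> com" where
  "renorm_prog x z = Cond (reg x <. pow2 (reg 8 -. Const 1)) (x ::= Const 2 *. reg x ;; inc z) Skip"

definition central_step :: com where
  "central_step = (17 ::= (reg 17 *. (Const 2 *. reg 16 +. Const 1)) div. (Const 2 *. reg 16 +. Const 2)) ;;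
    renorm_prog 17 18 ;; inc 16"

definition central_prog :: com where
  "central_prog = While (reg 16 <. pow2 (reg 15 -. Const 1)) central_step"

definition square_step :: com where
  "square_step = (19 ::= Op Shr (reg 19 *. reg 19) (reg 8) ;; 20 ::= Const 2 *. reg 20) ;;
    renorm_prog 19 20 ;; inc 21"

definition square_prog :: com where
  "square_prog = (19 ::= reg 17 ;; 20 ::= reg 18 ;; 21 ::= Const 0) ;; While (reg 21 <. reg 7) square_step"

definition rate_prog :: com where
  "rate_prog = 22 ::= reg 2 -. reg 15 ;; 23 ::= reg 3 -. (Const 3 *. reg 15 div. Const 4) ;;
    24 ::= reg 20 +. Const 1 +. pow2 (reg 7 -. reg 23) ;; 25 ::= reg 23 +. reg 4 ;;
    Cond (reg 22 <. reg 25) (25 ::= reg 22) Skip"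

definition seg_width_prog :: com where
  "seg_width_prog = 26 ::= reg 5 +. Op Shr ((pow2 (reg 25) -. Const 1) *. reg 24) (reg 7) ;; 14 ::=
    Const 64 +. Const 4 *. reg 22"

definition header_prog :: com where
  "header_prog = Store (reg 14) (reg 27) ;; Store (reg 14 +. Const 1) (reg 24) ;;
    Store (reg 14 +. Const 2) (reg 25) ;;
    Store (reg 14 +. Const 3) (reg 26)"

definition level_params_prog :: com where
  "level_params_prog = rate_prog ;; seg_width_prog ;; header_prog"

definition shift_prog :: com where
  "shift_prog = Cond (reg 30)
      (32 ::= reg 31 -. Op Shr ((reg 30 -. Const 1) *. reg 24) (reg 7) ;; Store (arr 2 (reg 29)) (pow2 (reg 5 -. reg 32)))
      (32 ::= reg 5 ;; Store (arr 2 (reg 29)) (pow2 (Const 56 *. (reg 2 +. Const 1))))"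

definition position_prog :: com where
  "position_prog = 29 ::= pow2 (reg 22) +. reg 28 ;; 30 ::= reg 28 mod. pow2 (reg 25) ;; 31 ::=
    Op Shr (reg 30 *. reg 24) (reg 7) ;;
    Store (arr 5 (reg 29)) (reg 27 +. Op Shr (reg 28) (reg 25) *. reg 26 +. reg 31)"

definition list_params_prog :: com where
  "list_params_prog = Store (arr 1 (reg 29)) (reg 32) ;;
    Store (arr 3 (reg 29)) ((Const 8 +. reg 22) *. reg 6 +. Op Shl (reg 28) (reg 15)) ;;
    Store (arr 4 (reg 29)) (pow2 (reg 15)) ;; inc 28"

definition node_params_step :: com where
  "node_params_step = position_prog ;; shift_prog ;; list_params_prog"

definition node_params_prog :: com where
  "node_params_prog = 28 ::= Const 0 ;; While (reg 28 <. pow2 (reg 22)) node_params_step"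

definition next_level_prog :: com where
  "next_level_prog = 27 ::= reg 27 +. Op Shr (pow2 (reg 22)) (reg 25) *. reg 26 ;; inc 15"

definition level_prog :: com where
  "level_prog = central_prog ;; square_prog ;; level_params_prog ;; node_params_prog ;; next_level_prog"

definition levels_prog :: com where
  "levels_prog = (15 ::= Const 1 ;; 16 ::= Const 0 ;; 17 ::= pow2 (reg 8) ;; 18 ::= Const 0 ;; 27 ::= Const 0) ;;
    While (reg 15 <. reg 2 +. Const 1) level_prog"

definition identity_prog :: com where
  "identity_prog = 10 ::= Const 0 ;; While (reg 10 <. reg 0) (Store (arr 8 (reg 10)) (reg 10) ;; inc 10)"

definition constants_prog :: com where
  "constants_prog = 5 ::= Const 64 *. reg 14 ;; 6 ::= pow2 (Const 20 *. reg 14) ;; 7 ::= reg 2 +. Const 2 ;;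
    8 ::= Const 2 *. reg 2 +. Const 8 ;; 44 ::= Const 256 *. reg 14"

definition init_prog :: com where
  "init_prog = ceillog_prog 2 0 ;; ceillog_prog 3 1 ;; 14 ::=
    reg 2 +. Const 1 ;; ceillog_prog 4 14 ;; constants_prog"

definition prepare_prog :: com where
  "prepare_prog = init_prog ;; identity_prog ;; levels_prog"

locale ram = params d y + word_ram w H ks
  for d y w :: nat and H :: "nat \<Rightarrow> 'k \<Rightarrow> bool" and ks :: "'k list" +
  assumes w: "w = 256 * (d + 1)"
begin

lemma take_bit_small: "k < 2 ^ 256 \<Longrightarrow> take_bit w k = k" for k :: nat
proof -
  assume k: "k < 2 ^ 256"
  have "(2::nat) ^ 256 \<le> 2 ^ w" unfolding w by (rule power_increasing) auto
  thus "take_bit w k = k" using k by (intro take_bit_nat_eq_self) linarith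
qed

lemma fits_less_word: "fits 255 x \<Longrightarrow> x < 2 ^ w"
proof -
  have "(2::nat) ^ (255 * (d + 1)) < 2 ^ w" unfolding w by (intro power_strict_increasing) auto
  thus "fits 255 x \<Longrightarrow> x < 2 ^ w" unfolding fits_def by linarith
qed

lemma take_bit_fits [simp]: "fits 255 x \<Longrightarrow> take_bit w x = x"
  by (intro take_bit_nat_eq_self fits_less_word)

lemma w_pos [simp]: "0 < w" "w \<noteq> 0" "256 \<le> w"
  by (simp_all add: w)

lemma fits_w [simp]: "20 \<le> a \<Longrightarrow> fits a w"
  unfolding w by (rule fits_mono[of 20]) simp_all

declare take_bit_of_exp [simp del] take_bit_of_2 [simp del]

lemma take_bit_1 [simp]: "take_bit w (Suc 0) = Suc 0"
  by simp

lemmas bit_ops = push_bit_eq_mult drop_bit_eq_div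

lemma runs_ceillog:
  assumes zx: "z \<noteq> x" "z < 64" "x < 64" and n: "n \<le> 2 ^ (2 * (d + 1))" "m x = n"
  shows "runs g (ceillog_prog z x) m (20 * ceillog2 n + 20) (\<lambda>m'. m' = m(z := ceillog2 n))"
proof -
  have z: "take_bit w z = z" "take_bit w x = x" using zx by (auto intro!: take_bit_small)
  have le: "ceillog2 n \<le> 2 * (d + 1)" using n by (cases "n = 0") (auto simp: ceillog2_le_iff)
  have gt: "2 ^ i < n" if "i < ceillog2 n" for i using that ceillog2_le_iff[of n i] by (cases "n = 0") auto
  have pow: "take_bit w (2 ^ i) = (2 ^ i :: nat)" if "i \<le> ceillog2 n" for i using that le by simp
  have i: "fits 255 (Suc i)" if "i < ceillog2 n" for i
  proof (rule fits_le)
    show "Suc i \<le> 2 * Suc d" using that le by simp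
  qed simp
  have "runs g (While (pow2 (reg z) <. reg x) (inc z)) (m(z := 0)) (20 * ceillog2 n + 10) (\<lambda>m'. m' = m(z := ceillog2 n))"
  proof (rule runs_for[where I = "\<lambda>i m'. m' = m(z := i)" and N = "ceillog2 n" and T = "\<lambda>_. 10"])
    fix i m' assume "i < ceillog2 n" "m' = m(z := i)"
    moreover from this have "runs g (inc z) m' 10 (\<lambda>m'. m' = m(z := Suc i))"
      by (intro runs_denote) (simp_all add: z i)
    ultimately show "aval w m' (pow2 (reg z) <. reg x) \<noteq> 0 \<and> runs g (inc z) m' 10 (\<lambda>m'. m' = m(z := Suc i))"
      using zx n gt by (simp add: z bit_ops pow)
  next
    fix m' assume "m' = m(z := ceillog2 n)"
    thus "aval w m' (pow2 (reg z) <. reg x) = 0"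
      using zx n le_two_power_ceillog2[of n] by (simp add: z bit_ops pow)
  qed simp_all
  thus ?thesis unfolding ceillog_prog_def by (rule runs_Seq_denote[rotated 2]) (simp_all add: z)
qed

lemma denote_renorm:
  assumes "x \<noteq> z" "x < 64" "z < 64" "x \<noteq> 8" "z \<noteq> 8" "m 8 = 2 * d + 8" "fits 20 (m x)" "fits 20 (m z)"
  shows "denote (renorm_prog x z) (m, g) =
    (m(x := fst (renorm (2 * d + 8) (m x) (m z)), z := snd (renorm (2 * d + 8) (m x) (m z))), g)"
proof -
  have "take_bit w x = x" "take_bit w z = z" using assms by (auto intro!: take_bit_small)
  moreover have "fits a (m x)" "fits a (m z)" if "20 \<le> a" for a using assms that by (auto intro: fits_mono)
  moreover have "(2 * d + 8) - 1 = 2 * d + 7" by simp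
  ultimately show ?thesis using assms(1-6) by (auto simp: renorm_prog_def renorm_def bit_ops fun_eq_iff)
qed

definition central_state :: "nat \<Rightarrow> memory \<Rightarrow> memory" where
  "central_state t m = m(16 := t, 17 := fst (float_central (2 * d + 8) t), 18 := snd (float_central (2 * d + 8) t))"

lemma runs_central_step:
  assumes "constants_ok m" "t < 2 ^ d"
  shows "runs g central_step (central_state t m) 50 (\<lambda>m'. m' = central_state (Suc t) m)"
proof (rule runs_denote)
  let ?q = "2 * d + 8" let ?X = "fst (float_central ?q t)" and ?E = "snd (float_central ?q t)"
  let ?m = "(central_state t m)(17 := ?X * (2 * t + 1) div (2 * t + 2))"
  have t: "fits a t" if "1 \<le> a" for a using assms(2) that by (intro fits_le_pow) auto
  have E: "fits a ?E" if "1 \<le> a" for a by (rule fits_le[OF t[OF that] snd_float_central_le])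
  have "denote (17 ::= (reg 17 *. (Const 2 *. reg 16 +. Const 1)) div.
    (Const 2 *. reg 16 +. Const 2)) (central_state t m, g) = (?m, g)"
    by (simp add: central_state_def t del: mult_Suc_right)
  moreover have "denote (renorm_prog 17 18) (?m, g) =
    (?m(17 := fst (renorm ?q (?m 17) (?m 18)), 18 := snd (renorm ?q (?m 17) (?m 18))), g)"
  proof (rule denote_renorm)
    show "?m 8 = ?q" using assms(1) by (simp add: central_state_def constants_ok_def)
    show "fits 20 (?m 17)" by (simp add: t)
    show "fits 20 (?m 18)" by (simp add: central_state_def E)
  qed simp_all
  ultimately show "denote central_step (central_state t m, g) = (central_state (Suc t) m, g)"
    by (simp add: central_step_def central_state_def fun_eq_iff t)
qed (simp_all add: renorm_prog_def central_step_def)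

lemma runs_central:
  assumes m: "constants_ok m" "m 15 = k" and k: "k \<in> {1..d}" and t: "t \<le> 2 ^ (k - 1)"
  shows "runs g central_prog (central_state t m) (60 * 2 ^ k + 60) (\<lambda>m'. m' = central_state (2 ^ (k - 1)) m)"
proof -
  have kd: "(2::nat) ^ (k - 1) \<le> 2 ^ d" using k by auto
  have fits: "fits a k" "fits a (2 ^ (k - Suc 0))" if "1 \<le> a" for a using k that by (auto intro: fits_le_d)
  have aval: "aval w (central_state u m) (reg 16 <. pow2 (reg 15 -. Const 1)) = of_bool (u < 2 ^ (k - 1))"
    if "u \<le> 2 ^ (k - 1)" for u
    using k m(2) by (simp add: central_state_def bit_ops fits)
  show ?thesis unfolding central_prog_def
  proof (rule runs_for[where I = "\<lambda>i m'. m' = central_state (t + i) m" and N = "2 ^ (k - 1) - t" and T = "\<lambda>_. 50"])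
    fix i m' assume i: "i < 2 ^ (k - 1) - t" and m': "m' = central_state (t + i) m"
    hence le: "t + i \<le> 2 ^ (k - 1)" and "t + i < 2 ^ d" using kd by linarith+
    show "aval w m' (reg 16 <. pow2 (reg 15 -. Const 1)) \<noteq> 0 \<and>
      runs g central_step m' 50 (\<lambda>m'. m' = central_state (t + Suc i) m)"
      unfolding m' aval[OF le] using runs_central_step[OF m(1) \<open>t + i < 2 ^ d\<close>] i by simp
  next
    have "(2::nat) ^ k = 2 * 2 ^ (k - 1)" using k by (cases k) auto
    thus "(\<Sum>i<2 ^ (k - 1) - t. 50 + (1 + acost (reg 16 <. pow2 (reg 15 -. Const 1)))) +
      (1 + acost (reg 16 <. pow2 (reg 15 -. Const 1))) \<le> 60 * 2 ^ k + 60" by simp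
  qed (use t aval in simp_all)
qed

lemma runs_square:
  assumes m: "constants_ok m" and k: "k \<le> d" and c: "central_state (2 ^ (k - 1)) m = m"
  shows "runs g square_prog m (100 * (d + 3)) (\<lambda>m'. unchanged {19..21} m m' \<and> m' 20 = log_estimate k)"
proof -
  let ?q = "2 * d + 8"
  define F where "F i = float_square ?q (float_central ?q (2 ^ (k - 1))) i" for i
  let ?st = "\<lambda>i. m(19 := fst (F i), 20 := snd (F i), 21 := i)"
  have m8: "m 8 = ?q" "m 7 = d + 2" using m by (simp_all add: constants_ok_def)
  have fits: "fits a (fst (F i))" if "8 \<le> a" for i a using that by (simp add: F_def)
  have step: "runs g square_step (?st i) 60 (\<lambda>m'. m' = ?st (Suc i))" if i: "i < d + 2" for i
  proof (rule runs_denote)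
    have snd: "fits a (snd (F i))" if "6 \<le> a" for a using k i that unfolding F_def
      by (intro fits_snd_float_square) auto
    have fi: "fits a i" if "3 \<le> a" for a by (rule fits_mono[OF fits_le that, of "d + 2"])
      (use i in simp_all)
    let ?m = "m(19 := fst (F i) * fst (F i) div 2 ^ ?q, 20 := 2 * snd (F i), 21 := i)"
    have "denote (19 ::= Op Shr (reg 19 *. reg 19) (reg 8) ;; 20 ::= Const 2 *. reg 20) (?st i, g) =
      (?m, g)"
      using m8 by (simp add: bit_ops fits snd fun_eq_iff)
    hence "denote square_step (?st i, g) = denote (inc 21) (denote (renorm_prog 19 20) (?m, g))"
      by (simp only: square_step_def denote.simps)
    also have "denote (renorm_prog 19 20) (?m, g) =
      (?m(19 := fst (renorm ?q (?m 19) (?m 20)), 20 := snd (renorm ?q (?m 19) (?m 20))), g)"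
      by (rule denote_renorm) (use m8 fits snd in simp_all)
    also have "denote (inc 21) (...) = (?st (Suc i), g)" by (simp add: fun_eq_iff fi F_def)
    finally show "denote square_step (?st i, g) = (?st (Suc i), g)" .
  qed (simp_all add: renorm_prog_def square_step_def)
  have "runs g (While (reg 21 <. reg 7) square_step) (?st 0) (100 * (d + 3) - 30) (\<lambda>m'. m' = ?st (d + 2))"
    by (rule runs_for[where I = "\<lambda>i m'. m' = ?st i" and N = "d + 2" and T = "\<lambda>_. 60"])
      (use step m8 in simp_all)
  hence loop: "runs g (While (reg 21 <. reg 7) square_step) (?st 0) (100 * (d + 3) - 30)
    (\<lambda>m'. unchanged {19..21} m m' \<and> m' 20 = log_estimate k)"
    by (rule runs_mono) (auto simp: F_def log_estimate_def)
  have "m 17 = fst (F 0)" "m 18 = snd (F 0)" 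
    using fun_cong[OF c, of 17] fun_cong[OF c, of 18] by (simp_all add: central_state_def F_def)
  hence "denote (19 ::= reg 17 ;; 20 ::= reg 18 ;; 21 ::= Const 0) (m, g) = (?st 0, g)"
    by (simp add: fun_eq_iff)
  thus ?thesis unfolding square_prog_def by (intro runs_Seq_denote[OF _ _ loop]) simp_all
qed
end

context ram
begin

definition level_regs :: "nat \<Rightarrow> memory \<Rightarrow> bool" where
  "level_regs k m \<longleftrightarrow> m 15 = k \<and> m 22 = d - k \<and> m 24 = rate k \<and> m 25 = seg_exp k \<and> m 26 = seg_width k \<and>
    m 27 = level_offset k"

lemma level_regs_cong: "unchanged A m m' \<Longrightarrow> A \<inter> {15, 22, 24, 25, 26, 27} = {} \<Longrightarrow>
  level_regs k m' = level_regs k m"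
  by (auto simp: level_regs_def unchanged_def)

lemma central_state_cong:
  assumes "unchanged A m m'" "A \<inter> {16, 17, 18} = {}" "central_state t m = m"
  shows "central_state t m' = m'"
proof
  fix b
  have "b \<notin> {16, 17, 18} \<or> m' b = m b" using unchangedD[OF assms(1)] assms(2) by blast
  thus "central_state t m' b = m' b" using fun_cong[OF assms(3), of b]
    by (auto simp: central_state_def split: if_splits)
qed

lemma runs_level_params:
  assumes m: "constants_ok m" "m 15 = k" "m 20 = log_estimate k" "m 27 = level_offset k" and k: "k \<in> {1..d}"
  shows "runs g level_params_prog m 200
    (\<lambda>m'. level_regs k m' \<and> header_ok k m' \<and> unchanged ({14} \<union> {22..26} \<union> header_cells k) m m')"
proof (rule runs_denote)
  let ?a = "64 + 4 * (d - k)"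
  let ?m1 = "m(22 := d - k, 23 := slack k, 24 := rate k, 25 := seg_exp k)"
    and ?m2 = "m(22 := d - k, 23 := slack k, 24 := rate k, 25 := seg_exp k, 26 := seg_width k, 14 := ?a)"
  let ?m3 = "?m2(?a := level_offset k, ?a + 1 := rate k, ?a + 2 := seg_exp k, ?a + 3 := seg_width k)"
  have fixed: "m 2 = d" "m 3 = y" "m 4 = ceillog2 (Suc d)" "m 5 = 64 * (d + 1)" "m 7 = d + 2"
    using m(1) by (simp_all add: constants_ok_def)
  have fits: "fits a k" "fits a y" if "1 \<le> a" for a using k y_le that by (auto intro: fits_le_d)
  have pow: "fits a (2 ^ (Suc (Suc d) - slack k))" if "2 \<le> a" for a
    by (rule fits_mono[OF fits_pow that]) simp
  have a: "fits a ?a" if "30 \<le> a" for a by (rule fits_mono[OF _ that]) simp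
  have "denote rate_prog (m, g) = (?m1, g)"
    using m k fixed by (simp add: rate_prog_def slack_def[symmetric] bit_ops fits pow rate_def seg_exp_def
      min_def fun_eq_iff)
  moreover have "denote seg_width_prog (?m1, g) = (?m2, g)"
    using k fixed by (simp add: seg_width_prog_def bit_ops seg_width_def seg_offset_def fun_eq_iff)
  moreover have "denote header_prog (?m2, g) = (?m3, g)"
    using m by (simp add: header_prog_def a)
  ultimately show "denote level_params_prog (m, g) = (?m3, g)"
    by (simp only: level_params_prog_def denote.simps)
  show "level_regs k ?m3 \<and> header_ok k ?m3 \<and> unchanged ({14} \<union> {22..26} \<union> header_cells k) m ?m3"
    using m by (auto simp: level_regs_def header_ok_def unchanged_def header_cells_def)
qed (simp_all add: level_params_prog_def rate_prog_def seg_width_prog_def header_prog_def)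

lemma denote_shift_prog:
  assumes m: "constants_ok m" "level_regs (height v) m" "m 28 = rank v" "m 29 = v"
    "m 30 = rank v mod 2 ^ seg_exp (height v)" "m 31 = seg_offset (height v) (m 30)"
      and v: "v \<in> {1..<2 ^ d}"
  shows "denote shift_prog (m, g) = (m(32 := shift v, 2 * stride + v := step v), g)"
proof -
  let ?r = "m 30"
  have fits: "fits a ?r" "fits a v" if "1 \<le> a" for a
    using m(5) v that seg_index_le[OF less_imp_le[OF mod_less_divisor, of "2 ^ seg_exp (height v)" "rank v"]]
    by (auto intro!: fits_le_pow)
  have r: "?r \<le> 2 ^ seg_exp (height v)" using m(5) by (simp add: less_imp_le)
  have fixed: "m 2 = d" "m 5 = 64 * (d + 1)" "m 6 = stride" "m 7 = d + 2" "m 24 = rate (height v)"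
    using m by (simp_all add: constants_ok_def level_regs_def)
  show ?thesis
  proof (cases "?r = 0")
    case True
    thus ?thesis using m(4,5) fixed by (simp add: shift_prog_def shift_def step_def bit_ops fits)
  next
    case False
    let ?s = "seg_offset (height v) ?r - (?r - 1) * rate (height v) div 2 ^ (d + 2)"
    have s: "?s = shift v" using False m(5) by (simp add: shift_def seg_offset_def Let_def)
    have pow: "fits 255 (2 ^ (64 * (d + 1) - shift v))" by (rule fits_mono[OF fits_pow[of _ 64]]) auto
    have step: "step v = 2 ^ (64 * (d + 1) - shift v)" using False m(5) by (simp add: step_def)
    have "denote (32 ::= reg 31 -. Op Shr ((reg 30 -. Const 1) *. reg 24) (reg 7)) (m, g) =
      (m(32 := ?s), g)"
      using m(6) fixed r fits by (simp add: bit_ops)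
    thus ?thesis using False m(4) fixed pow fits unfolding s step
      by (simp add: shift_prog_def bit_ops)
  qed
qed

lemma runs_node_params_step:
  assumes m: "constants_ok m" "level_regs k m" "m 28 = q" and k: "k \<in> {1..d}" and q: "q < 2 ^ (d - k)"
  shows "runs g node_params_step m 200 (\<lambda>m'. m' 28 = Suc q \<and> node_ok (2 ^ (d - k) + q) m' \<and>
    unchanged ({28..32} \<union> node_cells {2 ^ (d - k) + q}) m m')"
proof (rule runs_denote)
  define v where "v = 2 ^ (d - k) + q"
  have v: "floor_log v = d - k" "height v = k" "rank v = q"
    using floor_log_pow_add[OF q] k by (auto simp: v_def height_def rank_def)
  have vl: "v \<in> {1..<2 ^ d}" using level_subset[OF k] q by (auto simp: level_def v_def)
  hence vs: "v < stride" by (simp add: node_less_stride)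
  let ?r = "q mod 2 ^ seg_exp k"
  let ?m1 = "m(29 := v, 30 := ?r, 31 := seg_offset k ?r, 5 * stride + v := position v)"
  let ?m2 = "?m1(32 := shift v, 2 * stride + v := step v)"
  let ?m3 = "?m2(stride + v := shift v, 3 * stride + v := list_addr v, 4 * stride + v := 2 ^ height v, 28 := Suc q)"
  have fixed: "m 6 = stride" "m 7 = d + 2" using m(1) by (simp_all add: constants_ok_def)
  note regs = m(2)[unfolded level_regs_def]
  have "q \<le> 2 ^ d" using q vl v_def by simp
  hence fits: "fits a q" "fits a v" "fits a k" "fits a (2 ^ k)" if "1 \<le> a" for a
    using k vl that by (simp_all add: fits_le_pow fits_le_d)
  have r: "?r \<le> 2 ^ seg_exp k" by (simp add: less_imp_le)
  have "denote position_prog (m, g) = (?m1, g)"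
    using m(3) regs fixed k r by
      (simp add: position_prog_def bit_ops fits position_def v seg_offset_def v_def[symmetric] fun_eq_iff)
  moreover have "denote shift_prog (?m1, g) = (?m2, g)"
    by (rule denote_shift_prog) (use m vl v in \<open>simp_all add: constants_ok_def level_regs_def\<close>)
  moreover have "denote list_params_prog (?m2, g) = (?m3, g)"
    using m(3) regs fixed k by (simp add: list_params_prog_def bit_ops fits v list_addr_def fun_eq_iff)
  ultimately show "denote node_params_step (m, g) = (?m3, g)"
    by (simp only: node_params_step_def denote.simps)
  show "?m3 28 = Suc q \<and> node_ok (2 ^ (d - k) + q) ?m3 \<and>
    unchanged ({28..32} \<union> node_cells {2 ^ (d - k) + q}) m ?m3"
    unfolding v_def[symmetric] using vs by (auto simp: node_ok_def unchanged_def in_node_cells_iff)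
qed (simp_all add: node_params_step_def position_prog_def shift_prog_def list_params_prog_def)

definition node_params_inv :: "nat \<Rightarrow> memory \<Rightarrow> nat \<Rightarrow> memory \<Rightarrow> bool" where
  "node_params_inv k m i m' \<longleftrightarrow> m' 28 = i \<and> (\<forall>q<i. node_ok (2 ^ (d - k) + q) m') \<and>
    unchanged ({28..32} \<union> node_cells (level k)) m m'"

lemma runs_node_params_inv:
  assumes m: "constants_ok m'" "level_regs k m'" and k: "k \<in> {1..d}" and i: "i < 2 ^ (d - k)"
    and inv: "node_params_inv k m i m'"
  shows "runs g node_params_step m' 200 (node_params_inv k m (Suc i))"
proof (rule runs_mono[OF runs_node_params_step[OF m _ k i]])
  let ?v = "\<lambda>q. 2 ^ (d - k) + q"
  show "m' 28 = i" using inv by (simp add: node_params_inv_def)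
  fix m'' assume m'': "m'' 28 = Suc i \<and> node_ok (?v i) m'' \<and>
    unchanged ({28..32} \<union> node_cells {?v i}) m' m''"
  have "node_ok (?v q) m''" if q: "q < i" for q
  proof -
    have "node_cells {?v q} \<inter> node_cells {?v i} = {}"
      using level_subset[OF k] q i node_less_stride by (intro node_cells_disjoint) (auto simp: level_def)
    moreover have "b \<notin> {28..32}" if "b \<in> node_cells {?v q}" for b using node_cells_gt[OF that] by simp
    ultimately have "m'' b = m' b" if "b \<in> node_cells {?v q}" for b
      using that m'' by (intro unchangedD[of "{28..32} \<union> node_cells {?v i}"]) auto
    hence "node_ok (?v q) m'' = node_ok (?v q) m'" by (rule node_ok_cong)
    thus ?thesis using inv q by (simp add: node_params_inv_def)
  qed
  moreover have "node_cells {?v i} \<subseteq> node_cells (level k)" using i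
    by (intro node_cells_mono) (auto simp: level_def)
  hence "unchanged ({28..32} \<union> node_cells (level k)) m m''"
    using inv m'' unfolding node_params_inv_def by (intro unchanged_trans[of _ m m' _ m'']) auto
  ultimately show "node_params_inv k m (Suc i) m''" using m''
    by (auto simp: node_params_inv_def less_Suc_eq)
qed simp_all

lemma runs_node_params:
  assumes m: "constants_ok m" "level_regs k m" and k: "k \<in> {1..d}"
  shows "runs g node_params_prog m (220 * 2 ^ (d - k) + 50)
    (\<lambda>m'. (\<forall>v\<in>level k. node_ok v m') \<and> unchanged ({28..32} \<union> node_cells (level k)) m m')"
  unfolding node_params_prog_def
proof (rule runs_Seq_denote)
  let ?inv = "node_params_inv k m"
  have fixed: "constants_ok m'" "level_regs k m'" if "?inv i m'" for i m'
  proof -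
    have u: "unchanged ({28..32} \<union> node_cells (level k)) m m'" using that by (simp add: node_params_inv_def)
    show "constants_ok m'" using constants_ok_cong[OF u] m(1) by simp
    show "level_regs k m'" using level_regs_cong[OF u] m(2) by simp
  qed
  have aval: "aval w m' (reg 28 <. pow2 (reg 22)) = of_bool (i < 2 ^ (d - k))" if "?inv i m'" for i m'
    using that fixed(2)[OF that] by (simp add: node_params_inv_def level_regs_def bit_ops)
  have nodes: "\<forall>v\<in>level k. node_ok v m'" if "?inv (2 ^ (d - k)) m'" for m'
  proof
    fix v assume "v \<in> level k"
    then obtain q where "v = 2 ^ (d - k) + q" "q < 2 ^ (d - k)" by (auto simp: level_def le_iff_add)
    thus "node_ok v m'" using that by (simp add: node_params_inv_def)
  qed
  show "runs g (While (reg 28 <. pow2 (reg 22)) node_params_step) (m(28 := 0)) (220 * 2 ^ (d - k) + 40)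
    (\<lambda>m'. (\<forall>v\<in>level k. node_ok v m') \<and> unchanged ({28..32} \<union> node_cells (level k)) m m')"
  proof (rule runs_for[where I = ?inv and N = "2 ^ (d - k)" and T = "\<lambda>_. 200"])
    show "aval w m' (reg 28 <. pow2 (reg 22)) \<noteq> 0 \<and> runs g node_params_step m' 200 (?inv (Suc i))"
      if "i < 2 ^ (d - k)" "?inv i m'" for i m' using that runs_node_params_inv[OF fixed[OF that(2)] k] aval
        by simp
    show "aval w m' (reg 28 <. pow2 (reg 22)) = 0" if "?inv (2 ^ (d - k)) m'" for m' using aval[OF that]
      by simp
    show "(\<forall>v\<in>level k. node_ok v m') \<and> unchanged ({28..32} \<union> node_cells (level k)) m m'"
      if "?inv (2 ^ (d - k)) m'" for m'
      using that nodes by (simp add: node_params_inv_def)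
  qed (simp_all add: node_params_inv_def)
qed simp_all

lemma runs_level_nodes:
  assumes m: "constants_ok m" "level_regs k m" "header_ok k m" "central_state (2 ^ (k - 1)) m = m"
    and k: "k \<in> {1..d}"
  shows "runs g (node_params_prog ;; next_level_prog) m (220 * 2 ^ (d - k) + 100)
    (\<lambda>m'. m' 15 = Suc k \<and> m' 27 = level_offset (Suc k) \<and> central_state (2 ^ (k - 1)) m' = m' \<and>
      (\<forall>v\<in>level k. node_ok v m') \<and> header_ok k m' \<and> unchanged
        ({15} \<union> {27..32} \<union> node_cells (level k)) m m')"
proof (rule runs_Seq[OF runs_node_params[OF m(1,2) k]])
  fix m' assume m': "(\<forall>v\<in>level k. node_ok v m') \<and> unchanged ({28..32} \<union> node_cells (level k)) m m'"
  let ?m = "m'(27 := level_offset (Suc k), 15 := Suc k)"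
  have same: "unchanged ({15} \<union> {27..32} \<union> node_cells (level k)) m ?m" using m'
    by (auto simp: unchanged_def)
  have "level_regs k m'" using level_regs_cong[of _ m m'] m(2) m' by auto
  hence denote: "denote next_level_prog (m', g) = (?m, g)" using k
    by (simp add: next_level_prog_def level_regs_def bit_ops level_offset_Suc fits_le_d)
  have "central_state (2 ^ (k - 1)) ?m = ?m" by (rule central_state_cong[OF same _ m(4)]) auto
  moreover have "node_ok v ?m" if "v \<in> level k" for v
    using m' that node_cells_gt[of _ "{v}"] by (subst node_ok_cong[of v ?m m']) auto
  moreover have "?m b = m b" if "b \<in> header_cells k" for b
    using that stride_gt(1) k by (intro unchangedD[OF same]) (auto simp: header_cells_def)
  hence "header_ok k ?m" using m(3) header_ok_cong[of k ?m m] by simp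
  ultimately show "runs g next_level_prog m' 50 (\<lambda>m'. m' 15 = Suc k \<and> m' 27 = level_offset (Suc k) \<and>
    central_state (2 ^ (k - 1)) m' = m' \<and>
      (\<forall>v\<in>level k. node_ok v m') \<and> header_ok k m' \<and> unchanged
        ({15} \<union> {27..32} \<union> node_cells (level k)) m m')"
    using same by (intro runs_denote[OF _ _ denote]) (simp_all add: next_level_prog_def)
qed simp

lemma runs_level:
  assumes m: "constants_ok m" "m 15 = k" "m 27 = level_offset k" "central_state t m = m"
    and k: "k \<in> {1..d}" and t: "t \<le> 2 ^ (k - 1)"
  shows "runs g level_prog m (60 * 2 ^ k + 220 * 2 ^ (d - k) + 100 * d + 800)
    (\<lambda>m'. m' 15 = Suc k \<and> m' 27 = level_offset (Suc k) \<and> central_state (2 ^ (k - 1)) m' = m' \<and>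
      (\<forall>v\<in>level k. node_ok v m') \<and> header_ok k m' \<and> unchanged
        ({14..32} \<union> header_cells k \<union> node_cells (level k)) m m')"
  (is "runs g _ m _ ?Q") unfolding level_prog_def
proof (rule runs_Seq)
  show "runs g central_prog m (60 * 2 ^ k + 60) (\<lambda>m'. m' = central_state (2 ^ (k - 1)) m)"
    using runs_central[OF m(1,2) k t] m(4) by simp
  fix m1 assume m1: "m1 = central_state (2 ^ (k - 1)) m"
  have const1: "constants_ok m1" using m(1) by (simp add: m1 central_state_def constants_ok_def)
  have central1: "central_state (2 ^ (k - 1)) m1 = m1" by (simp add: m1 central_state_def)
  show "runs g (square_prog ;; level_params_prog ;; node_params_prog ;;
    next_level_prog) m1 (220 * 2 ^ (d - k) + 100 * d + 700) ?Q"
  proof (rule runs_Seq[OF runs_square[OF const1 _ central1]])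
    fix m2 assume m2: "unchanged {19..21} m1 m2 \<and> m2 20 = log_estimate k"
    have const2: "constants_ok m2" using constants_ok_cong[of _ m1 m2] m2 const1 by auto
    have central2: "central_state (2 ^ (k - 1)) m2 = m2" by (rule central_state_cong[OF _ _ central1])
      (use m2 in auto)
    have regs: "m2 15 = k" "m2 27 = level_offset k" using m2 m
      by (simp_all add: unchanged_def m1 central_state_def)
    show "runs g (level_params_prog ;; node_params_prog ;; next_level_prog) m2 (220 * 2 ^ (d - k) + 300) ?Q"
    proof (rule runs_Seq[OF runs_level_params[OF const2 regs(1) _ regs(2) k]])
      fix m3 assume m3: "level_regs k m3 \<and> header_ok k m3 \<and>
        unchanged ({14} \<union> {22..26} \<union> header_cells k) m2 m3"
      have const3: "constants_ok m3" using constants_ok_cong[of _ m2 m3] m3 const2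
        by (auto simp: header_cells_def)
      have central3: "central_state (2 ^ (k - 1)) m3 = m3"
        by (rule central_state_cong[OF _ _ central2, of "{14} \<union> {22..26} \<union> header_cells k"])
          (use m3 in \<open>auto simp: header_cells_def\<close>)
      show "runs g (node_params_prog ;; next_level_prog) m3 (220 * 2 ^ (d - k) + 100) ?Q"
        by (rule runs_mono[OF runs_level_nodes[OF const3 _ _ central3 k]])
          (use m2 m3 in \<open>auto simp: unchanged_def m1 central_state_def\<close>)
    qed (use m2 in auto)
  qed (use k in auto)
qed simp

definition level_inv :: "memory \<Rightarrow> nat \<Rightarrow> memory \<Rightarrow> bool" where
  "level_inv m0 i m \<longleftrightarrow> constants_ok m \<and> m 15 = Suc i \<and> m 27 = level_offset (Suc i) \<and>
    central_state (if i = 0 then 0 else 2 ^ (i - 1)) m = m \<and>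
      (\<forall>k\<in>{1..i}. (\<forall>v\<in>level k. node_ok v m) \<and> header_ok k m) \<and>
    unchanged ({14..32} \<union> {64..<64 + 4 * d} \<union> node_cells {1..<2 ^ d}) m0 m"

lemma runs_level_inv:
  assumes inv: "level_inv m0 i m" and i: "i < d"
  shows "runs g level_prog m (60 * 2 ^ Suc i + 220 * 2 ^ (d - Suc i) + 100 * d + 800) (level_inv m0 (Suc i))"
proof (rule runs_mono[OF runs_level])
  let ?k = "Suc i"
  show "constants_ok m" "m 15 = ?k" "m 27 = level_offset ?k" "?k \<in> {1..d}"
    "central_state (if i = 0 then 0 else 2 ^ (i - 1)) m = m" using inv i by (auto simp: level_inv_def)
  show "(if i = 0 then 0 else 2 ^ (i - 1)) \<le> (2::nat) ^ (?k - 1)" by simp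
  fix m' assume m': "m' 15 = Suc ?k \<and> m' 27 = level_offset (Suc ?k) \<and> central_state (2 ^ (?k - 1)) m' = m' \<and>
      (\<forall>v\<in>level ?k. node_ok v m') \<and> header_ok ?k m' \<and> unchanged
        ({14..32} \<union> header_cells ?k \<union> node_cells (level ?k)) m m'"
  have k: "?k \<in> {1..d}" using i by simp
  have header: "header_cells j \<subseteq> {64..<64 + 4 * d}" if "j \<in> {1..d}" for j using that
    by (auto simp: header_cells_def)
  have same: "m' b = m b" if "b \<notin> {14..32}" "b \<notin> header_cells ?k" "b \<notin> node_cells (level ?k)" for b
    using that m' by (intro unchangedD[of "{14..32} \<union> header_cells ?k \<union> node_cells (level ?k)"]) auto
  have "constants_ok m'"
    using constants_ok_cong[of _ m m'] m' inv header[OF k] by (auto simp: level_inv_def header_cells_def)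
  moreover have "(\<forall>v\<in>level j. node_ok v m') \<and> header_ok j m'" if j: "j \<in> {1..i}" for j
  proof
    have jk: "j \<in> {1..d}" "j < ?k" using j i by auto
    have "level j \<subseteq> {..<stride}" "level ?k \<subseteq> {..<stride}"
      using level_subset[OF jk(1)] level_subset[OF k] node_less_stride by fastforce+
    hence "node_cells (level j) \<inter> node_cells (level ?k) = {}"
      using levels_disjoint[of j ?k] jk k by (intro node_cells_disjoint) auto
    hence "m' b = m b" if "v \<in> level j" "b \<in> node_cells {v}" for v b
      using that node_cells_gt[OF that(2)] node_cells_mono[of "{v}" "level j"] header[OF k]
        by (intro same) auto
    thus "\<forall>v\<in>level j. node_ok v m'" using inv j node_ok_cong[of _ m' m] by (auto simp: level_inv_def)
    have "m' b = m b" if "b \<in> header_cells j" for b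
      using that jk i stride_gt(1) by (intro same) (auto simp: header_cells_def)
    thus "header_ok j m'" using inv j header_ok_cong[of j m' m] by (auto simp: level_inv_def)
  qed
  moreover have "unchanged ({14..32} \<union> {64..<64 + 4 * d} \<union> node_cells {1..<2 ^ d}) m0 m'"
    using inv m' header[OF k] node_cells_mono[OF level_subset[OF k]] unfolding level_inv_def
    by (intro unchanged_trans[of _ m0 m "{14..32} \<union> header_cells ?k \<union> node_cells (level ?k)" m']) auto
  ultimately show "level_inv m0 ?k m'" using m' by (auto simp: level_inv_def le_Suc_eq)
qed simp

lemma runs_levels:
  assumes m: "constants_ok m"
  shows "runs g levels_prog m (400 * 2 ^ d + 100 * (d * d) + 1000 * d + 100) (level_inv m d)"
  unfolding levels_prog_def
proof (rule runs_Seq_denote)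
  let ?m = "m(15 := 1, 16 := 0, 17 := 2 ^ (2 * d + 8), 18 := 0, 27 := 0)"
    and ?e = "reg 15 <. reg 2 +. Const 1"
  show "denote (15 ::= Const 1 ;; 16 ::= Const 0 ;; 17 ::= pow2 (reg 8) ;; 18 ::= Const 0 ;; 27 ::=
    Const 0) (m, g) = (?m, g)"
    using m fits_pow[of "2 * d + 8" 255] by (simp add: constants_ok_def bit_ops)
  have inv: "level_inv m 0 ?m"
    using m by (simp add: level_inv_def constants_ok_def level_offset_def central_state_def unchanged_def fun_eq_iff)
  have aval: "aval w m' ?e = of_bool (i < d)" if "level_inv m i m'" for i m'
    using that by (simp add: level_inv_def constants_ok_def)
  show "runs g (While ?e level_prog) ?m (400 * 2 ^ d + 100 * (d * d) + 1000 * d + 50) (level_inv m d)"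
  proof (rule runs_for[where I = "level_inv m" and N = d and T = "\<lambda>i. 60 * 2 ^ Suc i +
    220 * 2 ^ (d - Suc i) + 100 * d + 800", OF inv])
    show "aval w m' ?e \<noteq> 0 \<and> runs g level_prog m' (60 * 2 ^ Suc i + 220 * 2 ^ (d - Suc i) + 100 * d +
      800) (level_inv m (Suc i))"
      if "i < d" "level_inv m i m'" for i m' using that runs_level_inv aval by simp
    show "aval w m' ?e = 0" if "level_inv m d m'" for m' using aval[OF that] by simp
    have pows: "(\<Sum>i<d. (2::nat) ^ Suc i) \<le> 2 * 2 ^ d" "(\<Sum>i<d. (2::nat) ^ (d - Suc i)) \<le> 2 ^ d"
      unfolding sum.nat_diff_reindex by (induction d) auto
    have "(\<Sum>i<d. 60 * 2 ^ Suc i + 220 * 2 ^ (d - Suc i) + 100 * d + 800 + (1 + acost ?e)) =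
      60 * (\<Sum>i<d. 2 ^ Suc i) + 220 * (\<Sum>i<d. 2 ^ (d - Suc i)) + d * (100 * d + 808)"
      by (simp add: sum.distrib sum_distrib_left algebra_simps)
    also have "... \<le> 60 * (2 * 2 ^ d) + 220 * 2 ^ d + d * (100 * d + 808)"
      using pows by (intro add_mono mult_le_mono2) auto
    finally show "(\<Sum>i<d. 60 * 2 ^ Suc i + 220 * 2 ^ (d - Suc i) + 100 * d + 800 + (1 + acost ?e)) +
      (1 + acost ?e)
      \<le> 400 * 2 ^ d + 100 * (d * d) + 1000 * d + 50" by (simp add: algebra_simps)
  qed
qed simp_all

lemma runs_identity:
  assumes m: "constants_ok m"
  shows "runs g identity_prog m (50 * 2 ^ d + 50)
    (\<lambda>m'. (\<forall>v<2 ^ d. m' (8 * stride + v) = v) \<and> unchanged ({10} \<union> {8 * stride..}) m m')"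
proof -
  define I where "I i m' \<longleftrightarrow> m' 10 = i \<and> (\<forall>v<i. m' (8 * stride + v) = v) \<and>
    unchanged ({10} \<union> {8 * stride..}) m m'" for i m'
  have fixed: "m' 6 = stride" "m' 0 = 2 ^ d" if "I i m'" for i m'
    using m that by (auto simp: constants_ok_def unchanged_def I_def)
  have "runs g (While (reg 10 <. reg 0) (Store (arr 8 (reg 10)) (reg 10) ;; inc 10)) (m(10 :=
    0)) (50 * 2 ^ d + 40) (I (2 ^ d))"
  proof (rule runs_for[where I = I and N = "2 ^ d" and T = "\<lambda>_. 30"])
    fix i m' assume i: "i < 2 ^ d" and I: "I i m'"
    have fits: "fits a i" if "1 \<le> a" for a using i that by (intro fits_le_pow) auto
    have "runs g (Store (arr 8 (reg 10)) (reg 10) ;; inc 10) m' 30 (I (Suc i))"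
    proof (rule runs_denote)
      show "denote (Store (arr 8 (reg 10)) (reg 10) ;; inc 10) (m', g) =
        (m'(8 * stride + i := i, 10 := Suc i), g)"
        using I fixed[OF I] by (simp add: I_def fits)
      show "I (Suc i) (m'(8 * stride + i := i, 10 := Suc i))"
        using I by (auto simp: I_def unchanged_def less_Suc_eq)
    qed simp_all
    thus "aval w m' (reg 10 <. reg 0) \<noteq> 0 \<and>
      runs g (Store (arr 8 (reg 10)) (reg 10) ;; inc 10) m' 30 (I (Suc i))"
      using i I fixed[OF I] by (simp add: I_def)
  next
    show "aval w m' (reg 10 <. reg 0) = 0" if "I (2 ^ d) m'" for m' using fixed[OF that] that
      by (simp add: I_def)
  qed (simp_all add: I_def)
  hence loop: "runs g (While (reg 10 <. reg 0) (Store (arr 8 (reg 10)) (reg 10) ;; inc 10)) (m(10 := 0)) (50 * 2 ^ d + 40)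
    (\<lambda>m'. (\<forall>v<2 ^ d. m' (8 * stride + v) = v) \<and> unchanged ({10} \<union> {8 * stride..}) m m')"
    by (elim runs_mono) (simp_all add: I_def)
  show ?thesis unfolding identity_prog_def by (intro runs_Seq_denote[OF _ _ loop]) simp_all
qed

lemma runs_init:
  assumes E: "E \<le> 2 ^ d" "ceillog2 E = y"
  shows "runs g init_prog ((\<lambda>_. 0)(0 := 2 ^ d, 1 := E)) (100 * d + 300) (\<lambda>m'. constants_ok m' \<and> (\<forall>b\<ge>64. m' b = 0))"
  unfolding init_prog_def
proof (rule runs_Seq)
  let ?m = "(\<lambda>_. 0)(0 := 2 ^ d, 1 := E) :: memory"
  have pow: "(2::nat) ^ d \<le> 2 ^ (2 * (d + 1))" "Suc d \<le> 2 ^ (2 * (d + 1))"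
    using fits_pow_le[of d 2] fits_d[of 1] fits_Suc[of 2 d] by (simp_all add: fits_def)
  have log_d: "ceillog2 (Suc d) \<le> Suc d" using less_exp[of "Suc d"] by (subst ceillog2_le_iff) auto
  show "runs g (ceillog_prog 2 0) ?m (20 * d + 20) (\<lambda>m'. m' = ?m(2 := d))"
    using runs_ceillog[of 2 0 "2 ^ d" ?m] pow by simp
  fix m assume m: "m = ?m(2 := d)"
  show "runs g (ceillog_prog 3 1 ;; 14 ::= reg 2 +. Const 1 ;; ceillog_prog 4 14 ;; constants_prog) m (60 * d + 270)
    (\<lambda>m'. constants_ok m' \<and> (\<forall>b\<ge>64. m' b = 0))"
  proof (rule runs_Seq)
    show "runs g (ceillog_prog 3 1) m (20 * d + 20) (\<lambda>m'. m' = m(3 := y))"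
      by (rule runs_mono[OF runs_ceillog[of 3 1 E m g]]) (use E pow y_le in \<open>auto simp: m\<close>)
    fix m' assume m': "m' = m(3 := y)"
    let ?m1 = "m'(14 := Suc d)"
    let ?m2 = "?m1(4 := ceillog2 (Suc d))"
    let ?m3 = "?m2(5 := 64 * (d + 1), 6 := stride, 7 := d + 2, 8 := 2 * d + 8, 44 := 256 * (d + 1))"
    have const: "runs g constants_prog ?m2 150 (\<lambda>m'. constants_ok m' \<and> (\<forall>b\<ge>64. m' b = 0))"
    proof (rule runs_denote)
      show "denote constants_prog (?m2, g) = (?m3, g)"
        using fits_stride[of 255] by (simp add: constants_prog_def m m' bit_ops stride_def fun_eq_iff)
      show "constants_ok ?m3 \<and> (\<forall>b\<ge>64. ?m3 b = 0)" by (simp add: constants_ok_def m m')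
    qed (simp_all add: constants_prog_def)
    have "runs g (ceillog_prog 4 14 ;; constants_prog) ?m1 (20 * d + 190) (\<lambda>m'. constants_ok m' \<and> (\<forall>b\<ge>64. m' b = 0))"
      by (rule runs_Seq[OF runs_ceillog[of 4 14 "Suc d" ?m1 g]]) (use pow log_d const in auto)
    thus "runs g (14 ::= reg 2 +. Const 1 ;; ceillog_prog 4 14 ;; constants_prog) m' (40 * d + 250)
      (\<lambda>m'. constants_ok m' \<and> (\<forall>b\<ge>64. m' b = 0))"
      by (rule runs_Seq_denote[rotated 2]) (simp_all add: m m')
  qed simp
qed simp

definition prepared :: "memory \<Rightarrow> bool" where
  "prepared m \<longleftrightarrow> constants_ok m \<and> m 27 = level_offset (Suc d) \<and> (\<forall>v\<in>{1..<2 ^ d}. node_ok v m) \<and>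
    (\<forall>k\<in>{1..d}. header_ok k m) \<and> (\<forall>v<2 ^ d. m (8 * stride + v) = v) \<and> (\<forall>b\<in>{64 + 4 * d..<stride}. m b = 0)"

lemma runs_prepare:
  assumes E: "E \<le> 2 ^ d" "ceillog2 E = y"
  shows "runs g prepare_prog ((\<lambda>_. 0)(0 := 2 ^ d, 1 := E)) (450 * 2 ^ d + 100 * (d * d) + 1100 * d + 500) prepared"
  unfolding prepare_prog_def
proof (rule runs_Seq[OF runs_init[OF E]])
  fix m assume m: "constants_ok m \<and> (\<forall>b\<ge>64. m b = 0)"
  show "runs g (identity_prog ;; levels_prog) m (450 * 2 ^ d + 100 * (d * d) + 1000 * d + 200) prepared"
  proof (rule runs_Seq[OF runs_identity])
    fix m' assume m': "(\<forall>v<2 ^ d. m' (8 * stride + v) = v) \<and> unchanged ({10} \<union> {8 * stride..}) m m'"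
    have c: "constants_ok m'" using constants_ok_cong[of "{10} \<union> {8 * stride..}" m m'] m m' by auto
    show "runs g levels_prog m' (400 * 2 ^ d + 100 * (d * d) + 1000 * d + 100) prepared"
    proof (rule runs_mono[OF runs_levels[OF c]])
      fix m'' assume inv: "level_inv m' d m''"
      have same: "m'' b = m' b" if "64 + 4 * d \<le> b" "b \<notin> node_cells {1..<2 ^ d}" for b
        using inv that by (simp add: level_inv_def unchanged_def)
      have "m'' (8 * stride + v) = v" if v: "v < 2 ^ d" for v
      proof -
        have "8 * stride + v \<notin> node_cells {1..<2 ^ d}"
          using node_less_stride by (fastforce simp: in_node_cells_iff)
        thus ?thesis using same[of "8 * stride + v"] m' v stride_gt(1) by simp
      qed
      moreover have "m'' b = 0" if b: "b \<in> {64 + 4 * d..<stride}" for b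
        using same[of b] b m m' unchangedD[of _ m m' b] by auto
      moreover have "node_ok v m''" if "v \<in> {1..<2 ^ d}" for v
        using inv in_level_height[OF that] height_bounds[OF that] by (auto simp: level_inv_def)
      ultimately show "prepared m''" using inv by (simp add: prepared_def level_inv_def)
    qed simp
  qed (use m in auto)
qed simp

end

section \<open>The search machine\<close>

definition splits_evenly :: "nat set \<Rightarrow> (nat \<Rightarrow> bool) \<Rightarrow> bool" where
  "splits_evenly X f \<longleftrightarrow> 2 * card {i \<in> X. f i} = card X"

text \<open>The keys are identified with their indices: \<open>T u c i\<close> is the hash value of key \<open>i\<close> at node \<open>u\<close>
  if its window contains \<open>c\<close>.\<close>

type_synonym table = "nat \<Rightarrow> nat \<Rightarrow> nat \<Rightarrow> bool"

text \<open>The search is at a node; it is about to test the window of that node or, when retreating, about to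
  replace it by the next candidate.\<close>

datatype search_state = Search nat "nat \<Rightarrow> nat" bool nat bool

fun gave_up :: "search_state \<Rightarrow> bool" where
  "gave_up (Search v win retreating fuel stuck) = stuck"

fun is_test :: "search_state \<Rightarrow> bool" where
  "is_test (Search v win retreating fuel stuck) \<longleftrightarrow> \<not> retreating \<and> fuel \<noteq> 0"

context params
begin

definition node_keys :: "table \<Rightarrow> (nat \<Rightarrow> nat) \<Rightarrow> nat \<Rightarrow> nat set" where
  "node_keys T win v = {i. i < 2 ^ d \<and> node_at (\<lambda>u. T u (win u)) (floor_log v) i = v}"

definition splits :: "table \<Rightarrow> (nat \<Rightarrow> nat) \<Rightarrow> nat \<Rightarrow> bool" where
  "splits T win v \<longleftrightarrow> splits_evenly (node_keys T win v) (T v (win v))"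

fun machine_step :: "table \<Rightarrow> search_state \<Rightarrow> search_state" where
  "machine_step T (Search v win retreating fuel stuck) =
    (if retreating then
        if win v + step v < 2 ^ (64 * (d + 1)) then Search v (win(v := win v + step v)) False fuel stuck
        else if shift v = 64 * (d + 1) then Search v win True fuel True
        else Search (v - 1) win True fuel stuck
      else if fuel = 0 then Search v win False fuel True
      else if splits T win v then Search (Suc v) (win(Suc v := win v div 2 ^ shift (Suc v))) False
        (fuel - 1) stuck
      else Search v win True (fuel - 1) stuck)"

fun halted :: "search_state \<Rightarrow> bool" where
  "halted (Search v win retreating fuel stuck) \<longleftrightarrow> 2 ^ d \<le> v \<or> stuck"

fun test_cost :: "search_state \<Rightarrow> nat" where
  "test_cost (Search v win retreating fuel stuck) = 2 ^ height v"

inductive machine_run :: "table \<Rightarrow> search_state \<Rightarrow> nat \<Rightarrow> nat \<Rightarrow> search_state \<Rightarrow> bool" for T where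
  stop: "machine_run T s 0 0 s"
| step: "\<not> halted s \<Longrightarrow> machine_run T (machine_step T s) A k s' \<Longrightarrow>
    machine_run T s (A + (if is_test s then test_cost s else 0)) (k + (if is_test s then 0 else 1)) s'"

lemma machine_run_trans:
  assumes "machine_run T s A k s'" "machine_run T s' A' k' s''"
  shows "machine_run T s (A + A') (k + k') s''"
  using assms
proof (induction rule: machine_run.induct)
  case (step s A k s')
  from machine_run.step[OF step.hyps(1) step.IH[OF step.prems]] show ?case by (simp add: ac_simps)
qed simp

lemma machine_run_step:
  assumes "\<not> halted s" "machine_step T s = s'"
  shows "is_test s \<Longrightarrow> machine_run T s (test_cost s) 0 s'" "\<not> is_test s \<Longrightarrow> machine_run T s 0 1 s'"
  using machine_run.step[OF assms(1) machine_run.stop, of T] assms(2) by simp_all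

text \<open>Every step without a test moves back, ends a retreat or gives up.\<close>

fun progress :: "search_state \<Rightarrow> nat" where
  "progress (Search v win retreating fuel stuck) = v + of_bool retreating"

lemma machine_run_potential:
  assumes "machine_run T s A k s'"
  shows "k + progress s' + of_bool (gave_up s) \<le> progress s + 2 * A + of_bool (gave_up s')"
  using assms
proof (induction rule: machine_run.induct)
  case (step s A k s')
  obtain v win r fuel stuck where s: "s = Search v win r fuel stuck" by (cases s)
  have "shift 0 = 64 * (d + 1)" by (simp add: shift_def rank_def)
  hence "shift v \<noteq> 64 * (d + 1) \<Longrightarrow> 0 < v" by (cases v) auto
  moreover obtain z where "(2::nat) ^ height v = Suc z"
    by (metis not0_implies_Suc power_not_zero zero_neq_numeral)
  ultimately show ?case using step.IH step.hyps(1) unfolding s by (auto split: if_splits)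
qed simp

fun remaining_fuel :: "search_state \<Rightarrow> nat" where
  "remaining_fuel (Search v win retreating fuel stuck) = fuel"

lemma machine_run_fuel: "machine_run T s A k s' \<Longrightarrow> A + 2 ^ d * remaining_fuel s' \<le> 2 ^ d * remaining_fuel s"
proof (induction rule: machine_run.induct)
  case (step s A k s')
  have cost: "test_cost s \<le> 2 ^ d" by (cases s) simp
  have fuel: "remaining_fuel (machine_step T s) = remaining_fuel s - of_bool (is_test s)" by (cases s) auto
  have "is_test s \<Longrightarrow> 1 \<le> remaining_fuel s" by (cases s) auto
  hence "is_test s \<Longrightarrow> 2 ^ d * remaining_fuel s = 2 ^ d * (remaining_fuel s - 1) + 2 ^ d"
    by (cases "remaining_fuel s") auto
  thus ?case using step.IH cost unfolding fuel by (cases "is_test s") auto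
qed simp

lemma node_keys_child:
  assumes "1 \<le> v" "b \<le> 1"
  shows "node_keys T win (2 * v + b) = {i \<in> node_keys T win v. T v (win v) i \<longleftrightarrow> b = 1}"
proof -
  have level: "floor_log (2 * v + b) = Suc (floor_log v)" using assms floor_log_rec[of "2 * v + b"] by simp
  have child: "2 * x + of_bool c = 2 * v + b \<longleftrightarrow> x = v \<and> (c \<longleftrightarrow> b = 1)" for x c
    using assms(2) by (cases c) (auto, presburger+)
  show ?thesis unfolding node_keys_def level node_at.simps child
  proof (intro set_eqI)
    fix i show "i \<in> {i. i < 2 ^ d \<and> node_at (\<lambda>u. T u (win u)) (floor_log v) i = v \<and>
        T (node_at (\<lambda>u. T u (win u)) (floor_log v) i) (win (node_at (\<lambda>u. T u (win u)) (floor_log v) i)) i =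
          (b = 1)} \<longleftrightarrow>
      i \<in> {i \<in> {i. i < 2 ^ d \<and> node_at (\<lambda>u. T u (win u)) (floor_log v) i = v}. T v (win v) i = (b = 1)}"
      by (cases "node_at (\<lambda>u. T u (win u)) (floor_log v) i = v") simp_all
  qed
qed

lemma node_keys_cong:
  assumes "\<And>u. 1 \<le> u \<Longrightarrow> u \<le> v div 2 \<Longrightarrow> win u = win' u"
  shows "node_keys T win v = node_keys T win' v"
  using assms
proof (induction v rule: less_induct)
  case (less v)
  show ?case
  proof (cases "v \<le> 1")
    case True
    hence "floor_log v = 0" by (cases v) auto
    thus ?thesis by (simp add: node_keys_def)
  next
    case False
    have v: "v = 2 * (v div 2) + v mod 2" "v mod 2 \<le> 1" "1 \<le> v div 2" "v div 2 < v" using False by auto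
    have "node_keys T win (v div 2) = node_keys T win' (v div 2)" using less.IH[OF v(4)] less.prems by auto
    moreover have "win (v div 2) = win' (v div 2)" using less.prems v(3) by auto
    ultimately show ?thesis
      using node_keys_child[OF v(3,2), of T win] node_keys_child[OF v(3,2), of T win'] v(1) by auto
  qed
qed

lemma node_keys_root: "node_keys T win 1 = {..<2 ^ d}"
  by (auto simp: node_keys_def)

lemma splits_cong:
  assumes "\<And>x. 1 \<le> x \<Longrightarrow> x \<le> u \<Longrightarrow> win x = win' x" "1 \<le> u"
  shows "splits T win u = splits T win' u"
proof -
  have "node_keys T win u = node_keys T win' u" by (rule node_keys_cong) (use assms in auto)
  thus ?thesis using assms by (simp add: splits_def)
qed

lemma height_child:
  assumes "v \<in> {1..<2 ^ d}" "b \<le> 1"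
  shows "floor_log (2 * v + b) = Suc (floor_log v)" "height v = Suc (height (2 * v + b))"
    "list_addr (2 * v + b) = list_addr v + stride + b * 2 ^ height (2 * v + b)"
proof -
  show level: "floor_log (2 * v + b) = Suc (floor_log v)" using assms floor_log_rec[of "2 * v + b"] by simp
  have "floor_log v < d" using assms(1) by (auto intro: floor_log_less)
  thus height: "height v = Suc (height (2 * v + b))" by (simp add: height_def level)
  have "rank (2 * v + b) = 2 * rank v + b" using floor_log_bounds(1)[of v] assms(1)
    by (simp add: rank_def level)
  thus "list_addr (2 * v + b) = list_addr v + stride + b * 2 ^ height (2 * v + b)"
    unfolding list_addr_def height level by (simp add: algebra_simps)
qed

lemma list_addr_ge: "8 * stride \<le> list_addr u"
  by (simp add: list_addr_def add_mult_distrib)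

lemma list_addr_neq_register [simp]:
  assumes "(numeral k :: nat) \<le> 2 ^ 19"
  shows "list_addr u \<noteq> numeral k" "list_addr u + t \<noteq> numeral k" "\<not> list_addr u + t \<le> numeral k"
proof -
  have "numeral k < stride" using assms by simp
  thus "list_addr u \<noteq> numeral k" "list_addr u + t \<noteq> numeral k" "\<not> list_addr u + t \<le> numeral k"
    using list_addr_ge[of u] by linarith+
qed

lemma list_end_le:
  assumes "1 \<le> u" "floor_log u \<le> d"
  shows "(rank u + 1) * 2 ^ height u \<le> 2 ^ d"
proof -
  have "rank u + 1 \<le> 2 ^ floor_log u" using floor_log_bounds(1)[OF assms(1)] floor_log_bounds(2)[of u]
    by (simp add: rank_def)
  hence "(rank u + 1) * 2 ^ height u \<le> 2 ^ floor_log u * 2 ^ height u" by (rule mult_le_mono1)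
  also have "... = 2 ^ d" using assms(2) by (simp add: height_def flip: power_add)
  finally show ?thesis .
qed

text \<open>Splitting the keys of \<open>v\<close> does not overwrite the keys of any node whose parent is before \<open>v\<close>,
  even if the split is so uneven that it spills over to the right of the lists of the children.\<close>

lemma list_addr_disjoint:
  assumes u: "1 \<le> u" "u < 2 * 2 ^ d" "u div 2 < v" "t < 2 ^ height u" and v: "v < 2 ^ d"
  shows "list_addr u + t \<notin> {list_addr v + stride..<list_addr v + stride + 2 ^ height v + 2 ^ height v}"
proof
  assume "list_addr u + t \<in> {list_addr v + stride..<list_addr v + stride + 2 ^ height v + 2 ^ height v}"
  then obtain x where x: "list_addr u + t = list_addr v + stride + x" "x < 2 * 2 ^ height v"
    by (auto simp: le_iff_add)
  have v1: "1 \<le> v" using u by simp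
  have logs: "floor_log v < d" "floor_log u \<le> d"
    using floor_log_less[OF v1 v] floor_log_less[of u "Suc d"] u by auto
  let ?r = "rank u * 2 ^ height u + t" and ?s = "rank v * 2 ^ height v"
  have "(2::nat) ^ height v \<le> 2 ^ d" by simp
  hence sx: "?s + x < stride" using list_end_le[OF v1] logs x(2) stride_gt(2) by simp
  have r: "?r < stride" using list_end_le[OF u(1) logs(2)] u(4) stride_gt(2) by simp
  have e: "(8 + floor_log u) * stride + ?r = (9 + floor_log v) * stride + (?s + x)"
    using x(1) unfolding list_addr_def by (simp add: algebra_simps)
  from arg_cong[OF e, of "\<lambda>b. b div stride"] have uv: "floor_log u = Suc (floor_log v)" using sx r by simp
  hence rs: "?r = ?s + x" using e by simp
  let ?p = "u div 2"
  have p: "1 \<le> ?p" "floor_log ?p = floor_log v" using uv u(1) floor_log_half[of u] by (cases "u = 1"; auto)+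
  have height: "height v = Suc (height u)" using uv logs by (simp add: height_def)
  have "rank u + 1 \<le> 2 * (rank ?p + 1)" using floor_log_bounds(1)[OF p(1)] by (simp add: rank_def uv p(2))
  also have "rank ?p + 1 \<le> rank v" using u(3) floor_log_bounds(1)[OF p(1)] unfolding rank_def p(2) by simp
  finally have "(rank u + 1) * 2 ^ height u \<le> 2 * rank v * 2 ^ height u" by (intro mult_le_mono1) simp
  hence "(rank u + 1) * 2 ^ height u \<le> ?s" by (simp add: height mult_ac)
  thus False using rs u(4) by simp
qed

end

section \<open>Programming the search machine\<close>

definition partition_step :: com where
  "partition_step = 40 ::= Load (reg 34 +. reg 36) ;; Hash (Const 39) (reg 33) (reg 40) ;;
    Cond (reg 39) (Store (reg 38) (reg 40) ;; inc 38) (Store (reg 37) (reg 40) ;; inc 37) ;; inc 36"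

definition partition_prog :: com where
  "partition_prog = While (reg 36 <. reg 35) partition_step"

definition advance_prog :: com where
  "advance_prog = 14 ::= Load (arr 6 (reg 10)) +. Load (arr 2 (reg 10)) ;;
    Cond (reg 14 <. pow2 (reg 5)) (Store (arr 6 (reg 10)) (reg 14) ;; 11 ::= Const 0)
      (Cond (Op Equal (Load (arr 1 (reg 10))) (reg 5)) (12 ::= Const 1) (10 ::= reg 10 -. Const 1))"

definition setup_prog :: com where
  "setup_prog = 9 ::= reg 9 -. Const 1 ;; 33 ::= Op Shl (reg 10) (reg 5) +. Load (arr 6 (reg 10)) ;;
    34 ::= Load (arr 3 (reg 10)) ;; 35 ::= Load
      (arr 4 (reg 10)) ;; 36 ::= Const 0 ;; 37 ::= reg 34 +. reg 6 ;;
    38 ::= reg 37 +. Op Shr (reg 35) (Const 1)"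

definition verdict_prog :: com where
  "verdict_prog = Cond (Op Equal (reg 38) (reg 34 +. reg 6 +. reg 35))
    (inc 10 ;; Store (arr 6 (reg 10)) (Op Shr (Load (arr 6 (reg 10) -. Const 1)) (Load (arr 1 (reg 10)))))
      (11 ::= Const 1)"

definition test_prog :: com where
  "test_prog = Cond (reg 9) (setup_prog ;; partition_prog ;; verdict_prog) (12 ::= Const 1)"

definition search_step :: com where
  "search_step = Cond (reg 11) advance_prog test_prog"

definition search_prog :: com where
  "search_prog = While (reg 10 +. reg 12 *. reg 0 <. reg 0) search_step"

definition stores :: "memory \<Rightarrow> nat \<Rightarrow> nat list \<Rightarrow> bool" where
  "stores m a xs \<longleftrightarrow> (\<forall>t<length xs. m (a + t) = xs ! t)"

lemma stores_Nil [simp]: "stores m a []"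
  by (simp add: stores_def)

lemma stores_snoc [simp]: "stores m a xs \<Longrightarrow> b = a + length xs \<Longrightarrow> stores (m(b := x)) a (xs @ [x])"
  by (auto simp: stores_def nth_append less_Suc_eq)

lemma stores_upd [simp]: "stores m a xs \<Longrightarrow> b < a \<or> a + length xs \<le> b \<Longrightarrow> stores (m(b := x)) a xs"
  by (auto simp: stores_def)

context ram
begin

definition partition_inv :: "memory \<Rightarrow> nat \<Rightarrow> nat \<Rightarrow> (nat \<Rightarrow> bool) \<Rightarrow> nat list \<Rightarrow> memory \<Rightarrow> bool" where
  "partition_inv m a h P xs m' \<longleftrightarrow> (let L = filter (\<lambda>x. \<not> P x) xs; R = filter P xs in
    m' 36 = length xs \<and> m' 37 = a + stride + length L \<and> m' 38 = a + stride + h + length R \<and>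
    (length L \<le> h \<longrightarrow> stores m' (a + stride) L \<and> stores m' (a + stride + h) R) \<and>
    unchanged ({36..40} \<union> {a + stride..<a + stride + 2 * h + h}) m m')"

lemma runs_partition_step:
  assumes inv: "partition_inv m a h P xs m'" and x: "x = m (a + length xs)" "x < 2 ^ d" "length xs < 2 * h"
    and m: "m 33 = s" "m 34 = a" and a: "stride \<le> a" "fits 60 a" and h: "2 * h \<le> 2 ^ d"
      and n: "length ks = 2 ^ d"
    and P: "P = (\<lambda>x. H (prod_encode (g, s)) (ks ! x))"
  shows "runs g partition_step m' 50 (partition_inv m a h P (xs @ [x]))"
proof (rule runs_denote)
  let ?L = "filter (\<lambda>x. \<not> P x) xs" and ?R = "filter P xs"
  have regs: "m' 36 = length xs" "m' 37 = a + stride + length ?L" "m' 38 = a + stride + h + length ?R"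
    and stored: "length ?L \<le> h \<Longrightarrow> stores m' (a + stride) ?L \<and> stores m' (a + stride + h) ?R"
    and same: "unchanged ({36..40} \<union> {a + stride..<a + stride + 2 * h + h}) m m'"
    using inv by (simp_all add: partition_inv_def Let_def)
  have "64 < stride" by simp
  hence big: "64 < a" using a(1) by linarith
  have "m' 33 = s" "m' 34 = a" "m' (a + length xs) = x"
    using same m x(1,3) big h stride_gt(2) by (auto simp: unchanged_def)
  have lens: "length ?L + length ?R = length xs" using sum_length_filter_compl[of P xs] by simp
  have fits: "fits b (length xs)" "fits b (length ?L)" "fits b (length ?R)" "fits b h" "fits b x" if "1 \<le> b"
    for b
    using x(2,3) lens h that by (auto intro!: fits_le_pow)
  have fa: "fits b a" if "60 \<le> b" for b using a(2) that by (rule fits_mono)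
  have hash: "hash_val H ks g s x = of_bool (P x)" using x(2) n by (simp add: hash_val_def P)
  let ?m = "m'(40 := x, 39 := of_bool (P x))" and ?b = "if P x then 38 else 37"
  let ?m' = "?m(m' ?b := x, ?b := Suc (m' ?b), 36 := Suc (length xs))"
  show "denote partition_step (m', g) = (?m', g)"
    using regs \<open>m' 33 = s\<close> \<open>m' 34 = a\<close> \<open>m' (a + length xs) = x\<close> big
    by (simp add: partition_step_def fits fa hash)
  have b: "m' ?b \<in> {a + stride..<a + stride + 2 * h + h}" using regs lens x(3) by simp
  have "unchanged ({36..40} \<union> {a + stride..<a + stride + 2 * h + h}) m ?m'" using same b by auto
  moreover have "stores ?m' (a + stride) (filter (\<lambda>x. \<not> P x) (xs @ [x])) \<and>
    stores ?m' (a + stride + h) (filter P (xs @ [x]))"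
    if "length (filter (\<lambda>x. \<not> P x) (xs @ [x])) \<le> h"
    using that stored regs big by auto
  ultimately show "partition_inv m a h P (xs @ [x]) ?m'"
    using regs big b by (auto simp: partition_inv_def Let_def)
qed (simp_all add: partition_step_def)

lemma runs_partition:
  assumes m: "m 33 = s" "m 34 = a" "m 35 = 2 * h" "m 36 = 0" "m 37 = a + stride" "m 38 = a + stride + h"
    and a: "stride \<le> a" "fits 60 a" and h: "2 * h \<le> 2 ^ d" and n: "length ks = 2 ^ d"
    and keys: "\<forall>t<2 * h. m (a + t) < 2 ^ d"
  shows "runs g partition_prog m (60 * (2 * h) + 20)
    (partition_inv m a h (\<lambda>x. H (prod_encode (g, s)) (ks ! x)) (map (\<lambda>t. m (a + t)) [0..<2 * h]))"
proof -
  let ?I = "\<lambda>i. partition_inv m a h (\<lambda>x. H (prod_encode (g, s)) (ks ! x)) (map (\<lambda>t. m (a + t)) [0..<i])"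
  have "64 < stride" by simp
  hence "64 < a" using a(1) by linarith
  hence reg: "m' 36 = i" "m' 35 = 2 * h" if "?I i m'" for i m'
    using that m(3) by (auto simp: partition_inv_def Let_def unchanged_def)
  show ?thesis unfolding partition_prog_def
  proof (rule runs_for[where I = ?I and N = "2 * h" and T = "\<lambda>_. 50"])
    show "?I 0 m" using m by (simp add: partition_inv_def)
    fix i m' assume i: "i < 2 * h" and I: "?I i m'"
    have "runs g partition_step m' 50 (?I (Suc i))"
      using runs_partition_step[OF I refl _ _ m(1,2) a h n refl] keys i by simp
    thus "aval w m' (reg 36 <. reg 35) \<noteq> 0 \<and> runs g partition_step m' 50 (?I (Suc i))" using reg[OF I] i
      by simp
  next
    show "aval w m' (reg 36 <. reg 35) = 0" if "?I (2 * h) m'" for m' using reg[OF that] by simp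
  qed simp_all
qed

end

context ram
begin

definition split_table :: "nat \<Rightarrow> table" where
  "split_table g u c i \<longleftrightarrow> H (prod_encode (g, u * 2 ^ (64 * (d + 1)) + c)) (ks ! i)"

definition windows_ok :: "(nat \<Rightarrow> nat) \<Rightarrow> nat \<Rightarrow> memory \<Rightarrow> bool" where
  "windows_ok win v m \<longleftrightarrow> (\<forall>u\<in>{1..v}. u < 2 ^ d \<longrightarrow> m (6 * stride + u) = win u \<and> win u < 2 ^ (64 * (d + 1)))"

definition keys_arranged :: "nat \<Rightarrow> (nat \<Rightarrow> nat) \<Rightarrow> nat \<Rightarrow> memory \<Rightarrow> bool" where
  "keys_arranged g win v m \<longleftrightarrow> (\<forall>u. 1 \<le> u \<longrightarrow> u < 2 * 2 ^ d \<longrightarrow> u div 2 < v \<longrightarrow>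
    bij_betw (\<lambda>t. m (list_addr u + t)) {..<2 ^ height u} (node_keys (split_table g) win u))"

fun simulates :: "nat \<Rightarrow> search_state \<Rightarrow> memory \<Rightarrow> bool" where
  "simulates g (Search v win retreating fuel stuck) m \<longleftrightarrow>
    prepared m \<and> m 9 = fuel \<and> m 10 = v \<and> m 11 = of_bool retreating \<and>
    m 12 = of_bool stuck \<and> v \<in> {1..2 ^ d} \<and> fuel \<le> 2 ^
      (8 * (d + 1)) \<and> windows_ok win v m \<and> keys_arranged g win v m"

definition scratch :: "nat set" where
  "scratch = {9..14} \<union> {33..40} \<union> {6 * stride..<8 * stride} \<union> {9 * stride..}"

lemma prepared_node:
  assumes "prepared m" "v \<in> {1..<2 ^ d}"
  shows "m (stride + v) = shift v" "m (2 * stride + v) = step v" "m (3 * stride + v) = list_addr v"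
    "m (4 * stride + v) = 2 ^ height v" "m (5 * stride + v) = position v"
  using assms by (auto simp: prepared_def node_ok_def)

lemma prepared_cong:
  assumes "unchanged scratch m m'" "prepared m"
  shows "prepared m'"
proof -
  note same = unchangedD[OF assms(1)]
  have "constants_ok m'" using constants_ok_cong[OF assms(1)] assms(2)
    by (simp add: scratch_def prepared_def)
  moreover have "m' 27 = level_offset (Suc d)" using same[of 27] assms(2)
    by (simp add: scratch_def prepared_def)
  moreover have "node_ok v m'" if v: "v \<in> {1..<2 ^ d}" for v
  proof -
    have "v < stride" "64 < stride" using v node_less_stride by simp_all
    hence "m' b = m b" if "b \<in> node_cells {v}" for b
      using that node_cells_gt[OF that] node_cells_ge[OF that] \<open>64 < stride\<close>
      by (intro same) (auto simp: scratch_def in_node_cells_iff)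
    thus ?thesis using node_ok_cong[of v m' m] assms(2) v by (simp add: prepared_def)
  qed
  moreover have "header_ok k m'" if k: "k \<in> {1..d}" for k
  proof -
    have "m' b = m b" if "b \<in> header_cells k" for b
      using that k stride_gt(1) by (intro same) (auto simp: scratch_def header_cells_def)
    thus ?thesis using header_ok_cong[of k m' m] assms(2) k by (simp add: prepared_def)
  qed
  moreover have "m' (8 * stride + v) = v" if "v < 2 ^ d" for v
    using same[of "8 * stride + v"] assms(2) node_less_stride[OF that] that
      by (simp add: scratch_def prepared_def)
  moreover have "m' b = 0" if "b \<in> {64 + 4 * d..<stride}" for b
    using same[of b] assms(2) that by (auto simp: scratch_def prepared_def)
  ultimately show ?thesis by (auto simp: prepared_def)
qed

lemma windows_okD:
  assumes "windows_ok win v m" "u \<in> {1..v}" "u < 2 ^ d"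
  shows "m (6 * stride + u) = win u" "win u < 2 ^ (64 * (d + 1))"
  using assms by (auto simp: windows_ok_def)

lemma windows_ok_mono: "windows_ok win v m \<Longrightarrow> v' \<le> v \<Longrightarrow> windows_ok win v' m"
  by (simp add: windows_ok_def)

lemma windows_ok_register [simp]:
  "(numeral k :: nat) \<le> 2 ^ 19 \<Longrightarrow> windows_ok win v (m(numeral k := x)) = windows_ok win v m"
  by (simp add: windows_ok_def)

lemma windows_ok_upd [simp]:
  "windows_ok win v m \<Longrightarrow> c < 2 ^ (64 * (d + 1)) \<Longrightarrow> windows_ok (win(v := c)) v (m(6 * stride + v := c))"
  by (simp add: windows_ok_def)

lemma keys_arrangedD:
  assumes "keys_arranged g win v m" "1 \<le> u" "u < 2 * 2 ^ d" "u div 2 < v"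
  shows "bij_betw (\<lambda>t. m (list_addr u + t)) {..<2 ^ height u} (node_keys (split_table g) win u)"
  using assms by (simp add: keys_arranged_def)

lemma bij_betw_stores:
  assumes "stores m a xs" "distinct xs"
  shows "bij_betw (\<lambda>t. m (a + t)) {..<length xs} (set xs)"
  using bij_betw_nth[OF assms(2) refl refl] assms(1)
    by (subst bij_betw_cong[of _ _ "(!) xs"]) (auto simp: stores_def)

lemma bij_betw_cells_cong:
  "(\<And>t. t < k \<Longrightarrow> m' (a + t) = m (a + t)) \<Longrightarrow>
    bij_betw (\<lambda>t. m' (a + t)) {..<k} X = bij_betw (\<lambda>t. m (a + t)) {..<k} X"
  for m m' :: memory
  by (rule bij_betw_cong) simp

lemma simulates_move:
  assumes S: "simulates g (Search v win retreating fuel stuck) m" and same: "unchanged scratch m m'"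
    and lists: "\<And>u t. 1 \<le> u \<Longrightarrow> u < 2 * 2 ^ d \<Longrightarrow> u div 2 < v' \<Longrightarrow> t < 2 ^ height u \<Longrightarrow>
      m' (list_addr u + t) = m (list_addr u + t)"
    and v': "1 \<le> v'" "v' \<le> v" and fuel: "fuel' \<le> fuel"
      and win: "\<And>u. u < v' \<Longrightarrow> win' u = win u" "windows_ok win' v' m'"
    and regs: "m' 9 = fuel'" "m' 10 = v'" "m' 11 = of_bool retreating'" "m' 12 = of_bool stuck'"
  shows "simulates g (Search v' win' retreating' fuel' stuck') m'"
proof -
  have "keys_arranged g win' v' m'" unfolding keys_arranged_def
  proof (intro allI impI)
    fix u assume u: "1 \<le> u" "u < 2 * 2 ^ d" "u div 2 < v'"
    have "node_keys (split_table g) win' u = node_keys (split_table g) win u" by (rule node_keys_cong)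
      (use u win(1) in auto)
    moreover have "bij_betw (\<lambda>t. m (list_addr u + t)) {..<2 ^ height u} (node_keys (split_table g) win u)"
      using S u v' by (intro keys_arrangedD[of g win v]) auto
    ultimately show "bij_betw (\<lambda>t. m' (list_addr u + t)) {..<2 ^ height u} (node_keys (split_table g) win' u)"
      using lists[OF u] bij_betw_cells_cong[of "2 ^ height u" m' "list_addr u" m] by simp
  qed
  thus ?thesis using S prepared_cong[OF same] v' fuel win regs by simp
qed

lemma simulates_move_registers:
  assumes S: "simulates g (Search v win retreating fuel stuck) m"
    and same: "unchanged ({10..14} \<union> {6 * stride..<7 * stride}) m m'"
    and v': "1 \<le> v'" "v' \<le> v" and win: "\<And>u. u < v' \<Longrightarrow> win' u = win u" "windows_ok win' v' m'"
    and regs: "m' 10 = v'" "m' 11 = of_bool retreating'" "m' 12 = of_bool stuck'"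
  shows "simulates g (Search v' win' retreating' fuel stuck') m'"
proof (rule simulates_move[OF S])
  show "unchanged scratch m m'" using same by (auto simp: unchanged_def scratch_def)
  show "m' (list_addr u + t) = m (list_addr u + t)" for u t
    using list_addr_ge[of u] by (intro unchangedD[OF same]) simp
  show "m' 9 = fuel" using unchangedD[OF same, of 9] S by simp
qed (use assms in simp_all)

lemma runs_advance:
  assumes S: "simulates g (Search v win True fuel False) m" and v: "v < 2 ^ d"
  shows "runs g advance_prog m 80 (simulates g (machine_step (split_table g) (Search v win True fuel False)))"
proof (rule runs_denote)
  let ?W = "64 * (d + 1)" and ?c = "win v + step v"
  have P: "prepared m" and regs: "m 9 = fuel" "m 10 = v" "m 11 = 1" "m 12 = 0" and v1: "1 \<le> v"
    and win: "windows_ok win v m" using S by auto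
  have const: "m 5 = ?W" "m 6 = stride" using P by (auto simp: prepared_def constants_ok_def)
  have vl: "v \<in> {1..<2 ^ d}" using v v1 by simp
  note node = prepared_node[OF P vl] and wv = windows_okD[OF win _ v]
  have vs: "v < stride" using v by (rule node_less_stride)
  have fits: "fits a v" if "1 \<le> a" for a using v that by (intro fits_le_pow) auto
  have fw: "fits a (win v)" if "64 \<le> a" for a using wv(2) v1 that by (intro fits_window) auto
  have pow: "fits 255 (2 ^ (64 + 64 * d))" by (rule fits_mono[OF fits_pow[of _ 64]]) auto
  let ?m1 = "m(14 := ?c)"
  let ?m = "if ?c < 2 ^ ?W then ?m1(6 * stride + v := ?c, 11 := 0) else if shift v =
    ?W then ?m1(12 := 1) else ?m1(10 := v - 1)"
  have "denote (14 ::= Load (arr 6 (reg 10)) +. Load (arr 2 (reg 10))) (m, g) = (?m1, g)"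
    using regs const node wv v1 by (simp add: fits fw)
  hence "denote advance_prog (m, g) =
    denote (Cond (reg 14 <. pow2 (reg 5)) (Store (arr 6 (reg 10)) (reg 14) ;; 11 ::= Const 0)
      (Cond (Op Equal (Load (arr 1 (reg 10))) (reg 5)) (12 ::= Const 1) (10 ::= reg 10 -. Const 1))) (?m1, g)"
    by (simp only: advance_prog_def denote.simps(4))
  also have "... = (?m, g)" using regs const node wv v1 pow by (simp add: bit_ops fits fw)
  finally show "denote advance_prog (m, g) = (?m, g)" .
  show "simulates g (machine_step (split_table g) (Search v win True fuel False)) ?m"
  proof -
    note moved = simulates_move_registers[OF S]
    have "shift 1 = ?W" by (simp add: shift_def rank_def)
    hence v2: "shift v \<noteq> ?W \<Longrightarrow> 1 \<le> v - 1" using v1 by (cases "v = 1") auto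
    have "simulates g (Search v (win(v := ?c)) False fuel False) (?m1(6 * stride + v := ?c, 11 := 0))"
      if "?c < 2 ^ ?W"
      by (rule moved) (use that v1 vs win regs in simp_all)
    moreover have "simulates g (Search v win True fuel True) (?m1(12 := 1))"
      by (rule moved) (use v1 win regs in simp_all)
    moreover have "simulates g (Search (v - 1) win True fuel False) (?m1(10 := v - 1))" if "shift v \<noteq> ?W"
      by (rule moved) (use v2[OF that] windows_ok_mono[OF win] regs in simp_all)
    ultimately show ?thesis by simp
  qed
qed (simp_all add: advance_prog_def)

definition key_list :: "nat \<Rightarrow> memory \<Rightarrow> nat list" where
  "key_list v m = map (\<lambda>t. m (list_addr v + t)) [0..<2 ^ height v]"

definition after_setup :: "nat \<Rightarrow> (nat \<Rightarrow> nat) \<Rightarrow> nat \<Rightarrow> memory \<Rightarrow> memory" where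
  "after_setup v win fuel m =
    m(9 := fuel - 1, 33 := v * 2 ^ (64 * (d + 1)) + win v, 34 := list_addr v, 35 := 2 ^ height v,
    36 := 0, 37 := list_addr v + stride, 38 := list_addr v + stride + 2 ^ (height v - 1))"

definition after_partition :: "nat \<Rightarrow> nat \<Rightarrow> (nat \<Rightarrow> nat) \<Rightarrow> nat \<Rightarrow> memory \<Rightarrow> memory \<Rightarrow> bool" where
  "after_partition g v win fuel m =
    partition_inv (after_setup v win fuel m) (list_addr v) (2 ^ (height v - 1))
    (split_table g v (win v)) (key_list v m)"

context
  fixes g v fuel :: nat and win :: "nat \<Rightarrow> nat" and m :: memory
  assumes S: "simulates g (Search v win False fuel False) m" and v: "v < 2 ^ d" and fuel: "fuel \<noteq> 0"
    and n: "length ks = 2 ^ d"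
begin

lemma node_before_end: "v \<in> {1..<2 ^ d}" and half_height: "2 * 2 ^ (height v - 1) = (2::nat) ^ height v"
proof -
  show "v \<in> {1..<2 ^ d}" using S v by simp
  hence "1 \<le> height v" using height_bounds by auto
  thus "2 * 2 ^ (height v - 1) = (2::nat) ^ height v" by (cases "height v") auto
qed

lemma key_list_node_keys: "distinct (key_list v m)" "set (key_list v m) = node_keys (split_table g) win v"
proof -
  have "bij_betw (\<lambda>t. m (list_addr v + t)) {..<2 ^ height v} (node_keys (split_table g) win v)"
    using S v by (intro keys_arrangedD[of g win v]) auto
  thus "distinct (key_list v m)" "set (key_list v m) = node_keys (split_table g) win v"
    by (auto simp: key_list_def distinct_map bij_betw_def atLeast0LessThan)
qed

lemma splits_iff: "splits (split_table g) win v \<longleftrightarrow>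
  length (filter (split_table g v (win v)) (key_list v m)) = 2 ^ (height v - 1)"
proof -
  let ?P = "split_table g v (win v)"
  have "card (node_keys (split_table g) win v) = 2 ^ height v"
    using distinct_card[OF key_list_node_keys(1)] key_list_node_keys(2) by (simp add: key_list_def)
  moreover have "card {i \<in> node_keys (split_table g) win v. ?P i} = length (filter ?P (key_list v m))"
    using distinct_card[OF distinct_filter[OF key_list_node_keys(1), of ?P]] key_list_node_keys(2) by simp
  ultimately show ?thesis using half_height by (auto simp: splits_def splits_evenly_def)
qed

lemma fits_list_addr: "60 \<le> a \<Longrightarrow> fits a (list_addr v)"
proof (rule fits_mono)
  have logs: "floor_log v \<le> d" using floor_log_less[of v d] node_before_end by simp
  hence "fits 29 (8 + floor_log v)" by (simp add: fits_le_d)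
  moreover have "fits 59 (rank v * 2 ^ height v)"
    using list_end_le[OF _ logs] node_before_end by (intro fits_le_pow) auto
  ultimately show "fits 60 (list_addr v)" by (simp add: list_addr_def)
qed

lemma denote_setup: "denote setup_prog (m, g) = (after_setup v win fuel m, g)"
proof -
  have P: "prepared m" and regs: "m 9 = fuel" "m 10 = v" "m 11 = 0" "m 12 = 0"
    and win: "m (6 * stride + v) = win v" "win v < 2 ^ (64 * (d + 1))"
      and fuel_le: "fuel \<le> 2 ^ (8 * (d + 1))"
    using S windows_okD[of win v m v] v by auto
  have const: "m 5 = 64 * (d + 1)" "m 6 = stride" using P by (auto simp: prepared_def constants_ok_def)
  note node = prepared_node[OF P node_before_end]
  have "8 * stride \<le> list_addr v" by (rule list_addr_ge)
  moreover have "fits a v" if "1 \<le> a" for a using v that by (intro fits_le_pow) auto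
  moreover have "fits a (win v)" if "64 \<le> a" for a using win(2) that by (rule fits_window)
  moreover have "fits 255 fuel" by (rule fits_mono[of 8]) (use fuel_le in \<open>simp_all add: fits_def\<close>)
  moreover have "fits a (2 ^ (64 + 64 * d))" if "64 \<le> a" for a by (rule fits_mono[OF fits_pow that]) simp
  moreover have "2 ^ height v div 2 = (2::nat) ^ (height v - 1)" using half_height by linarith
  ultimately show ?thesis using regs const node win fuel
    by (simp add: setup_prog_def after_setup_def bit_ops fits_list_addr)
qed

lemma runs_partition_keys:
  "runs g partition_prog (after_setup v win fuel m) (60 * 2 ^ height v + 20) (after_partition g v win fuel m)"
proof -
  let ?m = "after_setup v win fuel m"
  have addr: "stride \<le> list_addr v" using list_addr_ge[of v] by linarith
  have same: "?m (list_addr v + t) = m (list_addr v + t)" for t by (simp add: after_setup_def)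
  have "m (list_addr v + t) < 2 ^ d" if "t < 2 ^ height v" for t
    using that key_list_node_keys(2) by (auto simp: key_list_def node_keys_def)
  hence "runs g partition_prog ?m (60 * (2 * 2 ^ (height v - 1)) + 20) (partition_inv ?m (list_addr v) (2 ^ (height v - 1))
    (\<lambda>x. H (prod_encode (g, v * 2 ^ (64 * (d + 1)) + win v)) (ks ! x))
      (map (\<lambda>t. ?m (list_addr v + t)) [0..<2 * 2 ^ (height v - 1)]))"
    using addr(1) half_height n
      by (intro runs_partition) (simp_all add: after_setup_def same fits_list_addr half_height)
  moreover have "(\<lambda>x. H (prod_encode (g, v * 2 ^ (64 * (d + 1)) + win v)) (ks ! x)) =
    split_table g v (win v)"
    by (simp add: split_table_def fun_eq_iff)
  ultimately show ?thesis unfolding half_height after_partition_def key_list_def same by simp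
qed

context
  fixes m' :: memory
  assumes after: "after_partition g v win fuel m m'"
begin

lemma after_partition_unchanged:
  "unchanged ({36..40} \<union> {list_addr v + stride..<list_addr v + stride + 2 * 2 ^ (height v - 1) + 2 ^ (height v - 1)})
    (after_setup v win fuel m) m'"
  using after by (simp add: after_partition_def partition_inv_def Let_def)

lemma after_partition_cells:
  "m' 34 = list_addr v" "m' 35 = 2 ^ height v" "m' 9 = fuel - 1" "m' 6 = stride" "m' 10 = v" "m' 11 = 0"
    "m' 12 = 0"
  "m' 38 = list_addr v + stride + 2 ^ (height v - 1) +
    length (filter (split_table g v (win v)) (key_list v m))"
  "unchanged scratch m m'"
proof -
  let ?A = "{36..40} \<union> {list_addr v + stride..<list_addr v + stride + 2 * 2 ^ (height v - 1) + 2 ^ (height v - 1)}"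
  show "m' 38 = list_addr v + stride + 2 ^ (height v - 1) +
    length (filter (split_table g v (win v)) (key_list v m))"
    using after by (simp add: after_partition_def partition_inv_def Let_def)
  have "64 < stride" by simp
  hence big: "64 < list_addr v" using list_addr_ge[of v] by linarith
  have "m 6 = stride" "m 10 = v" "m 11 = 0" "m 12 = 0" using S by (auto simp: prepared_def constants_ok_def)
  moreover have "m' b = after_setup v win fuel m b" if "b < 36" for b
    using that big by (intro unchangedD[OF after_partition_unchanged]) auto
  ultimately show "m' 34 = list_addr v" "m' 35 = 2 ^ height v" "m' 9 = fuel - 1" "m' 6 = stride" "m' 10 = v"
    "m' 11 = 0" "m' 12 = 0"
    by (simp_all add: after_setup_def)
  have "unchanged scratch m (after_setup v win fuel m)"
    by (auto simp: unchanged_def after_setup_def scratch_def)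
  moreover have "?A \<subseteq> scratch" using list_addr_ge[of v] by (auto simp: scratch_def)
  ultimately show "unchanged scratch m m'" using unchanged_trans[OF _ after_partition_unchanged] by blast
qed

lemma after_partition_list:
  assumes "1 \<le> u" "u < 2 * 2 ^ d" "u div 2 < v" "t < 2 ^ height u"
  shows "m' (list_addr u + t) = m (list_addr u + t)"
proof -
  have "m' (list_addr u + t) = after_setup v win fuel m (list_addr u + t)"
    using list_addr_disjoint[OF assms v] half_height
      by (intro unchangedD[OF after_partition_unchanged]) auto
  thus ?thesis by (simp add: after_setup_def)
qed


lemma after_partition_windows: "windows_ok win v m'"
proof -
  have "m' (6 * stride + u) = after_setup v win fuel m (6 * stride + u)" if "u \<in> {1..v}" for u
  proof (intro unchangedD[OF after_partition_unchanged])
    have "u < stride" using that v node_less_stride by simp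
    thus "6 * stride + u \<notin> {36..40} \<union> {list_addr v + stride..<list_addr v + stride +
      2 * 2 ^ (height v - 1) + 2 ^ (height v - 1)}"
      using list_addr_ge[of v] by simp
  qed
  moreover have "after_setup v win fuel m (6 * stride + u) = m (6 * stride + u)" for u
    by (simp add: after_setup_def)
  ultimately show ?thesis using S by (simp add: windows_ok_def)
qed

lemma after_partition_child:
  assumes split: "splits (split_table g) win v" and b: "b \<le> 1"
  defines "xs \<equiv> filter (\<lambda>i. split_table g v (win v) i \<longleftrightarrow> b = 1) (key_list v m)"
  shows "stores m' (list_addr (2 * v + b)) xs" "length xs = 2 ^ height (2 * v + b)"
proof -
  let ?P = "split_table g v (win v)" and ?h = "2 ^ (height v - 1) :: nat"
  let ?L = "filter (\<lambda>i. \<not> ?P i) (key_list v m)" and ?R = "filter ?P (key_list v m)"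
  have R: "length ?R = ?h" using split by (simp add: splits_iff)
  hence L: "length ?L = ?h"
    using sum_length_filter_compl[of ?P "key_list v m"] half_height by (simp add: key_list_def)
  have stored: "stores m' (list_addr v + stride) ?L" "stores m' (list_addr v + stride + ?h) ?R"
    using after L by (simp_all add: after_partition_def partition_inv_def Let_def)
  note child = height_child[OF node_before_end b]
  have "b = 0 \<or> b = 1" using b by auto
  thus "stores m' (list_addr (2 * v + b)) xs" "length xs = 2 ^ height (2 * v + b)"
    unfolding xs_def child(3) using stored L R child(2) by (elim disjE; simp)+
qed

lemma keys_arranged_child:
  assumes split: "splits (split_table g) win v" and win': "\<And>u. u \<le> v \<Longrightarrow> win' u = win u"
    and m'': "\<And>b. 8 * stride \<le> b \<Longrightarrow> m'' b = m' b"
  shows "keys_arranged g win' (Suc v) m''"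
  unfolding keys_arranged_def
proof (intro allI impI)
  fix u assume u: "1 \<le> u" "u < 2 * 2 ^ d" "u div 2 < Suc v"
  have keys: "node_keys (split_table g) win' u = node_keys (split_table g) win u"
    by (rule node_keys_cong) (use u win' in auto)
  have same: "m'' (list_addr u + t) = m' (list_addr u + t)" for t using list_addr_ge[of u]
    by (intro m'') simp
  show "bij_betw (\<lambda>t. m'' (list_addr u + t)) {..<2 ^ height u} (node_keys (split_table g) win' u)"
  proof (cases "u div 2 < v")
    case True
    have "bij_betw (\<lambda>t. m (list_addr u + t)) {..<2 ^ height u} (node_keys (split_table g) win u)"
      using S u True by (intro keys_arrangedD[of g win v]) auto
    thus ?thesis unfolding keys same
      using bij_betw_cells_cong[of "2 ^ height u" m' "list_addr u" m] after_partition_list[OF u(1,2) True]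
        by simp
  next
    case False
    define b where "b = u mod 2"
    have b: "u = 2 * v + b" "b \<le> 1" using u(3) False unfolding b_def by (auto, presburger)
    let ?xs = "filter (\<lambda>i. split_table g v (win v) i \<longleftrightarrow> b = 1) (key_list v m)"
    note child = after_partition_child[OF split b(2)]
    have "set ?xs = node_keys (split_table g) win u"
      unfolding b(1) using node_keys_child[of v b] key_list_node_keys(2) node_before_end b(2) by auto
    thus ?thesis unfolding keys same
      using bij_betw_stores[OF child(1) distinct_filter[OF key_list_node_keys(1)]] child(2)
        by (simp add: b(1))
  qed
qed

lemma simulates_descend:
  assumes split: "splits (split_table g) win v"
    and z: "Suc v < 2 ^ d \<Longrightarrow> z = win v div 2 ^ shift (Suc v)"
  shows "simulates g (Search (Suc v) (win(Suc v := win v div 2 ^ shift (Suc v))) False (fuel - 1) False)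
    (m'(10 := Suc v, 6 * stride + Suc v := z))"
proof -
  let ?win = "win(Suc v := win v div 2 ^ shift (Suc v))" and ?m = "m'(10 := Suc v, 6 * stride + Suc v := z)"
  note cells = after_partition_cells
  have vs: "Suc v < stride" using v stride_gt(2) by simp
  have "unchanged scratch m ?m" using cells(9) vs by (auto simp: scratch_def)
  hence "prepared ?m" by (rule prepared_cong) (use S in simp)
  moreover have "keys_arranged g ?win (Suc v) ?m" by (rule keys_arranged_child[OF split]) (use vs in auto)
  moreover have "windows_ok ?win (Suc v) ?m" unfolding windows_ok_def
  proof (intro ballI impI)
    fix u assume u: "u \<in> {1..Suc v}" "u < 2 ^ d"
    show "?m (6 * stride + u) = ?win u \<and> ?win u < 2 ^ (64 * (d + 1))"
    proof (cases "u = Suc v")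
      case True
      have "win v < 2 ^ (64 * (d + 1))" using windows_okD(2)[OF after_partition_windows _ v] node_before_end
        by simp
      thus ?thesis using True z u by (simp add: le_less_trans[OF div_le_dividend])
    next
      case False
      thus ?thesis using windows_okD[OF after_partition_windows _ u(2)] u by simp
    qed
  qed
  moreover have "fuel \<le> 2 ^ (8 * (d + 1))" using S by simp
  hence "fuel - 1 \<le> 2 ^ (8 * (d + 1))" by linarith
  ultimately show ?thesis using cells v by simp
qed

lemma runs_verdict: "runs g verdict_prog m' 80 (simulates g (machine_step (split_table g) (Search v win False fuel False)))"
proof (rule runs_denote)
  let ?h = "2 ^ (height v - 1) :: nat" and ?R = "filter (split_table g v (win v)) (key_list v m)"
  let ?z = "take_bit w (win v div 2 ^ m' (stride + Suc v))"
  let ?m = "if splits (split_table g) win v then m'(10 := Suc v, 6 * stride + Suc v := ?z) else m'(11 := 1)"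
  note cells = after_partition_cells
  have win: "m' (6 * stride + v) = win v" "win v < 2 ^ (64 * (d + 1))"
    using windows_okD[OF after_partition_windows _ v] node_before_end by simp_all
  have "length ?R \<le> length (key_list v m)" by (rule length_filter_le)
  also have "... \<le> 2 ^ d" by (simp add: key_list_def)
  finally have "length ?R \<le> 2 ^ d" "?h \<le> 2 ^ d" by simp_all
  hence fits: "fits a ?h" "fits a (length ?R)" "fits a v" if "1 \<le> a" for a using that v
    by (simp_all add: fits_le_pow)
  show "denote verdict_prog (m', g) = (?m, g)"
    using cells win by (auto simp: verdict_prog_def bit_ops fits fits_list_addr splits_iff half_height[symmetric])
  show "simulates g (machine_step (split_table g) (Search v win False fuel False)) ?m"
  proof (cases "splits (split_table g) win v")
    case True
    have "?z = win v div 2 ^ shift (Suc v)" if "Suc v < 2 ^ d"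
      using prepared_node(1)[OF prepared_cong[OF cells(9)], of "Suc v"] S that fits_window[OF win(2), of 255] by simp
    thus ?thesis using True fuel simulates_descend by simp
  next
    case False
    have "simulates g (Search v win True (fuel - 1) False) (m'(11 := 1))"
    proof (rule simulates_move[OF S])
      show "unchanged scratch m (m'(11 := 1))" using cells(9) by (simp add: scratch_def)
      show "windows_ok win v (m'(11 := 1))" using after_partition_windows by (simp add: windows_ok_def)
      show "(m'(11 := 1)) (list_addr u + t) = m (list_addr u + t)"
        if "1 \<le> u" "u < 2 * 2 ^ d" "u div 2 < v" "t < 2 ^ height u" for u t
        using after_partition_list[OF that] by simp
    qed (use cells node_before_end in simp_all)
    thus ?thesis using False fuel by simp
  qed
qed (simp_all add: verdict_prog_def)

end

end

lemma runs_test: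
  assumes S: "simulates g (Search v win False fuel False) m" and v: "v < 2 ^ d" and n: "length ks = 2 ^ d"
  shows "runs g test_prog m (if fuel = 0 then 30 else 60 * 2 ^ height v + 200)
    (simulates g (machine_step (split_table g) (Search v win False fuel False)))"
proof (cases "fuel = 0")
  case True
  have "simulates g (Search v win False fuel True) (m(12 := 1))"
  proof (rule simulates_move[OF S])
    show "unchanged scratch m (m(12 := 1))" by (simp add: scratch_def)
    show "windows_ok win v (m(12 := 1))" using S by (simp add: windows_ok_def)
  qed (use S in simp_all)
  hence "runs g (12 ::= Const 1) m 10 (simulates g (machine_step (split_table g) (Search v win False fuel False)))"
    using True by (intro runs_denote[where m' = "m(12 := 1)"]) simp_all
  thus ?thesis unfolding test_prog_def by (intro runs_Cond[where ?T1.0 = 10]) (use S True in simp_all)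
next
  case False
  have "runs g (setup_prog ;; partition_prog ;; verdict_prog) m (60 * 2 ^ height v + 190)
    (simulates g (machine_step (split_table g) (Search v win False fuel False)))"
  proof (rule runs_Seq_denote[OF _ denote_setup[OF S v False]])
    show "runs g (partition_prog ;; verdict_prog) (after_setup v win fuel m) (60 * 2 ^ height v + 100)
      (simulates g (machine_step (split_table g) (Search v win False fuel False)))"
      by (rule runs_Seq[OF runs_partition_keys[OF S v False n] runs_verdict[OF S v False n]]) simp_all
  qed (use n in \<open>simp_all add: setup_prog_def\<close>)
  thus ?thesis unfolding test_prog_def
    by (intro runs_Cond[where ?T1.0 = "60 * 2 ^ height v + 190"]) (use S False in simp_all)
qed

lemma runs_search_step:
  assumes S: "simulates g s m" and s: "\<not> halted s" and n: "length ks = 2 ^ d"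
  shows "runs g search_step m (if is_test s then 60 * test_cost s +
    210 else 90) (simulates g (machine_step (split_table g) s))"
proof -
  obtain v win r fuel stuck where e: "s = Search v win r fuel stuck" by (cases s)
  have v: "v < 2 ^ d" "\<not> stuck" using s by (simp_all add: e)
  show ?thesis
  proof (cases r)
    case True
    thus ?thesis unfolding search_step_def using S v runs_advance[of g v win fuel m]
      by (intro runs_Cond[where ?T1.0 = 80]) (simp_all add: e)
  next
    case False
    thus ?thesis unfolding search_step_def using S v n runs_test[of g v win fuel m]
      by (intro runs_Cond[where ?T1.0 = "if fuel = 0 then 30 else 60 * 2 ^ height v + 200"])
        (simp_all add: e)
  qed
qed

lemma runs_search:
  assumes "machine_run (split_table g) s A k s'" and "halted s'" "simulates g s m"
    and n: "length ks = 2 ^ d"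
  shows "runs g search_prog m (300 * (A + k) + 20) (simulates g s')"
  using assms(1-3)
proof (induction arbitrary: m rule: machine_run.induct)
  case (stop s)
  obtain v win r fuel stuck where s: "s = Search v win r fuel stuck" by (cases s)
  have m: "m 10 = v" "m 12 = of_bool stuck" "m 0 = 2 ^ d" "v \<le> 2 ^ d"
    using stop.prems(2) by (auto simp: s prepared_def constants_ok_def)
  have "fits a v" if "1 \<le> a" for a using m(4) that by (rule fits_le_pow)
  hence "aval w m (reg 10 +. reg 12 *. reg 0 <. reg 0) = 0"
    using m stop.prems(1) by (cases stuck) (simp_all add: s)
  thus ?case unfolding search_prog_def runs_def using stop.prems(2) by (intro reaches_While_done) auto
next
  case (step s A k s')
  obtain v win r fuel stuck where s: "s = Search v win r fuel stuck" by (cases s)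
  have m: "m 10 = v" "m 12 = 0" "m 0 = 2 ^ d" "v < 2 ^ d"
    using step.prems(2) step.hyps(1) by (auto simp: s prepared_def constants_ok_def)
  have "fits a v" if "1 \<le> a" for a using m(4) that by (simp add: fits_le_pow)
  hence cond: "aval w (fst (m, g)) (reg 10 +. reg 12 *. reg 0 <. reg 0) \<noteq> 0" using m by simp
  show ?case unfolding search_prog_def runs_def
  proof (rule reaches_While_step[OF cond])
    show "reaches search_step (m, g) (if is_test s then 60 * test_cost s + 210 else 90)
      (\<lambda>t. snd t = g \<and> simulates g (machine_step (split_table g) s) (fst t))"
      using runs_search_step[OF step.prems(2) step.hyps(1) n] by (simp add: runs_def)
    show "reaches (While (reg 10 +. reg 12 *. reg 0 <. reg 0) search_step) t (300 * (A + k) + 20)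
      (\<lambda>t. snd t = g \<and> simulates g s' (fst t))" if "snd t = g \<and> simulates g (machine_step (split_table g) s)
        (fst t)" for t
      using step.IH[OF step.prems(1), of "fst t"] that by (cases t) (simp add: search_prog_def runs_def)
    have "1 \<le> test_cost s" by (cases s) simp
    thus "1 + acost (reg 10 +. reg 12 *. reg 0 <. reg 0) +
      (if is_test s then 60 * test_cost s + 210 else 90) + (300 * (A + k) + 20)
      \<le> 300 * (A + (if is_test s then test_cost s else 0) + (k + (if is_test s then 0 else 1))) + 20" by simp
  qed
qed

end

section \<open>The machine performs the depth-first search\<close>

fun sweep :: "nat \<Rightarrow> nat \<Rightarrow> nat list \<Rightarrow> bool" where
  "sweep W i [] = False"
| "sweep W i [c] = (c < 2 ^ W \<and> 2 ^ W \<le> c + i)"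
| "sweep W i (c # c' # cs) = (c' = c + i \<and> sweep W i (c' # cs))"

lemma sweep_less: "sweep W i cs \<Longrightarrow> \<forall>c\<in>set cs. c < 2 ^ W"
proof (induction W i cs rule: sweep.induct)
  case (3 W i c c' cs)
  hence "c' < 2 ^ W" "c \<le> c'" by auto
  thus ?case using 3 by auto
qed auto

lemma sweep_map_upt:
  assumes "m < F" "c0 + (F - 1) * i < 2 ^ W" "2 ^ W \<le> c0 + F * i"
  shows "sweep W i (map (\<lambda>f. c0 + f * i) [m..<F])"
  using assms(1)
proof (induction "F - m" arbitrary: m)
  case (Suc x)
  show ?case
  proof (cases "Suc m = F")
    case True
    thus ?thesis using assms(2,3) by (auto simp: add.commute add.left_commute)
  next
    case False
    hence m: "Suc m < F" using Suc by simp
    have "sweep W i (map (\<lambda>f. c0 + f * i) [Suc m..<F])" using Suc m by auto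
    moreover have "[m..<F] = m # Suc m # [Suc (Suc m)..<F]" "[Suc m..<F] = Suc m # [Suc (Suc m)..<F]"
      using m by (simp_all add: upt_conv_Cons)
    ultimately show ?thesis by simp
  qed
qed simp

lemma sweep_children:
  assumes "b \<le> W" "c < 2 ^ W"
  shows "sweep W (2 ^ (W - b)) (children W b c)"
  unfolding children_def
proof (rule sweep_map_upt)
  have "c div 2 ^ b + (2 ^ b - 1) * 2 ^ (W - b) \<in> set (children W b c)" unfolding children_def
    by (auto simp: image_iff)
  thus "c div 2 ^ b + (2 ^ b - 1) * 2 ^ (W - b) < 2 ^ W" by (rule children_less[OF assms])
  have "(2::nat) ^ b * 2 ^ (W - b) = 2 ^ W" using assms(1) by (simp flip: power_add)
  thus "2 ^ W \<le> c div 2 ^ b + 2 ^ b * 2 ^ (W - b)" by simp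
qed simp

context params
begin

primrec layers_at :: "table \<Rightarrow> (nat \<Rightarrow> nat set) \<Rightarrow> nat \<Rightarrow> nat list \<Rightarrow> layer list" where
  "layers_at T Xs v [] = []"
| "layers_at T Xs v (b # bs) =
  (\<lambda>c. c < 2 ^ (64 * (d + 1)) \<and> splits_evenly (Xs v) (T v c), b) # layers_at T Xs (Suc v) bs"

lemma length_layers_at [simp]: "length (layers_at T Xs v bs) = length bs"
  by (induction bs arbitrary: v) auto

lemma layers_at_nth: "r < length bs \<Longrightarrow>
  layers_at T Xs v bs ! r = (\<lambda>c. c < 2 ^ (64 * (d + 1)) \<and> splits_evenly (Xs (v + r)) (T (v + r) c), bs ! r)"
  by (induction bs arbitrary: v r) (auto simp: nth_Cons split: nat.split)

definition search_outcome ::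
  "nat \<Rightarrow> nat \<Rightarrow> (nat \<Rightarrow> nat) \<Rightarrow> nat \<Rightarrow> nat list option \<times> nat \<Rightarrow> nat \<Rightarrow> search_state \<Rightarrow> bool" where
  "search_outcome v v1 win fuel r A s \<longleftrightarrow> (if snd r \<le> fuel then A = 2 ^ height v * snd r \<and> (case fst r of
      Some p \<Rightarrow> \<exists>win'. s = Search v1 win' False (fuel - snd r) False \<and> (\<forall>x<v. win' x = win x) \<and>
        (\<forall>i<length p. win' (v + i) = p ! i) \<and> win' v1 = last p div 2 ^ shift v1
    | None \<Rightarrow> \<exists>win'. s = Search v win' True (fuel - snd r) False \<and> (\<forall>x<v. win' x = win x) \<and> 2 ^
      (64 * (d + 1)) \<le> win' v + step v)
    else A \<le> 2 ^ height v * snd r \<and> gave_up s)"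

definition performs :: "table \<Rightarrow> nat \<Rightarrow> nat \<Rightarrow> (nat \<Rightarrow> nat) \<Rightarrow> nat \<Rightarrow> nat list option \<times> nat \<Rightarrow> bool" where
  "performs T v v1 win fuel r \<longleftrightarrow>
    (\<exists>A k s. machine_run T (Search v win False fuel False) A k s \<and> search_outcome v v1 win fuel r A s)"

lemma performsI: "machine_run T (Search v win False fuel False) A k s \<Longrightarrow> search_outcome v v1 win fuel r A s \<Longrightarrow>
  performs T v v1 win fuel r"
  by (auto simp: performs_def)

lemma performs_no_fuel:
  assumes "v < 2 ^ d" "1 \<le> snd r"
  shows "performs T v v1 win 0 r"
proof (rule performsI)
  show "machine_run T (Search v win False 0 False) 0 1 (Search v win False 0 True)"
    by (rule machine_run_step(2)) (use assms in simp_all)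
  show "search_outcome v v1 win 0 r 0 (Search v win False 0 True)" using assms
    by (simp add: search_outcome_def)
qed

lemma machine_run_test:
  assumes "v < 2 ^ d" "fuel \<noteq> 0"
  shows "machine_run T (Search v win False fuel False) (2 ^ height v) 0
    (if splits T win v then Search (Suc v) (win(Suc v := win v div 2 ^ shift (Suc v))) False (fuel - 1) False
      else Search v win True (fuel - 1) False)"
  using machine_run_step(1)[OF _ refl, of "Search v win False fuel False" T] assms by auto

lemma performs_next:
  assumes run: "machine_run T (Search v win False fuel False) (2 ^ height v * t) k (Search v win' True (fuel - t) False)"
    and t: "t \<le> fuel" and win': "\<forall>x<v. win' x = win x" "win' v = c" and v: "v < 2 ^ d"
    and cs: "sweep (64 * (d + 1)) (step v) (c # cs)"
    and next_candidate: "\<And>win''. cs \<noteq> [] \<Longrightarrow> win'' v = hd cs \<Longrightarrow> \<forall>x<v. win'' x = win x \<Longrightarrow>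
      performs T v v1 win'' (fuel - t) r"
    and Nil: "cs = [] \<Longrightarrow> r = (None, 0)"
  shows "performs T v v1 win fuel (fst r, t + snd r)"
proof (cases cs)
  case Nil
  show ?thesis
  proof (rule performsI[OF run])
    show "search_outcome v v1 win fuel (fst r, t + snd r) (2 ^ height v * t) (Search v win' True (fuel - t) False)"
      using assms(8) Nil t win' cs by (simp add: search_outcome_def)
  qed
next
  case (Cons c' cs')
  let ?win = "win'(v := c')"
  have c': "c' = c + step v" "c' < 2 ^ (64 * (d + 1))" using cs sweep_less[OF cs] Cons by auto
  have step: "machine_run T (Search v win' True (fuel - t) False) 0 1 (Search v ?win False (fuel - t) False)"
    by (rule machine_run_step(2)) (use c' win' v in simp_all)
  have "performs T v v1 ?win (fuel - t) r" by (rule next_candidate) (use Cons win' in auto)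
  then obtain A k' s where run': "machine_run T (Search v ?win False (fuel - t) False) A k' s"
    and out: "search_outcome v v1 ?win (fuel - t) r A s" by (auto simp: performs_def)
  show ?thesis
  proof (rule performsI[OF machine_run_trans[OF run machine_run_trans[OF step run']]])
    show "search_outcome v v1 win fuel (fst r, t + snd r) (2 ^ height v * t + (0 + A)) s"
      using out t win' unfolding search_outcome_def
        by (auto simp: algebra_simps split: option.splits if_splits)
  qed
qed

lemma performs_descend:
  assumes v: "Suc v < 2 ^ d" and fuel: "fuel \<noteq> 0" and split: "splits T win v"
    and child: "shift (Suc v) < 64 * (d + 1)" "height (Suc v) = height v"
      "performs T (Suc v) v1 (win(Suc v := win v div 2 ^ shift (Suc v))) (fuel - 1) r'"
    and found: "\<And>p. fst r' = Some p \<Longrightarrow> p \<noteq> [] \<and> r = (Some (win v # p), Suc (snd r'))"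
      and tests: "snd r' < snd r"
    and retry: "\<And>k win'. fst r' = None \<Longrightarrow> Suc (snd r') \<le> fuel \<Longrightarrow> \<forall>x\<le>v. win' x = win x \<Longrightarrow>
      machine_run T (Search v win False fuel False) (2 ^ height v * Suc (snd r')) k
        (Search v win' True (fuel - Suc (snd r')) False) \<Longrightarrow>
      performs T v v1 win fuel r"
  shows "performs T v v1 win fuel r"
proof -
  let ?win = "win(Suc v := win v div 2 ^ shift (Suc v))"
  obtain A k s where run: "machine_run T (Search (Suc v) ?win False (fuel - 1) False) A k s"
    and out: "search_outcome (Suc v) v1 ?win (fuel - 1) r' A s" using child(3) by (auto simp: performs_def)
  have "machine_run T (Search v win False fuel False) (2 ^ height v) 0 (Search (Suc v) ?win False (fuel - 1) False)"
    using machine_run_test[of v fuel T win] v fuel split by simp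
  note run = machine_run_trans[OF this run]
  consider "fuel - 1 < snd r'" | p where "snd r' \<le> fuel - 1" "fst r' = Some p" | "snd r' \<le> fuel - 1"
    "fst r' = None" by fastforce
  thus ?thesis
  proof cases
    case 1
    have "2 ^ height v * Suc (snd r') \<le> 2 ^ height v * snd r" using tests by (intro mult_le_mono2) simp
    moreover have "\<not> snd r \<le> fuel" using 1 tests fuel by linarith
    ultimately have "search_outcome v v1 win fuel r (2 ^ height v + A) s"
      using out 1 child(2) by (simp add: search_outcome_def)
    thus ?thesis by (rule performsI[OF run])
  next
    case (2 p)
    obtain win' where s: "s = Search v1 win' False (fuel - 1 - snd r') False" "\<forall>x<Suc v. win' x = ?win x"
      "\<forall>i<length p. win' (Suc v + i) = p ! i" "win' v1 = last p div 2 ^ shift v1"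
        and A: "A = 2 ^ height v * snd r'"
      using out 2 child(2) by (auto simp: search_outcome_def)
    have "win' (v + i) = (win v # p) ! i" if "i < length (win v # p)" for i using s(2,3) that
      by (cases i) auto
    hence "search_outcome v v1 win fuel r (2 ^ height v + A) s"
      using found[OF 2(2)] s 2 A fuel by (auto simp: search_outcome_def)
    thus ?thesis by (rule performsI[OF run])
  next
    case 3
    obtain win' where s: "s = Search (Suc v) win' True (fuel - 1 - snd r') False"
      "\<forall>x<Suc v. win' x = ?win x"
      "2 ^ (64 * (d + 1)) \<le> win' (Suc v) + step (Suc v)" and A: "A = 2 ^ height v * snd r'"
      using out 3 child(2) by (auto simp: search_outcome_def)
    have "machine_run T s 0 1 (Search v win' True (fuel - 1 - snd r') False)"
      unfolding s(1) by (rule machine_run_step(2)) (use s v child(1) in simp_all)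
    from machine_run_trans[OF run this]
    have "machine_run T (Search v win False fuel False) (2 ^ height v * Suc (snd r')) (0 + k + 1)
      (Search v win' True (fuel - Suc (snd r')) False)" by (simp add: A)
    thus ?thesis using 3 fuel s(2) by (intro retry) auto
  qed
qed

definition shifts_from :: "nat \<Rightarrow> nat list \<Rightarrow> bool" where
  "shifts_from v bs \<longleftrightarrow> (\<forall>i. Suc i < length bs \<longrightarrow>
    shift (v + Suc i) = bs ! i \<and> bs ! i < 64 * (d + 1) \<and> step (v + Suc i) = 2 ^
      (64 * (d + 1) - bs ! i) \<and> height (v + Suc i) = height v)"

lemma shifts_from_Cons:
  assumes "shifts_from v (b # bs)" "bs \<noteq> []"
  shows "shift (Suc v) = b" "b < 64 * (d + 1)" "step (Suc v) = 2 ^ (64 * (d + 1) - b)"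
    "height (Suc v) = height v"
    "shifts_from (Suc v) bs"
proof -
  have 0: "shift (v + Suc i) = (b # bs) ! i \<and> (b # bs) ! i < 64 * (d + 1) \<and>
    step (v + Suc i) = 2 ^ (64 * (d + 1) - (b # bs) ! i) \<and>
    height (v + Suc i) = height v" if "i < length bs" for i
    using assms(1) that by (simp add: shifts_from_def)
  from this[of 0] assms(2)
  show "shift (Suc v) = b" "b < 64 * (d + 1)" "step (Suc v) = 2 ^ (64 * (d + 1) - b)"
    "height (Suc v) = height v" by auto
  with 0[of "Suc _"] show "shifts_from (Suc v) bs" by (simp add: shifts_from_def)
qed

context
  fixes T Xs v0 v1 win0
  assumes v1: "v1 \<le> 2 ^ d"
    and accepts: "\<And>win u. \<forall>x<v0. win x = win0 x \<Longrightarrow> v0 \<le> u \<Longrightarrow> u < v1 \<Longrightarrow> win u < 2 ^ (64 * (d + 1)) \<Longrightarrow>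
      splits T win u = splits_evenly (Xs u) (T u (win u))"
begin

context
  fixes v b bs
  assumes start: "v0 \<le> v" and length: "v + length (b # bs) = v1" and shifts: "shifts_from v (b # bs)"
    and deeper: "\<And>cs win fuel. bs \<noteq> [] \<Longrightarrow> sweep (64 * (d + 1)) (step (Suc v)) cs \<Longrightarrow> win (Suc v) = hd cs \<Longrightarrow>
      \<forall>x<v0. win x = win0 x \<Longrightarrow> performs T (Suc v) v1 win fuel
        (search (64 * (d + 1)) (layers_at T Xs (Suc v) bs) cs)"
begin

lemma performs_child:
  assumes fuel: "fuel \<noteq> 0" and split: "splits T win v" and bs: "bs \<noteq> []"
    and c: "win v = c" "c < 2 ^ (64 * (d + 1))" and same: "\<forall>x<v0. win x = win0 x"
    and retry: "\<And>k t win'. machine_run T (Search v win False fuel False) (2 ^ height v * t) k (Search v win'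
      True (fuel - t) False) \<Longrightarrow>
      t \<le> fuel \<Longrightarrow> \<forall>x\<le>v. win' x = win x \<Longrightarrow> performs T v v1 win fuel
        (fst (search (64 * (d + 1)) (layers_at T Xs v (b # bs)) cs), t + snd
          (search (64 * (d + 1)) (layers_at T Xs v (b # bs)) cs))"
  shows "performs T v v1 win fuel (search (64 * (d + 1)) (layers_at T Xs v (b # bs)) (c # cs))"
proof -
  let ?search = "search (64 * (d + 1)) (layers_at T Xs v (b # bs))"
  let ?child = "search (64 * (d + 1)) (layers_at T Xs (Suc v) bs) (children (64 * (d + 1)) b c)"
  note next_node = shifts_from_Cons[OF shifts bs]
  have "splits_evenly (Xs v) (T v c)" using accepts[OF same start] split c length by simp
  hence search: "?search (c # cs) = (case ?child of (Some p, t) \<Rightarrow> (Some (c # p), Suc t)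
    | (None, t) \<Rightarrow> (fst (?search cs), Suc (t + snd (?search cs))))"
    using c(2) unfolding layers_at.simps search.simps by simp
  show ?thesis
  proof (rule performs_descend[OF _ fuel split])
    show "Suc v < 2 ^ d" using bs length v1 by (cases bs) auto
    show "performs T (Suc v) v1 (win(Suc v := win v div 2 ^ shift (Suc v))) (fuel - 1) ?child"
      using same start bs c next_node sweep_children[of b "64 * (d + 1)" c]
        by (intro deeper) (auto simp: hd_children)
    show "snd ?child < snd (?search (c # cs))" unfolding search by (auto split: prod.splits option.splits)
    show "p \<noteq> [] \<and> ?search (c # cs) = (Some (win v # p), Suc (snd ?child))" if "fst ?child = Some p" for p
    proof -
      have child: "?child = (Some p, snd ?child)" using that by (metis prod.collapse)
      have "length p = length bs" using search_Some_path[OF child] by simp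
      thus ?thesis using bs c(1) unfolding search by (subst child) auto
    qed
    show "performs T v v1 win fuel (?search (c # cs))"
      if "fst ?child = None" "Suc (snd ?child) \<le> fuel" "\<forall>x\<le>v. win' x = win x"
      "machine_run T (Search v win False fuel False) (2 ^ height v * Suc (snd ?child)) k (Search v win' True
        (fuel - Suc (snd ?child)) False)"
      for k win'
      using retry[OF that(4,2,3)] that(1) unfolding search by (cases ?child) auto
  qed (use next_node in simp_all)
qed

lemma performs_candidates:
  assumes "sweep (64 * (d + 1)) (step v) cs" "win v = hd cs" "\<forall>x<v0. win x = win0 x"
  shows "performs T v v1 win fuel (search (64 * (d + 1)) (layers_at T Xs v (b # bs)) cs)"
  using assms
proof (induction cs arbitrary: win fuel)
  case (Cons c cs)
  let ?search = "search (64 * (d + 1)) (layers_at T Xs v (b # bs))"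
  have v: "v < 2 ^ d" "v < v1" using length v1 by auto
  have c: "win v = c" "c < 2 ^ (64 * (d + 1))" using Cons.prems sweep_less[OF Cons.prems(1)] by auto
  have split: "splits T win v = fst (hd (layers_at T Xs v (b # bs))) c"
    using accepts[OF Cons.prems(3) start v(2)] c by simp
  have rest: "performs T v v1 win fuel (fst (?search cs), t + snd (?search cs))"
    if "machine_run T (Search v win False fuel False) (2 ^ height v * t) k (Search v win' True (fuel - t) False)"
      "t \<le> fuel" "\<forall>x\<le>v. win' x = win x" for k t win'
  proof (rule performs_next[OF that(1,2) _ _ v(1) Cons.prems(1)])
    show "\<forall>x<v. win' x = win x" "win' v = c" using that(3) c by auto
    show "?search cs = (None, 0)" if "cs = []" using that by simp
    show "performs T v v1 win'' (fuel - t) (?search cs)"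
      if "cs \<noteq> []" "win'' v = hd cs" "\<forall>x<v. win'' x = win x" for win''
      using that Cons.prems(1,3) start by (intro Cons.IH) (cases cs, auto)
  qed
  consider "fuel = 0" | "fuel \<noteq> 0" "\<not> splits T win v" | "fuel \<noteq> 0" "splits T win v" "bs = []"
    | "fuel \<noteq> 0" "splits T win v" "bs \<noteq> []" by blast
  thus ?case
  proof cases
    case 1
    have "1 \<le> snd (?search (c # cs))" by (auto split: prod.splits option.splits)
    thus ?thesis using performs_no_fuel[OF v(1)] 1 by simp
  next
    case 2
    have "performs T v v1 win fuel (fst (?search cs), 1 + snd (?search cs))"
      by (rule rest[of 1 0 win]) (use machine_run_test[OF v(1) 2(1), of T win] 2 in simp_all)
    thus ?thesis using 2(2) split by auto
  next
    case 3
    show ?thesis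
      by (rule performsI[OF machine_run_test[OF v(1) 3(1)]])
        (use 3 split length c in \<open>auto simp: search_outcome_def\<close>)
  next
    case 4
    thus ?thesis by (rule performs_child[OF _ _ _ c Cons.prems(3) rest])
  qed
qed simp

end

lemma performs_search:
  assumes "bs \<noteq> []" "v0 \<le> v" "v + length bs = v1" "shifts_from v bs" "sweep (64 * (d + 1)) (step v) cs"
    "win v = hd cs" "\<forall>x<v0. win x = win0 x"
  shows "performs T v v1 win fuel (search (64 * (d + 1)) (layers_at T Xs v bs) cs)"
  using assms
proof (induction bs arbitrary: v cs win fuel)
  case (Cons b bs)
  show ?case
  proof (rule performs_candidates[OF Cons.prems(2-4) _ Cons.prems(5-7)])
    show "performs T (Suc v) v1 win fuel (search (64 * (d + 1)) (layers_at T Xs (Suc v) bs) cs)"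
      if "bs \<noteq> []" "sweep (64 * (d + 1)) (step (Suc v)) cs" "win (Suc v) = hd cs" "\<forall>x<v0. win x = win0 x"
        for cs win fuel
      by (rule Cons.IH) (use that Cons.prems shifts_from_Cons[OF Cons.prems(4) that(1)] in simp_all)
  qed
qed simp

end

end

section \<open>Visiting the segments of the tree\<close>

context params
begin

definition roots :: "nat list" where
  "roots = children (64 * (d + 1)) (8 * (d + 1)) 0"

definition segment_layers :: "table \<Rightarrow> (nat \<Rightarrow> nat set) \<Rightarrow> nat \<Rightarrow> layer list" where
  "segment_layers T Xs v = layers_at T Xs v (fresh_bits (height v))"

definition segment_end :: "nat \<Rightarrow> nat" where
  "segment_end v = v + 2 ^ seg_exp (height v)"

text \<open>The keys arriving at the nodes once the windows \<open>p\<close> have been chosen from node \<open>v\<close> on.\<close>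

definition refine :: "table \<Rightarrow> nat \<Rightarrow> nat list \<Rightarrow> (nat \<Rightarrow> nat set) \<Rightarrow> nat \<Rightarrow> nat set" where
  "refine T v p Xs u = (if v \<le> u div 2 \<and> u div 2 < v + length p
    then {i \<in> Xs (u div 2). T (u div 2) (p ! (u div 2 - v)) i \<longleftrightarrow> u mod 2 = 1} else Xs u)"

abbreviation root_search :: "layer list \<Rightarrow> nat list option \<times> nat" where
  "root_search ls \<equiv> search (64 * (d + 1)) ls roots"

abbreviation root_fails :: "layer list \<Rightarrow> bool" where
  "root_fails ls \<equiv> fails (64 * (d + 1)) ls roots"

abbreviation root_repeats :: "layer list \<Rightarrow> bool" where
  "root_repeats ls \<equiv> repeats (64 * (d + 1)) ls roots"

function visit :: "table \<Rightarrow> nat \<Rightarrow> (nat \<Rightarrow> nat set) \<Rightarrow> (nat \<times> layer list) list" where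
  "visit T v Xs = (if v < 2 ^ d then (height v, segment_layers T Xs v) #
      (case fst (root_search (segment_layers T Xs v)) of None \<Rightarrow> []
        | Some p \<Rightarrow> visit T (segment_end v) (refine T v p Xs)) else [])"
  by pat_completeness auto
termination by (relation "Wellfounded.measure (\<lambda>(T, v, Xs). 2 ^ d - v)")
  (auto simp: segment_end_def intro!: diff_less_mono2)

declare visit.simps [simp del]

definition total_tests :: "(nat \<times> layer list) list \<Rightarrow> nat" where
  "total_tests vs = (\<Sum>(k, ls)\<leftarrow>vs. snd (root_search ls))"

definition total_cost :: "(nat \<times> layer list) list \<Rightarrow> nat" where
  "total_cost vs = (\<Sum>(k, ls)\<leftarrow>vs. 2 ^ k * snd (root_search ls))"

definition all_found :: "(nat \<times> layer list) list \<Rightarrow> bool" where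
  "all_found vs \<longleftrightarrow> (\<forall>(k, ls)\<in>set vs. \<not> root_fails ls)"

definition seg_start :: "nat \<Rightarrow> bool" where
  "seg_start v \<longleftrightarrow> 1 \<le> v \<and> v \<le> 2 ^ d \<and> (v < 2 ^ d \<longrightarrow> 2 ^ seg_exp (height v) dvd rank v)"

definition valid_window :: "table \<Rightarrow> (nat \<Rightarrow> nat) \<Rightarrow> nat \<Rightarrow> bool" where
  "valid_window T win u \<longleftrightarrow> splits T win u \<and> win u < 2 ^ (64 * (d + 1)) \<and>
    (shift u \<noteq> 64 * (d + 1) \<longrightarrow> win u mod 2 ^ (64 * (d + 1) - shift u) = win (u - 1) div 2 ^ shift u)"

lemma roots_less: "\<forall>c\<in>set roots. c < 2 ^ (64 * (d + 1))"
proof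
  fix c assume "c \<in> set roots"
  thus "c < 2 ^ (64 * (d + 1))" unfolding roots_def by (rule children_less[rotated 2]) simp_all
qed

lemma visit_Cons: "v < 2 ^ d \<Longrightarrow> visit T v Xs = (height v, segment_layers T Xs v) #
  (case fst (root_search (segment_layers T Xs v)) of None \<Rightarrow> [] | Some p \<Rightarrow> visit T (segment_end v) (refine T v p Xs))"
  by (subst visit.simps) simp

lemma visit_Nil: "2 ^ d \<le> v \<Longrightarrow> visit T v Xs = []"
  by (subst visit.simps) simp

lemma length_segment_layers [simp]: "length (segment_layers T Xs v) = 2 ^ seg_exp (height v)"
  by (simp add: segment_layers_def)

lemma seg_start_1: "seg_start 1"
  by (simp add: seg_start_def rank_def)

context
  fixes v assumes start: "seg_start v" and v: "v < 2 ^ d"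
begin

lemma seg_start_node: "v \<in> {1..<2 ^ d}" and seg_start_height: "height v \<in> {1..d}"
proof -
  show "v \<in> {1..<2 ^ d}" using start v by (simp add: seg_start_def)
  thus "height v \<in> {1..d}" by (rule height_bounds)
qed

lemma segment_end_le_level: "segment_end v \<le> 2 * 2 ^ floor_log v"
proof -
  let ?K = "2 ^ seg_exp (height v) :: nat" and ?j = "floor_log v"
  have v1: "1 \<le> v" using seg_start_node by simp
  have j: "?j < d" using floor_log_less[OF v1 v] .
  hence "seg_exp (height v) \<le> ?j" using seg_exp_le(1)[of "height v"] by (simp add: height_def)
  hence J: "2 ^ ?j = ?K * 2 ^ (?j - seg_exp (height v))" by (simp flip: power_add)
  obtain q where q: "rank v = ?K * q" using start v by (auto simp: seg_start_def dvd_def)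
  have "?K * q < ?K * 2 ^ (?j - seg_exp (height v))"
    using q floor_log_bounds(1)[OF v1] floor_log_bounds(2)[of v] unfolding J[symmetric] rank_def by linarith
  hence "Suc q \<le> 2 ^ (?j - seg_exp (height v))" by simp
  hence "?K * Suc q \<le> 2 ^ ?j" unfolding J by (rule mult_le_mono2)
  thus ?thesis using q floor_log_bounds(1)[OF v1] by (simp add: segment_end_def rank_def)
qed

lemma segment_end_le: "segment_end v \<le> 2 ^ d"
proof -
  have "floor_log v < d" using floor_log_less seg_start_node by auto
  hence "2 * 2 ^ floor_log v \<le> (2::nat) ^ d" by (rule two_times_pow_le)
  thus ?thesis using segment_end_le_level by linarith
qed

lemma segment_coords:
  assumes "r < 2 ^ seg_exp (height v)"
  shows "floor_log (v + r) = floor_log v" "height (v + r) = height v" "rank (v + r) = rank v + r"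
    "rank (v + r) mod 2 ^ seg_exp (height v) = r"
proof -
  have v1: "1 \<le> v" using seg_start_node by simp
  show log: "floor_log (v + r) = floor_log v"
    using assms segment_end_le_level floor_log_bounds(1)[OF v1]
      by (intro floor_log_eqI) (auto simp: segment_end_def)
  show "height (v + r) = height v" by (simp add: height_def log)
  show rank: "rank (v + r) = rank v + r" using floor_log_bounds(1)[OF v1] by (simp add: rank_def log)
  have "2 ^ seg_exp (height v) dvd rank v" using start v by (simp add: seg_start_def)
  thus "rank (v + r) mod 2 ^ seg_exp (height v) = r" using assms unfolding rank by (auto simp: dvd_def)
qed

lemma parent_before_segment: "u < segment_end v \<Longrightarrow> u div 2 < v"
  using segment_end_le_level floor_log_bounds(1)[of v] seg_start_node by simp

lemma seg_start_segment_end: "seg_start (segment_end v)"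
proof -
  let ?K = "2 ^ seg_exp (height v) :: nat" and ?j = "floor_log v"
  have v1: "1 \<le> v" using seg_start_node by simp
  have "2 ^ seg_exp (height (segment_end v)) dvd rank (segment_end v)"
  proof (cases "segment_end v = 2 * 2 ^ ?j")
    case True
    have "floor_log (segment_end v) = Suc ?j" unfolding True using floor_log_power[of "Suc ?j"] by simp
    thus ?thesis using True by (simp add: rank_def)
  next
    case False
    hence log: "floor_log (segment_end v) = ?j"
      using segment_end_le_level floor_log_bounds(1)[OF v1]
        by (intro floor_log_eqI) (auto simp: segment_end_def)
    have "rank (segment_end v) = rank v + ?K"
      unfolding rank_def log using floor_log_bounds(1)[OF v1] by (simp add: segment_end_def)
    moreover have "height (segment_end v) = height v" by (simp add: height_def log)
    ultimately show ?thesis using start v by (simp add: seg_start_def)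
  qed
  thus ?thesis using segment_end_le v1 by (simp add: seg_start_def segment_end_def)
qed

lemma shift_seg_start: "shift v = 64 * (d + 1)" "step v = 2 ^ (56 * (d + 1))"
  using segment_coords(4)[of 0] by (simp_all add: shift_def step_def)

lemma shift_in_segment:
  assumes r: "Suc r < 2 ^ seg_exp (height v)"
  shows "shift (v + Suc r) = fresh_bits (height v) ! r" "fresh_bits (height v) ! r < 64 * (d + 1)"
    "step (v + Suc r) = 2 ^ (64 * (d + 1) - shift (v + Suc r))"
proof -
  note coords = segment_coords[OF r]
  show "shift (v + Suc r) = fresh_bits (height v) ! r"
    using coords(2,4) r by (simp add: shift_def Let_def fresh_bits_nth)
  have "fresh_bits (height v) ! r \<in> set (fresh_bits (height v))" using r by simp
  hence "fresh_bits (height v) ! r \<le> 4 * (d + 1)" using fresh_bits_le[OF seg_start_height] by blast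
  thus "fresh_bits (height v) ! r < 64 * (d + 1)" by simp
  show "step (v + Suc r) = 2 ^ (64 * (d + 1) - shift (v + Suc r))" using coords(2,4) by (simp add: step_def)
qed

lemma shifts_from_seg_start: "shifts_from v (fresh_bits (height v))"
  using shift_in_segment segment_coords(2)[of "Suc _"]
    by (auto simp: shifts_from_def simp del: add_Suc_right)

lemma performs_segment_search:
  assumes win: "win v = 0" and keys: "\<And>u. 1 \<le> u \<Longrightarrow> u div 2 < v \<Longrightarrow> node_keys T win u = Xs u"
  shows "performs T v (segment_end v) win fuel (root_search (segment_layers T Xs v))"
  unfolding segment_layers_def
proof (rule performs_search[OF segment_end_le])
  fix win' u assume w': "\<forall>x<v. win' x = win x" and u: "v \<le> u" "u < segment_end v"
  have "node_keys T win' u = node_keys T win u"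
    by (rule node_keys_cong) (use parent_before_segment[OF u(2)] w' in auto)
  also have "... = Xs u" using keys[of u] parent_before_segment[OF u(2)] u seg_start_node by simp
  finally show "splits T win' u = splits_evenly (Xs u) (T u (win' u))" by (simp add: splits_def)
next
  have "sweep (64 * (d + 1)) (2 ^ (64 * (d + 1) - 8 * (d + 1))) roots" unfolding roots_def
    by (rule sweep_children) auto
  moreover have "64 * (d + 1) - 8 * (d + 1) = 56 * (d + 1)" by simp
  ultimately show "sweep (64 * (d + 1)) (step v) roots" unfolding shift_seg_start(2) by (simp only:)
  show "win v = hd roots" using win by (simp add: roots_def hd_children)
  show "shifts_from v (fresh_bits (height v))" by (rule shifts_from_seg_start)
  show "fresh_bits (height v) \<noteq> []" using length_fresh_bits[of "height v"]
    by (cases "fresh_bits (height v)") auto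
qed (simp_all add: segment_end_def)

context
  fixes T Xs p
  assumes path: "fst (root_search (segment_layers T Xs v)) = Some p"
begin

lemma length_path: "length p = 2 ^ seg_exp (height v)"
  and path_nth: "r < 2 ^ seg_exp (height v) \<Longrightarrow>
    p ! r < 2 ^ (64 * (d + 1)) \<and> splits_evenly (Xs (v + r)) (T (v + r) (p ! r))"
  and path_overlap: "Suc r < 2 ^ seg_exp (height v) \<Longrightarrow>
    p ! Suc r mod 2 ^ (64 * (d + 1) - shift (v + Suc r)) = p ! r div 2 ^ shift (v + Suc r)"
proof -
  let ?ls = "segment_layers T Xs v"
  have "root_search ?ls = (Some p, snd (root_search ?ls))" using path by (metis prod.collapse)
  note p = search_Some_path[OF this]
  show "length p = 2 ^ seg_exp (height v)" using p by simp
  show nth: "p ! r < 2 ^ (64 * (d + 1)) \<and> splits_evenly (Xs (v + r)) (T (v + r) (p ! r))"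
    if "r < 2 ^ seg_exp (height v)" for r
    using p that by (simp add: segment_layers_def layers_at_nth)
  assume r: "Suc r < 2 ^ seg_exp (height v)"
  have "p ! Suc r \<in> set (children (64 * (d + 1)) (fresh_bits (height v) ! r) (p ! r))"
    using p r by (simp add: segment_layers_def layers_at_nth)
  thus "p ! Suc r mod 2 ^ (64 * (d + 1) - shift (v + Suc r)) = p ! r div 2 ^ shift (v + Suc r)"
    using shift_in_segment[OF r] nth[of r] r by (intro children_mod) auto
qed

lemma path_valid_window:
  assumes keys: "\<And>u. 1 \<le> u \<Longrightarrow> u div 2 < v \<Longrightarrow> node_keys T win u = Xs u"
    and win: "\<forall>i<length p. win (v + i) = p ! i" and u: "u \<in> {v..<segment_end v}"
  shows "valid_window T win u"
proof -
  obtain r where r: "u = v + r" "r < 2 ^ seg_exp (height v)" using u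
    by (auto simp: segment_end_def le_iff_add)
  have wu: "win u = p ! r" using win r length_path by simp
  have "node_keys T win u = Xs u" using keys[of u] parent_before_segment[of u] u seg_start_node by simp
  hence "splits T win u" using path_nth[OF r(2)] r(1) wu by (simp add: splits_def)
  moreover have "win u mod 2 ^ (64 * (d + 1) - shift u) = win (u - 1) div 2 ^ shift u"
    if "shift u \<noteq> 64 * (d + 1)"
  proof (cases r)
    case 0
    thus ?thesis using that shift_seg_start(1) r(1) by simp
  next
    case (Suc r')
    hence "win (u - 1) = p ! r'" using win r length_path by simp
    thus ?thesis using path_overlap[of r'] r Suc wu by simp
  qed
  ultimately show ?thesis using path_nth[OF r(2)] wu by (simp add: valid_window_def)
qed

lemma node_keys_refine:
  assumes keys: "\<And>u. 1 \<le> u \<Longrightarrow> u div 2 < v \<Longrightarrow> node_keys T win u = Xs u"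
    and win: "\<forall>i<length p. win (v + i) = p ! i" and u: "1 \<le> u" "u div 2 < segment_end v"
  shows "node_keys T win u = refine T v p Xs u"
proof (cases "u div 2 < v")
  case True
  thus ?thesis using keys[OF u(1)] by (simp add: refine_def)
next
  case False
  let ?x = "u div 2"
  have x: "v \<le> ?x" "1 \<le> ?x" "?x div 2 < v" using False u parent_before_segment seg_start_node by auto
  have "win ?x = p ! (?x - v)" using win[rule_format, of "?x - v"] x u(2) length_path
    by (simp add: segment_end_def)
  moreover have "node_keys T win (2 * ?x + u mod 2) =
    {i \<in> node_keys T win ?x. T ?x (win ?x) i \<longleftrightarrow> u mod 2 = 1}"
    by (rule node_keys_child) (use x in auto)
  ultimately show ?thesis using x u(2) length_path keys[of ?x] by (simp add: refine_def segment_end_def)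
qed

end

end

lemma valid_window_cong:
  assumes "\<And>x. x \<le> u \<Longrightarrow> win x = win' x" "1 \<le> u"
  shows "valid_window T win u = valid_window T win' u"
  using splits_cong[of u win win' T] assms by (simp add: valid_window_def)

definition visit_result ::
  "table \<Rightarrow> nat \<Rightarrow> (nat \<Rightarrow> nat) \<Rightarrow> nat \<Rightarrow> (nat \<times> layer list) list \<Rightarrow> search_state \<Rightarrow> bool" where
  "visit_result T v win fuel vs s \<longleftrightarrow> (if all_found vs \<and> total_tests vs \<le> fuel
    then \<exists>win' fuel'. s = Search (2 ^ d) win' False fuel' False \<and> (\<forall>x<v. win' x = win x) \<and>
      (\<forall>u\<in>{v..<2 ^ d}. valid_window T win' u)
    else gave_up s)"

definition visits :: "table \<Rightarrow> (nat \<Rightarrow> nat set) \<Rightarrow> nat \<Rightarrow> (nat \<Rightarrow> nat) \<Rightarrow> nat \<Rightarrow> bool" where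
  "visits T Xs v win fuel \<longleftrightarrow> (\<exists>A k s. machine_run T (Search v win False fuel False) A k s \<and> halted s \<and>
    A \<le> total_cost (visit T v Xs) \<and>
    visit_result T v win fuel (visit T v Xs) s)"

lemma visits_end: "visits T Xs (2 ^ d) win fuel"
proof -
  have "machine_run T (Search (2 ^ d) win False fuel False) 0 0 (Search (2 ^ d) win False fuel False)"
    by (rule machine_run.stop)
  thus ?thesis unfolding visits_def
    by (intro exI[of _ 0] exI[of _ "Search (2 ^ d) win False fuel False"])
      (simp add: visit_result_def visit_Nil all_found_def total_tests_def)
qed

context
  fixes T :: table and Xs :: "nat \<Rightarrow> nat set" and v fuel :: nat and win :: "nat \<Rightarrow> nat"
  assumes start: "seg_start v" and v: "v < 2 ^ d" and zero: "win v = 0"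
    and keys: "\<And>u. 1 \<le> u \<Longrightarrow> u div 2 < v \<Longrightarrow> node_keys T win u = Xs u"
begin

lemma visits_incomplete:
  assumes "fuel < snd (root_search (segment_layers T Xs v)) \<or> fst (root_search (segment_layers T Xs v)) =
    None"
  shows "visits T Xs v win fuel"
proof -
  let ?r = "root_search (segment_layers T Xs v)" and ?V = "visit T v Xs"
  obtain A k s where run: "machine_run T (Search v win False fuel False) A k s"
    and out: "search_outcome v (segment_end v) win fuel ?r A s"
    using performs_segment_search[OF start v zero keys, where fuel = fuel] unfolding performs_def by blast
  have first: "2 ^ height v * snd ?r \<le> total_cost ?V" "snd ?r \<le> total_tests ?V"
    using v by (simp_all add: visit_Cons total_cost_def total_tests_def)
  show ?thesis
  proof (cases "fuel < snd ?r")
    case True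
    hence "A \<le> total_cost ?V" "gave_up s" using out first by (auto simp: search_outcome_def)
    moreover have "halted s" using \<open>gave_up s\<close> by (cases s) simp
    moreover have "\<not> total_tests ?V \<le> fuel" using first True by linarith
    ultimately show ?thesis using run by (auto simp: visits_def visit_result_def)
  next
    case False
    hence r: "snd ?r \<le> fuel" "fst ?r = None" using assms by auto
    obtain win' where s: "s = Search v win' True (fuel - snd ?r) False"
      "2 ^ (64 * (d + 1)) \<le> win' v + step v"
      and A: "A = 2 ^ height v * snd ?r" using out r by (auto simp: search_outcome_def)
    let ?s = "Search v win' True (fuel - snd ?r) True"
    have "machine_run T s 0 1 ?s" by (rule machine_run_step(2))
      (use s v shift_seg_start(1)[OF start v] in simp_all)
    note machine_run_trans[OF run this]
    moreover have "\<not> all_found ?V" using r(2) v by (simp add: visit_Cons all_found_def search_None_iff)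
    ultimately show ?thesis using A first unfolding visits_def
      by (intro exI[of _ "A + 0"] exI[of _ "k + 1"] exI[of _ ?s]) (simp add: visit_result_def)
  qed
qed

lemma visits_segment:
  assumes r: "snd (root_search (segment_layers T Xs v)) \<le> fuel"
    and p: "fst (root_search (segment_layers T Xs v)) = Some p"
    and rest: "\<And>win'. (segment_end v < 2 ^ d \<Longrightarrow> win' (segment_end v) = 0) \<Longrightarrow>
      (\<And>u. 1 \<le> u \<Longrightarrow> u div 2 < segment_end v \<Longrightarrow> node_keys T win' u = refine T v p Xs u) \<Longrightarrow>
      visits T (refine T v p Xs) (segment_end v) win' (fuel - snd (root_search (segment_layers T Xs v)))"
  shows "visits T Xs v win fuel"
proof -
  let ?r = "root_search (segment_layers T Xs v)" and ?V = "visit T v Xs" and ?v1 = "segment_end v"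
  let ?V' = "visit T ?v1 (refine T v p Xs)"
  obtain A k s where run: "machine_run T (Search v win False fuel False) A k s"
    and out: "search_outcome v ?v1 win fuel ?r A s"
    using performs_segment_search[OF start v zero keys, where fuel = fuel] unfolding performs_def by blast
  obtain win' where s: "s = Search ?v1 win' False (fuel - snd ?r) False" and win': "\<forall>x<v. win' x = win x"
    "\<forall>i<length p. win' (v + i) = p ! i" "win' ?v1 = last p div 2 ^ shift ?v1"
      and A: "A = 2 ^ height v * snd ?r"
    using out r p by (auto simp: search_outcome_def)
  have keys': "node_keys T win' u = Xs u" if "1 \<le> u" "u div 2 < v" for u
    using node_keys_cong[of u win' win T] keys[OF that] win'(1) that by simp
  have zero': "win' ?v1 = 0" if "?v1 < 2 ^ d"
  proof -
    have "p \<noteq> []" using length_path[OF start v p] by (cases p) auto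
    hence "last p < 2 ^ (64 * (d + 1))"
      using path_nth[OF start v p, of "length p - 1"] length_path[OF start v p] by (simp add: last_conv_nth)
    thus ?thesis using win'(3) shift_seg_start(1)[OF seg_start_segment_end[OF start v] that] by simp
  qed
  have "visits T (refine T v p Xs) ?v1 win' (fuel - snd ?r)"
  proof (rule rest)
    show "win' ?v1 = 0" if "?v1 < 2 ^ d" using zero'[OF that] .
    show "node_keys T win' u = refine T v p Xs u" if "1 \<le> u" "u div 2 < ?v1" for u
      using node_keys_refine[OF start v p keys' win'(2) that] .
  qed
  then obtain A' k' s' where run': "machine_run T (Search ?v1 win' False (fuel - snd ?r) False) A' k' s'"
    and s': "halted s'" "A' \<le> total_cost ?V'"
      and result: "visit_result T ?v1 win' (fuel - snd ?r) ?V' s'" unfolding visits_def by blast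
  have "all_found ?V \<and> total_tests ?V \<le> fuel \<longleftrightarrow> all_found ?V' \<and> total_tests ?V' \<le> fuel - snd ?r"
    using r p v by (auto simp: visit_Cons all_found_def total_tests_def simp flip: search_None_iff)
  moreover have "valid_window T win'' u" if "\<forall>x<?v1. win'' x = win' x" "u \<in> {v..<?v1}" for win'' u
    using valid_window_cong[of u win'' win' T] path_valid_window[OF start v p keys'
      win'(2)] that seg_start_node[OF start v] by auto
  moreover have "{v..<2 ^ d} = {v..<?v1} \<union> {?v1..<2 ^ d}" using segment_end_le[OF start v]
    by (auto simp: segment_end_def)
  moreover have "\<forall>x<v. win'' x = win x" if "\<forall>x<?v1. win'' x = win' x" for win'' using that win'(1)
    by (simp add: segment_end_def)
  ultimately have "visit_result T v win fuel ?V s'" using result unfolding visit_result_def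
    by (auto split: if_splits)
  moreover have "A + A' \<le> total_cost ?V" using s'(2) p v A by (simp add: visit_Cons total_cost_def)
  ultimately show ?thesis using machine_run_trans[OF run run'[folded s]] s'(1) unfolding visits_def by blast
qed

end

lemma machine_visits:
  assumes "seg_start v" "v < 2 ^ d \<Longrightarrow> win v = 0"
    and "\<And>u. 1 \<le> u \<Longrightarrow> u div 2 < v \<Longrightarrow> node_keys T win u = Xs u"
  shows "visits T Xs v win fuel"
  using assms
proof (induction "2 ^ d - v" arbitrary: v win Xs fuel rule: less_induct)
  case (less v win Xs fuel)
  let ?r = "root_search (segment_layers T Xs v)"
  show ?case
  proof (cases "v < 2 ^ d")
    case False
    hence "v = 2 ^ d" using less.prems(1) by (simp add: seg_start_def)
    thus ?thesis using visits_end by simp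
  next
    case v: True
    show ?thesis
    proof (cases "snd ?r \<le> fuel \<and> fst ?r \<noteq> None")
      case True
      then obtain p where r: "snd ?r \<le> fuel" "fst ?r = Some p" by auto
      have shorter: "2 ^ d - segment_end v < 2 ^ d - v" using v
        by (simp add: segment_end_def diff_less_mono2)
      show ?thesis
      proof (rule visits_segment[OF less.prems(1) v _ _ r])
        fix win' assume "segment_end v < 2 ^ d \<Longrightarrow> win' (segment_end v) = 0"
          "\<And>u. 1 \<le> u \<Longrightarrow> u div 2 < segment_end v \<Longrightarrow> node_keys T win' u = refine T v p Xs u"
        thus "visits T (refine T v p Xs) (segment_end v) win' (fuel - snd ?r)"
          by (rule less.hyps[OF shorter seg_start_segment_end[OF less.prems(1) v]])
      qed (use less.prems v in auto)
    next
      case False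
      thus ?thesis by (intro visits_incomplete[OF less.prems(1) v]) (use less.prems v in auto)
    qed
  qed
qed

end

section \<open>Positions of the windows\<close>

lemma less_pow_bit: "(x::nat) < 2 ^ w \<Longrightarrow> bit x n \<Longrightarrow> n < w"
  by (metis bit_take_bit_iff take_bit_nat_eq_self)

context params
begin

definition seg_index :: "nat \<Rightarrow> nat" where
  "seg_index v = rank v div 2 ^ seg_exp (height v)"

definition seg_rank :: "nat \<Rightarrow> nat" where
  "seg_rank v = rank v mod 2 ^ seg_exp (height v)"

definition bit_string :: "(nat \<Rightarrow> nat) \<Rightarrow> nat \<Rightarrow> nat \<Rightarrow> bool" where
  "bit_string win N i \<longleftrightarrow> (\<exists>u\<in>{1..<N}. position u \<le> i \<and> bit (win u) (i - position u))"

lemma seg_rank_less: "seg_rank v < 2 ^ seg_exp (height v)"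
  by (simp add: seg_rank_def)

lemma position_seg:
  "position v = level_offset (height v) + seg_index v * seg_width (height v) +
    seg_offset (height v) (seg_rank v)"
  by (simp add: position_def seg_index_def seg_rank_def Let_def)

lemma position_le_seg_end:
  "position v + 64 * (d + 1) \<le> level_offset (height v) + Suc (seg_index v) * seg_width (height v)"
proof -
  have "seg_offset (height v) (seg_rank v) \<le> seg_offset (height v) (2 ^ seg_exp (height v) - 1)"
    using seg_rank_less[of v] by (intro seg_offset_mono) simp
  thus ?thesis by (simp add: position_seg seg_width_def)
qed

lemma seg_end_le_level:
  assumes v: "v \<in> {1..<2 ^ d}"
  shows "level_offset (height v) + Suc (seg_index v) * seg_width (height v) \<le> level_offset (Suc (height v))"
proof -
  let ?k = "height v"
  have e: "2 ^ (d - ?k) = 2 ^ (d - ?k - seg_exp ?k) * (2 ^ seg_exp ?k :: nat)"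
    unfolding power_add[symmetric] using seg_exp_le(1)[of ?k]
      by (intro arg_cong[where f = "power 2"]) linarith
  have "seg_index v < 2 ^ (d - ?k - seg_exp ?k)"
    unfolding seg_index_def using rank_less[OF v] unfolding e by (rule less_mult_imp_div_less)
  hence "Suc (seg_index v) * seg_width ?k \<le> 2 ^ (d - ?k) div 2 ^ seg_exp ?k * seg_width ?k"
    unfolding e by (intro mult_le_mono1) simp
  thus ?thesis using height_bounds[OF v] by (simp add: level_offset_Suc)
qed

lemma position_le_end: "v \<in> {1..<2 ^ d} \<Longrightarrow> position v + 64 * (d + 1) \<le> level_offset (Suc d)"
  using position_le_seg_end[of v] seg_end_le_level[of v] level_offset_mono[of "Suc (height v)" "Suc
    d"] height_le(1)[of v] by linarith

lemma position_separated:
  assumes u: "u \<in> {1..<2 ^ d}"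
    and less: "height u < height v \<or> height u = height v \<and> seg_index u < seg_index v"
  shows "position u + 64 * (d + 1) \<le> position v"
  using less
proof
  assume "height u < height v"
  hence "level_offset (Suc (height u)) \<le> level_offset (height v)" by (intro level_offset_mono) simp
  thus ?thesis using position_le_seg_end[of u] seg_end_le_level[OF u] by (simp add: position_seg[of v])
next
  assume e: "height u = height v \<and> seg_index u < seg_index v"
  hence "Suc (seg_index u) * seg_width (height u) \<le> seg_index v * seg_width (height v)"
    using e by (simp add: Suc_leI mult_le_mono1 del: mult_Suc)
  thus ?thesis using position_le_seg_end[of u] e by (simp add: position_seg[of v])
qed

lemma overlap_same_segment:
  assumes "u \<in> {1..<2 ^ d}" "v \<in> {1..<2 ^ d}" "position u < position v + 64 * (d + 1)"
    "position v < position u + 64 * (d + 1)"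
  shows "height u = height v" "seg_index u = seg_index v"
  using position_separated[OF assms(1), of v] position_separated[OF assms(2), of u] assms(3,4) by linarith+

lemma seg_start_minus_seg_rank:
  assumes v: "v \<in> {1..<2 ^ d}"
  shows "seg_start (v - seg_rank v)" "v - seg_rank v < 2 ^ d" "height (v - seg_rank v) = height v"
    "seg_rank v \<le> v"
    "v - seg_rank v = 2 ^ (d - height v) + seg_index v * 2 ^ seg_exp (height v)"
proof -
  let ?v0 = "v - seg_rank v"
  have log: "floor_log v = d - height v" using floor_log_less[of v d] v by (simp add: height_def)
  have bounds: "2 ^ floor_log v \<le> v" "v < 2 * 2 ^ floor_log v" using floor_log_bounds v by auto
  have rank: "seg_index v * 2 ^ seg_exp (height v) + seg_rank v = v - 2 ^ floor_log v"
    unfolding seg_index_def seg_rank_def rank_def by (rule div_mult_mod_eq)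
  thus le: "seg_rank v \<le> v" and v0: "?v0 = 2 ^ (d - height v) + seg_index v * 2 ^ seg_exp (height v)"
    using bounds(1) unfolding log[symmetric] by linarith+
  have log0: "floor_log ?v0 = floor_log v" using v0 bounds by (intro floor_log_eqI) (auto simp: log)
  thus height: "height ?v0 = height v" by (simp add: height_def)
  have "rank ?v0 = seg_index v * 2 ^ seg_exp (height v)" unfolding rank_def log0 using v0 by (simp add: log)
  moreover have "1 \<le> (2::nat) ^ (d - height v)" by simp
  hence "1 \<le> ?v0" unfolding v0 by linarith
  ultimately show "seg_start ?v0" "?v0 < 2 ^ d" using v height by (auto simp: seg_start_def)
qed

context
  fixes T and win :: "nat \<Rightarrow> nat"
  assumes valid: "\<And>u. u \<in> {1..<2 ^ d} \<Longrightarrow> valid_window T win u"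
begin

lemma bit_window_shift:
  assumes start: "seg_start v" "v < 2 ^ d" and "r \<le> r'" "r' < 2 ^ seg_exp (height v)"
    "t + (seg_offset (height v) r' - seg_offset (height v) r) < 64 * (d + 1)"
  shows "bit (win (v + r')) t \<longleftrightarrow>
    bit (win (v + r)) (t + (seg_offset (height v) r' - seg_offset (height v) r))"
  using assms(3-)
proof (induction r' arbitrary: t rule: dec_induct)
  case (step n)
  let ?W = "64 * (d + 1)" and ?u = "v + Suc n" and ?o = "seg_offset (height v)"
  let ?b = "?o (Suc n) - ?o n"
  have shift: "shift ?u = ?b"
    using shift_in_segment(1)[OF start step.prems(1)] step.prems(1) by (simp add: fresh_bits_nth)
  have mono: "?o n \<le> ?o (Suc n)" "?o r \<le> ?o n" using step by (auto intro: seg_offset_mono)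
  have lt: "t + ?b < ?W" using step.prems mono by linarith
  have "?u \<in> {1..<2 ^ d}" using segment_end_le[OF start] step.prems by (simp add: segment_end_def)
  hence "valid_window T win ?u" by (rule valid)
  moreover have "shift ?u \<noteq> ?W" unfolding shift using lt by simp
  ultimately have "win ?u mod 2 ^ (?W - ?b) = win (v + n) div 2 ^ ?b" unfolding shift valid_window_def
    by simp
  hence "bit (take_bit (?W - ?b) (win ?u)) t \<longleftrightarrow> bit (drop_bit ?b (win (v + n))) t"
    by (simp add: take_bit_eq_mod drop_bit_eq_div)
  hence "bit (win ?u) t \<longleftrightarrow> bit (win (v + n)) (t + ?b)" using lt less_diff_conv[of t ?W ?b]
    by (simp only: bit_take_bit_iff bit_drop_bit_eq o_apply add.commute simp_thms)
  also have "... \<longleftrightarrow> bit (win (v + r)) (t + ?b + (?o n - ?o r))" by (rule step.IH)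
    (use step.prems mono in auto)
  also have "t + ?b + (?o n - ?o r) = t + (?o (Suc n) - ?o r)" using mono by simp
  finally show ?case .
qed simp

lemma bit_windows_agree:
  assumes "u \<in> {1..<2 ^ d}" "v \<in> {1..<2 ^ d}" "height u = height v" "seg_index u = seg_index v"
    "i \<in> {position u..<position u + 64 * (d + 1)}" "i \<in> {position v..<position v + 64 * (d + 1)}"
  shows "bit (win u) (i - position u) \<longleftrightarrow> bit (win v) (i - position v)"
proof -
  have le: "bit (win u) (i - position u) \<longleftrightarrow> bit (win v) (i - position v)"
    if v: "v \<in> {1..<2 ^ d}" and u: "u \<in> {1..<2 ^ d}"
      and same: "height u = height v" "seg_index u = seg_index v"
      and i: "i \<in> {position u..<position u + 64 * (d + 1)}" "position v \<le> i"
        and ranks: "seg_rank u \<le> seg_rank v" for u v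
  proof -
    let ?o = "seg_offset (height v)" and ?v0 = "v - seg_rank v"
    have "i - position u < 64 * (d + 1)" using i(1) by auto
    note v0 = seg_start_minus_seg_rank[OF v] and u0 = seg_start_minus_seg_rank[OF u]
    have "u = ?v0 + seg_rank u" "v = ?v0 + seg_rank v" using u0(4,5) v0(4,5) same by simp_all
    moreover have mono: "?o (seg_rank u) \<le> ?o (seg_rank v)" using ranks by (rule seg_offset_mono)
    hence shift: "(i - position v) + (?o (seg_rank v) - ?o (seg_rank u)) = i - position u"
      using i(2) same by (simp add: position_seg)
    moreover have "bit (win (?v0 + seg_rank v)) (i - position v) \<longleftrightarrow>
        bit (win (?v0 + seg_rank u)) ((i - position v) + (?o (seg_rank v) - ?o (seg_rank u)))"
      using bit_window_shift[OF v0(1,2) ranks, of "i - position v"] seg_rank_less[of v] v0(3) shift \<open>i -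
        position u < 64 * (d + 1)\<close> by simp
    ultimately show ?thesis by simp
  qed
  show ?thesis
  proof (cases "seg_rank u \<le> seg_rank v")
    case True
    thus ?thesis using le[of v u] assms by simp
  next
    case False
    thus ?thesis using le[of u v] assms by simp
  qed
qed

lemma bit_string_window:
  assumes v: "v \<in> {1..<2 ^ d}" and t: "t < 64 * (d + 1)"
  shows "bit_string win (2 ^ d) (position v + t) \<longleftrightarrow> bit (win v) t"
proof
  assume "bit (win v) t"
  thus "bit_string win (2 ^ d) (position v + t)" unfolding bit_string_def using v
    by (intro bexI[of _ v]) auto
next
  assume "bit_string win (2 ^ d) (position v + t)"
  then obtain u where u: "u \<in> {1..<2 ^ d}" "position u \<le> position v + t"
    and b: "bit (win u) (position v + t - position u)"
    by (auto simp: bit_string_def)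
  have "position v + t - position u < 64 * (d + 1)"
    by (rule less_pow_bit[OF _ b]) (use valid[OF u(1)] in \<open>simp add: valid_window_def\<close>)
  hence i: "position v + t \<in> {position u..<position u + 64 * (d + 1)}" using u(2) by simp
  hence "height u = height v" "seg_index u = seg_index v" using u t
    by (auto intro!: overlap_same_segment[OF u(1) v])
  from bit_windows_agree[OF u(1) v this i] t b show "bit (win v) t" by simp
qed

end

definition visit_all :: "table \<Rightarrow> (nat \<times> layer list) list" where
  "visit_all T = visit T 1 (\<lambda>_. {..<2 ^ d})"

definition succeeds :: "table \<Rightarrow> bool" where
  "succeeds T \<longleftrightarrow> all_found (visit_all T) \<and> total_tests (visit_all T) \<le> 2 ^ (8 * (d + 1))"

definition search_cost :: "table \<Rightarrow> nat" where
  "search_cost T = min (total_cost (visit_all T)) (2 ^ (8 * (d + 1)) * 2 ^ d)"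

lemma machine_succeeds:
  obtains A k s where "machine_run T (Search 1 (\<lambda>_. 0) False (2 ^ (8 * (d + 1))) False) A k s" "halted s"
    "A + k \<le> 3 * search_cost T + 2"
    "if succeeds T then \<exists>win fuel. s = Search (2 ^ d) win False fuel False \<and>
      (\<forall>u\<in>{1..<2 ^ d}. valid_window T win u) else gave_up s"
proof -
  let ?s = "Search 1 (\<lambda>_. 0) False (2 ^ (8 * (d + 1))) False"
  have "visits T (\<lambda>_. {..<2 ^ d}) 1 (\<lambda>_. 0) (2 ^ (8 * (d + 1)))"
  proof (rule machine_visits[OF seg_start_1 refl])
    fix u :: nat assume "1 \<le> u" "u div 2 < 1"
    hence "u = 1" by linarith
    thus "node_keys T (\<lambda>_. 0) u = {..<2 ^ d}" using node_keys_root by simp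
  qed
  then obtain A k s where run: "machine_run T ?s A k s" and s: "halted s" "A \<le> total_cost (visit_all T)"
    and result: "visit_result T 1 (\<lambda>_. 0) (2 ^ (8 * (d + 1))) (visit_all T) s"
    unfolding visits_def visit_all_def[symmetric] by blast
  from result have result': "if succeeds T then \<exists>win fuel. s = Search (2 ^ d) win False fuel False \<and>
    (\<forall>u\<in>{1..<2 ^ d}. valid_window T win u) else gave_up s"
    unfolding visit_result_def succeeds_def by (auto split: if_splits)
  have "A \<le> search_cost T" using machine_run_fuel[OF run] s(2) by (simp add: search_cost_def mult.commute)
  moreover have "k \<le> 2 + 2 * A" using machine_run_potential[OF run] by (cases "gave_up s") simp_all
  ultimately show ?thesis using that[OF run s(1) _ result'] by simp
qed

end

section \<open>Searching with a batch of hash functions\<close>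

definition reset_prog :: com where
  "reset_prog = 9 ::= pow2 (Const 8 *. (reg 2 +. Const 1)) ;; 10 ::= Const 1 ;; 11 ::= Const 0 ;; 12 ::=
    Const 0 ;;
    Store (arr 6 (reg 10)) (Const 0)"

definition attempt_prog :: com where
  "attempt_prog = (reset_prog ;; search_prog) ;; Cond (reg 12) (Rehash ;; 13 ::= Const 0) (13 ::= Const 1)"

definition attempts_prog :: com where
  "attempts_prog = 13 ::= Const 0 ;; While (Op Equal (reg 13) (Const 0)) attempt_prog"

context ram
begin

definition found :: "nat \<Rightarrow> (nat \<Rightarrow> nat) \<Rightarrow> memory \<Rightarrow> bool" where
  "found g win m \<longleftrightarrow> prepared m \<and>
    (\<forall>u\<in>{1..<2 ^ d}. m (6 * stride + u) = win u \<and> valid_window (split_table g) win u)"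

lemma simulates_reset:
  assumes P: "prepared m"
  shows "simulates g (Search 1 (\<lambda>_. 0) False (2 ^ (8 * (d + 1))) False)
    (m(9 := 2 ^ (8 * (d + 1)), 10 := 1, 11 := 0, 12 := 0, 6 * stride + 1 := 0))"
proof -
  let ?m = "m(9 := 2 ^ (8 * (d + 1)), 10 := 1, 11 := 0, 12 := 0, 6 * stride + 1 := 0)"
  have "1 < stride" by simp
  hence "Suc (6 * stride) < 8 * stride" by linarith
  hence P': "prepared ?m" by (intro prepared_cong[OF _ P]) (simp add: scratch_def)
  have "keys_arranged g (\<lambda>_. 0) 1 ?m" unfolding keys_arranged_def
  proof (intro allI impI)
    fix u :: nat assume u: "1 \<le> u" "u < 2 * 2 ^ d" "u div 2 < 1"
    hence u1: "u = 1" by linarith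
    have root: "list_addr 1 = 8 * stride" "height 1 = d"
      by (simp_all add: list_addr_def rank_def height_def)
    have "?m (8 * stride + t) = t" if "t < 2 ^ d" for t using P' that unfolding prepared_def by blast
    hence "bij_betw (\<lambda>t. ?m (8 * stride + t)) {..<2 ^ d} {..<2 ^ d} =
      bij_betw (\<lambda>t. t) {..<2 ^ d} ({..<2 ^ d} :: nat set)"
      by (intro bij_betw_cong) simp
    thus "bij_betw (\<lambda>t. ?m (list_addr u + t)) {..<2 ^ height u} (node_keys (split_table g) (\<lambda>_. 0) u)"
      unfolding u1 root node_keys_root using bij_betw_id unfolding id_def by simp
  qed
  moreover have "windows_ok (\<lambda>_. 0) 1 ?m" by (simp add: windows_ok_def)
  ultimately show ?thesis using P' by simp
qed

lemma runs_reset_search: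
  assumes P: "prepared m" and n: "length ks = 2 ^ d"
  shows "runs g (reset_prog ;; search_prog) m (900 * search_cost (split_table g) + 720) (\<lambda>m'. prepared m' \<and>
    (if succeeds (split_table g) then m' 12 = 0 \<and> (\<exists>win. found g win m') else m' 12 = 1))"
proof -
  obtain A k s where run: "machine_run (split_table g) (Search 1 (\<lambda>_. 0) False (2 ^ (8 * (d + 1))) False) A k s"
    and s: "halted s" "A + k \<le> 3 * search_cost (split_table g) + 2"
    "if succeeds (split_table g) then \<exists>win fuel. s = Search (2 ^ d) win False fuel False \<and>
      (\<forall>u\<in>{1..<2 ^ d}. valid_window (split_table g) win u)
      else gave_up s" by (rule machine_succeeds)
  have search: "runs g search_prog (m(9 := 2 ^ (8 * (d + 1)), 10 := 1, 11 := 0, 12 := 0, 6 * stride + 1 := 0))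
    (900 * search_cost (split_table g) + 620) (\<lambda>m'. prepared m' \<and>
      (if succeeds (split_table g) then m' 12 = 0 \<and> (\<exists>win. found g win m') else m' 12 = 1))"
  proof (rule runs_mono[OF runs_search[OF run s(1) simulates_reset[OF P] n]])
    show "300 * (A + k) + 20 \<le> 900 * search_cost (split_table g) + 620" using mult_le_mono2[OF s(2), of 300]
      by simp
    fix m' assume S: "simulates g s m'"
    hence "prepared m'" "m' 12 = of_bool (gave_up s)" by (cases s; simp)+
    moreover have "found g win m'"
      if "s = Search (2 ^ d) win False fuel False" "\<forall>u\<in>{1..<2 ^ d}. valid_window (split_table g) win u"
      for win fuel
      using S that windows_okD(1)[of win "2 ^ d" m'] by (simp add: found_def)
    ultimately show "prepared m' \<and>
      (if succeeds (split_table g) then m' 12 = 0 \<and> (\<exists>win. found g win m') else m' 12 = 1)"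
      using s(3) by (auto split: if_splits)
  qed
  have "m 2 = d" "m 6 = stride" using P by (auto simp: prepared_def constants_ok_def)
  hence "denote reset_prog (m, g) =
    (m(9 := 2 ^ (8 * (d + 1)), 10 := 1, 11 := 0, 12 := 0, 6 * stride + 1 := 0), g)"
    using fits_pow[of "8 * (d + 1)" 255] by (simp add: reset_prog_def bit_ops)
  thus ?thesis by (intro runs_Seq_denote[OF _ _ search]) (simp_all add: reset_prog_def)
qed

definition attempted :: "nat \<Rightarrow> memory * nat \<Rightarrow> bool" where
  "attempted g s \<longleftrightarrow> prepared (fst s) \<and>
    (if succeeds (split_table g) then snd s = g \<and> fst s 13 = 1 \<and> (\<exists>win. found g win (fst s)) else snd s =
      Suc g \<and> fst s 13 = 0)"

lemma reaches_attempt: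
  assumes P: "prepared m" and n: "length ks = 2 ^ d"
  shows "reaches attempt_prog (m, g) (900 * search_cost (split_table g) + 750) (attempted g)"
  unfolding attempt_prog_def
proof (rule reaches_Seq[OF runs_reset_search[OF P n, unfolded runs_def]])
  fix s assume s: "snd s = g \<and> prepared (fst s) \<and>
    (if succeeds (split_table g) then fst s 12 = 0 \<and> (\<exists>win. found g win (fst s)) else fst s 12 = 1)"
  have flag: "prepared ((fst s)(13 := x))" for x by (rule prepared_cong[of "fst s"])
    (use s in \<open>simp_all add: scratch_def\<close>)
  have "found g win ((fst s)(13 := x))" if "found g win (fst s)" for win x using that flag
    by (simp add: found_def)
  thus "reaches (Cond (reg 12) (Rehash ;; 13 ::= Const 0) (13 ::= Const 1)) s 20 (attempted g)"
    using s flag unfolding attempted_def by (intro reaches_denote) (auto split: if_splits)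
qed simp

lemma reaches_attempts:
  assumes n: "length ks = 2 ^ d" and "prepared m" "m 13 = 0"
    and "\<And>i. i < N \<Longrightarrow> \<not> succeeds (split_table (g + i))" "succeeds (split_table (g + N))"
  shows "reaches (While (Op Equal (reg 13) (Const 0)) attempt_prog) (m, g)
    ((\<Sum>i\<le>N. 900 * search_cost (split_table (g + i)) + 770) + 10)
      (\<lambda>s. snd s = g + N \<and> (\<exists>win. found (g + N) win (fst s)))"
  using assms(2-)
proof (induction N arbitrary: m g)
  case 0
  show ?case
  proof (rule reaches_While_step[OF _ reaches_attempt[OF 0(1) n]])
    show "aval w (fst (m, g)) (Op Equal (reg 13) (Const 0)) \<noteq> 0" using 0 by simp
    show "reaches (While (Op Equal (reg 13) (Const 0)) attempt_prog) s 10 (\<lambda>s. snd s = g + 0 \<and>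
      (\<exists>win. found (g + 0) win (fst s)))"
      if "attempted g s" for s
      using that 0 by (intro reaches_While_done) (auto simp: attempted_def)
  qed simp
next
  case (Suc N)
  let ?T = "\<lambda>g N. (\<Sum>i\<le>N. 900 * search_cost (split_table (g + i)) + 770) + 10"
  have fails: "\<not> succeeds (split_table g)" using Suc.prems(3)[of 0] by simp
  have T: "?T g (Suc N) = 900 * search_cost (split_table g) + 770 + ?T (Suc g) N"
    by (subst sum.atMost_Suc_shift) simp
  show ?case
  proof (rule reaches_While_step[OF _ reaches_attempt[OF Suc.prems(1) n]])
    show "aval w (fst (m, g)) (Op Equal (reg 13) (Const 0)) \<noteq> 0" using Suc.prems by simp
    fix s assume "attempted g s"
    hence s: "prepared (fst s)" "fst s 13 = 0" "s = (fst s, Suc g)" using fails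
      by (auto simp: attempted_def prod_eq_iff)
    show "reaches (While (Op Equal (reg 13) (Const 0)) attempt_prog) s (?T (Suc g) N)
      (\<lambda>s. snd s = g + Suc N \<and> (\<exists>win. found (g + Suc N) win (fst s)))"
      using Suc.IH[OF s(1,2), of "Suc g"] Suc.prems(3)[of "Suc _"] Suc.prems(4) by (subst s(3)) simp
  qed (unfold T, simp)
qed

end

section \<open>Writing the bit string\<close>

definition load_window_prog :: com where
  "load_window_prog = 41 ::= Load (arr 5 (reg 10)) ;; 42 ::=
    Const 64 +. Const 4 *. reg 2 +. reg 41 div. reg 44 ;;
    41 ::= reg 41 mod. reg 44 ;; 43 ::= Load (arr 6 (reg 10))"

definition or_window_prog :: com where
  "or_window_prog = Store (reg 42) (Op BOr (Load (reg 42)) (Op Shl (reg 43) (reg 41))) ;; inc 42 ;;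
    Store (reg 42) (Op BOr (Load (reg 42)) (Op Shr (reg 43) (reg 44 -. reg 41))) ;; inc 10"

definition write_window_prog :: com where
  "write_window_prog = load_window_prog ;; or_window_prog"

definition write_prog :: com where
  "write_prog = 10 ::= Const 1 ;; While (reg 10 <. reg 0) write_window_prog ;;
    0 ::= reg 44 *. (Const 65 +. Const 4 *. reg 2 +. reg 27 div. reg 44)"

definition or_window :: "nat \<Rightarrow> nat \<Rightarrow> nat \<Rightarrow> nat \<Rightarrow> memory \<Rightarrow> memory" where
  "or_window w a p x m = m(a + p div w := Bit_Operations.or (m (a + p div w)) (take_bit w (push_bit (p mod w) x)),
    Suc (a + p div w) := Bit_Operations.or (m (Suc (a + p div w))) (drop_bit (w - p mod w) x))"

lemma bit_or_window:
  assumes w: "0 < w" and x: "x < 2 ^ w"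
  shows "bit (or_window w a p x m (a + i div w)) (i mod w) \<longleftrightarrow>
    bit (m (a + i div w)) (i mod w) \<or> (p \<le> i \<and> bit x (i - p))"
proof -
  define Q s q t where "Q = p div w" and "s = p mod w" and "q = i div w" and "t = i mod w"
  have s: "s < w" "p = Q * w + s" and t: "t < w" "i = q * w + t" using w
    by (auto simp: Q_def s_def q_def t_def)
  have or: "or_window w a p x m = m(a + Q := Bit_Operations.or (m (a + Q)) (take_bit w (push_bit s x)),
    Suc (a + Q) := Bit_Operations.or (m (Suc (a + Q)))
      (drop_bit (w - s) x))" by (simp add: or_window_def Q_def s_def)
  consider "q < Q" | "q = Q" | "q = Suc Q" | "Q + 2 \<le> q" by linarith
  hence "bit (or_window w a p x m (a + q)) t \<longleftrightarrow> bit (m (a + q)) t \<or> (p \<le> i \<and> bit x (i - p))"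
  proof cases
    case 1
    hence "Suc q * w \<le> Q * w" by (intro mult_le_mono1) simp
    hence "\<not> p \<le> i" using s t by simp
    thus ?thesis using 1 by (simp add: or)
  next
    case 2
    hence "p \<le> i \<longleftrightarrow> s \<le> t" "i - p = t - s" using s(2) t(2) by simp_all
    thus ?thesis using 2 t(1) by (simp add: or bit_or_iff bit_take_bit_iff bit_push_bit_iff)
  next
    case 3
    have "i - p = w - s + t" "p \<le> i" using s t 3 by auto
    thus ?thesis using 3 by (simp add: or bit_or_iff bit_drop_bit_eq)
  next
    case 4
    hence "(Q + 2) * w \<le> q * w" by (rule mult_le_mono1)
    hence "w \<le> i - p" using s t by (simp add: algebra_simps)
    hence "\<not> bit x (i - p)" using less_pow_bit[OF x] by (meson not_le)
    thus ?thesis using 4 by (simp add: or)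
  qed
  thus ?thesis by (simp add: q_def t_def)
qed

lemma or_window_less:
  assumes "x < 2 ^ w" "\<And>b. b \<in> B \<Longrightarrow> m b < 2 ^ w" "b \<in> B"
  shows "or_window w a p x m b < 2 ^ w"
proof -
  have "drop_bit (w - p mod w) x < 2 ^ w"
    unfolding drop_bit_eq_div using assms(1) by (rule le_less_trans[OF div_le_dividend])
  hence "take_bit w (drop_bit (w - p mod w) x) = drop_bit (w - p mod w) x" by (rule take_bit_nat_eq_self)
  moreover have "take_bit w (m b) = m b" using assms(2,3) by (intro take_bit_nat_eq_self)
  ultimately have "take_bit w (or_window w a p x m b) = or_window w a p x m b"
    using assms(3) by (auto simp: or_window_def take_bit_or)
  thus ?thesis by (metis take_bit_nat_less_exp)
qed

context ram
begin

lemma fits_position: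
  assumes v: "v \<in> {1..<2 ^ d}" and a: "18 \<le> a"
  shows "fits a (position v)"
  by (rule fits_le[of _ "level_offset (Suc d)"]) (use position_le_end[OF v] a in simp_all)

lemma bit_string_end_less: "64 + 4 * d + level_offset (Suc d) div w + 2 < stride"
proof (rule fits_less_stride)
  have "fits 18 (66 + 4 * d)" "fits 18 (level_offset (Suc d) div w)" by simp_all
  from fits_add[OF _ this[THEN fits_mono[of _ _ "19 - 1"]]]
  show "fits 19 (64 + 4 * d + level_offset (Suc d) div w + 2)" by (simp add: add_ac)
qed simp

lemma window_end_less:
  assumes v: "v \<in> {1..<2 ^ d}"
  shows "position v div w \<le> level_offset (Suc d) div w" "Suc (64 + 4 * d + position v div w) < stride"
proof -
  show "position v div w \<le> level_offset (Suc d) div w" using position_le_end[OF v]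
    by (intro div_le_mono) simp
  thus "Suc (64 + 4 * d + position v div w) < stride" using bit_string_end_less by linarith
qed

lemma less_word: "(x::nat) < 2 ^ (64 * (d + 1)) \<Longrightarrow> x < 2 ^ w"
  by (erule less_le_trans) (simp add: w power_increasing)

lemma denote_write_window:
  assumes m: "m 2 = d" "m 6 = stride" "m 10 = v" "m 44 = w" "m (5 * stride + v) = position v"
    "m (6 * stride + v) = x"
    and v: "v \<in> {1..<2 ^ d}" and x: "x < 2 ^ (64 * (d + 1))"
    and cells: "\<And>b. b \<in> {64 + 4 * d..<stride} \<Longrightarrow> m b < 2 ^ w"
  shows "denote write_window_prog (m, g) = ((or_window w (64 + 4 * d) (position v) x
    (m(41 := position v mod w, 42 := Suc (64 + 4 * d + position v div w), 43 := x)))(10 := Suc v), g)"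
proof -
  let ?a = "64 + 4 * d + position v div w" and ?s = "position v mod w"
  let ?m1 = "m(41 := ?s, 42 := ?a, 43 := x)"
  let ?lo = "Bit_Operations.or (m ?a) (take_bit w (push_bit ?s x))"
    and ?hi = "Bit_Operations.or (m (Suc ?a)) (drop_bit (w - ?s) x)"
  have fits: "fits a v" if "1 \<le> a" for a using v that by (intro fits_le_pow) auto
  have fp: "fits a (position v)" if "18 \<le> a" for a using fits_position[OF v that] .
  have fa: "fits a (position v div w)" "fits a ?s" if "18 \<le> a" for a using fp[OF that] by simp_all
  have a: "?a \<in> {64 + 4 * d..<stride}" "Suc ?a \<in> {64 + 4 * d..<stride}" using window_end_less(2)[OF v]
    by simp_all
  have xw: "drop_bit (w - ?s) x < 2 ^ w"
    unfolding drop_bit_eq_div using less_word[OF x] by (rule le_less_trans[OF div_le_dividend])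
  have words: "take_bit w (m ?a) = m ?a" "take_bit w (m (Suc ?a)) = m (Suc ?a)"
    "take_bit w (drop_bit (w - ?s) x) = drop_bit (w - ?s) x"
    using cells[OF a(1)] cells[OF a(2)] xw by (simp_all add: take_bit_nat_eq_self)
  have "denote write_window_prog (m, g) = denote or_window_prog (denote load_window_prog (m, g))"
    by (simp only: write_window_prog_def denote.simps)
  also have "denote load_window_prog (m, g) = (?m1, g)"
    using m by (simp add: load_window_prog_def fits fp fa fun_eq_iff)
  also have "denote or_window_prog (?m1, g) = (?m1(?a := ?lo, 42 := Suc ?a, Suc ?a := ?hi, 10 := Suc v), g)"
    using m words by (simp add: or_window_prog_def take_bit_or fits fa)
  also have "?m1(?a := ?lo, 42 := Suc ?a, Suc ?a := ?hi, 10 := Suc v) =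
    (or_window w (64 + 4 * d) (position v) x (m(41 := ?s, 42 := Suc ?a, 43 := x)))(10 := Suc v)"
    by (simp add: or_window_def fun_eq_iff)
  finally show ?thesis .
qed

definition write_inv :: "memory \<Rightarrow> (nat \<Rightarrow> nat) \<Rightarrow> nat \<Rightarrow> memory \<Rightarrow> bool" where
  "write_inv m win i m' \<longleftrightarrow> m' 10 = Suc i \<and> unchanged ({10, 41, 42, 43} \<union> {64 + 4 * d..<stride}) m m' \<and>
    (\<forall>b\<in>{64 + 4 * d..<stride}. m' b < 2 ^ w) \<and>
    (\<forall>x. 64 + 4 * d + x div w < stride \<longrightarrow> bit (m' (64 + 4 * d + x div w)) (x mod w) = bit_string win (Suc i) x)"

lemma write_inv_cells:
  assumes "write_inv m win i m'" "prepared m"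
  shows "m' 0 = 2 ^ d" "m' 2 = d" "m' 6 = stride" "m' 44 = w" "m' 27 = level_offset (Suc d)"
proof -
  have "unchanged ({10, 41, 42, 43} \<union> {64 + 4 * d..<stride}) m m'" using assms(1)
    by (simp add: write_inv_def)
  note same = unchangedD[OF this]
  show "m' 0 = 2 ^ d" "m' 2 = d" "m' 6 = stride" "m' 44 = w" "m' 27 = level_offset (Suc d)"
    using same[of 0] same[of 2] same[of 6] same[of 44] same[of 27] assms(2)
      by (simp_all add: prepared_def constants_ok_def w)
qed

lemma runs_write_window:
  assumes F: "found g win m" and inv: "write_inv m win i m'" and i: "i < 2 ^ d - 1"
  shows "runs g write_window_prog m' 90 (write_inv m win (Suc i))"
proof (rule runs_denote)
  let ?v = "Suc i" and ?B = "64 + 4 * d"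
  let ?x = "win ?v"
  let ?m = "m'(41 := position ?v mod w, 42 := Suc (?B + position ?v div w), 43 := ?x)"
  let ?m' = "(or_window w ?B (position ?v) ?x ?m)(10 := Suc ?v)"
  have v: "?v \<in> {1..<2 ^ d}" using i by auto
  have P: "prepared m" and win: "m (6 * stride + ?v) = ?x" "?x < 2 ^ (64 * (d + 1))"
    using F v unfolding found_def valid_window_def by blast+
  note cells = write_inv_cells[OF inv P]
  have same: "unchanged ({10, 41, 42, 43} \<union> {?B..<stride}) m m'"
    and words: "\<And>b. b \<in> {?B..<stride} \<Longrightarrow> m' b < 2 ^ w"
    and bits: "\<And>x. ?B + x div w < stride \<Longrightarrow> bit (m' (?B + x div w)) (x mod w) = bit_string win (Suc i) x"
    using inv by (auto simp: write_inv_def)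
  have arrays: "m' (5 * stride + ?v) = position ?v" "m' (6 * stride + ?v) = ?x"
    using unchangedD[OF same, of "5 * stride + ?v"] unchangedD[OF same, of "6 * stride + ?v"] prepared_node(5)[OF P v] win(1)
    by simp_all
  show "denote write_window_prog (m', g) = (?m', g)"
    by (rule denote_write_window[OF cells(2,3) _ cells(4) arrays v win(2) words])
      (use inv in \<open>simp add: write_inv_def\<close>)
  have "or_window w ?B (position ?v) ?x ?m b < 2 ^ w" if "b \<in> {?B..<stride}" for b
    by (rule or_window_less[OF less_word[OF win(2)] _ that]) (use words in auto)
  moreover have "bit (?m' (?B + x div w)) (x mod w) = bit_string win (Suc ?v) x" if "?B + x div w < stride"
    for x
  proof -
    have "bit (?m' (?B + x div w)) (x mod w) =
      (bit (m' (?B + x div w)) (x mod w) \<or> position ?v \<le> x \<and> bit ?x (x - position ?v))"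
      using bit_or_window[OF w_pos(1) less_word[OF win(2)], of ?B "position ?v" ?m x] by simp
    thus ?thesis using bits[OF that] by (auto simp: bit_string_def atLeastLessThanSuc)
  qed
  moreover have "unchanged ({10, 41, 42, 43} \<union> {?B..<stride}) m ?m'"
    using same window_end_less(2)[OF v] by (simp add: or_window_def)
  ultimately show "write_inv m win ?v ?m'" by (auto simp: write_inv_def)
qed (simp_all add: write_window_prog_def load_window_prog_def or_window_prog_def)

definition written :: "(nat \<Rightarrow> nat) \<Rightarrow> memory \<Rightarrow> bool" where
  "written win m \<longleftrightarrow> m 0 = w * (65 + 4 * d + level_offset (Suc d) div w) \<and> m 2 = d \<and>
    (\<forall>k\<in>{1..d}. header_ok k m) \<and>
    (\<forall>i. 64 + 4 * d + i div w < stride \<longrightarrow> bit (m (64 + 4 * d + i div w)) (i mod w) = bit_string win (2 ^ d) i)"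

lemma written_if_write_inv:
  assumes P: "prepared m" and inv: "write_inv m win (2 ^ d - 1) m'"
  shows "written win (m'(0 := w * (65 + 4 * d + level_offset (Suc d) div w)))"
proof -
  have "header_ok k (m'(0 := x))" if k: "k \<in> {1..d}" for k x
  proof -
    have "(m'(0 := x)) b = m b" if "b \<in> header_cells k" for b
    proof -
      have "68 + 4 * (d - k) \<le> 64 + 4 * d" using k by auto
      thus ?thesis using inv that by (auto simp: write_inv_def unchanged_def header_cells_def)
    qed
    thus ?thesis using header_ok_cong[of k "m'(0 := x)" m] P k by (simp add: prepared_def)
  qed
  thus ?thesis using inv write_inv_cells(2)[OF inv P] by (simp add: written_def write_inv_def)
qed

lemma runs_write:
  assumes F: "found g win m"
  shows "runs g write_prog m (150 * 2 ^ d + 100) (written win)"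
  unfolding write_prog_def
proof (rule runs_Seq_denote)
  have P: "prepared m" using F by (simp add: found_def)
  have inv: "write_inv m win 0 (m(10 := 1))" using P
    by (auto simp: write_inv_def prepared_def bit_string_def)
  have aval: "aval w m' (reg 10 <. reg 0) = of_bool (Suc i < 2 ^ d)" if "write_inv m win i m'" for i m'
    using that write_inv_cells(1)[OF that P] by (simp add: write_inv_def)
  let ?len = "0 ::= reg 44 *. (Const 65 +. Const 4 *. reg 2 +. reg 27 div. reg 44)"
  have loop: "runs g (While (reg 10 <. reg 0) write_window_prog) (m(10 := 1)) (150 * 2 ^ d +
    10) (write_inv m win (2 ^ d - 1))"
  proof (rule runs_for[where I = "write_inv m win" and N = "2 ^ d - 1" and T = "\<lambda>_. 90", OF inv])
    show "aval w m' (reg 10 <. reg 0) \<noteq> 0 \<and> runs g write_window_prog m' 90 (write_inv m win (Suc i))"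
      if "i < 2 ^ d - 1" "write_inv m win i m'" for i m'
        using runs_write_window[OF F that(2,1)] aval[OF that(2)] that(1) by simp
    show "aval w m' (reg 10 <. reg 0) = 0" if "write_inv m win (2 ^ d - 1) m'" for m' using aval[OF that]
      by simp
    have "(\<Sum>i<N. 90 + (1 + 5)) + (1 + 5) \<le> 150 * M + 10" if "N \<le> M" for N M :: nat using that by simp
    from this[of "2 ^ d - 1" "2 ^ d"]
    show "(\<Sum>i<2 ^ d - 1 :: nat. 90 + (1 + acost (reg 10 <. reg 0))) + (1 + acost (reg 10 <. reg 0)) \<le>
      150 * 2 ^ d + 10" by simp
  qed
  show "runs g (While (reg 10 <. reg 0) write_window_prog ;; ?len) (m(10 := 1)) (150 * 2 ^ d + 90) (written win)"
  proof (rule runs_Seq[OF loop])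
    fix m' assume inv: "write_inv m win (2 ^ d - 1) m'"
    show "runs g ?len m' 80 (written win)"
    proof (rule runs_denote)
      show "written win (m'(0 := w * (65 + 4 * d + level_offset (Suc d) div w)))"
        by (rule written_if_write_inv[OF P inv])
      show "denote ?len (m', g) = (m'(0 := w * (65 + 4 * d + level_offset (Suc d) div w)), g)"
        using write_inv_cells[OF inv P] by simp
    qed simp_all
  qed simp
qed simp_all

end

section \<open>Random tables\<close>

definition random_bits :: "nat \<Rightarrow> (nat \<Rightarrow> bool) pmf" where
  "random_bits n = Pi_pmf {..<n} False (\<lambda>_. bernoulli_pmf (1 / 2))"

lemma card_random_bits:
  assumes X: "X \<subseteq> {..<n}"
  shows "map_pmf (\<lambda>f. card {x \<in> X. f x}) (random_bits n) = binomial_pmf (card X) (1 / 2)"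
proof -
  have "finite X" using X by (rule finite_subset) simp
  hence "binomial_pmf (card X) (1 / 2) =
    map_pmf (\<lambda>f. card {x \<in> X. f x}) (Pi_pmf X False (\<lambda>_. bernoulli_pmf (1 / 2)))"
    by (intro binomial_pmf_altdef') auto
  also have "Pi_pmf X False (\<lambda>_. bernoulli_pmf (1 / 2)) =
    map_pmf (\<lambda>f x. if x \<in> X then f x else False) (random_bits n)"
    unfolding random_bits_def by (rule Pi_pmf_subset) (use X in auto)
  also have "map_pmf (\<lambda>f. card {x \<in> X. f x}) ... = map_pmf (\<lambda>f. card {x \<in> X. f x}) (random_bits n)"
    unfolding pmf.map_comp by (intro map_pmf_cong refl) (auto intro!: arg_cong[where f = card])
  finally show ?thesis ..
qed

lemma splits_evenly_random_bits:
  assumes X: "X \<subseteq> {..<n}" "card X = 2 ^ k" and k: "1 \<le> k"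
  shows "map_pmf (splits_evenly X) (random_bits n) = bernoulli_pmf (split_prob k)"
proof -
  define t where "t = (2::nat) ^ (k - 1)"
  have card: "card X = 2 * t" using X(2) k by (cases k) (auto simp: t_def)
  have "map_pmf (splits_evenly X) (random_bits n) =
    map_pmf (\<lambda>c. c = t) (map_pmf (\<lambda>f. card {x \<in> X. f x}) (random_bits n))"
    unfolding pmf.map_comp by (intro map_pmf_cong refl) (auto simp: splits_evenly_def card)
  also have "... = map_pmf (\<lambda>c. c = t) (binomial_pmf (2 * t) (1 / 2))" unfolding card_random_bits[OF X(1)] card ..
  also have "... = bernoulli_pmf (split_prob k)"
  proof (rule pmf_eqI)
    have "pmf (map_pmf (\<lambda>c. c = t) (binomial_pmf (2 * t) (1 / 2))) True =
      measure (binomial_pmf (2 * t) (1 / 2)) {t}"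
      unfolding pmf_map by (rule arg_cong[where f = "measure _"]) auto
    also have "... = real ((2 * t) choose t) * (1 / 2) ^ t * (1 / 2) ^ t" by (simp add: measure_pmf_single)
    also have "... = split_prob k"
      by (simp add: split_prob_def central_binomial_def t_def power_divide flip: power_mult_distrib power_add)
    finally have "pmf (map_pmf (\<lambda>c. c = t) (binomial_pmf (2 * t) (1 / 2))) True = split_prob k" .
    thus "pmf (map_pmf (\<lambda>c. c = t) (binomial_pmf (2 * t) (1 / 2))) i = pmf (bernoulli_pmf (split_prob k)) i"
      for i
      using split_prob_bounds[of k] by (cases i) (simp_all add: pmf_False_conv_True)
  qed
  finally show ?thesis .
qed

context params
begin

definition random_functions :: "(nat \<Rightarrow> nat \<Rightarrow> bool) pmf" where
  "random_functions = Pi_pmf {..<2 ^ (64 * (d + 1))} (\<lambda>_. False) (\<lambda>_. random_bits (2 ^ d))"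

definition random_table :: "nat set \<Rightarrow> table pmf" where
  "random_table A = Pi_pmf A (\<lambda>_ _. False) (\<lambda>_. random_functions)"

abbreviation random_tables :: "table pmf" where
  "random_tables \<equiv> random_table {1..<2 ^ d}"

abbreviation random_segment :: "nat \<Rightarrow> layer list pmf" where
  "random_segment k \<equiv> random_layers (64 * (d + 1)) (split_prob k) (fresh_bits k)"

definition tables_agree :: "nat set \<Rightarrow> table \<Rightarrow> table \<Rightarrow> bool" where
  "tables_agree A T T' \<longleftrightarrow> (\<forall>u\<in>A. \<forall>c<2 ^ (64 * (d + 1)). \<forall>i<2 ^ d. T u c i = T' u c i)"

lemma tables_agree_subset: "tables_agree A T T' \<Longrightarrow> B \<subseteq> A \<Longrightarrow> tables_agree B T T'"
  by (auto simp: tables_agree_def)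

lemma splits_evenly_random_functions:
  assumes X: "X \<subseteq> {..<2 ^ d}" "card X = 2 ^ k" and k: "1 \<le> k"
  shows "map_pmf (\<lambda>f c. c < 2 ^ (64 * (d + 1)) \<and> splits_evenly X (f c)) random_functions =
    random_test (64 * (d + 1)) (split_prob k)"
proof -
  have const: "\<not> splits_evenly X (\<lambda>_. False)" using X by (simp add: splits_evenly_def)
  have "random_test (64 * (d + 1)) (split_prob k) =
      Pi_pmf {..<2 ^ (64 * (d + 1))} False (\<lambda>_. map_pmf (splits_evenly X) (random_bits (2 ^ d)))"
    unfolding splits_evenly_random_bits[OF X k] ..
  also have "... = map_pmf (\<lambda>f. splits_evenly X \<circ> f) random_functions"
    unfolding random_functions_def by (rule Pi_pmf_map) (use const in simp_all)
  also have "... = map_pmf (\<lambda>f c. c < 2 ^ (64 * (d + 1)) \<and> splits_evenly X (f c)) random_functions"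
  proof (rule map_pmf_cong[OF refl])
    fix f assume "f \<in> set_pmf random_functions"
    moreover have "set_pmf random_functions \<subseteq> {f. \<forall>c. c \<notin> {..<2 ^ (64 * (d + 1))} \<longrightarrow> f c = (\<lambda>_. False)}"
      unfolding random_functions_def by (rule set_Pi_pmf_subset) simp
    ultimately have "f c = (\<lambda>_. False)" if "\<not> c < 2 ^ (64 * (d + 1))" for c using that by auto
    hence "splits_evenly X (f c) \<longleftrightarrow> c < 2 ^ (64 * (d + 1)) \<and> splits_evenly X (f c)" for c
      using const by (cases "c < 2 ^ (64 * (d + 1))") simp_all
    thus "splits_evenly X \<circ> f = (\<lambda>c. c < 2 ^ (64 * (d + 1)) \<and> splits_evenly X (f c))" unfolding o_def
      by (rule ext)
  qed
  finally show ?thesis ..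
qed

lemma layers_at_cong:
  assumes "tables_agree {v..<v + length bs} T T'" "\<And>u. Xs u \<subseteq> {..<2 ^ d}"
  shows "layers_at T Xs v bs = layers_at T' Xs v bs"
  using assms(1)
proof (induction bs arbitrary: v)
  case (Cons b bs)
  have "tables_agree {Suc v..<Suc v + length bs} T T'" using Cons.prems by (rule tables_agree_subset) auto
  moreover have "{i \<in> Xs v. T v c i} = {i \<in> Xs v. T' v c i}" if "c < 2 ^ (64 * (d + 1))" for c
    using Cons.prems that assms(2)[of v] by (auto simp: tables_agree_def)
  hence "(c < 2 ^ (64 * (d + 1)) \<and> splits_evenly (Xs v) (T v c)) =
    (c < 2 ^ (64 * (d + 1)) \<and> splits_evenly (Xs v) (T' v c))" for c
    by (auto simp: splits_evenly_def)
  ultimately show ?case using Cons.IH by simp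
qed simp

lemma layers_at_random_table:
  assumes "\<And>u. u \<in> {v..<v + length bs} \<Longrightarrow> Xs u \<subseteq> {..<2 ^ d} \<and> card (Xs u) = 2 ^ k" and k: "1 \<le> k"
  shows "map_pmf (\<lambda>T. layers_at T Xs v bs) (random_table {v..<v + length bs}) =
    random_layers (64 * (d + 1)) (split_prob k) bs"
  using assms(1)
proof (induction bs arbitrary: v)
  case (Cons b bs)
  let ?W = "64 * (d + 1)" and ?A = "{Suc v..<Suc v + length bs}"
  have A: "{v..<v + length (b # bs)} = insert v ?A" by auto
  have table: "random_table (insert v ?A) =
    bind_pmf random_functions (\<lambda>f. map_pmf (\<lambda>T. T(v := f)) (random_table ?A))"
    unfolding random_table_def by (subst Pi_pmf_insert') (simp_all add: map_pmf_def)
  have later: "layers_at (T(v := f)) Xs w bs' = layers_at T Xs w bs'" if "v < w" for T f w bs'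
    using that by (induction bs' arbitrary: w) auto
  have IH: "map_pmf (\<lambda>T. layers_at T Xs (Suc v) bs) (random_table ?A) = random_layers ?W (split_prob k) bs"
    by (rule Cons.IH) (use Cons.prems in auto)
  have X: "Xs v \<subseteq> {..<2 ^ d}" "card (Xs v) = 2 ^ k" using Cons.prems[of v] by auto
  have "map_pmf (\<lambda>T. layers_at T Xs v (b # bs)) (random_table (insert v ?A)) =
      bind_pmf random_functions (\<lambda>f. map_pmf (\<lambda>ls. (\<lambda>c. c < 2 ^ ?W \<and> splits_evenly (Xs v) (f c), b) # ls)
        (map_pmf (\<lambda>T. layers_at T Xs (Suc v) bs) (random_table ?A)))"
    unfolding table map_bind_pmf pmf.map_comp o_def by (simp add: later)
  also have "... = bind_pmf (map_pmf (\<lambda>f c. c < 2 ^ ?W \<and> splits_evenly (Xs v) (f c)) random_functions)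
      (\<lambda>ok. map_pmf (\<lambda>ls. (ok, b) # ls) (random_layers ?W (split_prob k) bs))" unfolding IH bind_map_pmf ..
  also have "... = random_layers ?W (split_prob k) (b # bs)" unfolding splits_evenly_random_functions[OF X k] by simp
  finally show ?case unfolding A .
qed (simp add: random_table_def)

lemma nn_integral_random_table_Un:
  assumes "finite A" "finite B" "A \<inter> B = {}"
  shows "(\<integral>\<^sup>+T. f T \<partial>random_table (A \<union> B)) =
    (\<integral>\<^sup>+T1. \<integral>\<^sup>+T2. f (\<lambda>u. if u \<in> A then T1 u else T2 u) \<partial>random_table B \<partial>random_table A)"
  unfolding random_table_def Pi_pmf_union[OF assms] nn_integral_map_pmf nn_integral_pair_pmf' by simp

end

section \<open>Expectations over the visited segments\<close>

context params
begin

definition well_split :: "nat \<Rightarrow> (nat \<Rightarrow> nat set) \<Rightarrow> bool" where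
  "well_split v Xs \<longleftrightarrow> (\<forall>u. Xs u \<subseteq> {..<2 ^ d}) \<and>
    (\<forall>u. 1 \<le> u \<and> u div 2 < v \<and> u < 2 * 2 ^ d \<longrightarrow> card (Xs u) = 2 ^ height u)"

lemma well_splitD:
  assumes "well_split v Xs"
  shows "Xs u \<subseteq> {..<2 ^ d}" "finite (Xs u)"
    "1 \<le> u \<Longrightarrow> u div 2 < v \<Longrightarrow> u < 2 * 2 ^ d \<Longrightarrow> card (Xs u) = 2 ^ height u"
  using assms by (auto simp: well_split_def intro: finite_subset)

lemma well_split_root: "well_split 1 (\<lambda>_. {..<2 ^ d})"
proof -
  have "height u = d" if "1 \<le> u" "u div 2 < 1" for u
  proof -
    have "u = 1" using that by linarith
    thus ?thesis by (simp add: height_def)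
  qed
  thus ?thesis by (simp add: well_split_def)
qed

lemma card_halves:
  assumes "finite X" "splits_evenly X P"
  shows "2 * card {i \<in> X. P i \<longleftrightarrow> b} = card X"
proof -
  have "card {i \<in> X. P i} + card {i \<in> X. \<not> P i} = card ({i \<in> X. P i} \<union> {i \<in> X. \<not> P i})"
    using assms(1) by (intro card_Un_disjoint[symmetric]) auto
  also have "{i \<in> X. P i} \<union> {i \<in> X. \<not> P i} = X" by auto
  finally show ?thesis using assms(2) by (cases b) (simp_all add: splits_evenly_def)
qed

context
  fixes v assumes start: "seg_start v" and v: "v < 2 ^ d"
begin

lemma segment_layers_cong:
  assumes "tables_agree {v..<segment_end v} T T'" "\<And>u. Xs u \<subseteq> {..<2 ^ d}"
  shows "segment_layers T Xs v = segment_layers T' Xs v"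
  unfolding segment_layers_def by (rule layers_at_cong) (use assms in \<open>simp_all add: segment_end_def\<close>)

context
  fixes T Xs p
  assumes path: "fst (root_search (segment_layers T Xs v)) = Some p"
begin

lemma refine_cong:
  assumes agree: "tables_agree {v..<segment_end v} T T'" and X: "\<And>u. Xs u \<subseteq> {..<2 ^ d}"
  shows "refine T v p Xs = refine T' v p Xs"
proof
  fix u
  have "T (u div 2) (p ! (u div 2 - v)) i = T' (u div 2) (p ! (u div 2 - v)) i"
    if "v \<le> u div 2" "u div 2 < v + length p" "i \<in> Xs (u div 2)" for i
  proof -
    have "u div 2 \<in> {v..<segment_end v}" "u div 2 - v < 2 ^ seg_exp (height v)"
      using that length_path[OF start v path] by (auto simp: segment_end_def)
    moreover have "i < 2 ^ d" using that(3) X by auto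
    ultimately show ?thesis using agree path_nth[OF start v path] unfolding tables_agree_def by blast
  qed
  thus "refine T v p Xs u = refine T' v p Xs u" unfolding refine_def by auto
qed

lemma well_split_refine:
  assumes ws: "well_split v Xs"
  shows "well_split (segment_end v) (refine T v p Xs)"
  unfolding well_split_def
proof (intro conjI allI impI)
  fix u
  show "refine T v p Xs u \<subseteq> {..<2 ^ d}" using well_splitD(1)[OF ws] by (auto simp: refine_def)
  assume u: "1 \<le> u \<and> u div 2 < segment_end v \<and> u < 2 * 2 ^ d"
  show "card (refine T v p Xs u) = 2 ^ height u"
  proof (cases "u div 2 < v")
    case True
    thus ?thesis using u well_splitD(3)[OF ws] by (simp add: refine_def)
  next
    case False
    let ?x = "u div 2"
    have x: "v \<le> ?x" "1 \<le> ?x" "?x div 2 < v" "?x < 2 ^ d" and r: "?x - v < 2 ^ seg_exp (height v)"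
      using False u parent_before_segment[OF start v, of ?x] seg_start_node[OF start v]
        by (auto simp: segment_end_def)
    have "floor_log u = Suc (floor_log ?x)" using floor_log_rec[of u] x by simp
    hence height: "height ?x = Suc (height u)" using floor_log_less[OF x(2,4)] by (simp add: height_def)
    have "splits_evenly (Xs ?x) (T ?x (p ! (?x - v)))" using path_nth[OF start v path r] x(1) by simp
    hence "2 * card {i \<in> Xs ?x. T ?x (p ! (?x - v)) i \<longleftrightarrow> u mod 2 = 1} = card (Xs ?x)"
      by (rule card_halves[OF well_splitD(2)[OF ws]])
    also have "... = 2 * 2 ^ height u" using well_splitD(3)[OF ws x(2,3)] x(4) by (simp add: height)
    finally show ?thesis using x(1) r length_path[OF start v path] by (simp add: refine_def)
  qed
qed

end

end

lemma visit_cong: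
  assumes "tables_agree {v..<2 ^ d} T T'" "\<And>u. Xs u \<subseteq> {..<2 ^ d}" "seg_start v"
  shows "visit T v Xs = visit T' v Xs"
  using assms
proof (induction "2 ^ d - v" arbitrary: v Xs rule: less_induct)
  case (less v Xs)
  show ?case
  proof (cases "v < 2 ^ d")
    case v: True
    note start = less.prems(3)
    have agree: "tables_agree {v..<segment_end v} T T'" "tables_agree {segment_end v..<2 ^ d} T T'"
      using segment_end_le[OF start v]
        by (auto intro!: tables_agree_subset[OF less.prems(1)] simp: segment_end_def)
    have "visit T (segment_end v) (refine T v p Xs) = visit T' (segment_end v) (refine T' v p Xs)"
      if "fst (root_search (segment_layers T Xs v)) = Some p" for p
      unfolding refine_cong[OF start v that agree(1) less.prems(2), symmetric]
    proof (rule less.hyps[OF _ agree(2) _ seg_start_segment_end[OF start v]])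
      show "2 ^ d - segment_end v < 2 ^ d - v" using v by (simp add: segment_end_def diff_less_mono2)
      show "refine T v p Xs u \<subseteq> {..<2 ^ d}" for u using less.prems(2) by (auto simp: refine_def)
    qed
    thus ?thesis using v segment_layers_cong[OF start v agree(1) less.prems(2)]
      by (auto simp: visit_Cons split: option.splits)
  qed (simp add: visit_Nil)
qed

lemma visit_merge:
  assumes start: "seg_start v" and v: "v < 2 ^ d" and X: "\<And>u. Xs u \<subseteq> {..<2 ^ d}"
  shows "visit (\<lambda>u. if u \<in> {v..<segment_end v} then T1 u else T2 u) v Xs =
    (height v, segment_layers T1 Xs v) # (case fst (root_search (segment_layers T1 Xs v)) of None \<Rightarrow> []
      | Some p \<Rightarrow> visit T2 (segment_end v) (refine T1 v p Xs))"
proof -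
  let ?T = "\<lambda>u. if u \<in> {v..<segment_end v} then T1 u else T2 u"
  have agree: "tables_agree {v..<segment_end v} T1 ?T" "tables_agree {segment_end v..<2 ^ d} ?T T2"
    by (auto simp: tables_agree_def)
  have "visit ?T (segment_end v) (refine ?T v p Xs) = visit T2 (segment_end v) (refine T1 v p Xs)"
    if "fst (root_search (segment_layers T1 Xs v)) = Some p" for p
    unfolding refine_cong[OF start v that agree(1) X, symmetric]
    by (rule visit_cong[OF agree(2) _ seg_start_segment_end[OF start v]]) (use X in \<open>auto simp: refine_def\<close>)
  thus ?thesis using v by (simp add: visit_Cons segment_layers_cong[OF start v agree(1) X] split: option.split)
qed

lemma segment_layers_random_table:
  assumes start: "seg_start v" and v: "v < 2 ^ d" and ws: "well_split v Xs"
  shows "map_pmf (\<lambda>T. segment_layers T Xs v) (random_table {v..<segment_end v}) =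
    random_segment (height v)"
proof -
  have "map_pmf (\<lambda>T. layers_at T Xs v (fresh_bits (height v))) (random_table {v..<v + length (fresh_bits (height v))}) =
    random_segment (height v)"
  proof (rule layers_at_random_table)
    fix u assume u: "u \<in> {v..<v + length (fresh_bits (height v))}"
    hence "height u = height v" using segment_coords(2)[OF start v, of "u - v"] by auto
    moreover have "1 \<le> u" "u div 2 < v" "u < 2 * 2 ^ d"
      using u parent_before_segment[OF start v, of u] segment_end_le[OF start v] seg_start_node[OF start v]
      by (auto simp: segment_end_def)
    ultimately show "Xs u \<subseteq> {..<2 ^ d} \<and> card (Xs u) = 2 ^ height v" using well_splitD[OF ws, of u] by simp
  qed (use seg_start_height[OF start v] in simp)
  thus ?thesis by (simp add: segment_layers_def segment_end_def)
qed

lemma sum_over_levels: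
  fixes b :: "nat \<Rightarrow> ennreal"
  shows "(\<Sum>u=1..<2 ^ d. b (height u)) = (\<Sum>k=1..d. of_nat (2 ^ (d - k)) * b k)"
proof -
  have "(\<Sum>u=1..<2 ^ e. b (height u)) = (\<Sum>j<e. of_nat (2 ^ j) * b (d - j))" for e
  proof (induction e)
    case (Suc e)
    have "(\<Sum>u=1..<2 ^ Suc e. b (height u)) =
      (\<Sum>u=1..<2 ^ e. b (height u)) + (\<Sum>u=2 ^ e..<2 ^ Suc e. b (height u))"
      by (rule sum.atLeastLessThan_concat[symmetric]) auto
    also have "(\<Sum>u=2 ^ e..<2 ^ Suc e. b (height u)) = (\<Sum>u=(2::nat) ^ e..<2 ^ Suc e. b (d - e))"
    proof (intro sum.cong refl)
      fix u :: nat assume u: "u \<in> {2 ^ e..<2 ^ Suc e}"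
      have "floor_log u = e" using u by (intro floor_log_eqI) (auto intro: less_le_trans[of 0 "2 ^ e"])
      thus "b (height u) = b (d - e)" by (simp add: height_def)
    qed
    finally show ?case using Suc by simp
  qed simp
  also have "(\<Sum>j<d. of_nat (2 ^ j) * b (d - j)) = (\<Sum>k=1..d. of_nat (2 ^ (d - k)) * b k)"
    by (rule sum.reindex_bij_witness[of _ "\<lambda>k. d - k" "\<lambda>j. d - j"]) auto
  finally show ?thesis .
qed

context
  fixes g :: "nat \<Rightarrow> layer list \<Rightarrow> ennreal"
begin

lemma expected_visit_Cons:
  assumes start: "seg_start v" and v: "v < 2 ^ d" and ws: "well_split v Xs"
    and rest: "\<And>T p. fst (root_search (segment_layers T Xs v)) = Some p \<Longrightarrow>
      (\<integral>\<^sup>+T'. (\<Sum>(k, ls)\<leftarrow>visit T' (segment_end v) (refine T v p Xs). g k ls) \<partial>random_table {segment_end v..<2 ^ d}) \<le> R"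
  shows "(\<integral>\<^sup>+T. (\<Sum>(k, ls)\<leftarrow>visit T v Xs. g k ls) \<partial>random_table {v..<2 ^ d}) \<le>
    (\<integral>\<^sup>+ls. g (height v) ls \<partial>random_segment (height v)) + R"
proof -
  let ?A = "{v..<segment_end v}" and ?B = "{segment_end v..<2 ^ d}"
  let ?first = "\<lambda>T. g (height v) (segment_layers T Xs v)"
  note merge = visit_merge[OF start v well_splitD(1)[OF ws]]
  have AB: "{v..<2 ^ d} = ?A \<union> ?B" using segment_end_le[OF start v] by (auto simp: segment_end_def)
  have given_first: "(\<integral>\<^sup>+T2. (\<Sum>(k, ls)\<leftarrow>visit (\<lambda>u. if u \<in> ?A then T1 u else T2 u) v Xs. g k ls) \<partial>random_table
    ?B) \<le> ?first T1 + R" for T1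
  proof (cases "fst (root_search (segment_layers T1 Xs v))")
    case None
    thus ?thesis unfolding merge by (simp add: measure_pmf.emeasure_space_1 add_increasing2)
  next
    case (Some p)
    have "(\<integral>\<^sup>+T2. (\<Sum>(k, ls)\<leftarrow>visit (\<lambda>u. if u \<in> ?A then T1 u else T2 u) v Xs. g k ls) \<partial>random_table ?B) =
      (\<integral>\<^sup>+T2. ?first T1 + (\<Sum>(k, ls)\<leftarrow>visit T2 (segment_end v) (refine T1 v p Xs). g k ls) \<partial>random_table ?B)"
      unfolding merge Some by simp
    also have "... = ?first T1 +
      (\<integral>\<^sup>+T2. (\<Sum>(k, ls)\<leftarrow>visit T2 (segment_end v) (refine T1 v p Xs). g k ls) \<partial>random_table ?B)"
      by (subst nn_integral_add) (simp_all add: measure_pmf.emeasure_space_1)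
    also have "... \<le> ?first T1 + R" by (intro add_left_mono rest Some)
    finally show ?thesis .
  qed
  have "(\<integral>\<^sup>+T. (\<Sum>(k, ls)\<leftarrow>visit T v Xs. g k ls) \<partial>random_table {v..<2 ^ d}) \<le>
    (\<integral>\<^sup>+T1. ?first T1 + R \<partial>random_table ?A)"
    unfolding AB by (subst nn_integral_random_table_Un)
      (simp, simp, force, rule nn_integral_mono, rule given_first)
  also have "... = (\<integral>\<^sup>+T1. ?first T1 \<partial>random_table ?A) + R"
    by (subst nn_integral_add) (simp_all add: measure_pmf.emeasure_space_1)
  also have "(\<integral>\<^sup>+T1. ?first T1 \<partial>random_table ?A) =
    (\<integral>\<^sup>+ls. g (height v) ls \<partial>random_segment (height v))"
    unfolding segment_layers_random_table[OF start v ws, symmetric] nn_integral_map_pmf ..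
  finally show ?thesis .
qed

context
  fixes b :: "nat \<Rightarrow> ennreal"
  assumes segment: "\<And>k. k \<in> {1..d} \<Longrightarrow>
    (\<integral>\<^sup>+ls. g k ls \<partial>random_segment k) \<le> of_nat (2 ^ seg_exp k) * b k"
begin

lemma expected_visit_le:
  assumes "seg_start v" "well_split v Xs"
  shows "(\<integral>\<^sup>+T. (\<Sum>(k, ls)\<leftarrow>visit T v Xs. g k ls) \<partial>random_table {v..<2 ^ d}) \<le> (\<Sum>u=v..<2 ^ d. b (height u))"
  using assms
proof (induction "2 ^ d - v" arbitrary: v Xs rule: less_induct)
  case (less v Xs)
  show ?case
  proof (cases "v < 2 ^ d")
    case v: True
    note start = less.prems(1) and ws = less.prems(2)
    let ?R = "\<Sum>u=segment_end v..<2 ^ d. b (height u)"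
    have shorter: "2 ^ d - segment_end v < 2 ^ d - v" using v by (simp add: segment_end_def diff_less_mono2)
    have "(\<integral>\<^sup>+T. (\<Sum>(k, ls)\<leftarrow>visit T v Xs. g k ls) \<partial>random_table {v..<2 ^ d}) \<le>
      (\<integral>\<^sup>+ls. g (height v) ls \<partial>random_segment (height v)) + ?R"
      by (intro expected_visit_Cons[OF start v ws] less.hyps[OF shorter] seg_start_segment_end[OF start v]
        well_split_refine[OF start v _ ws])
    also have "... \<le> of_nat (2 ^ seg_exp (height v)) * b (height v) + ?R"
      by (intro add_right_mono segment seg_start_height[OF start v])
    also have "of_nat (2 ^ seg_exp (height v)) * b (height v) = (\<Sum>u=v..<segment_end v. b (height v))"
      by (simp add: segment_end_def)
    also have "... = (\<Sum>u=v..<segment_end v. b (height u))"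
    proof (intro sum.cong refl)
      fix u assume "u \<in> {v..<segment_end v}"
      thus "b (height v) = b (height u)" using segment_coords(2)[OF start v, of "u - v"]
        by (auto simp: segment_end_def)
    qed
    also have "... + ?R = (\<Sum>u=v..<2 ^ d. b (height u))"
      by (rule sum.atLeastLessThan_concat) (use segment_end_le[OF start v] in \<open>auto simp: segment_end_def\<close>)
    finally show ?thesis .
  qed (simp add: visit_Nil)
qed

lemma expected_visit_all_le:
  "(\<integral>\<^sup>+T. (\<Sum>(k, ls)\<leftarrow>visit_all T. g k ls) \<partial>random_tables) \<le> (\<Sum>k=1..d. of_nat (2 ^ (d - k)) * b k)"
  using expected_visit_le[OF seg_start_1 well_split_root] unfolding visit_all_def sum_over_levels .

end

lemma expected_visit_all_const_le:
  assumes "\<And>k. k \<in> {1..d} \<Longrightarrow>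
      (\<integral>\<^sup>+ls. g k ls \<partial>random_segment k) \<le> of_nat (2 ^ seg_exp k) * ennreal c"
    and c: "0 \<le> c"
  shows "(\<integral>\<^sup>+T. (\<Sum>(k, ls)\<leftarrow>visit_all T. g k ls) \<partial>random_tables) \<le> ennreal (2 ^ d * c)"
proof -
  have "(\<integral>\<^sup>+T. (\<Sum>(k, ls)\<leftarrow>visit_all T. g k ls) \<partial>random_tables) \<le> (\<Sum>u=1..<(2::nat) ^ d. ennreal c)"
    using expected_visit_all_le[of "\<lambda>_. ennreal c", OF assms(1)] unfolding sum_over_levels[of "\<lambda>_. ennreal c"] .
  also have "... \<le> (\<Sum>u<(2::nat) ^ d. ennreal c)" by (rule sum_mono2) auto
  also have "... = ennreal (2 ^ d * c)" using c
    by (simp add: ennreal_mult ennreal_of_nat_eq_real_of_nat flip: ennreal_power ennreal_numeral)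
  finally show ?thesis .
qed

end

end

section \<open>Expected cost of an attempt\<close>

lemma of_bool_Bex_snd_le: "(of_bool (\<exists>(k, l)\<in>set xs. P l) :: ennreal) \<le> (\<Sum>(k, l)\<leftarrow>xs. of_bool (P l))"
proof (induction xs)
  case (Cons x xs)
  have "(of_bool (\<exists>(k, l)\<in>set (x # xs). P l) :: ennreal) \<le>
    of_bool (P (snd x)) + of_bool (\<exists>(k, l)\<in>set xs. P l)" by auto
  also have "... \<le> of_bool (P (snd x)) + (\<Sum>(k, l)\<leftarrow>xs. of_bool (P l))" by (rule add_left_mono[OF Cons])
  finally show ?case by (simp add: case_prod_unfold)
qed simp

lemma ennreal_two_power: "(2::ennreal) ^ n = ennreal (2 ^ n)"
  by (simp add: ennreal_power flip: ennreal_numeral)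

lemma one_minus_power_le:
  fixes q :: real
  assumes q: "0 < q" "q \<le> 1" and n: "0 < n"
  shows "(1 - q) ^ n \<le> (1 / q) / real n"
proof -
  have "(1 - q) ^ n * (1 + real n * q) \<le> (1 - q) ^ n * (1 + q) ^ n"
    using q by (intro mult_left_mono Bernoulli_inequality) auto
  also have "... = ((1 - q) * (1 + q)) ^ n" by (simp add: power_mult_distrib)
  also have "... \<le> 1" using q by (intro power_le_one) (auto simp: algebra_simps mult_le_one)
  finally have "(1 - q) ^ n + (1 - q) ^ n * (real n * q) \<le> 1" by (simp only: distrib_left mult_1_right)
  moreover have "0 \<le> (1 - q) ^ n" using q by simp
  ultimately have "(1 - q) ^ n * (real n * q) \<le> 1" by linarith
  thus ?thesis using q n by (simp add: field_simps)
qed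

context params
begin

definition some_repeat :: "(nat \<times> layer list) list \<Rightarrow> bool" where
  "some_repeat vs \<longleftrightarrow> (\<exists>(k, ls)\<in>set vs. root_repeats ls)"

lemma fresh_bits_le_window: "k \<in> {1..d} \<Longrightarrow> \<forall>b\<in>set (fresh_bits k). b \<le> 64 * (d + 1)"
  using fresh_bits_le[of k] by fastforce

lemma total_cost_le_sum: "of_nat (total_cost vs) * of_bool (\<not> some_repeat vs) \<le>
  (\<Sum>(k, ls)\<leftarrow>vs. 2 ^ k * (of_nat (snd (root_search ls)) * of_bool (\<not> root_repeats ls)) :: ennreal)"
proof (cases "some_repeat vs")
  case False
  hence "of_nat (total_cost vs) =
    (\<Sum>(k, ls)\<leftarrow>vs. 2 ^ k * (of_nat (snd (root_search ls)) * of_bool (\<not> root_repeats ls)) :: ennreal)"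
    by (induction vs) (auto simp: total_cost_def some_repeat_def)
  thus ?thesis using False by simp
qed simp

lemma expected_total_cost_no_repeat:
  "(\<integral>\<^sup>+T. of_nat (total_cost (visit_all T)) * of_bool (\<not> some_repeat (visit_all T)) \<partial>random_tables) \<le>
    ennreal search_cost_bound"
proof -
  let ?g = "\<lambda>k ls. 2 ^ k * (of_nat (snd (root_search ls)) * of_bool (\<not> root_repeats ls)) :: ennreal"
  let ?c = "\<lambda>k. 6 * 2 ^ slack k / split_prob k"
  have c: "0 \<le> ?c k" for k using split_prob_bounds[of k] by simp
  have "(\<integral>\<^sup>+T. of_nat (total_cost (visit_all T)) * of_bool (\<not> some_repeat (visit_all T)) \<partial>random_tables) \<le>
      (\<integral>\<^sup>+T. (\<Sum>(k, ls)\<leftarrow>visit_all T. ?g k ls) \<partial>random_tables)"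
    by (intro nn_integral_mono total_cost_le_sum)
  also have "... \<le> (\<Sum>k=1..d. of_nat (2 ^ (d - k)) * ennreal (2 ^ k * ?c k))"
  proof (rule expected_visit_all_le)
    fix k assume k: "k \<in> {1..d}"
    have "(\<integral>\<^sup>+ls. ?g k ls \<partial>random_segment k) =
        2 ^ k * (\<integral>\<^sup>+ls. of_nat (snd (root_search ls)) * of_bool (\<not> root_repeats ls)
          \<partial>random_segment k)" by (rule nn_integral_cmult) simp
    also have "... \<le> 2 ^ k * ennreal (expected_tests (split_prob k) (fresh_bits k))"
      by (intro mult_left_mono expected_search_tests split_prob_pos split_prob_bounds
        fresh_bits_le_window[OF k] roots_less) simp
    also have "... \<le> 2 ^ k * ennreal (real (2 ^ seg_exp k) * ?c k)"
      by (intro mult_left_mono ennreal_leI expected_tests_fresh_bits_le[OF k]) simp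
    also have "... = of_nat (2 ^ seg_exp k) * ennreal (2 ^ k * ?c k)"
      using split_prob_pos[of k] unfolding ennreal_two_power ennreal_of_nat_eq_real_of_nat
      by (subst (1 2) ennreal_mult[symmetric]) (simp_all add: ac_simps)
    finally show "(\<integral>\<^sup>+ls. ?g k ls \<partial>random_segment k) \<le>
      of_nat (2 ^ seg_exp k) * ennreal (2 ^ k * ?c k)" .
  qed
  also have "... = (\<Sum>k=1..d. ennreal (2 ^ (d - k) * (2 ^ k * ?c k)))"
    unfolding ennreal_of_nat_eq_real_of_nat
    by (intro sum.cong refl, subst ennreal_mult[symmetric])
      (simp_all add: zero_le_divide_iff split_prob_bounds)
  also have "... = ennreal (\<Sum>k=1..d. 2 ^ (d - k) * (2 ^ k * ?c k))"
    by (rule sum_ennreal) (intro mult_nonneg_nonneg c, simp_all)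
  also have "... \<le> ennreal search_cost_bound" by (intro ennreal_leI sum_search_cost_le)
  finally show ?thesis .
qed

lemma prob_segment_repeats:
  assumes k: "k \<in> {1..d}"
  shows "(\<integral>\<^sup>+ls. of_bool (root_repeats ls) \<partial>random_segment k) \<le>
    of_nat (2 ^ seg_exp k) * ennreal (1 / 2 ^ (31 * (d + 1)))" (is "?I \<le> _")
proof -
  let ?D = "d + 1" and ?n = "of_nat (2 ^ seg_exp k) :: ennreal" and ?two = "2 :: ennreal"
  let ?G = "?two ^ (5 * ?D)"
  have growth: "growth (ennreal (split_prob k)) t (drop s (fresh_bits k)) \<le> ?G" for s t
    using growth_ennreal[of "split_prob k" t "drop s (fresh_bits k)"] split_prob_bounds(1)[of
      k] growth_fresh_bits_le[OF k, of t s]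
    unfolding ennreal_two_power by (simp add: ennreal_leI)
  have four: "(4::ennreal) ^ n = ?two ^ (2 * n)" for n by (simp add: power_mult)
  have "?two ^ (64 * ?D) * ?I \<le> ?n * (?G\<^sup>2 * 4 ^ (8 * ?D) + ?n * (?G ^ 3 * 4 ^ (4 * ?D)) * 2 ^ (8 * ?D))"
    using prob_repeats[of "split_prob k" "fresh_bits k" "64 * ?D" "4 * ?D" "8 * ?D" ?G]
      split_prob_pos split_prob_bounds fresh_bits_le_window[OF k] fresh_bits_le[OF k] growth
        by (simp add: roots_def)
  also have "?G\<^sup>2 * 4 ^ (8 * ?D) = ?two ^ (26 * ?D)"
    unfolding four power_mult[symmetric] power_add[symmetric] by (rule arg_cong[where f = "power 2"]) simp
  also have "?n * (?G ^ 3 * 4 ^ (4 * ?D)) * 2 ^ (8 * ?D) = ?n * ?two ^ (31 * ?D)"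
    unfolding mult.assoc four power_mult[symmetric] power_add[symmetric]
    by (rule arg_cong[where f = "\<lambda>e. _ * 2 ^ e"]) simp
  also have "?n * (?two ^ (26 * ?D) + ?n * ?two ^ (31 * ?D)) \<le>
    ?n * (?two ^ (32 * ?D) + ?two ^ ?D * ?two ^ (31 * ?D))"
  proof (intro mult_left_mono add_mono mult_right_mono)
    show "?n \<le> ?two ^ ?D"
      unfolding of_nat_power of_nat_numeral by (intro power_increasing order_trans[OF seg_exp_le(2)]) auto
  qed (simp_all add: power_increasing)
  also have "?two ^ ?D * ?two ^ (31 * ?D) = ?two ^ (32 * ?D)"
    unfolding power_add[symmetric] by (rule arg_cong[where f = "power 2"]) simp
  also have "?n * (?two ^ (32 * ?D) + ?two ^ (32 * ?D)) = ?n * ?two ^ Suc (32 * ?D)"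
    by (simp only: power_Suc mult_2)
  also have "... \<le> ?n * ?two ^ (33 * ?D)" by (intro mult_left_mono power_increasing) auto
  also have "?two ^ (64 * ?D) = ?two ^ (33 * ?D) * ?two ^ (31 * ?D)"
    unfolding power_add[symmetric] by (rule arg_cong[where f = "power 2"]) simp
  finally have "?two ^ (33 * ?D) * (?two ^ (31 * ?D) * ?I) \<le> ?two ^ (33 * ?D) * ?n" by (simp only: mult_ac)
  hence "?two ^ (31 * ?D) * ?I \<le> ?n"
    by (subst (asm) ennreal_mult_le_mult_iff) (simp_all add: power_eq_top_ennreal)
  hence "ennreal (1 / 2 ^ (31 * ?D)) * (?two ^ (31 * ?D) * ?I) \<le> ennreal (1 / 2 ^ (31 * ?D)) * ?n"
    by (rule mult_left_mono) simp
  moreover have "ennreal (1 / 2 ^ (31 * ?D)) * ?two ^ (31 * ?D) = 1"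
    unfolding ennreal_two_power by (subst ennreal_mult[symmetric]) simp_all
  ultimately show ?thesis by (simp add: mult.commute mult.left_commute flip: mult.assoc)
qed

lemma prob_some_repeat:
  "(\<integral>\<^sup>+T. of_bool (some_repeat (visit_all T)) \<partial>random_tables) \<le> ennreal (2 ^ d * (1 / 2 ^ (31 * (d + 1))))"
proof -
  have "(\<integral>\<^sup>+T. of_bool (some_repeat (visit_all T)) \<partial>random_tables) \<le>
      (\<integral>\<^sup>+T. (\<Sum>(k, ls)\<leftarrow>visit_all T. of_bool (root_repeats ls)) \<partial>random_tables)"
    unfolding some_repeat_def by (intro nn_integral_mono of_bool_Bex_snd_le)
  also have "... \<le> ennreal (2 ^ d * (1 / 2 ^ (31 * (d + 1))))"
    by (intro expected_visit_all_const_le prob_segment_repeats) simp_all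
  finally show ?thesis .
qed

lemma prob_segment_fails:
  assumes k: "k \<in> {1..d}"
  shows "(\<integral>\<^sup>+ls. of_bool (root_fails ls \<and> \<not> root_repeats ls)
      \<partial>random_segment k) \<le> of_nat (2 ^ seg_exp k) * ennreal (1 / 2 ^ (2 * (d + 1)))"
proof -
  let ?q = "success_prob (split_prob k) (fresh_bits k)" and ?N = "length roots"
  have q: "0 < ?q" "?q \<le> 1" using success_prob_bounds[OF split_prob_pos split_prob_bounds(2)] by auto
  have N: "?N = 2 ^ (8 * (d + 1))" by (simp add: roots_def)
  have "(\<integral>\<^sup>+ls. of_bool (root_fails ls \<and> \<not> root_repeats ls)
      \<partial>random_segment k) \<le> ennreal ((1 - ?q) ^ ?N)"
    by (intro prob_fails split_prob_pos split_prob_bounds fresh_bits_le_window[OF k] roots_less)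
  also have "... \<le> ennreal (1 / 2 ^ (2 * (d + 1)))"
  proof (rule ennreal_leI)
    have "(1 - ?q) ^ ?N \<le> (1 / ?q) / real ?N" by (rule one_minus_power_le[OF q]) (simp add: N)
    also have "... \<le> 2 ^ (6 * (d + 1)) / real ?N"
      by (intro divide_right_mono inverse_success_prob_fresh_bits_le[OF k]) simp
    also have "real ?N = 2 ^ (6 * (d + 1)) * 2 ^ (2 * (d + 1))"
      unfolding N power_add[symmetric] of_nat_power of_nat_numeral
        by (rule arg_cong[where f = "power 2"]) simp
    finally show "(1 - ?q) ^ ?N \<le> 1 / 2 ^ (2 * (d + 1))" by simp
  qed
  also have "... \<le> of_nat (2 ^ seg_exp k) * ennreal (1 / 2 ^ (2 * (d + 1)))"
    using mult_right_mono[of 1 "of_nat (2 ^ seg_exp k)" "ennreal (1 / 2 ^ (2 * (d + 1)))"]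
      by (simp add: one_le_power)
  finally show ?thesis .
qed

lemma prob_not_all_found:
  "(\<integral>\<^sup>+T. of_bool (\<not> all_found (visit_all T) \<and> \<not> some_repeat (visit_all T)) \<partial>random_tables) \<le>
    ennreal (2 ^ d * (1 / 2 ^ (2 * (d + 1))))"
proof -
  let ?f = "\<lambda>ls. root_fails ls \<and> \<not> root_repeats ls"
  have "of_bool (\<not> all_found vs \<and> \<not> some_repeat vs) \<le> (\<Sum>(k, ls)\<leftarrow>vs. of_bool (?f ls) :: ennreal)" for vs
  proof -
    have "of_bool (\<not> all_found vs \<and> \<not> some_repeat vs) \<le> (of_bool (\<exists>(k, ls)\<in>set vs. ?f ls) :: ennreal)"
      by (auto simp: all_found_def some_repeat_def)
    also have "... \<le> (\<Sum>(k, ls)\<leftarrow>vs. of_bool (?f ls))"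
      by (rule of_bool_Bex_snd_le)
    finally show ?thesis .
  qed
  hence "(\<integral>\<^sup>+T. of_bool (\<not> all_found (visit_all T) \<and> \<not> some_repeat (visit_all T)) \<partial>random_tables) \<le>
      (\<integral>\<^sup>+T. (\<Sum>(k, ls)\<leftarrow>visit_all T. of_bool (?f ls)) \<partial>random_tables)" by (intro nn_integral_mono)
  also have "... \<le> ennreal (2 ^ d * (1 / 2 ^ (2 * (d + 1))))"
    by (intro expected_visit_all_const_le prob_segment_fails) simp_all
  finally show ?thesis .
qed

lemma total_tests_le_total_cost: "total_tests vs \<le> total_cost vs"
  unfolding total_tests_def total_cost_def by (intro sum_list_mono) auto

text \<open>Without repeated windows an attempt fails because a segment has no solution, or because of its
  cost, where Markov's inequality applies.\<close>

lemma not_succeeds_le: "of_bool (\<not> succeeds T) \<le>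
  (of_bool (some_repeat (visit_all T)) + (of_bool (\<not> all_found (visit_all T) \<and> \<not> some_repeat (visit_all T)) +
    ennreal (1 / 2 ^ (8 * (d + 1))) *
      (of_nat (total_cost (visit_all T)) * of_bool (\<not> some_repeat (visit_all T)))))"
proof (cases "succeeds T \<or> some_repeat (visit_all T) \<or> \<not> all_found (visit_all T)")
  case False
  hence "2 ^ (8 * (d + 1)) \<le> total_cost (visit_all T)"
    using total_tests_le_total_cost[of "visit_all T"] by (auto simp: succeeds_def)
  hence "real (2 ^ (8 * (d + 1))) \<le> real (total_cost (visit_all T))" by (rule of_nat_mono)
  hence "1 \<le> 1 / 2 ^ (8 * (d + 1)) * real (total_cost (visit_all T))" by (simp add: field_simps)
  hence "ennreal 1 \<le> ennreal (1 / 2 ^ (8 * (d + 1))) * of_nat (total_cost (visit_all T))"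
    unfolding ennreal_of_nat_eq_real_of_nat
      by (subst ennreal_mult[symmetric]) (auto intro: ennreal_leI simp del: ennreal_1)
  thus ?thesis using False by simp
qed auto

lemma failure_terms_le:
  assumes d: "1 \<le> d"
  shows "2 ^ d * (1 / 2 ^ (31 * (d + 1))) +
    (2 ^ d * (1 / 2 ^ (2 * (d + 1))) + 1 / 2 ^ (8 * (d + 1)) * search_cost_bound) \<le> 1 / 2"
proof -
  have "2 ^ d * (1 / 2 ^ (2 * (d + 1))) = (1 / 2 ^ (d + 2) :: real)"
    by (simp add: field_simps flip: power_add)
  also have "... \<le> 1 / 2 ^ 3" using d by (intro divide_left_mono power_increasing) auto
  finally have fails: "2 ^ d * (1 / 2 ^ (2 * (d + 1))) \<le> (1 / 8 :: real)" by simp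
  have "1 / (2::real) ^ (31 * (d + 1)) \<le> 1 / 2 ^ (2 * (d + 1))"
    by (intro divide_left_mono power_increasing) auto
  hence repeat: "2 ^ d * (1 / 2 ^ (31 * (d + 1))) \<le> 2 ^ d * (1 / (2::real) ^ (2 * (d + 1)))"
    by (rule mult_left_mono) simp
  have "(2::real) ^ (8 * (d + 1)) = 256 * 256 ^ d" by (simp add: power_mult power_add)
  moreover have "search_cost_bound \<le> 256 * 4 ^ d" using search_cost_bound_le zero_le_power[of "4::real" d]
    by linarith
  ultimately have "1 / 2 ^ (8 * (d + 1)) * search_cost_bound \<le> (256 * 4 ^ d) / (256 * 256 ^ d)"
    by (simp add: field_simps)
  also have "... = (4 / 256) ^ d" unfolding power_divide by simp
  also have "... \<le> (4 / 256) ^ 1" using d by (intro power_decreasing) auto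
  also have "... = 1 / 64" by simp
  finally show ?thesis using fails repeat by linarith
qed

lemma prob_not_succeeds: "(\<integral>\<^sup>+T. of_bool (\<not> succeeds T) \<partial>random_tables) \<le> ennreal (1 / 2)"
proof (cases "d = 0")
  case True
  hence "visit_all T = []" for T unfolding visit_all_def by (intro visit_Nil) simp
  thus ?thesis by (simp add: succeeds_def all_found_def total_tests_def)
next
  case False
  let ?F = "1 / 2 ^ (8 * (d + 1)) :: real" and ?R = "random_tables"
  let ?r = "\<lambda>T. of_bool (some_repeat (visit_all T)) :: ennreal"
  let ?m = "\<lambda>T. of_bool (\<not> all_found (visit_all T) \<and> \<not> some_repeat (visit_all T)) :: ennreal"
  let ?c = "\<lambda>T. of_nat (total_cost (visit_all T)) * of_bool (\<not> some_repeat (visit_all T)) :: ennreal"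
  have "(\<integral>\<^sup>+T. of_bool (\<not> succeeds T) \<partial>?R) \<le> (\<integral>\<^sup>+T. ?r T + (?m T + ennreal ?F * ?c T) \<partial>?R)"
    by (intro nn_integral_mono not_succeeds_le)
  also have "... = (\<integral>\<^sup>+T. ?r T \<partial>?R) + ((\<integral>\<^sup>+T. ?m T \<partial>?R) + ennreal ?F * (\<integral>\<^sup>+T. ?c T \<partial>?R))"
    by (subst nn_integral_add; (subst nn_integral_add)?; (subst nn_integral_cmult)?) simp_all
  also have "... \<le> ennreal (2 ^ d * (1 / 2 ^ (31 * (d + 1)))) +
    (ennreal (2 ^ d * (1 / 2 ^ (2 * (d + 1)))) + ennreal ?F * ennreal search_cost_bound)"
    by (intro add_mono mult_left_mono prob_some_repeat prob_not_all_found expected_total_cost_no_repeat) simp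
  also have "... = ennreal (2 ^ d * (1 / 2 ^ (31 * (d + 1))) + (2 ^ d * (1 / 2 ^ (2 * (d + 1))) + ?F * search_cost_bound))"
    using search_cost_bound_nonneg by (subst ennreal_mult[symmetric]) (simp_all add: ennreal_plus)
  also have "... \<le> ennreal (1 / 2)" using False by (intro ennreal_leI failure_terms_le) simp
  finally show ?thesis .
qed

lemma expected_search_cost:
  "(\<integral>\<^sup>+T. of_nat (search_cost T) \<partial>random_tables) \<le> ennreal (search_cost_bound + 1)"
proof -
  let ?F = "2 ^ (8 * (d + 1)) * 2 ^ d :: nat" and ?R = "random_tables"
  let ?r = "\<lambda>T. of_bool (some_repeat (visit_all T)) :: ennreal"
  let ?c = "\<lambda>T. of_nat (total_cost (visit_all T)) * of_bool (\<not> some_repeat (visit_all T)) :: ennreal"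
  have "(of_nat (search_cost T) :: ennreal) \<le> of_nat (total_cost (visit_all T))"
    "(of_nat (search_cost T) :: ennreal) \<le> of_nat ?F" for T
    unfolding search_cost_def by (intro of_nat_mono; simp)+
  hence "(of_nat (search_cost T) :: ennreal) \<le> ?c T + of_nat ?F * ?r T" for T
    by (cases "some_repeat (visit_all T)") (simp_all del: of_nat_mult of_nat_power)
  hence "(\<integral>\<^sup>+T. of_nat (search_cost T) \<partial>?R) \<le> (\<integral>\<^sup>+T. ?c T + of_nat ?F * ?r T \<partial>?R)"
    by (intro nn_integral_mono)
  also have "... = (\<integral>\<^sup>+T. ?c T \<partial>?R) + of_nat ?F * (\<integral>\<^sup>+T. ?r T \<partial>?R)"
    by (subst nn_integral_add; (subst nn_integral_cmult)?) simp_all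
  also have "... \<le> ennreal search_cost_bound + of_nat ?F * ennreal (2 ^ d * (1 / 2 ^ (31 * (d + 1))))"
    by (intro add_mono mult_left_mono prob_some_repeat expected_total_cost_no_repeat) simp
  also have "... = ennreal (search_cost_bound + real ?F * (2 ^ d * (1 / 2 ^ (31 * (d + 1)))))"
    unfolding ennreal_of_nat_eq_real_of_nat using search_cost_bound_nonneg
      by (subst ennreal_mult[symmetric]) (auto simp: ennreal_plus)
  also have "... \<le> ennreal (search_cost_bound + 1)"
  proof (intro ennreal_leI add_left_mono)
    have "real ?F * 2 ^ d = 2 ^ (8 * (d + 1) + d + d)"
      by (simp only: of_nat_mult of_nat_power of_nat_numeral power_add[of _ _ d])
    also have "... \<le> 2 ^ (31 * (d + 1))" by (rule power_increasing) auto
    finally show "real ?F * (2 ^ d * (1 / 2 ^ (31 * (d + 1)))) \<le> 1" by (simp add: field_simps)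
  qed
  finally show ?thesis .
qed

end

section \<open>Queries\<close>

lemma pack_output_bits:
  assumes len: "m 0 = w * N" and a: "a < N" and word: "m (Suc a) < 2 ^ w"
  shows "pack w (output_bits w m) a = m (Suc a)"
proof -
  have le: "a * w + w \<le> w * N" using mult_le_mono1[of "Suc a" N w] a by (simp add: mult.commute)
  have "take w (drop (a * w) (output_bits w m)) = map (bit (m (Suc a))) [0..<w]"
  proof (rule nth_equalityI)
    show "length (take w (drop (a * w) (output_bits w m))) = length (map (bit (m (Suc a))) [0..<w])"
      using le by (simp add: output_bits_def len)
    fix i assume "i < length (take w (drop (a * w) (output_bits w m)))"
    hence i: "i < w" by simp
    hence "a * w \<le> w * N" "a * w + i < w * N" using le by linarith+
    thus "take w (drop (a * w) (output_bits w m)) ! i = map (bit (m (Suc a))) [0..<w] ! i"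
      using i by (simp add: output_bits_def len nth_drop)
  qed
  thus ?thesis unfolding pack_def using word by (simp add: horner_sum_bit_eq_take_bit take_bit_nat_eq_self)
qed

definition read_position :: "nat \<Rightarrow> memory \<Rightarrow> nat \<Rightarrow> nat" where
  "read_position d m v = (let j = floor_log v; r = v - 2 ^ j; a = 63 + 4 * j in
    m a + r div 2 ^ m (a + 2) * m (a + 3) + r mod 2 ^ m (a + 2) * m (a + 1) div 2 ^ (d + 2))"

definition read_window :: "nat \<Rightarrow> memory \<Rightarrow> nat \<Rightarrow> nat" where
  "read_window d m v = (let w = 256 * (d + 1); p = read_position d m v; a = 63 + 4 * d + p div w; s = p mod w in
    take_bit (64 * (d + 1)) (Bit_Operations.or (drop_bit s (m a)) (take_bit w (push_bit (w - s) (m (Suc a))))))"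

definition seed :: "nat \<Rightarrow> bool list \<Rightarrow> nat \<Rightarrow> nat" where
  "seed d bits v = v * 2 ^ (64 * (d + 1)) + read_window d (pack (256 * (d + 1)) bits) v"

definition locate_prog :: com where
  "locate_prog = 14 ::= Const 63 +. Const 4 *. reg 11 ;; 15 ::= reg 10 -. pow2 (reg 11) ;; 16 ::=
    Load (reg 14 +. Const 2) ;;
    17 ::= Load (reg 14) +. reg 15 div. pow2 (reg 16) *. Load (reg 14 +. Const 3)
      +. reg 15 mod. pow2 (reg 16) *. Load (reg 14 +. Const 1) div. pow2 (reg 1 +. Const 2)"

definition fetch_prog :: com where
  "fetch_prog = 18 ::= Const 63 +. Const 4 *. reg 1 +. reg 17 div. reg 13 ;; 19 ::= reg 17 mod. reg 13 ;;
    20 ::= Op BOr (Op Shr (Load (reg 18)) (reg 19))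
      (Op Shl (Load (reg 18 +. Const 1)) (reg 13 -. reg 19)) mod. pow2 (reg 12)"

definition descend_prog :: com where
  "descend_prog = Hash (Const 21) (reg 10 *. pow2 (reg 12) +. reg 20) (Const 0) ;; 10 ::=
    Const 2 *. reg 10 +. reg 21 ;; inc 11"

definition query_step :: com where
  "query_step = locate_prog ;; fetch_prog ;; descend_prog"

definition query_prog :: com where
  "query_prog = (10 ::= Const 1 ;; 11 ::= Const 0 ;; 12 ::= Const 64 *. (reg 1 +. Const 1) ;; 13 ::=
    Const 256 *. (reg 1 +. Const 1)) ;;
    While (reg 11 <. reg 1) query_step ;; 0 ::= reg 10 +. Const 1 -. pow2 (reg 1)"

lemma bit_two_words:
  fixes c0 c1 s w W t :: nat
  assumes "s < w" "c0 < 2 ^ w" "W \<le> w"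
  shows "bit (take_bit W (Bit_Operations.or (drop_bit s c0) (take_bit w (push_bit (w - s) c1)))) t \<longleftrightarrow>
    t < W \<and> bit (if s + t < w then c0 else c1) ((s + t) mod w)"
proof (cases "t < W")
  case True
  show ?thesis
  proof (cases "s + t < w")
    case False
    have "(s + t) mod w = t - (w - s)" using False True assms by (simp add: mod_if add.commute)
    moreover have "\<not> bit c0 (s + t)" using less_pow_bit[OF assms(2), of "s + t"] False by auto
    ultimately show ?thesis using True False assms
      by (auto simp: bit_take_bit_iff bit_or_iff bit_drop_bit_eq bit_push_bit_iff add.commute)
  qed (use True assms in \<open>auto simp: bit_take_bit_iff bit_or_iff bit_drop_bit_eq bit_push_bit_iff\<close>)
qed (simp only: bit_take_bit_iff simp_thms)

lemma div_mod_add_less: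
  fixes p t w :: nat
  assumes "t < w"
  shows "(p + t) div w = (if p mod w + t < w then p div w else Suc (p div w))"
    "(p + t) mod w = (p mod w + t) mod w"
proof -
  have "p mod w < w" using assms by (intro mod_less_divisor) simp
  hence "p mod w + t - w < w" using assms by linarith
  hence "(p mod w + t) div w = (if p mod w + t < w then 0 else 1)" using assms
    by (cases "p mod w + t < w") (simp_all add: le_div_geq)
  moreover have "p + t = p mod w + t + p div w * w" by simp
  ultimately show "(p + t) div w = (if p mod w + t < w then p div w else Suc (p div w))"
    using assms by (metis add.commute add_0 div_mult_self1 less_nat_zero_code mult.commute plus_1_eq_Suc)
qed (simp add: mod_add_left_eq)

lemma node_at_bounds: "2 ^ j \<le> node_at f j x" "node_at f j x < 2 * 2 ^ j"
  by (induction j) auto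

lemma floor_log_node_at: "floor_log (node_at f j x) = j"
  using node_at_bounds(1)[of j f x] node_at_bounds(2)[of f j x]
    by (intro floor_log_eqI) (auto intro: less_le_trans[of 0 "2 ^ j"])

lemma node_at_less: "j < d \<Longrightarrow> node_at f j x \<in> {1..<2 ^ d}"
proof -
  assume "j < d"
  hence "(2::nat) * 2 ^ j \<le> 2 ^ d" using power_increasing[of "Suc j" d "2::nat"] by simp
  moreover have "(1::nat) \<le> 2 ^ j" by simp
  ultimately show ?thesis using node_at_bounds(1)[of j f x] node_at_bounds(2)[of f j x] by auto
qed

context ram
begin

definition packed :: "(nat \<Rightarrow> nat) \<Rightarrow> memory \<Rightarrow> bool" where
  "packed win m \<longleftrightarrow> m 1 = d \<and> (\<forall>k\<in>{1..d}. header_ok k (\<lambda>b. m (b - 1))) \<and>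
    (\<forall>i. i div w \<le> Suc (level_offset (Suc d) div w) \<longrightarrow> bit (m (63 + 4 * d + i div w)) (i mod w) = bit_string win (2 ^ d) i) \<and>
    (\<forall>a\<le>64 + 4 * d + level_offset (Suc d) div w. m a < 2 ^ w)"

lemma packed_output:
  assumes m: "written win m" and words: "\<forall>a. m a < 2 ^ w"
  shows "packed win (pack w (output_bits w m))"
proof -
  let ?N = "65 + 4 * d + level_offset (Suc d) div w"
  have "m 0 = w * ?N" using m by (simp add: written_def)
  hence pack: "pack w (output_bits w m) a = m (Suc a)" if "a < ?N" for a using pack_output_bits that words
    by blast
  show ?thesis unfolding packed_def
  proof (intro conjI allI impI ballI)
    show "pack w (output_bits w m) 1 = d" using m pack[of 1] by (simp add: written_def numeral_2_eq_2)
    fix k assume k: "k \<in> {1..d}"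
    have "pack w (output_bits w m) (b - 1) = m b" if "b \<in> header_cells k" for b
    proof -
      have "64 \<le> b" "b - 1 < ?N" using that k by (auto simp: header_cells_def)
      thus ?thesis using pack[of "b - 1"] by simp
    qed
    thus "header_ok k (\<lambda>b. pack w (output_bits w m) (b - 1))" using header_ok_cong[of k _ m] m k
      by (simp add: written_def)
  next
    fix a assume "a \<le> 64 + 4 * d + level_offset (Suc d) div w"
    thus "pack w (output_bits w m) a < 2 ^ w" using words by (simp add: pack)
  next
    fix i assume i: "i div w \<le> Suc (level_offset (Suc d) div w)"
    have "bit (m (64 + 4 * d + i div w)) (i mod w) = bit_string win (2 ^ d) i"
      using m i bit_string_end_less by (auto simp: written_def)
    thus "bit (pack w (output_bits w m) (63 + 4 * d + i div w)) (i mod w) = bit_string win (2 ^ d) i"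
      using i pack[of "63 + 4 * d + i div w"] by (simp add: add.assoc)
  qed
qed

context
  fixes win :: "nat \<Rightarrow> nat" and m :: memory
  assumes m: "packed win m"
begin

lemma packed_header:
  assumes j: "j < d"
  shows "m (63 + 4 * j) = level_offset (d - j)" (is ?offset) and "m (64 + 4 * j) = rate (d - j)" (is ?rate)
    and "m (65 + 4 * j) = seg_exp (d - j)" (is ?exponent)
      and "m (66 + 4 * j) = seg_width (d - j)" (is ?width)
proof -
  have "header_ok (d - j) (\<lambda>b. m (b - 1))" using m j by (simp add: packed_def)
  thus ?offset ?rate ?exponent ?width using j by (simp_all add: header_ok_def Let_def)
qed

lemma read_position_eq:
  assumes v: "v \<in> {1..<2 ^ d}"
  shows "read_position d m v = position v"
proof -
  have "floor_log v < d" using floor_log_less v by auto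
  thus ?thesis using packed_header[of "floor_log v"]
    by (simp add: read_position_def position_def height_def rank_def seg_offset_def Let_def add.commute)
qed

lemma read_window_eq:
  assumes v: "v \<in> {1..<2 ^ d}" and valid: "\<And>u. u \<in> {1..<2 ^ d} \<Longrightarrow> valid_window T win u"
  shows "read_window d m v = win v"
proof (rule bit_eqI)
  fix t
  let ?W = "64 * (d + 1)" and ?p = "position v" and ?a = "63 + 4 * d + position v div w"
  note p = window_end_less(1)[OF v]
  have "m ?a < 2 ^ w" using m p by (simp add: packed_def)
  hence "bit (read_window d m v) t \<longleftrightarrow>
    t < ?W \<and> bit (if ?p mod w + t < w then m ?a else m (Suc ?a)) ((?p mod w + t) mod w)"
    unfolding read_window_def read_position_eq[OF v] Let_def w[symmetric]
      by (intro bit_two_words) (simp_all add: w)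
  also have "... \<longleftrightarrow> t < ?W \<and> bit (win v) t"
  proof (cases "t < ?W")
    case True
    hence "t < w" by (simp add: w)
    note sum = div_mod_add_less[OF this, of ?p]
    have "(?p + t) div w \<le> Suc (level_offset (Suc d) div w)" using p by (simp add: sum(1))
    hence "bit (m (63 + 4 * d + (?p + t) div w)) ((?p + t) mod w) = bit_string win (2 ^ d) (?p + t)"
      using m unfolding packed_def by blast
    also have "... = bit (win v) t" by (rule bit_string_window[OF valid v True])
    finally show ?thesis unfolding sum by (cases "?p mod w + t < w") simp_all
  qed simp
  also have "... \<longleftrightarrow> bit (win v) t" using less_pow_bit[of "win v" ?W t] valid[OF v]
    by (auto simp: valid_window_def)
  finally show "bit (read_window d m v) t = bit (win v) t" .
qed

lemma read_window_less: "read_window d m v < 2 ^ (64 * (d + 1))"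
  unfolding read_window_def Let_def by (rule take_bit_nat_less_exp)

context
  fixes m' :: memory and v :: nat
  assumes v: "v \<in> {1..<2 ^ d}" and same: "\<And>b. 60 \<le> b \<Longrightarrow> m' b = m b"
  and regs: "m' 1 = d" "m' 10 = v" "m' 11 = floor_log v" "m' 12 = 64 * (d + 1)" "m' 13 = w"
begin

lemma denote_locate:
  "denote locate_prog (m', g) =
    (m'(14 := 63 + 4 * floor_log v, 15 := rank v, 16 := seg_exp (height v), 17 := position v), g)"
proof -
  let ?j = "floor_log v"
  have j: "?j < d" "v < 2 ^ d" using floor_log_less v by auto
  have fits: "fits a v" "fits a ?j" "fits a (2 ^ ?j)" if "1 \<le> a" for a
    using that j by (simp_all add: fits_le_pow fits_le_d)
  have rank: "fits a (rank v)" if "1 \<le> a" for a unfolding rank_def using fits[OF that] by simp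
  have fp: "fits 255 (position v)" using fits_position[OF v] by simp
  show ?thesis using regs same fits rank fp packed_header[OF j(1)]
    by (simp add: locate_prog_def position_def height_def rank_def seg_offset_def Let_def bit_ops fun_eq_iff)
qed

lemma denote_fetch:
  assumes p: "m' 17 = position v"
  shows "denote fetch_prog (m', g) =
    (m'(18 := 63 + 4 * d + position v div w, 19 := position v mod w, 20 := read_window d m v), g)"
proof -
  let ?W = "64 * (d + 1)" and ?a = "63 + 4 * d + position v div w" and ?s = "position v mod w"
  let ?or = "Bit_Operations.or (drop_bit ?s (m ?a)) (take_bit w (push_bit (w - ?s) (m (Suc ?a))))"
  have fp: "fits a (position v)" if "18 \<le> a" for a using fits_position[OF v that] .
  have "m ?a < 2 ^ w" using m window_end_less(1)[OF v] by (simp add: packed_def)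
  hence word: "take_bit w (drop_bit ?s (m ?a)) = drop_bit ?s (m ?a)"
    unfolding drop_bit_eq_div by (intro take_bit_nat_eq_self le_less_trans[OF div_le_dividend])
  have window: "?or mod 2 ^ ?W = read_window d m v"
    unfolding read_window_def read_position_eq[OF v] Let_def w[symmetric] take_bit_eq_mod ..
  have "take_bit w (read_window d m v) = read_window d m v"
    by (rule take_bit_nat_eq_self[OF less_word[OF read_window_less]])
  thus ?thesis using regs p word window same[of ?a] same[of "Suc ?a"]
    by (simp add: fetch_prog_def fp take_bit_or fun_eq_iff)
qed

lemma denote_descend:
  fixes g :: nat
  assumes x: "m' 20 = x" "x < 2 ^ (64 * (d + 1))" and key: "ks = [key]"
  defines "b \<equiv> of_bool (H (prod_encode (g, v * 2 ^ (64 * (d + 1)) + x)) key)"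
  shows "denote descend_prog (m', g) = (m'(21 := b, 10 := 2 * v + b, 11 := Suc (floor_log v)), g)"
proof -
  have "floor_log v < d" using floor_log_less v by auto
  hence fits: "fits a v" "fits a (floor_log v)" if "1 \<le> a" for a using that v
    by (simp_all add: fits_le_pow fits_le_d)
  have fx: "fits a x" if "64 \<le> a" for a using fits_window[OF x(2) that] .
  have fW: "fits a (2 ^ (64 * (d + 1)))" if "64 \<le> a" for a by (rule fits_mono[OF fits_pow that]) simp
  have fb: "fits a b" for a by (simp add: b_def)
  have "hash_val H ks g (v * 2 ^ (64 * (d + 1)) + x) 0 = b" by (simp add: hash_val_def key b_def)
  thus ?thesis using regs x(1) by (simp add: descend_prog_def bit_ops fits fx fW fb fun_eq_iff)
qed

end

definition query_inv :: "(nat \<Rightarrow> 'k \<Rightarrow> bool) \<Rightarrow> 'k \<Rightarrow> nat \<Rightarrow> memory \<Rightarrow> bool" where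
  "query_inv f x j m' \<longleftrightarrow> m' 10 = node_at f j x \<and> m' 11 = j \<and> m' 12 = 64 * (d + 1) \<and> m' 13 = w \<and> m' 1 = d \<and>
    (\<forall>b\<ge>60. m' b = m b)"

context
  fixes x :: 'k and g :: nat and f :: "nat \<Rightarrow> 'k \<Rightarrow> bool"
  assumes key: "ks = [x]" and f: "f = (\<lambda>v. H (prod_encode (g, v * 2 ^ (64 * (d + 1)) + read_window d m v)))"
begin

lemma runs_query_step:
  assumes inv: "query_inv f x j m'" and j: "j < d"
  shows "runs g query_step m' 150 (query_inv f x (Suc j))"
proof (rule runs_denote)
  let ?v = "node_at f j x" and ?b = "of_bool (f (node_at f j x) x)"
  let ?m1 = "m'(14 := 63 + 4 * j, 15 := rank ?v, 16 := seg_exp (height ?v), 17 := position ?v)"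
  let ?m2 = "?m1(18 := 63 + 4 * d + position ?v div w, 19 := position ?v mod w, 20 := read_window d m ?v)"
  let ?m3 = "?m2(21 := ?b, 10 := 2 * ?v + ?b, 11 := Suc j)"
  note v = node_at_less[OF j, of f x]
  have same: "\<And>b. 60 \<le> b \<Longrightarrow> m' b = m b"
    and regs: "m' 1 = d" "m' 10 = ?v" "m' 11 = j" "m' 12 = 64 * (d + 1)" "m' 13 = w"
    using inv by (auto simp: query_inv_def)
  have "denote locate_prog (m', g) = (?m1, g)"
    using denote_locate[OF v same] regs by (simp add: floor_log_node_at)
  moreover have "denote fetch_prog (?m1, g) = (?m2, g)"
    by (rule denote_fetch[OF v]) (use regs same in \<open>simp_all add: floor_log_node_at\<close>)
  moreover have "denote descend_prog (?m2, g) = (?m3, g)"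
    using denote_descend[OF v, of ?m2 "read_window d m ?v" x g] regs same key read_window_less[of ?v]
    by (simp add: floor_log_node_at f)
  ultimately show "denote query_step (m', g) = (?m3, g)" by (simp add: query_step_def)
  show "query_inv f x (Suc j) ?m3" using regs same by (simp add: query_inv_def)
qed (simp_all add: query_step_def locate_prog_def fetch_prog_def descend_prog_def)

lemma runs_query: "runs g query_prog m (200 * d + 100) (\<lambda>m'. m' 0 = leaf_rank d f x)"
  unfolding query_prog_def
proof (rule runs_Seq_denote)
  let ?m0 = "m(10 := 1, 11 := 0, 12 := 64 * (d + 1), 13 := w)"
  have d: "m 1 = d" using m by (simp add: packed_def)
  show "denote (10 ::= Const 1 ;; 11 ::= Const 0 ;; 12 ::= Const 64 *. (reg 1 +. Const 1) ;; 13 ::=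
    Const 256 *. (reg 1 +. Const 1)) (m, g) = (?m0, g)"
  proof -
    have "256 + 256 * d = w" by (simp add: w)
    thus ?thesis using d by (simp add: fun_eq_iff)
  qed
  have inv: "query_inv f x 0 ?m0" using d by (simp add: query_inv_def)
  have loop: "runs g (While (reg 11 <. reg 1) query_step) ?m0 (200 * d + 10) (query_inv f x d)"
  proof (rule runs_for[where I = "query_inv f x" and N = d and T = "\<lambda>_. 150", OF inv])
    fix j m' assume inv: "query_inv f x j m'" and j: "j < d"
    show "aval w m' (reg 11 <. reg 1) \<noteq> 0 \<and> runs g query_step m' 150 (query_inv f x (Suc j))"
      using runs_query_step[OF inv j] inv j by (simp add: query_inv_def[of f x j])
  qed (simp_all add: query_inv_def)
  show "runs g (While (reg 11 <. reg 1) query_step ;; 0 ::= reg 10 +. Const 1 -. pow2 (reg 1)) ?m0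
    (200 * d + 60) (\<lambda>m'. m' 0 = leaf_rank d f x)"
  proof (rule runs_Seq[OF loop])
    fix m' assume inv: "query_inv f x d m'"
    have "fits a (node_at f d x)" if "2 \<le> a" for a
      by (rule fits_mono[OF fits_le[of 2 "2 * 2 ^ d"] that]) (use node_at_bounds(2)[of f d x] in auto)
    hence leaf: "denote (0 ::= reg 10 +. Const 1 -. pow2 (reg 1)) (m', g) = (m'(0 := leaf_rank d f x), g)"
      using inv by (simp add: query_inv_def leaf_rank_def bit_ops)
    show "runs g (0 ::= reg 10 +. Const 1 -. pow2 (reg 1)) m' 50 (\<lambda>m'. m' 0 = leaf_rank d f x)"
      by (rule runs_denote[OF _ _ leaf]) simp_all
  qed simp
qed simp_all

end

end

end

section \<open>Perfect splittings are bijections\<close>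

lemma card_node_at:
  assumes split: "splits_perfectly d f X" and X: "finite X" "card X = 2 ^ d"
  shows "j \<le> d \<Longrightarrow> v \<in> {2 ^ j..<2 ^ Suc j} \<Longrightarrow> card {x \<in> X. node_at f j x = v} = 2 ^ (d - j)"
proof (induction j arbitrary: v)
  case (Suc j)
  let ?u = "v div 2" and ?b = "v mod 2 = 1"
  have u: "?u \<in> {2 ^ j..<2 ^ Suc j}" using Suc.prems by auto
  let ?in = "{x \<in> X. node_at f j x = ?u \<and> f ?u x}" and ?out = "{x \<in> X. node_at f j x = ?u \<and> \<not> f ?u x}"
  have "card ?in + card ?out = card (?in \<union> ?out)" using X(1) by (intro card_Un_disjoint[symmetric]) auto
  also have "?in \<union> ?out = {x \<in> X. node_at f j x = ?u}" by auto
  also have "card ... = 2 * 2 ^ (d - Suc j)" using Suc.IH[OF _ u] Suc.prems(1)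
    by (simp flip: power_Suc add: Suc_diff_Suc)
  finally have "card ?in + card ?out = 2 * 2 ^ (d - Suc j)" .
  moreover have "card ?in = card ?out"
    using split[unfolded splits_perfectly_def, rule_format, OF _ u] Suc.prems(1) by simp
  ultimately have "card ?in = 2 ^ (d - Suc j)" "card ?out = 2 ^ (d - Suc j)" by linarith+
  moreover have "{x \<in> X. node_at f (Suc j) x = v} = (if ?b then ?in else ?out)"
  proof -
    have child: "2 * z + of_bool c = v \<longleftrightarrow> z = ?u \<and> c = ?b" for z c by (cases c) (auto, presburger+)
    show ?thesis unfolding node_at.simps child by (cases ?b) (auto intro!: Collect_cong)
  qed
  ultimately show ?case by simp
qed (use X in auto)

lemma splits_perfectly_bij_betw:
  assumes split: "splits_perfectly d f X" and X: "finite X" "card X = 2 ^ d"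
  shows "bij_betw (leaf_rank d f) X {1..2 ^ d}"
proof -
  have inj: "inj_on (leaf_rank d f) X"
  proof (rule inj_onI)
    fix x x' assume x: "x \<in> X" "x' \<in> X" "leaf_rank d f x = leaf_rank d f x'"
    hence "node_at f d x = node_at f d x'" using node_at_bounds(1)[of d f x] node_at_bounds(1)[of d f x']
      by (simp add: leaf_rank_def)
    hence "{x, x'} \<subseteq> {z \<in> X. node_at f d z = node_at f d x}" using x by auto
    moreover have "card {z \<in> X. node_at f d z = node_at f d x} = 1"
      using card_node_at[OF split X order_refl, of "node_at f d x"] node_at_bounds(1)[of d f
        x] node_at_bounds(2)[of f d x] by simp
    ultimately show "x = x'" by (metis card_1_singletonE insert_subset singletonD)
  qed
  have "leaf_rank d f ` X \<subseteq> {1..2 ^ d}"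
  proof
    fix z assume "z \<in> leaf_rank d f ` X"
    then obtain x where "z = leaf_rank d f x" by auto
    thus "z \<in> {1..2 ^ d}" using node_at_bounds(1)[of d f x] node_at_bounds(2)[of f d x] unfolding leaf_rank_def by auto
  qed
  hence "leaf_rank d f ` X = {1..2 ^ d}" using card_image[OF inj] X(2) by (intro card_subset_eq) auto
  thus ?thesis using inj by (simp add: bij_betw_def)
qed

lemma (in ram) splits_perfectly_keys:
  assumes keys: "length ks = 2 ^ d" "distinct ks"
    and split: "\<And>u. u \<in> {1..<2 ^ d} \<Longrightarrow> splits (split_table g) win u"
    and f: "\<And>u. u \<in> {1..<2 ^ d} \<Longrightarrow> f u = H (prod_encode (g, u * 2 ^ (64 * (d + 1)) + win u))"
  shows "splits_perfectly d f (set ks)"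
  unfolding splits_perfectly_def
proof (intro allI impI ballI)
  let ?T = "\<lambda>u. split_table g u (win u)"
  have T: "?T u i = f u (ks ! i)" if "u \<in> {1..<2 ^ d}" for u i using f[OF that]
    by (simp add: split_table_def)
  have node: "node_at ?T j i = node_at f j (ks ! i)" if "j \<le> d" for j i
    using that
  proof (induction j)
    case (Suc j)
    thus ?case using T[OF node_at_less[of j d f "ks ! i"]] by simp
  qed simp
  have card: "card {x \<in> set ks. Q x} = card {i. i < length ks \<and> Q (ks ! i)}" for Q
  proof -
    have "{x \<in> set ks. Q x} = (!) ks ` {i. i < length ks \<and> Q (ks ! i)}" by (auto simp: in_set_conv_nth)
    moreover have "inj_on ((!) ks) {i. i < length ks \<and> Q (ks ! i)}" using keys(2)
      by (auto simp: inj_on_def nth_eq_iff_index_eq)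
    ultimately show ?thesis by (simp add: card_image)
  qed
  fix j v :: nat assume j: "j < d" and v: "v \<in> {2 ^ j..<2 ^ Suc j}"
  have log: "floor_log v = j" using v by (intro floor_log_eqI) (auto intro: less_le_trans[of 0 "2 ^ j"])
  have "(2::nat) ^ Suc j \<le> 2 ^ d" using j by (intro power_increasing) auto
  moreover have "(1::nat) \<le> 2 ^ j" by simp
  ultimately have vd: "v \<in> {1..<2 ^ d}" using v by auto
  let ?X = "node_keys (split_table g) win v"
  have X: "?X = {i. i < length ks \<and> node_at f j (ks ! i) = v}" unfolding node_keys_def log
    using node[of j] j keys(1) by simp
  have "splits_evenly ?X (?T v)" using split[OF vd] by (simp add: splits_def)
  hence "2 * card {i \<in> ?X. ?T v i \<longleftrightarrow> b} = card ?X" for b unfolding X by (intro card_halves) simp_all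
  from this[of True] this[of False] have "card {i \<in> ?X. ?T v i} = card {i \<in> ?X. \<not> ?T v i}" by simp
  thus "card {x \<in> set ks. node_at f j x = v \<and> f v x} = card {x \<in> set ks. node_at f j x = v \<and> \<not> f v x}"
    unfolding card T[OF vd] X by (simp add: conj_ac)
qed

section \<open>Independent attempts\<close>

lemma set_Pi_pmfD:
  assumes "f \<in> set_pmf (Pi_pmf A dflt p)" "finite A"
  shows "x \<notin> A \<Longrightarrow> f x = dflt" "x \<in> A \<Longrightarrow> f x \<in> set_pmf (p x)"
  using assms by (auto simp: set_Pi_pmf PiE_dflt_def)

lemma nn_integral_finite_range:
  fixes p :: "'b pmf"
  assumes S: "finite S" "set_pmf p \<subseteq> S" "\<And>om. om \<in> space M \<Longrightarrow> X om \<in> S"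
    and sets: "\<And>T. T \<in> S \<Longrightarrow> {om \<in> space M. X om = T} \<in> sets M"
    and prob: "\<And>T. T \<in> S \<Longrightarrow> emeasure M {om \<in> space M. X om = T} = ennreal (pmf p T)"
  shows "(\<integral>\<^sup>+om. F (X om) \<partial>M) = (\<integral>\<^sup>+T. F T \<partial>p)"
proof -
  have "(\<integral>\<^sup>+om. F (X om) \<partial>M) = (\<integral>\<^sup>+om. (\<Sum>T\<in>S. F T * indicator {om \<in> space M. X om = T} om) \<partial>M)"
  proof (rule nn_integral_cong)
    fix om assume om: "om \<in> space M"
    have "(\<Sum>T\<in>S. F T * indicator {om \<in> space M. X om = T} om) =
      (\<Sum>T\<in>{X om}. F T * indicator {om \<in> space M. X om = T} om)"
      by (rule sum.mono_neutral_right) (use S om in auto)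
    thus "F (X om) = (\<Sum>T\<in>S. F T * indicator {om \<in> space M. X om = T} om)" using om by simp
  qed
  also have "... = (\<Sum>T\<in>S. F T * ennreal (pmf p T))"
    using sets prob
    by (subst nn_integral_sum)
      (auto simp: nn_integral_cmult_indicator intro!: borel_measurable_times_ennreal borel_measurable_indicator sum.cong)
  also have "... = (\<integral>\<^sup>+T. F T \<partial>p)"
    by (rule nn_integral_measure_pmf_support[symmetric]) (use S in auto)
  finally show ?thesis .
qed

lemma (in prob_space) prob_independent_bits:
  fixes X :: "'i \<Rightarrow> 'a \<Rightarrow> bool"
  assumes X: "indep_vars (\<lambda>_. count_space UNIV) X UNIV"
    and fair: "\<And>p b. prob (X p -` {b} \<inter> space M) = 1 / 2" and I: "finite I"
  shows "prob {om \<in> space M. \<forall>p\<in>I. X p om = t p} = (1 / 2) ^ card I"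
proof (cases "I = {}")
  case False
  have "{om \<in> space M. \<forall>p\<in>I. X p om = t p} = (\<Inter>p\<in>I. X p -` {t p} \<inter> space M)" using False by blast
  also have "prob ... = (\<Prod>p\<in>I. prob (X p -` {t p} \<inter> space M))"
    by (rule indep_varsD[OF X]) (use False I in auto)
  finally show ?thesis by (simp add: fair)
qed (simp add: prob_space)

locale recsplit = params d y for d y +
  fixes M :: "'w measure" and h :: "nat \<Rightarrow> 'k \<Rightarrow> 'w \<Rightarrow> bool" and keys :: "'k list" and \<epsilon> :: real
  assumes uniform: "simple_uniform_hashing M h" and distinct_keys: "distinct keys"
    and length_keys: "length keys = 2 ^ d"
    and eps: "\<epsilon> \<in> {1 / 2 ^ d..1}" and y: "y = ceillog2 (nat \<lceil>1 / \<epsilon>\<rceil>)"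
begin

sublocale prob_space M
  using uniform by (simp add: simple_uniform_hashing_def)

lemma indep_hash: "indep_vars (\<lambda>_. count_space UNIV) (\<lambda>(s, x). h s x) UNIV"
  using uniform by (simp add: simple_uniform_hashing_def)

lemma measurable_hash: "h s x \<in> measurable M (count_space UNIV)"
proof -
  have "\<forall>p\<in>UNIV. random_variable (count_space UNIV) ((\<lambda>(s, x). h s x) p)"
    using indep_hash unfolding indep_vars_def by (rule conjunct1)
  from this[rule_format, of "(s, x)"] show ?thesis by simp
qed

lemma prob_hash: "prob ((case p of (s, x) \<Rightarrow> h s x) -` {b} \<inter> space M) = 1 / 2"
proof -
  obtain s x where p: "p = (s, x)" by (cases p)
  have "prob (h s x -` {b} \<inter> space M) = measure (distr M (count_space UNIV) (h s x)) {b}"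
    by (rule measure_distr[symmetric]) (simp_all add: measurable_hash)
  also have "... = measure (measure_pmf (pmf_of_set (UNIV :: bool set))) {b}"
    using uniform by (simp add: simple_uniform_hashing_def)
  also have "... = 1 / 2" unfolding measure_pmf_single by (subst pmf_of_set) (simp_all add: UNIV_bool)
  finally show ?thesis by (simp add: p)
qed

definition table_cells :: "(nat \<times> nat \<times> nat) set" where
  "table_cells = {1..<2 ^ d} \<times> {..<2 ^ (64 * (d + 1))} \<times> {..<2 ^ d}"

definition cell_hash :: "nat \<Rightarrow> nat \<times> nat \<times> nat \<Rightarrow> nat \<times> 'k" where
  "cell_hash g z = (case z of (u, c, i) \<Rightarrow> (prod_encode (g, u * 2 ^ (64 * (d + 1)) + c), keys ! i))"

definition table_of :: "nat \<Rightarrow> (nat \<times> 'k \<Rightarrow> bool) \<Rightarrow> table" where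
  "table_of g \<rho> = (\<lambda>u c i. (u, c, i) \<in> table_cells \<and> \<rho> (cell_hash g (u, c, i)))"

definition table :: "nat \<Rightarrow> 'w \<Rightarrow> table" where
  "table g om = table_of g (\<lambda>(s, x). h s x om)"

definition cell_tables :: "table set" where
  "cell_tables = {T. \<forall>u c i. T u c i \<longrightarrow> (u, c, i) \<in> table_cells}"

lemma finite_table_cells [simp]: "finite table_cells"
  by (simp add: table_cells_def)

lemma cell_hash_eq_iff:
  assumes "z \<in> table_cells" "z' \<in> table_cells"
  shows "cell_hash g z = cell_hash g' z' \<longleftrightarrow> g = g' \<and> z = z'"
proof -
  obtain u c i u' c' i' where z: "z = (u, c, i)" "z' = (u', c', i')" by (metis prod_cases3)
  let ?W = "2 ^ (64 * (d + 1)) :: nat"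
  have lt: "c < ?W" "c' < ?W" "i < 2 ^ d" "i' < 2 ^ d" using assms by (auto simp: table_cells_def z)
  have "u = u' \<and> c = c'" if "u * ?W + c = u' * ?W + c'"
  proof -
    have "u = (u * ?W + c) div ?W" "c = (u * ?W + c) mod ?W" "u' = (u' * ?W + c') div ?W"
      "c' = (u' * ?W + c') mod ?W" using lt by simp_all
    thus ?thesis using that by metis
  qed
  moreover have "i = i'" if "keys ! i = keys ! i'" using that lt distinct_keys length_keys
    by (simp add: nth_eq_iff_index_eq)
  ultimately show ?thesis by (auto simp: z cell_hash_def inj_eq)
qed

lemma inj_on_cell_hash: "inj_on (cell_hash g) table_cells"
  by (rule inj_onI) (simp add: cell_hash_eq_iff)

lemma finite_cell_tables: "finite cell_tables"
proof (rule finite_subset)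
  show "cell_tables \<subseteq> (\<lambda>S u c i. (u, c, i) \<in> S) ` Pow table_cells"
  proof
    fix T assume "T \<in> cell_tables"
    hence "{(u, c, i). T u c i} \<in> Pow table_cells" by (auto simp: cell_tables_def)
    moreover have "T = (\<lambda>S u c i. (u, c, i) \<in> S) {(u, c, i). T u c i}" by simp
    ultimately show "T \<in> (\<lambda>S u c i. (u, c, i) \<in> S) ` Pow table_cells" by (rule rev_image_eqI)
  qed
qed simp

lemma table_in_cell_tables: "table g om \<in> cell_tables"
  by (simp add: table_def table_of_def cell_tables_def)

lemma set_random_table: "set_pmf random_tables \<subseteq> cell_tables"
proof
  fix T assume "T \<in> set_pmf random_tables"
  note nodes = set_Pi_pmfD[OF this[unfolded random_table_def] finite_atLeastLessThan]
  note windows = set_Pi_pmfD[OF nodes(2)[unfolded random_functions_def] finite_lessThan]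
  note bits = set_Pi_pmfD(1)[OF windows(2)[unfolded random_bits_def] finite_lessThan]
  have "(u, c, i) \<in> table_cells" if "T u c i" for u c i
  proof (rule ccontr)
    assume "(u, c, i) \<notin> table_cells"
    then consider "u \<notin> {1..<2 ^ d}" | "u \<in> {1..<2 ^ d}" "c \<notin> {..<2 ^ (64 * (d + 1))}"
      | "u \<in> {1..<2 ^ d}" "c \<in> {..<2 ^ (64 * (d + 1))}" "i \<notin> {..<2 ^ d}" unfolding table_cells_def by blast
    thus False using that nodes(1)[of u] windows(1)[of u c] bits[of u c i] by cases simp_all
  qed
  thus "T \<in> cell_tables" by (simp add: cell_tables_def)
qed

lemma pmf_random_table:
  assumes T: "T \<in> cell_tables"
  shows "pmf random_tables T = (1 / 2) ^ card table_cells"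
proof -
  let ?W = "2 ^ (64 * (d + 1)) :: nat"
  have "pmf (random_bits (2 ^ d)) (T u c) = (\<Prod>i<2 ^ d. pmf (bernoulli_pmf (1 / 2)) (T u c i))" for u c
    unfolding random_bits_def using T by (intro pmf_Pi') (auto simp: cell_tables_def table_cells_def)
  moreover have "pmf (bernoulli_pmf (1 / 2)) b = 1 / 2" for b by (cases b) simp_all
  ultimately have bits: "pmf (random_bits (2 ^ d)) (T u c) = (1 / 2) ^ 2 ^ d" for u c by simp
  have "pmf random_functions (T u) = (\<Prod>c<?W. pmf (random_bits (2 ^ d)) (T u c))" for u
    unfolding random_functions_def using T
      by (intro pmf_Pi') (auto simp: cell_tables_def table_cells_def fun_eq_iff)
  hence windows: "pmf random_functions (T u) = ((1 / 2) ^ 2 ^ d) ^ ?W" for u unfolding bits by simp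
  have "pmf random_tables T = (\<Prod>u=1..<2 ^ d. pmf random_functions (T u))"
    unfolding random_table_def using T
      by (intro pmf_Pi') (auto simp: cell_tables_def table_cells_def fun_eq_iff)
  also have "... = (1 / 2) ^ card table_cells"
    unfolding windows by (simp add: table_cells_def card_cartesian_product ac_simps flip: power_mult)
  finally show ?thesis .
qed

lemma table_event:
  assumes T: "T \<in> cell_tables"
  shows "{om \<in> space M. table g om = T} \<in> sets M"
    "prob {om \<in> space M. table g om = T} = (1 / 2) ^ card table_cells"
proof -
  let ?X = "\<lambda>(s, x). h s x" and ?I = "cell_hash g ` table_cells"
  define t where "t p \<longleftrightarrow> (\<exists>u c i. p = cell_hash g (u, c, i) \<and> T u c i)" for p
  have t: "t (cell_hash g (u, c, i)) \<longleftrightarrow> T u c i" if "(u, c, i) \<in> table_cells" for u c i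
    unfolding t_def using T that by (auto simp: cell_tables_def cell_hash_eq_iff)
  have "table g om = T \<longleftrightarrow> (\<forall>z\<in>table_cells. ?X (cell_hash g z) om = t (cell_hash g z))" for om
  proof -
    have "table g om u c i = T u c i \<longleftrightarrow> ((u, c, i) \<in> table_cells \<longrightarrow> ?X (cell_hash g (u, c, i)) om = T u c i)"
      for u c i
      using T by (auto simp: table_def table_of_def cell_tables_def case_prod_beta)
    hence "table g om = T \<longleftrightarrow> (\<forall>u c i. (u, c, i) \<in> table_cells \<longrightarrow> ?X (cell_hash g (u, c, i)) om = T u c i)"
      unfolding fun_eq_iff by simp
    thus ?thesis unfolding Ball_def split_paired_All by (simp add: t cong: imp_cong)
  qed
  hence event: "{om \<in> space M. table g om = T} = {om \<in> space M. \<forall>p\<in>?I. ?X p om = t p}" by auto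
  show "{om \<in> space M. table g om = T} \<in> sets M" unfolding event
  proof (rule sets.sets_Collect_finite_All)
    fix p assume "p \<in> ?I"
    have "Measurable.pred M (h (fst p) (snd p))" using measurable_hash by auto
    thus "{om \<in> space M. ?X p om = t p} \<in> sets M" unfolding case_prod_beta by measurable
  qed simp
  have "prob {om \<in> space M. \<forall>p\<in>?I. ?X p om = t p} = (1 / 2) ^ card ?I"
    by (rule prob_independent_bits[OF indep_hash prob_hash]) simp
  thus "prob {om \<in> space M. table g om = T} = (1 / 2) ^ card table_cells"
    unfolding event card_image[OF inj_on_cell_hash] .
qed

lemma nn_integral_table: "(\<integral>\<^sup>+om. F (table g om) \<partial>M) = (\<integral>\<^sup>+T. F T \<partial>random_tables)"
  by (rule nn_integral_finite_range[OF finite_cell_tables set_random_table table_in_cell_tables table_event(1)])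
    (simp_all add: emeasure_eq_measure table_event(2) pmf_random_table del: One_nat_def)

lemma indep_tables:
  fixes F :: "nat \<Rightarrow> table \<Rightarrow> ennreal"
  shows "indep_vars (\<lambda>_. borel) (\<lambda>g om. F g (table g om)) UNIV"
proof -
  let ?X = "\<lambda>(s, x). h s x" and ?I = "\<lambda>g. cell_hash g ` table_cells"
  have "disjoint_family_on ?I UNIV" unfolding disjoint_family_on_def using cell_hash_eq_iff by blast
  hence "indep_vars (\<lambda>g. PiM (?I g) (\<lambda>_. count_space UNIV)) (\<lambda>g om. restrict (\<lambda>p. ?X p om) (?I g)) UNIV"
    by (intro indep_vars_restrict[OF indep_hash]) simp_all
  hence "indep_vars (\<lambda>_. borel) (\<lambda>g om. F g (table_of g (restrict (\<lambda>p. ?X p om) (?I g)))) UNIV"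
  proof (rule indep_vars_compose2[where Y = "\<lambda>g \<rho>. F g (table_of g \<rho>)"])
    fix g :: nat
    have "PiM (?I g) (\<lambda>_. count_space (UNIV :: bool set)) = count_space (PiE (?I g) (\<lambda>_. UNIV))"
      by (rule count_space_PiM_finite) simp_all
    thus "(\<lambda>\<rho>. F g (table_of g \<rho>)) \<in> measurable (PiM (?I g) (\<lambda>_. count_space UNIV)) borel" by simp
  qed
  moreover have "table_of g (restrict (\<lambda>p. ?X p om) (?I g)) = table g om" for g om
    unfolding table_def table_of_def by (intro ext) (auto simp: case_prod_beta)
  ultimately show ?thesis by simp
qed

lemma measurable_table: "(\<lambda>om. F (table g om)) \<in> borel_measurable M" for F :: "_ \<Rightarrow> ennreal"
  using indep_tables[of "\<lambda>_. F"] unfolding indep_vars_def by blast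

lemma sets_succeeds: "{om \<in> space M. succeeds (table g om)} \<in> sets M"
proof -
  have "{om \<in> space M. succeeds (table g om)} =
    (\<lambda>om. of_bool (succeeds (table g om)) :: ennreal) -` {1} \<inter> space M" by auto
  thus ?thesis using measurable_sets[OF measurable_table[of "\<lambda>T. of_bool (succeeds T)" g], of "{1}"] by simp
qed

definition all_fail :: "nat \<Rightarrow> 'w \<Rightarrow> bool" where
  "all_fail N om \<longleftrightarrow> (\<forall>g<N. \<not> succeeds (table g om))"

definition attempts_sum :: "(table \<Rightarrow> ennreal) \<Rightarrow> 'w \<Rightarrow> ennreal" where
  "attempts_sum F om = (\<Sum>g. of_bool (all_fail g om) * F (table g om))"

lemma sets_all_fail: "{om \<in> space M. all_fail N om} \<in> sets M"
proof -
  have "{om \<in> space M. \<forall>g\<in>{..<N}. \<not> succeeds (table g om)} \<in> sets M"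
    by (intro sets.sets_Collect_finite_All sets.sets_Collect_neg sets_succeeds) simp
  thus ?thesis unfolding all_fail_def Ball_def lessThan_iff .
qed

lemma measurable_attempts_sum: "attempts_sum F \<in> borel_measurable M"
proof -
  have "(\<lambda>om. of_bool (all_fail g om) :: ennreal) \<in> borel_measurable M" for g
    using sets_all_fail[of g] by (simp add: measurable_of_bool pred_def)
  thus ?thesis unfolding attempts_sum_def[abs_def]
    by (intro borel_measurable_suminf_order borel_measurable_times_ennreal measurable_table)
qed

lemma expected_attempt_le:
  "(\<integral>\<^sup>+om. of_bool (all_fail N om) * F (table N om) \<partial>M) \<le>
    ennreal ((1 / 2) ^ N) * (\<integral>\<^sup>+T. F T \<partial>random_tables)"
proof -
  let ?F = "\<lambda>g T. if g < N then of_bool (\<not> succeeds T) else F T"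
  have "of_bool (all_fail N om) * F (table N om) = (\<Prod>g\<le>N. ?F g (table g om))" for om
  proof -
    have "(\<Prod>g<N. of_bool (\<not> succeeds (table g om))) = (of_bool (all_fail N om) :: ennreal)"
      unfolding all_fail_def by (induction N) (auto simp: less_Suc_eq)
    moreover have "(\<Prod>g<N. ?F g (table g om)) = (\<Prod>g<N. of_bool (\<not> succeeds (table g om)))"
      by (intro prod.cong) auto
    ultimately show ?thesis by (simp flip: lessThan_Suc_atMost)
  qed
  hence "(\<integral>\<^sup>+om. of_bool (all_fail N om) * F (table N om) \<partial>M) = (\<integral>\<^sup>+om. (\<Prod>g\<le>N. ?F g (table g om)) \<partial>M)"
    by simp
  also have "... = (\<Prod>g\<le>N. \<integral>\<^sup>+om. ?F g (table g om) \<partial>M)"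
    by (rule indep_vars_nn_integral) (auto intro: indep_vars_subset[OF indep_tables])
  also have "... = (\<Prod>g\<le>N. \<integral>\<^sup>+T. ?F g T \<partial>random_tables)"
    by (intro prod.cong refl) (rule nn_integral_table[of "?F _"])
  also have "... = (\<Prod>g<N. \<integral>\<^sup>+T. of_bool (\<not> succeeds T) \<partial>random_tables) * (\<integral>\<^sup>+T. F T \<partial>random_tables)"
    by (simp flip: lessThan_Suc_atMost)
  also have "... \<le> (\<Prod>g<N. ennreal (1 / 2)) * (\<integral>\<^sup>+T. F T \<partial>random_tables)"
    by (intro mult_right_mono prod_mono_ennreal prob_not_succeeds) simp
  also have "(\<Prod>g<N. ennreal (1 / 2)) = ennreal ((1 / 2) ^ N)" unfolding prod_constant card_lessThan
    by (rule ennreal_power) simp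
  finally show ?thesis .
qed

lemma expected_attempts_sum:
  assumes F: "(\<integral>\<^sup>+T. F T \<partial>random_tables) \<le> ennreal c" and c: "0 \<le> c"
  shows "(\<integral>\<^sup>+om. attempts_sum F om \<partial>M) \<le> ennreal (2 * c)"
proof -
  have "(\<lambda>om. of_bool (all_fail g om) :: ennreal) \<in> borel_measurable M" for g
    using sets_all_fail[of g] by (simp add: measurable_of_bool pred_def)
  hence "(\<integral>\<^sup>+om. attempts_sum F om \<partial>M) = (\<Sum>g. \<integral>\<^sup>+om. of_bool (all_fail g om) * F (table g om) \<partial>M)"
    unfolding attempts_sum_def by (intro nn_integral_suminf borel_measurable_times_ennreal measurable_table)
  also have "... \<le> (\<Sum>g. ennreal ((1 / 2) ^ g * c))"
  proof (intro suminf_le)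
    fix g
    have "(\<integral>\<^sup>+om. of_bool (all_fail g om) * F (table g om) \<partial>M) \<le>
      ennreal ((1 / 2) ^ g) * (\<integral>\<^sup>+T. F T \<partial>random_tables)"
      by (rule expected_attempt_le)
    also have "... \<le> ennreal ((1 / 2) ^ g) * ennreal c" by (intro mult_left_mono F) simp
    also have "... = ennreal ((1 / 2) ^ g * c)" using c by (simp add: ennreal_mult)
    finally show "(\<integral>\<^sup>+om. of_bool (all_fail g om) * F (table g om) \<partial>M) \<le> ennreal ((1 / 2) ^ g * c)" .
  qed simp_all
  also have "... = ennreal (2 * c)"
  proof (rule suminf_ennreal_eq)
    have "(\<lambda>g. (1 / 2 :: real) ^ g) sums (1 / (1 - 1 / 2))" by (rule geometric_sums) simp
    from sums_mult2[OF this, of c] show "(\<lambda>g. (1 / 2) ^ g * c) sums (2 * c)" by simp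
  qed (use c in simp)
  finally show ?thesis .
qed

lemma prob_all_fail: "prob {om \<in> space M. all_fail N om} \<le> (1 / 2) ^ N"
proof -
  let ?A = "{om \<in> space M. all_fail N om}"
  have "ennreal (prob ?A) = (\<integral>\<^sup>+om. indicator ?A om \<partial>M)"
    unfolding emeasure_eq_measure[symmetric] by (rule nn_integral_indicator[OF sets_all_fail, symmetric])
  also have "... = (\<integral>\<^sup>+om. of_bool (all_fail N om) * 1 \<partial>M)"
    by (intro nn_integral_cong) (auto simp: indicator_def)
  also have "... \<le> ennreal ((1 / 2) ^ N) * (\<integral>\<^sup>+T. 1 \<partial>random_tables)" by (rule expected_attempt_le)
  also have "... = ennreal ((1 / 2) ^ N)" by (simp add: measure_pmf.emeasure_space_1)
  finally show ?thesis by (rule ennreal_le_iff[THEN iffD1, rotated]) simp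
qed

definition successful_attempt :: "nat \<Rightarrow> 'w \<Rightarrow> bool" where
  "successful_attempt N om \<longleftrightarrow> all_fail N om \<and> succeeds (table N om)"

lemma successful_attempt_if_succeeds:
  assumes "succeeds (table g om)"
  obtains N where "N \<le> g" "successful_attempt N om"
  using assms exists_least_iff[of "\<lambda>g. succeeds (table g om)"] that
  unfolding successful_attempt_def all_fail_def by (metis linorder_not_less)

lemma AE_successful_attempt: "AE om in M. \<exists>N. successful_attempt N om"
proof -
  let ?A = "{om \<in> space M. \<forall>N. all_fail N om}"
  have sets: "?A \<in> sets M" by (intro sets.sets_Collect_countable_All sets_all_fail)
  have "prob ?A \<le> (1 / 2) ^ N" for N
    by (rule order_trans[OF finite_measure_mono prob_all_fail]) (auto simp: sets_all_fail)
  moreover have "(\<lambda>N. (1 / 2 :: real) ^ N) \<longlonglongrightarrow> 0" by (rule LIMSEQ_power_zero) simp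
  ultimately have "prob ?A \<le> 0" by (intro LIMSEQ_le_const) auto
  hence "?A \<in> null_sets M" using sets by (auto simp: null_sets_def emeasure_eq_measure measure_le_0_iff)
  moreover have "{om \<in> space M. \<not> (\<exists>N. successful_attempt N om)} \<subseteq> ?A"
  proof
    fix om assume "om \<in> {om \<in> space M. \<not> (\<exists>N. successful_attempt N om)}"
    thus "om \<in> ?A" using successful_attempt_if_succeeds[of _ om] unfolding all_fail_def by blast
  qed
  ultimately show ?thesis by (rule AE_I')
qed

lemma sum_attempts_le:
  assumes "successful_attempt N om"
  shows "(\<Sum>g\<le>N. F (table g om)) \<le> attempts_sum F om"
proof -
  have "(\<Sum>g\<le>N. F (table g om)) = (\<Sum>g\<le>N. of_bool (all_fail g om) * F (table g om))"
    using assms by (intro sum.cong refl) (auto simp: successful_attempt_def all_fail_def)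
  also have "... \<le> attempts_sum F om" unfolding attempts_sum_def by (rule sum_le_suminf) auto
  finally show ?thesis .
qed

end

section \<open>The data structure\<close>

definition build_prog :: com where
  "build_prog = prepare_prog ;; attempts_prog ;; write_prog"

lemma (in ram) reaches_build:
  assumes n: "length ks = 2 ^ d" and E: "E \<le> 2 ^ d" "ceillog2 E = y"
    and N: "\<And>g. g < N \<Longrightarrow> \<not> succeeds (split_table g)" "succeeds (split_table N)"
  shows "reaches build_prog ((\<lambda>_. 0)(0 := 2 ^ d, 1 := E), 0)
    (600 * 2 ^ d + 100 * (d * d) + 1100 * d + 700 + (\<Sum>g\<le>N. 900 * search_cost (split_table g) + 770))
    (\<lambda>s. snd s = N \<and> (\<exists>win. written win (fst s) \<and> (\<forall>u\<in>{1..<2 ^ d}. valid_window (split_table N) win u)))"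
  unfolding build_prog_def
proof (rule reaches_Seq[OF runs_prepare[OF E, unfolded runs_def]])
  let ?S = "\<Sum>g\<le>N. 900 * search_cost (split_table g) + 770"
  fix s :: state assume s: "snd s = 0 \<and> prepared (fst s)"
  have P: "prepared ((fst s)(13 := 0))"
    by (rule prepared_cong[OF _ conjunct2[OF s]]) (simp add: scratch_def)
  show "reaches (attempts_prog ;; write_prog) s (?S + 20 + (150 * 2 ^ d + 100))
    (\<lambda>s. snd s = N \<and> (\<exists>win. written win (fst s) \<and> (\<forall>u\<in>{1..<2 ^ d}. valid_window (split_table N) win u)))"
  proof (rule reaches_Seq[where R = "\<lambda>s. snd s = N \<and> (\<exists>win. found N win (fst s))"])
    show "reaches attempts_prog s (?S + 20) (\<lambda>s. snd s = N \<and> (\<exists>win. found N win (fst s)))"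
      unfolding attempts_prog_def
    proof (rule reaches_Seq[where R = "\<lambda>s'. s' = ((fst s)(13 := 0), 0)"])
      show "reaches (13 ::= Const 0) s 10 (\<lambda>s'. s' = ((fst s)(13 := 0), 0))" using s
        by (intro reaches_denote) simp_all
      fix s' :: state assume s': "s' = ((fst s)(13 := 0), 0)"
      have "reaches (While (Op Equal (reg 13) (Const 0)) attempt_prog) ((fst s)(13 := 0), 0)
          ((\<Sum>g\<le>N. 900 * search_cost (split_table (0 + g)) + 770) + 10)
            (\<lambda>s. snd s = 0 + N \<and> (\<exists>win. found (0 + N) win (fst s)))"
        by (rule reaches_attempts[OF n P]) (use N in auto)
      thus "reaches (While (Op Equal (reg 13) (Const 0)) attempt_prog) s' (?S + 10) (\<lambda>s. snd s = N \<and>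
        (\<exists>win. found N win (fst s)))"
        unfolding s' by simp
    qed simp
    fix s' assume s': "snd s' = N \<and> (\<exists>win. found N win (fst s'))"
    then obtain win where F: "found N win (fst s')" by blast
    hence valid: "\<forall>u\<in>{1..<2 ^ d}. valid_window (split_table N) win u" by (simp add: found_def)
    show "reaches write_prog s' (150 * 2 ^ d + 100)
      (\<lambda>s. snd s = N \<and> (\<exists>win. written win (fst s) \<and> (\<forall>u\<in>{1..<2 ^ d}. valid_window (split_table N) win u)))"
    proof -
      have "reaches write_prog (fst s', N) (150 * 2 ^ d + 100) (\<lambda>s. snd s = N \<and> written win (fst s))"
        using runs_write[OF F] unfolding runs_def .
      moreover have "s' = (fst s', N)" using s' by (simp add: prod_eq_iff)
      ultimately show ?thesis using valid by (auto elim: reaches_mono)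
    qed
  qed simp
qed simp

lemma run_build_exec:
  assumes "exec w H ks c (build_input (length ks) \<epsilon>, 0) t (m, g)"
  shows "run_build w H ks \<epsilon> c = Some (t, output_bits w m, g)"
proof -
  have "(THE r. (\<lambda>(t, s). exec w H ks c (build_input (length ks) \<epsilon>, 0) t s) r) = (t, m, g)"
    by (rule the_equality) (use assms exec_deterministic in \<open>fastforce+\<close>)
  thus ?thesis using assms unfolding run_build_def Let_def by auto
qed

lemma run_build_SomeD:
  assumes "run_build w H ks \<epsilon> c = Some (t, bits, g)"
  obtains m where "exec w H ks c (build_input (length ks) \<epsilon>, 0) t (m, g)" "bits = output_bits w m"
proof -
  have "\<exists>r. (\<lambda>(t, s). exec w H ks c (build_input (length ks) \<epsilon>, 0) t s) r"
    using assms unfolding run_build_def Let_def by (metis option.distinct(1))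
  then obtain t' m' g' where e: "exec w H ks c (build_input (length ks) \<epsilon>, 0) t' (m', g')" by auto
  from run_build_exec[OF e] assms e that show ?thesis by auto
qed

lemma nat_ceiling_inverse_le:
  assumes "\<epsilon> \<in> {1 / 2 ^ d..1 :: real}"
  shows "nat \<lceil>1 / \<epsilon>\<rceil> \<le> 2 ^ d"
proof -
  have "0 < \<epsilon>" using assms by (auto intro: less_le_trans[of 0 "1 / 2 ^ d"])
  hence "1 / \<epsilon> \<le> 2 ^ d" using assms by (simp add: field_simps)
  hence "\<lceil>1 / \<epsilon>\<rceil> \<le> int (2 ^ d)" by (simp add: ceiling_le_iff)
  thus ?thesis by simp
qed

lemma square_le_pow: "d * d \<le> 4 * 2 ^ d" for d :: nat
proof (induction d)
  case (Suc d)
  have "d < 2 ^ d" by (rule less_exp)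
  moreover have "Suc d * Suc d = d * d + 2 * d + 1" by simp
  ultimately show ?case unfolding power_Suc using Suc by linarith
qed simp

context params
begin

definition num_bits :: nat where
  "num_bits = 256 * (d + 1) * (65 + 4 * d + level_offset (Suc d) div (256 * (d + 1)))"

definition build_overhead :: nat where
  "build_overhead = 600 * 2 ^ d + 100 * (d * d) + 1100 * d + 700"

lemma num_bits_le:
  "real num_bits \<le> 2 ^ d * log 2 (exp 1) + 396 * (2 ^ d / 2 ^ y) + 1088 * (real d * real d) +
    17728 * real d + 16640"
proof -
  let ?w = "256 * (d + 1)"
  have "num_bits = ?w * (65 + 4 * d) + ?w * (level_offset (Suc d) div ?w)" unfolding num_bits_def
    by (simp add: distrib_left)
  also have "... \<le> ?w * (65 + 4 * d) + level_offset (Suc d)"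
    by (intro add_left_mono times_div_less_eq_dividend)
  finally have "real num_bits \<le> real (?w * (65 + 4 * d) + level_offset (Suc d))" by (rule of_nat_mono)
  also have "... = 1024 * (real d * real d) + 17664 * real d + 16640 + real (level_offset (Suc d))"
    by (simp add: algebra_simps)
  finally show ?thesis using level_offset_bound by (simp add: algebra_simps)
qed

lemma build_overhead_le: "real build_overhead \<le> 6100 * 2 ^ d"
proof -
  have "d \<le> d * d" by (cases d) simp_all
  hence "build_overhead \<le> 6100 * 2 ^ d"
    using square_le_pow[of d] one_le_power[of "2::nat" d] unfolding build_overhead_def by linarith
  hence "real build_overhead \<le> real (6100 * 2 ^ d)" by (rule of_nat_mono)
  thus ?thesis by simp
qed

lemma visit_all_cong: "tables_agree {1..<2 ^ d} T T' \<Longrightarrow> visit_all T = visit_all T'"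
  unfolding visit_all_def by (rule visit_cong[OF _ _ seg_start_1]) simp_all

end

context recsplit
begin

abbreviation hash :: "'w \<Rightarrow> nat \<Rightarrow> 'k \<Rightarrow> bool" where
  "hash om \<equiv> (\<lambda>s x. h s x om)"

abbreviation built :: "'w \<Rightarrow> (nat \<times> bool list \<times> nat) option" where
  "built om \<equiv> run_build (256 * (d + 1)) (hash om) keys \<epsilon> build_prog"

definition perfect_hash :: "real \<Rightarrow> 'w \<Rightarrow> nat \<Rightarrow> bool list \<Rightarrow> bool" where
  "perfect_hash T om g bits \<longleftrightarrow> (let f = (\<lambda>v. hash om (prod_encode (g, seed d bits v))) in
    splits_perfectly d f (set keys) \<and> bij_betw (leaf_rank d f) (set keys) {1..2 ^ d} \<and>
    (\<forall>x. \<exists>tq m g'. exec (256 * (d + 1)) (hash om) [x] query_prog (pack (256 * (d + 1)) bits, g) tq (m, g') \<and>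
      m 0 = leaf_rank d f x \<and> real tq \<le> T))"

lemma perfect_hash_mono: "perfect_hash T om g bits \<Longrightarrow> T \<le> T' \<Longrightarrow> perfect_hash T' om g bits"
  unfolding perfect_hash_def Let_def by (meson order_trans)

lemma split_table_eq_table:
  "succeeds (ram.split_table d (hash om) keys g) = succeeds (table g om)"
  "search_cost (ram.split_table d (hash om) keys g) = search_cost (table g om)"
proof -
  interpret R: ram d y "256 * (d + 1)" "hash om" keys by unfold_locales simp
  have "visit_all (R.split_table g) = visit_all (table g om)"
    by (rule visit_all_cong)
      (auto simp: tables_agree_def R.split_table_def table_def table_of_def table_cells_def cell_hash_def)
  thus "succeeds (R.split_table g) = succeeds (table g om)"
    "search_cost (R.split_table g) = search_cost (table g om)"
    by (simp_all add: succeeds_def search_cost_def)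
qed

lemma perfect_hash_if_packed:
  assumes m: "ram.packed d y (256 * (d + 1)) win (pack (256 * (d + 1)) bits)"
    and valid: "\<And>u. u \<in> {1..<2 ^ d} \<Longrightarrow> valid_window (ram.split_table d (hash om) keys g) win u"
  shows "perfect_hash (200 * real d + 100) om g bits"
proof -
  interpret R: ram d y "256 * (d + 1)" "hash om" keys by unfold_locales simp
  let ?f = "\<lambda>v. hash om (prod_encode (g, seed d bits v))"
  have split: "splits_perfectly d ?f (set keys)"
  proof (rule R.splits_perfectly_keys[OF length_keys distinct_keys])
    fix u :: nat assume u: "u \<in> {1..<2 ^ d}"
    show "splits (R.split_table g) win u" using valid[OF u] by (simp add: valid_window_def)
    have "read_window d (pack (256 * (d + 1)) bits) u = win u"
      by (rule R.read_window_eq[OF m u]) (rule valid)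
    thus "?f u = hash om (prod_encode (g, u * 2 ^ (64 * (d + 1)) + win u))" by (simp only: seed_def)
  qed
  have card: "card (set keys) = 2 ^ d" using distinct_card[OF distinct_keys] length_keys by simp
  have "\<exists>tq m g'. exec (256 * (d + 1)) (hash om) [x] query_prog (pack (256 * (d + 1)) bits, g) tq (m, g') \<and>
      m 0 = leaf_rank d ?f x \<and> real tq \<le> 200 * real d + 100" for x
  proof -
    interpret Q: ram d y "256 * (d + 1)" "hash om" "[x]" by unfold_locales simp
    have "Q.runs g query_prog (pack (256 * (d + 1)) bits) (200 * d + 100) (\<lambda>m. m 0 = leaf_rank d ?f x)"
      by (rule Q.runs_query[OF m refl]) (simp add: seed_def)
    then obtain tq s where "exec (256 * (d + 1)) (hash om) [x] query_prog (pack (256 * (d + 1)) bits, g) tq s"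
      and tq: "tq \<le> 200 * d + 100" and "fst s 0 = leaf_rank d ?f x" unfolding Q.runs_def Q.reaches_def
        by blast
    moreover have "real tq \<le> real (200 * d + 100)" using tq by (rule of_nat_mono)
    hence "real tq \<le> 200 * real d + 100" by simp
    ultimately show ?thesis by (metis prod.collapse)
  qed
  thus ?thesis using split splits_perfectly_bij_betw[OF split _ card]
    by (simp add: perfect_hash_def Let_def)
qed

lemma built_successful_attempt:
  assumes N: "successful_attempt N om"
  obtains t bits where "built om = Some (t, bits, N)"
    "t \<le> build_overhead + (\<Sum>g\<le>N. 900 * search_cost (table g om) + 770)"
    "length bits = num_bits" "perfect_hash (200 * real d + 100) om N bits"
proof -
  let ?w = "256 * (d + 1)" and ?E = "nat \<lceil>1 / \<epsilon>\<rceil>"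
  interpret R: ram d y ?w "hash om" keys by unfold_locales simp
  note E = nat_ceiling_inverse_le[OF eps]
  have "R.reaches build_prog ((\<lambda>_. 0)(0 := 2 ^ d, 1 := ?E), 0) (build_overhead +
    (\<Sum>g\<le>N. 900 * search_cost (R.split_table g) + 770))
    (\<lambda>s. snd s = N \<and> (\<exists>win. R.written win (fst s) \<and> (\<forall>u\<in>{1..<2 ^ d}. valid_window (R.split_table N) win u)))"
    unfolding build_overhead_def by (rule R.reaches_build[OF length_keys E y[symmetric]])
      (use N in \<open>simp_all add: split_table_eq_table successful_attempt_def all_fail_def\<close>)
  then obtain t m win where ex:
    "exec ?w (hash om) keys build_prog ((\<lambda>_. 0)(0 := 2 ^ d, 1 := ?E), 0) t (m, N)"
    and t: "t \<le> build_overhead + (\<Sum>g\<le>N. 900 * search_cost (table g om) + 770)"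
    and m: "R.written win m" and valid: "\<And>u. u \<in> {1..<2 ^ d} \<Longrightarrow> valid_window (R.split_table N) win u"
    unfolding R.reaches_def split_table_eq_table by auto
  have "(2::nat) ^ d < 2 ^ ?w" by (rule power_strict_increasing) auto
  hence words: "\<forall>a. m a < 2 ^ ?w" using exec_bounded[OF ex] E by (auto simp: le_less_trans)
  have "built om = Some (t, output_bits ?w m, N)"
    by (rule run_build_exec) (use ex length_keys in \<open>simp add: build_input_def\<close>)
  moreover have "m 0 = num_bits" using m unfolding R.written_def num_bits_def by blast
  hence "length (output_bits ?w m) = num_bits" by (simp add: output_bits_def)
  moreover have "perfect_hash (200 * real d + 100) om N (output_bits ?w m)"
    by (rule perfect_hash_if_packed[OF R.packed_output[OF m words] valid])
  ultimately show ?thesis using t that by blast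
qed

lemma measurable_run_build: "(\<lambda>om. run_build w (hash om) keys \<epsilon> c) \<in> measurable M (count_space UNIV)"
proof -
  let ?B = "\<lambda>H. run_build w H keys \<epsilon> c"
  have Some: "{om \<in> space M. ?B (hash om) = Some r} \<in> sets M" for r
  proof (rule sets_Collect_finitely_determined[where P = "\<lambda>H. ?B H = Some r" and K = "set keys", OF measurable_hash])
    fix H :: "nat \<Rightarrow> 'k \<Rightarrow> bool" assume r: "?B H = Some r"
    obtain t bits g where "r = (t, bits, g)" by (cases r)
    then obtain m where ex: "exec w H keys c (build_input (length keys) \<epsilon>, 0) t (m, g)"
      and r': "r = (t, output_bits w m, g)"
      using run_build_SomeD r by metis
    obtain N where N: "\<forall>H'. (\<forall>i<N. \<forall>x\<in>set keys. H' i x = H i x) \<longrightarrow>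
      exec w H' keys c (build_input (length keys) \<epsilon>, 0) t (m, g)"
      using eventually_happens'[OF sequentially_bot exec_finitely_many_hashes[OF ex]] by blast
    have "?B H' = Some r" if "\<forall>i<N. \<forall>x\<in>set keys. H' i x = H i x" for H'
      unfolding r' by (rule run_build_exec[OF N[rule_format, OF that[rule_format]]])
    thus "\<exists>N. \<forall>H'. (\<forall>i<N. \<forall>x\<in>set keys. H' i x = H i x) \<longrightarrow> ?B H' = Some r" by blast
  qed simp
  have "{om \<in> space M. ?B (hash om) = None} = space M - (\<Union>r. {om \<in> space M. ?B (hash om) = Some r})"
  proof (rule set_eqI)
    fix om
    show "om \<in> {om \<in> space M. ?B (hash om) = None} \<longleftrightarrow>
      om \<in> space M - (\<Union>r. {om \<in> space M. ?B (hash om) = Some r})"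
      by (cases "?B (hash om)") auto
  qed
  also have "... \<in> sets M" by (intro sets.Diff sets.top sets.countable_UN image_subsetI Some)
  finally have None: "{om \<in> space M. ?B (hash om) = None} \<in> sets M" .
  have "(\<lambda>om. ?B (hash om)) -` {a} \<inter> space M \<in> sets M" for a
  proof -
    have "(\<lambda>om. ?B (hash om)) -` {a} \<inter> space M = {om \<in> space M. ?B (hash om) = a}" by blast
    thus ?thesis using Some None by (cases a) simp_all
  qed
  thus ?thesis by (simp add: measurable_count_space_eq_countable)
qed

lemma measurable_built: "(\<lambda>om. F (built om)) \<in> borel_measurable M"
  by (rule measurable_compose[OF measurable_run_build]) simp

lemma nn_integral_const_add_attempts_sum_le:
  assumes "AE om in M. f om \<le> of_nat k + attempts_sum F om"
    and "(\<integral>\<^sup>+T. F T \<partial>random_tables) \<le> ennreal c" "0 \<le> c"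
  shows "(\<integral>\<^sup>+om. f om \<partial>M) \<le> ennreal (real k + 2 * c)"
proof -
  have "(\<integral>\<^sup>+om. f om \<partial>M) \<le> (\<integral>\<^sup>+om. of_nat k + attempts_sum F om \<partial>M)"
    by (rule nn_integral_mono_AE[OF assms(1)])
  also have "... = of_nat k + (\<integral>\<^sup>+om. attempts_sum F om \<partial>M)"
    by (subst nn_integral_add) (simp_all add: measurable_attempts_sum emeasure_space_1)
  also have "... \<le> of_nat k + ennreal (2 * c)" by (intro add_left_mono expected_attempts_sum assms)
  also have "... = ennreal (real k + 2 * c)" unfolding ennreal_of_nat_eq_real_of_nat using assms(3)
    by (subst ennreal_plus) simp_all
  finally show ?thesis .
qed

lemma space_bits_built: "successful_attempt N om \<Longrightarrow> space_bits (built om) = of_nat (num_bits + (N + 1))"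
  by (erule built_successful_attempt) (simp add: space_bits_def)

lemma expected_space: "(\<integral>\<^sup>+om. space_bits (built om) \<partial>M) \<le> ennreal (real num_bits + 2)"
proof -
  have "AE om in M. space_bits (built om) \<le> of_nat num_bits + attempts_sum (\<lambda>_. 1) om"
    using AE_successful_attempt
  proof eventually_elim
    fix om assume "\<exists>N. successful_attempt N om"
    then obtain N where N: "successful_attempt N om" by auto
    have "space_bits (built om) = of_nat num_bits + (\<Sum>g\<le>N. 1)" unfolding space_bits_built[OF N] by simp
    also have "... \<le> of_nat num_bits + attempts_sum (\<lambda>_. 1) om"
      by (intro add_left_mono sum_attempts_le[OF N])
    finally show "space_bits (built om) \<le> of_nat num_bits + attempts_sum (\<lambda>_. 1) om" .
  qed
  from nn_integral_const_add_attempts_sum_le[OF this, of 1] show ?thesis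
    by (simp add: measure_pmf.emeasure_space_1)
qed

lemma prob_space_le: "1 - 1 / 2 ^ d \<le>
  prob {om \<in> space M. space_bits (built om) \<le> ennreal (real num_bits + real d + 2)}"
proof -
  let ?A = "{om \<in> space M. all_fail (Suc d) om}" and ?S = "ennreal (real num_bits + real d + 2)"
  have "1 - 1 / 2 ^ d \<le> 1 - (1 / 2 :: real) ^ Suc d" by (simp add: power_divide field_simps)
  also have "... \<le> prob (space M - ?A)" using prob_all_fail[of "Suc d"] prob_compl[OF sets_all_fail] by simp
  also have "... \<le> prob {om \<in> space M. space_bits (built om) \<le> ?S}"
  proof (rule finite_measure_mono)
    show "space M - ?A \<subseteq> {om \<in> space M. space_bits (built om) \<le> ?S}"
    proof
      fix om assume "om \<in> space M - ?A"
      then obtain g where g: "om \<in> space M" "g < Suc d" "succeeds (table g om)" by (auto simp: all_fail_def)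
      then obtain N where N: "N \<le> g" "successful_attempt N om" by (elim successful_attempt_if_succeeds)
      have "space_bits (built om) = ennreal (real (num_bits + (N + 1)))"
        unfolding space_bits_built[OF N(2)] ennreal_of_nat_eq_real_of_nat ..
      also have "... \<le> ?S" using N(1) g(2) by (intro ennreal_leI) simp
      finally show "om \<in> {om \<in> space M. space_bits (built om) \<le> ?S}" using g(1) by simp
    qed
    show "{om \<in> space M. space_bits (built om) \<le> ?S} \<in> sets M"
      by (rule borel_measurable_le[OF measurable_built borel_measurable_const])
  qed
  finally show ?thesis .
qed

lemma expected_time: "(\<integral>\<^sup>+om. build_time (built om) \<partial>M) \<le>
  ennreal (real build_overhead + 2 * (900 * search_cost_bound + 1670))"
proof -
  let ?F = "\<lambda>T. of_nat (900 * search_cost T + 770) :: ennreal"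
  have "(\<integral>\<^sup>+T. ?F T \<partial>random_tables) = 900 * (\<integral>\<^sup>+T. of_nat (search_cost T) \<partial>random_tables) + 770"
    by (simp add: nn_integral_add nn_integral_cmult measure_pmf.emeasure_space_1)
  also have "... \<le> 900 * ennreal (search_cost_bound + 1) + 770"
    by (intro add_right_mono mult_left_mono expected_search_cost) simp
  also have "... = ennreal (900 * (search_cost_bound + 1) + 770)"
    using search_cost_bound_nonneg
      by (simp add: ennreal_plus ennreal_mult del: ennreal_plus)
      (simp flip: ennreal_numeral ennreal_mult ennreal_plus)
  also have "900 * (search_cost_bound + 1) + 770 = 900 * search_cost_bound + 1670" by simp
  finally have F: "(\<integral>\<^sup>+T. ?F T \<partial>random_tables) \<le> ennreal (900 * search_cost_bound + 1670)" .
  have "AE om in M. build_time (built om) \<le> of_nat build_overhead + attempts_sum ?F om"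
    using AE_successful_attempt
  proof eventually_elim
    fix om assume "\<exists>N. successful_attempt N om"
    then obtain N where N: "successful_attempt N om" by auto
    obtain t bits where "built om = Some (t, bits, N)"
      and t: "t \<le> build_overhead + (\<Sum>g\<le>N. 900 * search_cost (table g om) + 770)"
      using N by (rule built_successful_attempt)
    hence "build_time (built om) = of_nat t" by (simp add: build_time_def)
    also have "... \<le> of_nat (build_overhead + (\<Sum>g\<le>N. 900 * search_cost (table g om) + 770))" using t
      by (rule of_nat_mono)
    also have "... = of_nat build_overhead + (\<Sum>g\<le>N. ?F (table g om))" by (simp only: of_nat_add of_nat_sum)
    also have "... \<le> of_nat build_overhead + attempts_sum ?F om"
      by (intro add_left_mono sum_attempts_le[OF N])
    finally show "build_time (built om) \<le> of_nat build_overhead + attempts_sum ?F om" .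
  qed
  from nn_integral_const_add_attempts_sum_le[OF this F] search_cost_bound_nonneg show ?thesis by simp
qed

end

section \<open>The asymptotic bounds\<close>

lemma bigo_log_imp_le:
  fixes OPT :: "nat \<Rightarrow> real"
  assumes "(\<lambda>n. real n * log 2 (exp 1) - OPT n) \<in> O(\<lambda>n. log 2 (real n))"
  obtains K where "0 \<le> K" "\<And>d. 2 ^ d * log 2 (exp 1) \<le> OPT (2 ^ d) + K * (real d + 1)"
proof -
  let ?\<delta> = "\<lambda>n. real n * log 2 (exp 1) - OPT n"
  obtain c where c: "0 < c" "eventually (\<lambda>n. norm (?\<delta> n) \<le> c * norm (log 2 (real n))) sequentially"
    using landau_o.bigE[OF assms] by blast
  then obtain n0 where n0: "\<And>n. n0 \<le> n \<Longrightarrow> norm (?\<delta> n) \<le> c * norm (log 2 (real n))"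
    by (auto simp: eventually_sequentially)
  let ?K = "c + (\<Sum>n<n0. norm (?\<delta> n))"
  have K: "c \<le> ?K" by (simp add: sum_nonneg)
  show ?thesis
  proof
    show "0 \<le> ?K" using K c(1) by linarith
    fix d
    have "norm (?\<delta> (2 ^ d)) \<le> ?K * (real d + 1)"
    proof (cases "2 ^ d < n0")
      case True
      hence "norm (?\<delta> (2 ^ d)) \<le> ?K * 1" using c(1) member_le_sum[of "2 ^ d" "{..<n0}" "\<lambda>n. norm (?\<delta> n)"]
        by simp
      also have "... \<le> ?K * (real d + 1)" using K c(1) by (intro mult_left_mono) linarith+
      finally show ?thesis .
    next
      case False
      hence "norm (?\<delta> (2 ^ d)) \<le> c * real d" using n0[of "2 ^ d"] by (simp add: log_nat_power)
      also have "... \<le> ?K * (real d + 1)" using K c(1) by (intro mult_mono) linarith+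
      finally show ?thesis .
    qed
    thus "2 ^ d * log 2 (exp 1) \<le> OPT (2 ^ d) + ?K * (real d + 1)" by (simp add: abs_le_iff)
  qed
qed

context recsplit
begin

lemma eps_bounds: "0 < \<epsilon>" "1 \<le> \<epsilon> * 2 ^ d" "1 \<le> 1 / \<epsilon>"
proof -
  show e: "0 < \<epsilon>" using eps by (auto intro: less_le_trans[of 0 "1 / 2 ^ d"])
  show "1 \<le> \<epsilon> * 2 ^ d" "1 \<le> 1 / \<epsilon>" using eps e by (simp_all add: field_simps)
qed

lemma two_pow_y_bounds: "1 / \<epsilon> \<le> 2 ^ y" "2 ^ y \<le> 4 / \<epsilon>"
proof -
  let ?E = "nat \<lceil>1 / \<epsilon>\<rceil>"
  have E: "1 / \<epsilon> \<le> real ?E" "real ?E \<le> 1 / \<epsilon> + 1" "0 < ?E" using eps_bounds(3) by linarith+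
  have "real ?E \<le> real (2 ^ y)" unfolding y by (intro of_nat_mono le_two_power_ceillog2)
  hence "real ?E \<le> 2 ^ y" by (simp only: of_nat_power of_nat_numeral)
  thus "1 / \<epsilon> \<le> 2 ^ y" using E(1) by linarith
  have "real (2 ^ y) \<le> real (2 * ?E)" unfolding y using two_power_ceillog2_gt[OF E(3)]
    by (intro of_nat_mono) simp
  hence "2 ^ y \<le> 2 * real ?E" by simp
  also have "... \<le> 4 * (1 / \<epsilon>)" using E(2) eps_bounds(3) by linarith
  finally show "2 ^ y \<le> 4 / \<epsilon>" by simp
qed

lemma space_le:
  assumes K: "0 \<le> K" and opt: "2 ^ d * log 2 (exp 1) \<le> opt + K * (real d + 1)"
  shows "real num_bits + real d + 2 \<le> opt + (K + 2000000) * (\<epsilon> * 2 ^ d + (real d)\<^sup>2)"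
proof -
  have d: "real d \<le> (real d)\<^sup>2" by (cases d) (simp_all add: power2_eq_square)
  have "1 / 2 ^ y \<le> \<epsilon>" using two_pow_y_bounds(1) eps_bounds(1) by (simp add: field_simps)
  hence "2 ^ d / 2 ^ y \<le> \<epsilon> * 2 ^ d" using mult_left_mono[of "1 / 2 ^ y" \<epsilon> "2 ^ d"]
    by (simp add: mult.commute)
  moreover have "K * (real d + 1) \<le> K * (\<epsilon> * 2 ^ d + (real d)\<^sup>2)" using d eps_bounds(2) K
    by (intro mult_left_mono) linarith+
  ultimately show ?thesis using num_bits_le opt d eps_bounds(2)
    by (simp add: power2_eq_square distrib_right)
qed

lemma time_le:
  assumes C: "2000000 \<le> C"
  shows "real build_overhead + 2 * (900 * search_cost_bound + 1670) \<le>
    C * max ((2 ^ d) powr (3 / 2)) (2 ^ d / \<epsilon>)"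
proof -
  define m where "m = max ((2 ^ d) powr (3 / 2)) (2 ^ d / \<epsilon>)"
  have "2 powr (3 * real d / 2) = (2 ^ d) powr (3 / 2)"
    by (simp add: powr_powr mult.commute flip: powr_realpow)
  hence pow: "2 powr (3 * real d / 2) \<le> m" by (simp add: m_def)
  have "2 ^ d * 2 ^ y \<le> 2 ^ d * (4 / \<epsilon>)" by (intro mult_left_mono two_pow_y_bounds) simp
  moreover have "2 ^ d * (4 / \<epsilon>) = 4 * (2 ^ d / \<epsilon>)" by simp
  moreover have "2 ^ d / \<epsilon> \<le> m" by (simp add: m_def)
  ultimately have "2 ^ d * 2 ^ y \<le> 4 * m" by linarith
  hence search: "search_cost_bound \<le> 624 * m" using pow unfolding search_cost_bound_def by linarith
  have "2 ^ d * 1 \<le> 2 ^ d * (1 / \<epsilon>)" using eps_bounds(3) by (intro mult_left_mono) auto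
  hence n: "2 ^ d \<le> m" by (simp add: m_def)
  moreover have "1 \<le> m" by (rule order_trans[OF _ n]) simp
  ultimately have "real build_overhead \<le> 6100 * m" "1670 \<le> 1670 * m" using build_overhead_le by linarith+
  hence "real build_overhead + 2 * (900 * search_cost_bound + 1670) \<le>
    6100 * m + 2 * (900 * (624 * m) + 1670 * m)"
    by (intro add_mono mult_left_mono search) simp_all
  also have "... \<le> 2000000 * m" using \<open>1 \<le> m\<close> by simp
  also have "... \<le> C * m" using C by (intro mult_right_mono order_trans[OF _ n]) auto
  finally show ?thesis unfolding m_def .
qed

lemma query_time_le:
  assumes "2000000 \<le> C"
  shows "200 * real d + 100 \<le> C * max 1 (real d)"
proof -
  have "200 * real d + 100 \<le> 2000000 * max 1 (real d)" by (simp add: max_def)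
  also have "... \<le> C * max 1 (real d)" using assms by (intro mult_right_mono) auto
  finally show ?thesis .
qed

end

context recsplit
begin

context
  fixes OPT :: "nat \<Rightarrow> real" and K :: real
  assumes K: "0 \<le> K" and OPT: "\<And>d. 2 ^ d * log 2 (exp 1) \<le> OPT (2 ^ d) + K * (real d + 1)"
begin

definition space_bound :: real where
  "space_bound = OPT (2 ^ d) + (K + 2000000) * (\<epsilon> * real (2 ^ d) + (log 2 (real (2 ^ d)))\<^sup>2)"

lemma space_bound_ge: "real num_bits + real d + 2 \<le> space_bound"
  using space_le[OF K OPT] by (simp add: space_bound_def log_nat_power)

lemma AE_built:
  "AE om in M. \<exists>t bits g. built om = Some (t, bits, g) \<and> real (length bits) \<le> space_bound \<and>
    perfect_hash ((K + 2000000) * max 1 (log 2 (real (2 ^ d)))) om g bits"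
  using AE_successful_attempt
proof eventually_elim
  fix om assume "\<exists>N. successful_attempt N om"
  then obtain N where "successful_attempt N om" by auto
  then obtain t bits where built: "built om = Some (t, bits, N)" "length bits = num_bits"
    and perfect: "perfect_hash (200 * real d + 100) om N bits"
    by (rule built_successful_attempt)
  have "200 * real d + 100 \<le> (K + 2000000) * max 1 (log 2 (real (2 ^ d)))"
    using query_time_le[of "K + 2000000"] K by (simp add: log_nat_power)
  hence "perfect_hash ((K + 2000000) * max 1 (log 2 (real (2 ^ d)))) om N bits"
    by (rule perfect_hash_mono[OF perfect])
  moreover have "real (length bits) \<le> space_bound" unfolding built(2) using space_bound_ge by linarith
  ultimately show "\<exists>t bits g. built om = Some (t, bits, g) \<and> real (length bits) \<le> space_bound \<and>
    perfect_hash ((K + 2000000) * max 1 (log 2 (real (2 ^ d)))) om g bits" using built(1) by blast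
qed

lemma expected_space_le: "(\<integral>\<^sup>+om. space_bits (built om) \<partial>M) \<le> ennreal space_bound"
  using space_bound_ge by (intro order_trans[OF expected_space ennreal_leI]) linarith

lemma prob_space_bound: "1 - 1 / real (2 ^ d) \<le>
  prob {om \<in> space M. space_bits (built om) \<le> ennreal space_bound}"
proof -
  have "prob {om \<in> space M. space_bits (built om) \<le> ennreal (real num_bits + real d + 2)} \<le>
    prob {om \<in> space M. space_bits (built om) \<le> ennreal space_bound}"
  proof (rule finite_measure_mono)
    show "{om \<in> space M. space_bits (built om) \<le> ennreal space_bound} \<in> sets M"
      by (rule borel_measurable_le[OF measurable_built borel_measurable_const])
  qed (use ennreal_leI[OF space_bound_ge] in \<open>auto intro: order_trans\<close>)
  thus ?thesis using prob_space_le by simp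
qed

lemma expected_time_le:
  "(\<integral>\<^sup>+om. build_time (built om) \<partial>M) \<le>
    ennreal ((K + 2000000) * max (real (2 ^ d) powr (3 / 2)) (real (2 ^ d) / \<epsilon>))"
  using order_trans[OF expected_time ennreal_leI[OF time_le]] K by simp

end

end

theorem theorem12:
  fixes OPT :: "nat \<Rightarrow> real"
  assumes OPT: "(\<lambda>n. real n * log 2 (exp 1) - OPT n) \<in> O(\<lambda>n. log 2 (real n))"
  shows "\<exists>(build :: com) (query :: com) (seed :: nat \<Rightarrow> bool list \<Rightarrow> nat \<Rightarrow> nat) (c :: nat) (C :: real).
    \<forall>(d :: nat) (n :: nat) (w :: nat) (\<epsilon> :: real) (M :: 'w measure)
      (h :: nat \<Rightarrow> 'k \<Rightarrow> 'w \<Rightarrow> bool) (keys :: 'k list).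
      n = 2 ^ d \<longrightarrow> w = c * (d + 1) \<longrightarrow> \<epsilon> \<in> {1 / real n..1} \<longrightarrow>
      simple_uniform_hashing M h \<longrightarrow> distinct keys \<longrightarrow> length keys = n \<longrightarrow>
      (let H = (\<lambda>\<omega> s x. h s x \<omega>);
           B = (\<lambda>\<omega>. run_build w (H \<omega>) keys \<epsilon> build);
           space_bound = OPT n + C * (\<epsilon> * real n + (log 2 (real n))\<^sup>2)
       in
         (AE \<omega> in M. \<exists>t bits g. B \<omega> = Some (t, bits, g) \<and>
            real (length bits) \<le> space_bound \<and>
            (let f = (\<lambda>v. H \<omega> (prod_encode (g, seed d bits v))) in
               splits_perfectly d f (set keys) \<and>
               bij_betw (leaf_rank d f) (set keys) {1..n} \<and>
               (\<forall>x. \<exists>tq m g'. exec w (H \<omega>) [x] query (pack w bits, g) tq (m, g') \<and>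
                  m 0 = leaf_rank d f x \<and>
                  real tq \<le> C * max 1 (log 2 (real n))))) \<and>
         (\<lambda>\<omega>. space_bits (B \<omega>)) \<in> borel_measurable M \<and>
         (\<integral>\<^sup>+\<omega>. space_bits (B \<omega>) \<partial>M) \<le> ennreal space_bound \<and>
         measure M {\<omega> \<in> space M. space_bits (B \<omega>) \<le> ennreal space_bound} \<ge> 1 - 1 / real n \<and>
         (\<lambda>\<omega>. build_time (B \<omega>)) \<in> borel_measurable M \<and>
         (\<integral>\<^sup>+\<omega>. build_time (B \<omega>) \<partial>M) \<le> ennreal (C * max (real n powr (3/2)) (real n / \<epsilon>)))"
proof -
  obtain K where K: "0 \<le> K" "\<And>d. 2 ^ d * log 2 (exp 1) \<le> OPT (2 ^ d) + K * (real d + 1)"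
    using bigo_log_imp_le[OF OPT] by blast
  show ?thesis
  proof (rule exI[of _ build_prog], rule exI[of _ query_prog], rule exI[of _ seed], rule exI[of _ 256], rule
    exI[of _ "K + 2000000"],
      intro allI impI, goal_cases)
    case (1 d n w \<epsilon> M h keys)
    note n = 1(1) and w = 1(2)
    have eps: "\<epsilon> \<in> {1 / 2 ^ d..1}" using 1(3) n by simp
    have "ceillog2 (nat \<lceil>1 / \<epsilon>\<rceil>) \<le> d" using ceillog2_mono[OF nat_ceiling_inverse_le[OF eps]] by simp
    then interpret recsplit d "ceillog2 (nat \<lceil>1 / \<epsilon>\<rceil>)" M h keys \<epsilon>
      using 1 eps by unfold_locales simp_all
    show ?case
      unfolding Let_def n w
      using AE_built[OF K] measurable_built expected_space_le[OF K] prob_space_bound[OF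
        K] measurable_built expected_time_le[OF K]
      unfolding Let_def perfect_hash_def space_bound_def[OF K] by (intro conjI) assumption+
  qed
qed

end
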